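(* Let $\mathfrak h_3>0$, $\delta>0$, let $\mathfrak h_8$ be the number defined in the context and let $\mathfrak h_\infty$ be sufficiently large depending only on $\mathfrak h_3,\mathfrak h_8$; let $\mathcal S$ be the corresponding set defined in the context. Let $f_0(p)=f_0(|p|)\in\mathcal S$ and $n_0>0$ satisfy the threshold condition $$n_0\ \ge\ \mathcal C(f_0)-m_2\langle f_0\rangle+\delta .$$ Then the system $$\frac{df}{dt}=\frac{\kappa_0}{n_c}\mathcal Q[f],\quad f(0,\cdot)=f_0,\qquad \frac{dn_c}{dt}=-\frac{\kappa_0}{n_c}\int \mathcal Q[f]\,dp,\quad n_c(0)=n_0,$$ has a unique conservative solution $(f,n_c)$ such that, for any $T>0$, $$0\le f(t,p)=f(t,|p|)\in \mathcal C([0,T];\mathcal S)\cap \mathcal C^1((0,T];L^1(\mathbb R^3,dp)),\qquad \delta\le n_c(t)\in\mathcal C([0,T])\cap\mathcal C^1((0,T]).$$ Momentum $\int_{\mathbb R^3} f(t,p)\,p\,dp$ and energy $\int_{\mathbb R^3} f(t,p)|p|\,dp$ are conserved in time, and the total mass of the system is conserved as well: $$m_2\langle f(t)\rangle+n_c(t)=m_2\langle f_0\rangle+n_0 .$$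
   Context: Radial functions on $\mathbb R^3$ are identified with functions of $r=|p|\ge0$. Line-moments: $m_k\langle f\rangle=\int_0^\infty f(r)r^k\,dr$. Collision operator. The underlying operator is $\mathcal Q[f](p)=\iint_{\mathbb R^3\times\mathbb R^3}[R(p,p_1,p_2)-R(p_1,p,p_2)-R(p_2,p_1,p)]\,dp_1dp_2$ with $R(p,p_1,p_2)=|p||p_1||p_2|\,\delta(|p|-|p_1|-|p_2|)\delta(p-p_1-p_2)[f(p_1)f(p_2)(1+f(p))-(1+f(p_1))(1+f(p_2))f(p)]$. For radial $f$ it takes the following form, with numerical factors ($8\pi^2$, $4\pi$) absorbed in the normalization of $\kappa_0$ and $n_c$. With $K(r,s)=r^2s^2(r+s)^2$, $$\mathcal Q_q[f](r)=\int_0^rK(s,r-s)f(s)f(r-s)\,ds+2\int_r^\infty K(r,s-r)f(s)f(s-r)\,ds+2f(r)\Big(\int_r^\infty K(r,s-r)f(s)\,ds-\int_0^rK(s,r-s)f(s)\,ds-\int_0^\infty K(r,s)f(s)\,ds\Big),$$ $$\mathcal L[f](r)=2\int_r^\infty K(r,s-r)f(s)\,ds-f(r)\int_0^rK(s,r-s)\,ds,$$ $$\mathcal Q[f](r):=r^{-2}\big(\mathcal Q_q[f](r)+\mathcal L[f](r)\big),\qquad \int\mathcal Q[f]\,dp:=\int_0^\infty\mathcal Q[f](r)\,r^2dr .$$ $\kappa_0>0$ is a fixed constant. The system is equivalent, as long as $n_c>0$, to $\frac{df}{dt}=\frac{\kappa_0}{n_c[f]}\mathcal Q[f]$ with $n_c[f](t)=\big(n_0^2-2\kappa_0\int_0^t\int\mathcal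 Q[f](s,p)\,dp\,ds\big)^{1/2}$. The set $\mathcal S$. It consists of all $f\in L^1(\mathbb R^3,dp)$ that are nonnegative and radially symmetric, with $m_3\langle f\rangle=\mathfrak h_3$, $m_8\langle f\rangle\le\mathfrak h_8$ and $\|f(\cdot)|\cdot|^2\|_{L^\infty}\le\mathfrak h_\infty$. Here $\mathfrak h_8:=2\mathfrak h_*+\frac{\kappa_0}{\delta}\tilde C_8\,\mathfrak h_3^{7/2}$, $\mathfrak h_*:=(\tilde C_8/\tilde c_8)^{1/2}\mathfrak h_3^{9/4}$, where $\tilde C_8,\tilde c_8>0$ are fixed universal constants such that $\int_0^\infty\mathcal Q[g](r)r^8dr\le m_3\langle g\rangle^{-1}\big(\tilde C_8\,m_3\langle g\rangle^{9/2}-\tilde c_8\,m_8\langle g\rangle^2\big)$ for all radial $g\ge0$ with finite line-moments. Threshold. With $c_0=\int_0^1z^2(1-z)^2dz$ and $m_3=m_3\langle f_0\rangle$, $$\mathcal C(f_0)=2\sqrt{m_3\max\Big\{\|f_0(\cdot)|\cdot|^2\|_{L^\infty},\ \frac{3\max\{m_4\langle f_0\rangle,\,C\,m_3^{5/4}\}}{2\,c_0^{1/4}m_3^{3/4}}\Big\}},$$ where $C>0$ is a fixed universal constant such that solutions satisfy $\sup_t m_4\langle f(t)\rangle\le\max\{m_4\langle f_0\rangle,C m_3^{5/4}\}$ as long as $n_c>0$. *)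

theory Defs
  imports "HOL-Analysis.Analysis" "HOL-Probability.Essential_Supremum"
begin

(* A radial function on R^3 is given by a profile f of r = |p|; the values of f on negative
   arguments are irrelevant.  Elements of L^1(R^3) are represented by Borel integrable functions,
   equality in L^1 being equality almost everywhere. *)

definition radial :: "(real \<Rightarrow> real) \<Rightarrow> real ^ 3 \<Rightarrow> real" where
  "radial f p = f (norm p)"

definition line_moment :: "nat \<Rightarrow> (real \<Rightarrow> real) \<Rightarrow> real" where
  "line_moment k f = (LBINT r:{0..}. f r * r ^ k)"

definition finite_line_moment :: "nat \<Rightarrow> (real \<Rightarrow> real) \<Rightarrow> bool" where
  "finite_line_moment k f \<longleftrightarrow> set_integrable lborel {0..} (\<lambda>r. f r * r ^ k)"

definition Linfty_norm :: "(real ^ 3 \<Rightarrow> real) \<Rightarrow> ereal" where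
  "Linfty_norm F = esssup lborel (\<lambda>p. ereal \<bar>F p\<bar>)"

definition collision_kernel :: "real \<Rightarrow> real \<Rightarrow> real" where
  "collision_kernel r s = r\<^sup>2 * s\<^sup>2 * (r + s)\<^sup>2"

definition quadratic_collision :: "(real \<Rightarrow> real) \<Rightarrow> real \<Rightarrow> real" where
  "quadratic_collision f r =
     (LBINT s:{0..r}. collision_kernel s (r - s) * f s * f (r - s))
     + 2 * (LBINT s:{r..}. collision_kernel r (s - r) * f s * f (s - r))
     + 2 * f r * ((LBINT s:{r..}. collision_kernel r (s - r) * f s)
                  - (LBINT s:{0..r}. collision_kernel s (r - s) * f s)
                  - (LBINT s:{0..}. collision_kernel r s * f s))"

definition linear_collision :: "(real \<Rightarrow> real) \<Rightarrow> real \<Rightarrow> real" where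
  "linear_collision f r =
     2 * (LBINT s:{r..}. collision_kernel r (s - r) * f s)
     - f r * (LBINT s:{0..r}. collision_kernel s (r - s))"

definition collision :: "(real \<Rightarrow> real) \<Rightarrow> real \<Rightarrow> real" where
  "collision f r = (quadratic_collision f r + linear_collision f r) / r\<^sup>2"

(* The integral of Q[f] dp, with the surface factor 4 pi absorbed in the constants. *)
definition collision_mass :: "(real \<Rightarrow> real) \<Rightarrow> real" where
  "collision_mass f = (LBINT r:{0..}. collision f r * r\<^sup>2)"

definition momentum :: "(real \<Rightarrow> real) \<Rightarrow> real ^ 3" where
  "momentum f = (LINT p|lborel. radial f p *\<^sub>R p)"

definition energy :: "(real \<Rightarrow> real) \<Rightarrow> real" where
  "energy f = (LINT p|lborel. radial f p * norm (p :: real ^ 3))"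


definition eighth_moment_constants :: "real \<Rightarrow> real \<Rightarrow> bool" where
  "eighth_moment_constants C8 c8 \<longleftrightarrow>
     (\<forall>g. (AE p in lborel. 0 \<le> radial g p) \<and> (\<forall>k. finite_line_moment k g) \<longrightarrow>
        line_moment 8 (collision g)
        \<le> (C8 * line_moment 3 g powr (9/2) - c8 * (line_moment 8 g)\<^sup>2) / line_moment 3 g)"

definition h_star :: "real \<Rightarrow> real \<Rightarrow> real \<Rightarrow> real" where
  "h_star C8 c8 h3 = (C8 / c8) powr (1/2) * h3 powr (9/4)"

definition h_eight :: "real \<Rightarrow> real \<Rightarrow> real \<Rightarrow> real \<Rightarrow> real \<Rightarrow> real" where
  "h_eight C8 c8 \<kappa>0 \<delta> h3 = 2 * h_star C8 c8 h3 + \<kappa>0 / \<delta> * C8 * h3 powr (7/2)"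

(* Finiteness of the moments is explicit since the Bochner integral of a non-integrable function
   is 0. *)
definition state_set :: "real \<Rightarrow> real \<Rightarrow> real \<Rightarrow> (real \<Rightarrow> real) set" where
  "state_set h3 h8 hinf =
     {f. integrable lborel (radial f) \<and> (AE p in lborel. 0 \<le> radial f p)
       \<and> finite_line_moment 3 f \<and> line_moment 3 f = h3
       \<and> finite_line_moment 8 f \<and> line_moment 8 f \<le> h8
       \<and> Linfty_norm (\<lambda>p. radial f p * (norm p)\<^sup>2) \<le> ereal hinf}"


definition L1_norm :: "(real ^ 3 \<Rightarrow> real) \<Rightarrow> real" where
  "L1_norm F = (LINT p|lborel. \<bar>F p\<bar>)"

definition L1_continuous_on :: "real set \<Rightarrow> (real \<Rightarrow> real ^ 3 \<Rightarrow> real) \<Rightarrow> bool" where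
  "L1_continuous_on I u \<longleftrightarrow>
     (\<forall>t\<in>I. integrable lborel (u t)
        \<and> ((\<lambda>s. L1_norm (\<lambda>p. u s p - u t p)) \<longlongrightarrow> 0) (at t within I))"

definition L1_has_derivative_on ::
  "real set \<Rightarrow> (real \<Rightarrow> real ^ 3 \<Rightarrow> real) \<Rightarrow> (real \<Rightarrow> real ^ 3 \<Rightarrow> real) \<Rightarrow> bool" where
  "L1_has_derivative_on I u u' \<longleftrightarrow>
     (\<forall>t\<in>I. integrable lborel (u t) \<and> integrable lborel (u' t)
        \<and> ((\<lambda>s. L1_norm (\<lambda>p. (u s p - u t p) / (s - t) - u' t p)) \<longlongrightarrow> 0) (at t within I))"

definition L1_C1_on :: "real set \<Rightarrow> (real \<Rightarrow> real ^ 3 \<Rightarrow> real) \<Rightarrow> bool" where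
  "L1_C1_on I u \<longleftrightarrow> (\<exists>u'. L1_has_derivative_on I u u' \<and> L1_continuous_on I u')"

definition C1_on :: "real set \<Rightarrow> (real \<Rightarrow> real) \<Rightarrow> bool" where
  "C1_on I u \<longleftrightarrow>
     (\<exists>u'. (\<forall>t\<in>I. (u has_real_derivative u' t) (at t within I)) \<and> continuous_on I u')"


definition regular_on ::
  "(real \<Rightarrow> real) set \<Rightarrow> real \<Rightarrow> (real \<Rightarrow> real \<Rightarrow> real) \<Rightarrow> (real \<Rightarrow> real) \<Rightarrow> bool" where
  "regular_on S T f nc \<longleftrightarrow>
     (\<forall>t\<in>{0..T}. f t \<in> S) \<and> L1_continuous_on {0..T} (\<lambda>t. radial (f t))
     \<and> L1_C1_on {0<..T} (\<lambda>t. radial (f t))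
     \<and> continuous_on {0..T} nc \<and> C1_on {0<..T} nc"

definition solves_system_on ::
  "real \<Rightarrow> real \<Rightarrow> (real \<Rightarrow> real) \<Rightarrow> real \<Rightarrow> (real \<Rightarrow> real \<Rightarrow> real) \<Rightarrow> (real \<Rightarrow> real) \<Rightarrow> bool" where
  "solves_system_on \<kappa>0 T f0 n0 f nc \<longleftrightarrow>
     (AE p in lborel. radial (f 0) p = radial f0 p) \<and> nc 0 = n0
     \<and> L1_has_derivative_on {0<..T} (\<lambda>t. radial (f t))
         (\<lambda>t p. \<kappa>0 / nc t * radial (collision (f t)) p)
     \<and> (\<forall>t\<in>{0<..T}. (nc has_real_derivative - (\<kappa>0 / nc t) * collision_mass (f t))
                        (at t within {0<..T}))"

definition conservative ::
  "(real \<Rightarrow> real) \<Rightarrow> real \<Rightarrow> (real \<Rightarrow> real \<Rightarrow> real) \<Rightarrow> (real \<Rightarrow> real) \<Rightarrow> bool" where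
  "conservative f0 n0 f nc \<longleftrightarrow>
     (\<forall>t\<ge>0. momentum (f t) = momentum f0 \<and> energy (f t) = energy f0
        \<and> line_moment 2 (f t) + nc t = line_moment 2 f0 + n0)"

(* The bound sup m_4<f(t)> <= max {m_4<f0>, C m_3^(5/4)} for solutions, as long as n_c > 0, with C
   independent of the data and of all parameters. *)
definition fourth_moment_constant :: "real \<Rightarrow> bool" where
  "fourth_moment_constant C \<longleftrightarrow>
     (\<forall>\<kappa>0 h3 h8 hinf T n0 f0 f nc.
        \<kappa>0 > 0 \<and> h3 > 0 \<and> T > 0 \<and> n0 > 0 \<and> f0 \<in> state_set h3 h8 hinf
        \<and> regular_on (state_set h3 h8 hinf) T f nc \<and> solves_system_on \<kappa>0 T f0 n0 f nc
        \<and> (\<forall>t\<in>{0..T}. nc t > 0)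
        \<longrightarrow> (\<forall>t\<in>{0..T}. line_moment 4 (f t)
                          \<le> max (line_moment 4 f0) (C * line_moment 3 f0 powr (5/4))))"

definition c_zero :: real where
  "c_zero = (LBINT z:{0..1}. z\<^sup>2 * (1 - z)\<^sup>2)"

definition mass_threshold :: "real \<Rightarrow> (real \<Rightarrow> real) \<Rightarrow> real" where
  "mass_threshold C f0 =
     2 * sqrt (line_moment 3 f0 *
       max (real_of_ereal (Linfty_norm (\<lambda>p. radial f0 p * (norm p)\<^sup>2)))
           (3 * max (line_moment 4 f0) (C * line_moment 3 f0 powr (5/4))
            / (2 * c_zero powr (1/4) * line_moment 3 f0 powr (3/4))))"

end

(* Write u(r) = r^2 f(r).  In the new time tau with dt = (n_c / kappa_0) d tau the system decouples:
   u solves the autonomous equation u' = coll u in L^1(0, oo), and n_c is recovered from the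
   conservation of mass.

   Uniqueness and stability: testing the difference w of two solutions with sign(w) times a weight of
   linear growth leaves quadratic terms of size (1 + r)^3 |w|.  For the affine weight 4 r - 1 they are
   absorbed by the linear part of the operator: splitting a particle of energy z, at rate z^5 / 30,
   conserves r but lowers the weight by 1.  Since w is only known to be differentiable in L^1, the weight
   has to be bounded; bounded weights approximate the affine one with a defect that the sixth moment
   controls.

   Existence: explicit Euler steps for the operator truncated to 1/n <= r <= n preserve positivity, the
   bound on the energy, the bound on the sixth moment (by the hypothesis on the eighth moment of f) and
   every level M for which the linear gain is dominated by the losses.  The stability estimate makes the
   paths converge as n -> oo.

   Lower bound on n_c: the fourth moment estimate makes the sharp level in the threshold admissible,
   and u <= m together with the energy gives the mass bound 2 sqrt(m_3 m).  The estimate itself is only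
   assumed for solutions of the coupled system, so it is applied to the same flow with an n_0 large
   enough that n_c > 0 is automatic. *)
theory Submission
  imports Defs
begin

section \<open>The collision operator on line densities\<close>

text \<open>Under the integrals f always carries the factor s^2, so the kernel of Q is absorbed by u
  = r^2 f and only r^2 times convolutions and correlations remains. The obstacle is that
  \<open>coll\<close> is not controlled by a Lipschitz bound in one weighted L^1 norm: spontaneous
  splitting costs five powers of r, so a fixed point argument does not close. Only a one-sided
  estimate is available, and it works because the quadratic terms cost three powers whereas the
  total splitting rate grows like r^5. The hypothesis on the eighth moment speaks of profiles with
  all line-moments finite. This forces approximations supported away from zero and infinity. The
  sharp level rests on the fourth moment bound, which is known for solutions only. The circle is
  broken by solving at a crude level first, which depends on \<open>h3\<close> and \<open>h8\<close>
  alone and becomes the lower bound for \<open>hinf\<close>. The sharp level is then propagated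
  along the same Euler paths, whose second moments in u are close to those of the limit. The bound
  may be imported from another n_0 since its constant is uniform in n_0 and kappa_0, and the flow in
  the new time involves neither.\<close>

lemma nn_integral_bound_imp_integrable:
  fixes F :: "'a \<Rightarrow> real"
  assumes "F \<in> borel_measurable M" "\<And>x. 0 \<le> F x" "(\<integral>\<^sup>+x. ennreal (F x) \<partial>M) \<le> ennreal C" "0 \<le> C"
  shows "integrable M F" "(LINT x|M. F x) \<le> C"
proof -
  show i: "integrable M F"
    using assms by (intro integrableI_nonneg) (auto simp: le_less_trans)
  have "ennreal (LINT x|M. F x) \<le> ennreal C"
    using assms(3) nn_integral_eq_integral[OF i] assms(2) by simp
  thus "(LINT x|M. F x) \<le> C" using assms(4) by simp
qed

text \<open>The development works with the line density \<open>u r = r\<^sup>2 * f r\<close>, extended by 0 to \<open>r \<le> 0\<close>.\<close>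

definition dens :: "(real \<Rightarrow> real) \<Rightarrow> bool" where
  "dens u \<longleftrightarrow> u \<in> borel_measurable borel \<and> (\<forall>r. 0 \<le> u r) \<and> (\<exists>M. \<forall>r. u r \<le> M)
     \<and> (\<forall>r\<le>0. u r = 0) \<and> integrable lborel (\<lambda>r. (1 + r) ^ 6 * u r)"

text \<open>The shifted power dominates all lower powers and is submultiplicative,
  \<open>1 + x + y \<le> (1 + x) * (1 + y)\<close>; this separates two collision partners. Order 6
  corresponds to the eighth line-moment of f.\<close>

definition mom :: "nat \<Rightarrow> (real \<Rightarrow> real) \<Rightarrow> real" where
  "mom k u = (LBINT r. (1 + r) ^ k * u r)"

lemma dens_meas [measurable_dest]: "dens u \<Longrightarrow> u \<in> borel_measurable borel"
  and dens_nonneg: "dens u \<Longrightarrow> 0 \<le> u r"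
  and dens_zero: "dens u \<Longrightarrow> r \<le> 0 \<Longrightarrow> u r = 0"
  by (auto simp: dens_def)

lemma dens_bound: assumes "dens u" obtains M where "\<And>r. u r \<le> M" "0 \<le> M"
  using assms unfolding dens_def by (meson order_trans)

lemma dens_weighted_nonneg: "dens u \<Longrightarrow> 0 \<le> (1 + r) ^ k * u r"
  by (cases "r > 0") (auto simp: dens_nonneg dens_zero)

lemma dens_integrable:
  assumes u: "dens u" and m: "\<phi> \<in> borel_measurable borel" and b: "\<And>r. 0 < r \<Longrightarrow> \<bar>\<phi> r\<bar> \<le> c * (1 + r) ^ 6"
  shows "integrable lborel (\<lambda>r. \<phi> r * u r)"
proof (rule Bochner_Integration.integrable_bound)
  show "integrable lborel (\<lambda>r. c * ((1 + r) ^ 6 * u r))"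
    using u by (auto simp: dens_def)
  show "(\<lambda>r. \<phi> r * u r) \<in> borel_measurable lborel" using dens_meas[OF u] m by simp
  have le: "\<bar>\<phi> r\<bar> * u r \<le> c * ((1 + r) ^ 6 * u r)" for r
  proof (cases "r > 0")
    case True
    thus ?thesis using mult_right_mono[OF b dens_nonneg[OF u, of r], of r] by (simp add: mult.assoc)
  qed (simp add: dens_zero[OF u])
  thus "AE r in lborel. norm (\<phi> r * u r) \<le> norm (c * ((1 + r) ^ 6 * u r))"
    by (intro AE_I2) (metis le abs_ge_self order_trans abs_mult abs_of_nonneg dens_nonneg[OF u] real_norm_def)
qed

lemma dens_integral_le:
  assumes u: "dens u" and m: "\<phi> \<in> borel_measurable borel" and b: "\<And>r. 0 < r \<Longrightarrow> \<bar>\<phi> r\<bar> \<le> c * (1 + r) ^ k"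
    and k: "k \<le> 6"
  shows "integrable lborel (\<lambda>r. \<phi> r * u r)" "(LBINT r. \<phi> r * u r) \<le> c * mom k u"
proof -
  have "0 \<le> c * (1 + 1) ^ k" using b[of 1] abs_ge_zero[of "\<phi> 1"] by linarith
  moreover have "0 < (1 + 1 :: real) ^ k" by simp
  ultimately have c: "0 \<le> c" by (metis mult_neg_pos not_le)
  have le: "(1 + r) ^ k \<le> (1 + r) ^ 6" if "r > 0" for r :: real
    using that k by (intro power_increasing) auto
  have "\<bar>\<phi> r\<bar> \<le> c * (1 + r) ^ 6" if "0 < r" for r
    using b[OF that] mult_left_mono[OF le[OF that] c] by linarith
  thus i: "integrable lborel (\<lambda>r. \<phi> r * u r)" by (rule dens_integrable[OF u m])
  have ik: "integrable lborel (\<lambda>r. (1 + r) ^ k * u r)"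
    by (rule dens_integrable[OF u, of _ 1]) (use le in \<open>auto simp: power_abs\<close>)
  have "(LBINT r. \<phi> r * u r) \<le> (LBINT r. c * ((1 + r) ^ k * u r))"
  proof (rule integral_mono[OF i])
    show "integrable lborel (\<lambda>r. c * ((1 + r) ^ k * u r))" using ik by simp
    fix r show "\<phi> r * u r \<le> c * ((1 + r) ^ k * u r)"
    proof (cases "r > 0")
      case True
      hence "\<phi> r \<le> c * (1 + r) ^ k" using b[OF True] by linarith
      from mult_right_mono[OF this dens_nonneg[OF u, of r]] show ?thesis by (simp add: mult.assoc)
    qed (simp add: dens_zero[OF u])
  qed
  thus "(LBINT r. \<phi> r * u r) \<le> c * mom k u" by (simp add: mom_def)
qed

lemma mom_integrable: "dens u \<Longrightarrow> k \<le> 6 \<Longrightarrow> integrable lborel (\<lambda>r. (1 + r) ^ k * u r)"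
  by (rule dens_integral_le(1)[where c = 1]) auto

lemma pow_integrable: "dens u \<Longrightarrow> k \<le> 6 \<Longrightarrow> integrable lborel (\<lambda>r. r ^ k * u r)"
  by (rule dens_integral_le(1)[where c = 1]) (auto intro: power_mono)

lemma dens_integrable_self: "dens u \<Longrightarrow> integrable lborel u"
  using mom_integrable[of u 0] by simp

lemma mom_nonneg: "dens u \<Longrightarrow> 0 \<le> mom k u"
  unfolding mom_def
  by (intro integral_nonneg_AE AE_I2 dens_weighted_nonneg)

lemma mom_mono: "dens u \<Longrightarrow> j \<le> k \<Longrightarrow> k \<le> 6 \<Longrightarrow> mom j u \<le> mom k u"
  using dens_integral_le(2)[of u "\<lambda>r. (1 + r) ^ j" 1 k]
  by (auto simp: mom_def intro!: power_increasing)

lemma dens_diff: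
  assumes u: "dens u" and v: "dens v" shows "dens (\<lambda>r. \<bar>u r - v r\<bar>)"
proof -
  obtain M where M: "\<And>r. u r \<le> M" "0 \<le> M" using dens_bound[OF u] by blast
  obtain M' where M': "\<And>r. v r \<le> M'" "0 \<le> M'" using dens_bound[OF v] by blast
  have "integrable lborel (\<lambda>r. \<bar>(1 + r) ^ 6 * u r - (1 + r) ^ 6 * v r\<bar>)"
    using mom_integrable[OF u] mom_integrable[OF v] by auto
  also have "(\<lambda>r. \<bar>(1 + r) ^ 6 * u r - (1 + r) ^ 6 * v r\<bar>) = (\<lambda>r. (1 + r) ^ 6 * \<bar>u r - v r\<bar>)"
    by (simp add: fun_eq_iff abs_mult flip: right_diff_distrib)
  finally have i: "integrable lborel (\<lambda>r. (1 + r) ^ 6 * \<bar>u r - v r\<bar>)" .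
  have "\<bar>u r - v r\<bar> \<le> M + M'" for r
    using M(1)[of r] M'(1)[of r] dens_nonneg[OF u, of r] dens_nonneg[OF v, of r] by auto
  thus ?thesis using i dens_meas[OF u] dens_meas[OF v] dens_zero[OF u] dens_zero[OF v]
    unfolding dens_def by auto
qed

lemma dens_add:
  assumes u: "dens u" and v: "dens v" shows "dens (\<lambda>r. u r + v r)"
proof -
  obtain M where M: "\<And>r. u r \<le> M" "0 \<le> M" using dens_bound[OF u] by blast
  obtain M' where M': "\<And>r. v r \<le> M'" "0 \<le> M'" using dens_bound[OF v] by blast
  have "integrable lborel (\<lambda>r. (1 + r) ^ 6 * (u r + v r))"
    using mom_integrable[OF u, of 6] mom_integrable[OF v, of 6] by (simp add: distrib_left)
  moreover have "u r + v r \<le> M + M'" for r using M(1)[of r] M'(1)[of r] by linarith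
  ultimately show ?thesis using dens_meas[OF u] dens_meas[OF v] dens_zero[OF u] dens_zero[OF v]
      dens_nonneg[OF u] dens_nonneg[OF v]
    unfolding dens_def by (auto intro: add_nonneg_nonneg)
qed

lemma mom_add: "dens u \<Longrightarrow> dens v \<Longrightarrow> k \<le> 6 \<Longrightarrow> mom k (\<lambda>r. u r + v r) = mom k u + mom k v"
  unfolding mom_def by (simp add: distrib_left mom_integrable)

lemma mom_diff_le: 
  assumes "dens u" "dens v" "k \<le> 6" shows "mom k (\<lambda>r. \<bar>u r - v r\<bar>) \<le> mom k u + mom k v"
proof -
  have "mom k (\<lambda>r. \<bar>u r - v r\<bar>) \<le> mom k (\<lambda>r. u r + v r)"
    unfolding mom_def
  proof (rule integral_mono)
    fix r show "(1 + r) ^ k * \<bar>u r - v r\<bar> \<le> (1 + r) ^ k * (u r + v r)"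
    proof (cases "r > 0")
      case True
      thus ?thesis using dens_nonneg[OF assms(1), of r] dens_nonneg[OF assms(2), of r]
        by (intro mult_left_mono) auto
    qed (simp add: dens_zero assms)
  qed (use assms in \<open>auto intro: mom_integrable dens_diff dens_add\<close>)
  thus ?thesis using mom_add[OF assms] by simp
qed


section \<open>Gain and loss terms as convolutions and correlations\<close>

definition conv :: "(real \<Rightarrow> real) \<Rightarrow> (real \<Rightarrow> real) \<Rightarrow> real \<Rightarrow> real" where
  "conv f g r = (LBINT s. f s * g (r - s))"

text \<open>\<open>conv\<close> is the merger of two particles into one of energy \<open>r\<close>.
  \<open>corr\<close> is the splitting of a particle of energy \<open>r + s\<close> into
  \<open>r\<close> and \<open>s\<close>, stimulated by the particles already present at
  \<open>s\<close>.\<close>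

definition corr :: "(real \<Rightarrow> real) \<Rightarrow> (real \<Rightarrow> real) \<Rightarrow> real \<Rightarrow> real" where
  "corr f g r = (LBINT s. f (r + s) * g s)"

text \<open>Extended by zero to negative arguments, so that all energy integrals run over the whole
  line and translation or reflection produces no boundary terms.\<close>

definition pos_square :: "real \<Rightarrow> real" where
  "pos_square s = (if s > 0 then s\<^sup>2 else 0)"

text \<open>On the diagonal the two orders of \<open>corr\<close> give the factor 2 of stimulated
  splitting. Two separate arguments are kept for the difference of two diagonal values.\<close>

definition gain :: "(real \<Rightarrow> real) \<Rightarrow> (real \<Rightarrow> real) \<Rightarrow> real \<Rightarrow> real" where
  "gain f g r = pos_square r * (conv f g r + corr f g r + corr g f r)"

text \<open>Spontaneous splitting: the weight s^2 takes the place of the stimulating density, and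
  the factor 2 counts both fragments.\<close>

definition split_gain :: "(real \<Rightarrow> real) \<Rightarrow> real \<Rightarrow> real" where
  "split_gain f r = 2 * pos_square r * corr f pos_square r"

text \<open>The three loss terms of \<open>quadratic_collision\<close> add up to
  \<open>2 * ((r + s)\<^sup>2 + (r - s)\<^sup>2)\<close> for \<open>s \<le> r\<close> and to \<open>2 * ((r + s)\<^sup>2 - (s - r)\<^sup>2)\<close> for \<open>r < s\<close>.\<close>

definition loss_kernel :: "real \<Rightarrow> real \<Rightarrow> real" where
  "loss_kernel r s = (if s \<le> r then 4 * (r\<^sup>2 + s\<^sup>2) else 8 * r * s)"

definition loss :: "(real \<Rightarrow> real) \<Rightarrow> real \<Rightarrow> real" where
  "loss f r = (LBINT s. loss_kernel r s * f s)"

definition coll :: "(real \<Rightarrow> real) \<Rightarrow> real \<Rightarrow> real" where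
  "coll u r = gain u u r + split_gain u r - u r * (loss u r + r ^ 5 / 30)"

lemma pos_square_meas [measurable]: "pos_square \<in> borel_measurable borel"
  unfolding pos_square_def by measurable

lemma pos_square_nonneg [simp]: "0 \<le> pos_square s"
  by (simp add: pos_square_def)

lemma loss_kernel_meas [measurable]:
  assumes [measurable]: "f \<in> borel_measurable M" "g \<in> borel_measurable M"
  shows "(\<lambda>x. loss_kernel (f x) (g x)) \<in> borel_measurable M"
  unfolding loss_kernel_def by measurable

lemma conv_meas [measurable]:
  assumes [measurable]: "f \<in> borel_measurable borel" "g \<in> borel_measurable borel"
  shows "conv f g \<in> borel_measurable borel"
proof -
  have "(\<lambda>r. LBINT s. f s * g (r - s)) \<in> borel_measurable borel"
    by (rule lborel.borel_measurable_lebesgue_integral) measurable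
  thus ?thesis unfolding conv_def[abs_def] .
qed

lemma corr_meas [measurable]:
  assumes [measurable]: "f \<in> borel_measurable borel" "g \<in> borel_measurable borel"
  shows "corr f g \<in> borel_measurable borel"
proof -
  have "(\<lambda>r. LBINT s. f (r + s) * g s) \<in> borel_measurable borel"
    by (rule lborel.borel_measurable_lebesgue_integral) measurable
  thus ?thesis unfolding corr_def[abs_def] .
qed

lemma loss_meas [measurable]:
  assumes [measurable]: "f \<in> borel_measurable borel"
  shows "loss f \<in> borel_measurable borel"
proof -
  have "(\<lambda>r. LBINT s. loss_kernel r s * f s) \<in> borel_measurable borel"
    by (rule lborel.borel_measurable_lebesgue_integral) measurable
  thus ?thesis unfolding loss_def[abs_def] .
qed

lemma gain_meas [measurable]:
  assumes [measurable]: "f \<in> borel_measurable borel" "g \<in> borel_measurable borel"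
  shows "gain f g \<in> borel_measurable borel"
  unfolding gain_def[abs_def] by measurable

lemma split_gain_meas [measurable]:
  assumes [measurable]: "f \<in> borel_measurable borel"
  shows "split_gain f \<in> borel_measurable borel"
  unfolding split_gain_def[abs_def] by measurable

lemma coll_meas [measurable]:
  assumes [measurable]: "f \<in> borel_measurable borel"
  shows "coll f \<in> borel_measurable borel"
  unfolding coll_def[abs_def] by measurable

lemma dens_conv_integrable:
  assumes f: "dens f" and g: "dens g" shows "integrable lborel (\<lambda>s. f s * g (r - s))"
proof -
  note [measurable] = dens_meas[OF f] dens_meas[OF g]
  obtain M where M: "\<And>r. f r \<le> M" "0 \<le> M" using dens_bound[OF f] by blast
  have "integrable lborel (\<lambda>s. M * g (r + (-1) * s))"
    using lborel_integrable_real_affine[OF dens_integrable_self[OF g], of "-1" r] by simp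
  thus ?thesis
    by (rule Bochner_Integration.integrable_bound)
      (auto simp: abs_mult dens_nonneg[OF f] dens_nonneg[OF g] M intro!: mult_right_mono AE_I2)
qed

lemma dens_corr_integrable:
  assumes f: "dens f" and g: "dens g" shows "integrable lborel (\<lambda>s. f (r + s) * g s)"
proof -
  note [measurable] = dens_meas[OF f] dens_meas[OF g]
  obtain M where M: "\<And>r. f r \<le> M" "0 \<le> M" using dens_bound[OF f] by blast
  have "integrable lborel (\<lambda>s. M * g s)" using dens_integrable_self[OF g] by simp
  thus ?thesis
    by (rule Bochner_Integration.integrable_bound)
      (auto simp: abs_mult dens_nonneg[OF f] dens_nonneg[OF g] M intro!: mult_right_mono AE_I2)
qed

lemma dens_split_integrable:
  assumes f: "dens f" and r: "0 < r" shows "integrable lborel (\<lambda>s. f (r + s) * pos_square s)"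
proof -
  note [measurable] = dens_meas[OF f]
  have "integrable lborel (\<lambda>s. (r + 1 * s)\<^sup>2 * f (r + 1 * s))"
    using lborel_integrable_real_affine[OF pow_integrable[OF f, of 2], of 1 r] by simp
  thus ?thesis
    by (rule Bochner_Integration.integrable_bound)
      (use r in \<open>auto simp: abs_mult dens_nonneg[OF f] pos_square_def mult.commute intro!: mult_left_mono AE_I2 power_mono\<close>)
qed

text \<open>Both branches lie below 8 r (r + s). The product form on the right lets the variable
  \<open>s\<close> be integrated out into a single moment.\<close>

lemma loss_kernel_bounds:
  assumes "0 < r" "0 < s"
  shows "0 \<le> loss_kernel r s" "loss_kernel r s \<le> 8 * (1 + r) ^ 2 * (1 + s)"
proof -
  show "0 \<le> loss_kernel r s" using assms by (auto simp: loss_kernel_def)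
  have "loss_kernel r s \<le> 8 * (r * (r + s))"
  proof (cases "s \<le> r")
    case True
    hence "s\<^sup>2 \<le> r * r" using assms by (simp add: power2_eq_square mult_mono)
    moreover have "0 \<le> r * s" using assms by simp
    ultimately show ?thesis using True unfolding loss_kernel_def
      by (simp add: power2_eq_square algebra_simps)
  qed (use assms in \<open>simp add: loss_kernel_def algebra_simps\<close>)
  also have "r * (r + s) \<le> (1 + r) ^ 2 * (1 + s)"
  proof -
    have "(1 + r) ^ 2 * (1 + s) - r * (r + s) = 1 + s + 2 * r + r * s + r * r * s"
      by (simp add: power2_eq_square algebra_simps)
    moreover have "0 \<le> r * s" "0 \<le> r * r * s" using assms by auto
    ultimately show ?thesis using assms by linarith
  qed
  finally show "loss_kernel r s \<le> 8 * (1 + r) ^ 2 * (1 + s)" by simp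
qed

lemma dens_loss_integrable:
  assumes f: "dens f" and r: "0 < r" shows "integrable lborel (\<lambda>s. loss_kernel r s * f s)"
  by (rule dens_integral_le(1)[OF f, where k = 1 and c = "8 * (1 + r) ^ 2"])
    (use r loss_kernel_bounds in auto)

lemma loss_bounds:
  assumes f: "dens f" and r: "0 < r"
  shows "0 \<le> loss f r" "loss f r \<le> 8 * (1 + r) ^ 2 * mom 1 f"
proof -
  show "loss f r \<le> 8 * (1 + r) ^ 2 * mom 1 f"
    unfolding loss_def
    by (rule dens_integral_le(2)[OF f]) (use r loss_kernel_bounds in auto)
  have "0 \<le> loss_kernel r s * f s" for s
    by (cases "s > 0") (auto simp: dens_zero[OF f] dens_nonneg[OF f] loss_kernel_bounds r)
  thus "0 \<le> loss f r" unfolding loss_def by simp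
qed

section \<open>Positivity, weak forms and moment bounds of gain and loss\<close>

lemma conv_nonneg: "dens f \<Longrightarrow> dens g \<Longrightarrow> 0 \<le> conv f g r"
  and corr_nonneg: "dens f \<Longrightarrow> dens g \<Longrightarrow> 0 \<le> corr f g r"
  unfolding conv_def corr_def by (simp_all add: dens_nonneg)

lemma gain_nonneg: "dens f \<Longrightarrow> dens g \<Longrightarrow> 0 \<le> gain f g r"
  by (simp add: gain_def conv_nonneg corr_nonneg)

lemma split_gain_nonneg: "dens f \<Longrightarrow> 0 \<le> split_gain f r"
  unfolding split_gain_def corr_def by (simp add: dens_nonneg)

text \<open>Weak form of merging: the test function is evaluated at the sum of the two energies.
  With nonnegative integrals Tonelli requires no integrability, and finiteness is a conclusion later
  on.\<close>

lemma nn_integral_conv: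
  assumes f: "dens f" and g: "dens g" and [measurable]: "\<phi> \<in> borel_measurable borel"
  shows "(\<integral>\<^sup>+r. \<phi> r * ennreal (conv f g r) \<partial>lborel)
    = (\<integral>\<^sup>+x. \<integral>\<^sup>+y. ennreal (f x * g y) * \<phi> (x + y) \<partial>lborel \<partial>lborel)"
proof -
  note [measurable] = dens_meas[OF f] dens_meas[OF g]
  have "ennreal (conv f g r) = (\<integral>\<^sup>+s. ennreal (f s * g (r - s)) \<partial>lborel)" for r
    unfolding conv_def
    by (rule nn_integral_eq_integral[symmetric])
      (simp_all add: dens_conv_integrable[OF f g] dens_nonneg[OF f] dens_nonneg[OF g])
  hence "(\<integral>\<^sup>+r. \<phi> r * ennreal (conv f g r) \<partial>lborel)
    = (\<integral>\<^sup>+r. \<integral>\<^sup>+s. \<phi> r * ennreal (f s * g (r - s)) \<partial>lborel \<partial>lborel)"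
    by (simp add: nn_integral_cmult)
  also have "\<dots> = (\<integral>\<^sup>+s. \<integral>\<^sup>+r. \<phi> r * ennreal (f s * g (r - s)) \<partial>lborel \<partial>lborel)"
    by (rule lborel_pair.Fubini') measurable
  also have "\<dots> = (\<integral>\<^sup>+s. \<integral>\<^sup>+y. ennreal (f s * g y) * \<phi> (s + y) \<partial>lborel \<partial>lborel)"
  proof (rule nn_integral_cong)
    fix s
    show "(\<integral>\<^sup>+r. \<phi> r * ennreal (f s * g (r - s)) \<partial>lborel) = (\<integral>\<^sup>+y. ennreal (f s * g y) * \<phi> (s + y) \<partial>lborel)"
      by (subst nn_integral_real_affine[where c = 1 and t = s]) (simp_all add: mult.commute)
  qed
  finally show ?thesis .
qed

text \<open>Integrability is asked for only where the test function is nonzero, since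
  \<open>g\<close> will also be \<open>pos_square\<close>, for which
  \<open>dens_split_integrable\<close> covers \<open>0 < r\<close>.\<close>

lemma nn_integral_corr:
  assumes [measurable]: "f \<in> borel_measurable borel" "g \<in> borel_measurable borel" "\<phi> \<in> borel_measurable borel"
    and nn: "\<And>r. 0 \<le> f r" "\<And>r. 0 \<le> g r"
    and i: "\<And>r. \<phi> r \<noteq> 0 \<Longrightarrow> integrable lborel (\<lambda>s. f (r + s) * g s)"
  shows "(\<integral>\<^sup>+r. \<phi> r * ennreal (corr f g r) \<partial>lborel)
    = (\<integral>\<^sup>+x. \<integral>\<^sup>+y. ennreal (f x * g y) * \<phi> (x - y) \<partial>lborel \<partial>lborel)"
proof -
  have "\<phi> r * ennreal (corr f g r) = \<phi> r * (\<integral>\<^sup>+s. ennreal (f (r + s) * g s) \<partial>lborel)" for r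
    unfolding corr_def
    by (cases "\<phi> r = 0") (use i nn in \<open>auto simp: nn_integral_eq_integral\<close>)
  hence "(\<integral>\<^sup>+r. \<phi> r * ennreal (corr f g r) \<partial>lborel)
    = (\<integral>\<^sup>+r. \<integral>\<^sup>+s. \<phi> r * ennreal (f (r + s) * g s) \<partial>lborel \<partial>lborel)"
    by (simp add: nn_integral_cmult)
  also have "\<dots> = (\<integral>\<^sup>+s. \<integral>\<^sup>+r. \<phi> r * ennreal (f (r + s) * g s) \<partial>lborel \<partial>lborel)"
    by (rule lborel_pair.Fubini') measurable
  also have "\<dots> = (\<integral>\<^sup>+s. \<integral>\<^sup>+x. ennreal (f x * g s) * \<phi> (x - s) \<partial>lborel \<partial>lborel)"
  proof (rule nn_integral_cong)
    fix s
    show "(\<integral>\<^sup>+r. \<phi> r * ennreal (f (r + s) * g s) \<partial>lborel) = (\<integral>\<^sup>+x. ennreal (f x * g s) * \<phi> (x - s) \<partial>lborel)"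
      by (subst (2) nn_integral_real_affine[where c = 1 and t = s]) (simp_all add: mult.commute add.commute)
  qed
  also have "\<dots> = (\<integral>\<^sup>+x. \<integral>\<^sup>+y. ennreal (f x * g y) * \<phi> (x - y) \<partial>lborel \<partial>lborel)"
    by (rule lborel_pair.Fubini') measurable
  finally show ?thesis .
qed

lemma nn_integral_dens_corr:
  assumes "dens f" "dens g" "\<phi> \<in> borel_measurable borel"
  shows "(\<integral>\<^sup>+r. \<phi> r * ennreal (corr f g r) \<partial>lborel)
    = (\<integral>\<^sup>+x. \<integral>\<^sup>+y. ennreal (f x * g y) * \<phi> (x - y) \<partial>lborel \<partial>lborel)"
  by (rule nn_integral_corr)
    (use assms in \<open>auto intro: dens_meas dens_nonneg dens_corr_integrable\<close>)

lemma nn_integral_mom: "dens f \<Longrightarrow> k \<le> 6 \<Longrightarrow> (\<integral>\<^sup>+x. ennreal ((1 + x) ^ k * f x) \<partial>lborel) = ennreal (mom k f)"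
  unfolding mom_def
  by (rule nn_integral_eq_integral) (simp_all add: mom_integrable dens_weighted_nonneg)

lemma nn_integral_product_bound:
  assumes f: "dens f" and g: "dens g" and c: "0 \<le> c" and j: "j \<le> 6" and k: "k \<le> 6"
    and le: "\<And>x y. 0 < x \<Longrightarrow> 0 < y \<Longrightarrow> \<psi> x y \<le> ennreal (c * ((1 + x) ^ j * (1 + y) ^ k))"
  shows "(\<integral>\<^sup>+x. \<integral>\<^sup>+y. ennreal (f x * g y) * \<psi> x y \<partial>lborel \<partial>lborel) \<le> ennreal (c * mom j f * mom k g)"
proof -
  note [measurable] = dens_meas[OF f] dens_meas[OF g]
  have "(\<integral>\<^sup>+x. \<integral>\<^sup>+y. ennreal (f x * g y) * \<psi> x y \<partial>lborel \<partial>lborel)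
    \<le> (\<integral>\<^sup>+x. \<integral>\<^sup>+y. ennreal (c * ((1 + x) ^ j * f x)) * ennreal ((1 + y) ^ k * g y) \<partial>lborel \<partial>lborel)"
  proof (intro nn_integral_mono)
    fix x y
    show "ennreal (f x * g y) * \<psi> x y \<le> ennreal (c * ((1 + x) ^ j * f x)) * ennreal ((1 + y) ^ k * g y)"
    proof (cases "0 < x \<and> 0 < y")
      case True
      have "ennreal (f x * g y) * \<psi> x y \<le> ennreal (f x * g y) * ennreal (c * ((1 + x) ^ j * (1 + y) ^ k))"
        using le True by (intro mult_left_mono) auto
      also have "\<dots> = ennreal (c * ((1 + x) ^ j * f x)) * ennreal ((1 + y) ^ k * g y)"
        using True c dens_nonneg[OF f, of x] dens_nonneg[OF g, of y]
        by (simp add: ennreal_mult[symmetric] mult_ac)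
      finally show ?thesis .
    qed (auto simp: dens_zero[OF f] dens_zero[OF g] not_less)
  qed
  also have "\<dots> = (\<integral>\<^sup>+x. ennreal (c * ((1 + x) ^ j * f x)) * ennreal (mom k g) \<partial>lborel)"
    by (simp add: nn_integral_cmult nn_integral_mom[OF g k])
  also have "\<dots> = (\<integral>\<^sup>+x. ennreal (mom k g) * (ennreal c * ennreal ((1 + x) ^ j * f x)) \<partial>lborel)"
  proof (rule nn_integral_cong)
    fix x
    show "ennreal (c * ((1 + x) ^ j * f x)) * ennreal (mom k g) = ennreal (mom k g) * (ennreal c * ennreal ((1 + x) ^ j * f x))"
      by (cases "x > 0") (use c dens_nonneg[OF f, of x] in \<open>auto simp: ennreal_mult mult.commute dens_zero[OF f] not_less\<close>)
  qed
  also have "\<dots> = ennreal (mom k g) * (ennreal c * ennreal (mom j f))"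
    by (simp add: nn_integral_cmult nn_integral_mom[OF f j, symmetric])
  also have "\<dots> = ennreal (c * mom j f * mom k g)"
    by (simp add: ennreal_mult c mom_nonneg[OF f] mom_nonneg[OF g] mult_ac)
  finally show ?thesis .
qed

text \<open>The factor r^2 adds two powers to those of the weight. The produced energy is at most x
  + y, so submultiplicativity charges all k powers to each partner. The 3 counts \<open>conv\<close>
  and the two \<open>corr\<close> terms.\<close>

lemma gain_bound_pow:
  assumes f: "dens f" and g: "dens g" and [measurable]: "\<omega> \<in> borel_measurable borel"
    and \<omega>: "\<And>r. 0 < r \<Longrightarrow> 0 \<le> \<omega> r" "\<And>r. 0 < r \<Longrightarrow> \<omega> r \<le> c * (1 + r) ^ j" and c: "0 \<le> c" and k: "k = 2 + j" "k \<le> 6"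
  shows "integrable lborel (\<lambda>r. \<omega> r * gain f g r)"
    and "(LBINT r. \<omega> r * gain f g r) \<le> 3 * c * mom k f * mom k g"
proof -
  note [measurable] = dens_meas[OF f] dens_meas[OF g]
  define \<phi> where "\<phi> r = pos_square r * \<omega> r" for r
  have [measurable]: "\<phi> \<in> borel_measurable borel" unfolding \<phi>_def[abs_def] by measurable
  have \<phi>0: "0 \<le> \<phi> r" for r by (auto simp: \<phi>_def pos_square_def \<omega>)
  have \<phi>le: "\<phi> r \<le> c * (1 + R) ^ k" if "r \<le> R" "0 \<le> R" for r R
  proof (cases "r > 0")
    case True
    have "\<phi> r \<le> r\<^sup>2 * (c * (1 + r) ^ j)" using \<omega>(2)[OF True] True by (simp add: \<phi>_def pos_square_def)
    also have "\<dots> \<le> (1 + R)\<^sup>2 * (c * (1 + R) ^ j)"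
      using that True c by (intro mult_mono mult_left_mono power_mono) auto
    finally show ?thesis by (simp only: power_add mult_ac k)
  qed (use that c in \<open>simp add: \<phi>_def pos_square_def\<close>)
  have pw: "(1 + x + y) ^ k \<le> (1 + x) ^ k * (1 + y) ^ k" if "0 < x" "0 < y" for x y :: real
  proof -
    have "1 + x + y \<le> (1 + x) * (1 + y)" using that by (simp add: algebra_simps)
    from power_mono[OF this, of k] that show ?thesis by (simp add: power_mult_distrib)
  qed
  have bd: "c * (1 + R) ^ k \<le> c * ((1 + x) ^ k * (1 + y) ^ k)" if "R \<le> x + y" "0 \<le> R" "0 < x" "0 < y" for R x y
  proof -
    have "(1 + R) ^ k \<le> (1 + x + y) ^ k" using that by (intro power_mono) auto
    also note pw[OF that(3,4)]
    finally show ?thesis using c by (intro mult_left_mono)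
  qed
  have le: "ennreal (\<phi> z) \<le> ennreal (c * ((1 + x) ^ k * (1 + y) ^ k))" if "z \<le> x + y" "0 < x" "0 < y" for x y z
  proof -
    have "\<phi> z \<le> c * (1 + (x + y)) ^ k" using \<phi>le[of z "x + y"] that by auto
    also have "\<dots> \<le> c * ((1 + x) ^ k * (1 + y) ^ k)" using bd[of "x + y" x y] that by auto
    finally show ?thesis by (rule ennreal_leI)
  qed
  have eq: "ennreal (\<omega> r * gain f g r) = ennreal (\<phi> r) * ennreal (conv f g r)
      + ennreal (\<phi> r) * ennreal (corr f g r) + ennreal (\<phi> r) * ennreal (corr g f r)" for r
  proof -
    have "\<omega> r * gain f g r = \<phi> r * conv f g r + \<phi> r * corr f g r + \<phi> r * corr g f r"
      by (simp add: gain_def \<phi>_def algebra_simps)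
    thus ?thesis
      using \<phi>0[of r] conv_nonneg[OF f g, of r] corr_nonneg[OF f g, of r] corr_nonneg[OF g f, of r]
      by (simp add: ennreal_mult[symmetric])
  qed
  have c1: "(\<integral>\<^sup>+r. ennreal (\<phi> r) * ennreal (conv f g r) \<partial>lborel) \<le> ennreal (c * mom k f * mom k g)"
    unfolding nn_integral_conv[OF f g, of "\<lambda>r. ennreal (\<phi> r)", simplified]
    by (rule nn_integral_product_bound[OF f g c]) (use k(2) in \<open>auto intro!: le\<close>)
  have c2: "(\<integral>\<^sup>+r. ennreal (\<phi> r) * ennreal (corr f g r) \<partial>lborel) \<le> ennreal (c * mom k f * mom k g)"
    unfolding nn_integral_dens_corr[OF f g, of "\<lambda>r. ennreal (\<phi> r)", simplified]
    by (rule nn_integral_product_bound[OF f g c]) (use k(2) in \<open>auto intro!: le\<close>)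
  have c3: "(\<integral>\<^sup>+r. ennreal (\<phi> r) * ennreal (corr g f r) \<partial>lborel) \<le> ennreal (c * mom k g * mom k f)"
    unfolding nn_integral_dens_corr[OF g f, of "\<lambda>r. ennreal (\<phi> r)", simplified]
    by (rule nn_integral_product_bound[OF g f c]) (use k(2) in \<open>auto intro!: le\<close>)
  have nn: "0 \<le> c * mom k f * mom k g" using c mom_nonneg f g by simp
  have "(\<integral>\<^sup>+r. ennreal (\<omega> r * gain f g r) \<partial>lborel)
    \<le> ennreal (c * mom k f * mom k g) + ennreal (c * mom k f * mom k g) + ennreal (c * mom k f * mom k g)"
    unfolding eq using c1 c2 c3
    by (simp add: nn_integral_add mult_ac) (meson add_mono)
  also have "\<dots> = ennreal (3 * c * mom k f * mom k g)"
    using nn by (simp add: ennreal_plus[symmetric] algebra_simps del: ennreal_plus)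
  finally have fin: "(\<integral>\<^sup>+r. ennreal (\<omega> r * gain f g r) \<partial>lborel) \<le> ennreal (3 * c * mom k f * mom k g)" .
  have n0: "0 \<le> \<omega> r * gain f g r" for r
    using gain_nonneg[OF f g, of r] \<omega>(1)[of r] by (cases "r > 0") (auto simp: gain_def pos_square_def)
  show "integrable lborel (\<lambda>r. \<omega> r * gain f g r)" "(LBINT r. \<omega> r * gain f g r) \<le> 3 * c * mom k f * mom k g"
    by (rule nn_integral_bound_imp_integrable[OF _ n0 fin]; use nn in simp)+
qed

lemma gain_bound:
  assumes "dens f" "dens g" "\<omega> \<in> borel_measurable borel"
    and "\<And>r. 0 < r \<Longrightarrow> 0 \<le> \<omega> r" "\<And>r. 0 < r \<Longrightarrow> \<omega> r \<le> c * (1 + r)" and "0 \<le> c"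
  shows "integrable lborel (\<lambda>r. \<omega> r * gain f g r)"
    and "(LBINT r. \<omega> r * gain f g r) \<le> 3 * c * mom 3 f * mom 3 g"
  using gain_bound_pow[of f g \<omega> c 1 3] assms by simp_all

text \<open>Weak form of spontaneous splitting: a particle of energy x yields fragments y and x - y
  at rate (x - y)^2 y^2. The substitution y to x - y moves the test function to the fragment
  y.\<close>

lemma nn_integral_split_gain:
  assumes f: "dens f" and [measurable]: "\<omega> \<in> borel_measurable borel" and \<omega>: "\<And>r. 0 < r \<Longrightarrow> 0 \<le> \<omega> r"
  shows "(\<integral>\<^sup>+r. ennreal (\<omega> r * split_gain f r) \<partial>lborel)
    = (\<integral>\<^sup>+x. ennreal (f x) * (\<integral>\<^sup>+y. ennreal (2 * pos_square (x - y) * pos_square y * \<omega> y) \<partial>lborel) \<partial>lborel)"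
proof -
  note [measurable] = dens_meas[OF f]
  define \<phi> where "\<phi> r = 2 * pos_square r * \<omega> r" for r
  have [measurable]: "\<phi> \<in> borel_measurable borel" unfolding \<phi>_def[abs_def] by measurable
  have \<phi>0: "0 \<le> \<phi> r" for r by (auto simp: \<phi>_def pos_square_def \<omega>)
  have c0: "0 \<le> corr f pos_square r" for r unfolding corr_def by (simp add: dens_nonneg[OF f])
  have "(\<integral>\<^sup>+r. ennreal (\<omega> r * split_gain f r) \<partial>lborel) = (\<integral>\<^sup>+r. ennreal (\<phi> r) * ennreal (corr f pos_square r) \<partial>lborel)"
    using \<phi>0 c0 by (intro nn_integral_cong) (simp add: split_gain_def \<phi>_def ennreal_mult[symmetric] mult_ac)
  also have "\<dots> = (\<integral>\<^sup>+x. \<integral>\<^sup>+y. ennreal (f x * pos_square y) * ennreal (\<phi> (x - y)) \<partial>lborel \<partial>lborel)"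
  proof (rule nn_integral_corr)
    fix r assume "ennreal (\<phi> r) \<noteq> 0"
    hence "r > 0" by (auto simp: \<phi>_def pos_square_def split: if_splits)
    thus "integrable lborel (\<lambda>s. f (r + s) * pos_square s)" by (rule dens_split_integrable[OF f])
  qed (auto simp: dens_nonneg[OF f])
  also have "\<dots> = (\<integral>\<^sup>+x. ennreal (f x) * (\<integral>\<^sup>+y. ennreal (2 * pos_square (x - y) * pos_square y * \<omega> y) \<partial>lborel) \<partial>lborel)"
  proof (rule nn_integral_cong)
    fix x
    have "(\<integral>\<^sup>+y. ennreal (f x * pos_square y) * ennreal (\<phi> (x - y)) \<partial>lborel)
      = (\<integral>\<^sup>+y. ennreal (f x) * ennreal (pos_square y * \<phi> (x - y)) \<partial>lborel)"
      using \<phi>0 dens_nonneg[OF f, of x] by (intro nn_integral_cong) (simp add: ennreal_mult[symmetric] mult_ac)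
    also have "\<dots> = ennreal (f x) * (\<integral>\<^sup>+y. ennreal (pos_square y * \<phi> (x - y)) \<partial>lborel)"
      by (rule nn_integral_cmult) measurable
    also have "(\<integral>\<^sup>+y. ennreal (pos_square y * \<phi> (x - y)) \<partial>lborel) = (\<integral>\<^sup>+y. ennreal (pos_square (x - y) * \<phi> y) \<partial>lborel)"
      by (subst nn_integral_real_affine[where c = "-1" and t = x]) simp_all
    finally show "(\<integral>\<^sup>+y. ennreal (f x * pos_square y) * ennreal (\<phi> (x - y)) \<partial>lborel)
      = ennreal (f x) * (\<integral>\<^sup>+y. ennreal (2 * pos_square (x - y) * pos_square y * \<omega> y) \<partial>lborel)"
      by (simp add: \<phi>_def mult_ac)
  qed
  finally show ?thesis .
qed

text \<open>The inner integral runs over an interval of length x with integrand of order 4 + j,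
  hence 5 + j powers of x. The restriction on \<open>j\<close> keeps this within the six moments of
  a density.\<close>

lemma split_gain_bound:
  assumes f: "dens f" and [measurable]: "\<omega> \<in> borel_measurable borel"
    and \<omega>: "\<And>r. 0 < r \<Longrightarrow> 0 \<le> \<omega> r" "\<And>r. 0 < r \<Longrightarrow> \<omega> r \<le> c * (1 + r) ^ j" and c: "0 \<le> c" and j: "j \<le> 1"
  shows "integrable lborel (\<lambda>r. \<omega> r * split_gain f r)"
    and "(LBINT r. \<omega> r * split_gain f r) \<le> 2 * c * mom (5 + j) f"
proof -
  note [measurable] = dens_meas[OF f]
  have inner: "(\<integral>\<^sup>+y. ennreal (2 * pos_square (x - y) * pos_square y * \<omega> y) \<partial>lborel) \<le> ennreal (2 * c * (1 + x) ^ (5 + j))"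
    if x: "0 < x" for x
  proof -
    have "(\<integral>\<^sup>+y. ennreal (2 * pos_square (x - y) * pos_square y * \<omega> y) \<partial>lborel)
      \<le> (\<integral>\<^sup>+y. ennreal (2 * c * (1 + x) ^ (4 + j)) * indicator {0..x} y \<partial>lborel)"
    proof (rule nn_integral_mono)
      fix y
      show "ennreal (2 * pos_square (x - y) * pos_square y * \<omega> y) \<le> ennreal (2 * c * (1 + x) ^ (4 + j)) * indicator {0..x} y"
      proof (cases "0 < y \<and> y < x")
        case True
        have "\<omega> y \<le> c * (1 + y) ^ j" using \<omega>(2) True by auto
        also have "\<dots> \<le> c * (1 + x) ^ j" using True c by (intro mult_left_mono power_mono) auto
        finally have a: "\<omega> y \<le> c * (1 + x) ^ j" .
        have "(x - y)\<^sup>2 \<le> (1 + x)\<^sup>2" "y\<^sup>2 \<le> (1 + x)\<^sup>2" using True by (auto intro: power_mono)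
        hence "(2 * pos_square (x - y)) * pos_square y * \<omega> y \<le> 2 * (1 + x)\<^sup>2 * (1 + x)\<^sup>2 * (c * (1 + x) ^ j)"
          using True a \<omega>(1)[of y] c unfolding pos_square_def by (intro mult_mono) auto
        also have "\<dots> = 2 * c * (1 + x) ^ (4 + j)" by (simp add: power_add eval_nat_numeral mult_ac)
        finally show ?thesis using True by (simp add: ennreal_leI)
      qed (auto simp: pos_square_def)
    qed
    also have "\<dots> = ennreal (2 * c * (1 + x) ^ (4 + j)) * ennreal x"
      using x by (simp add: nn_integral_cmult)
    also have "\<dots> = ennreal (2 * c * (1 + x) ^ (4 + j) * x)"
      using x c by (simp add: ennreal_mult[symmetric])
    also have "\<dots> \<le> ennreal (2 * c * (1 + x) ^ (5 + j))"
    proof (rule ennreal_leI)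
      have "2 * c * (1 + x) ^ (4 + j) * x \<le> 2 * c * (1 + x) ^ (4 + j) * (1 + x)"
        using x c by (intro mult_left_mono) auto
      thus "2 * c * (1 + x) ^ (4 + j) * x \<le> 2 * c * (1 + x) ^ (5 + j)" by (simp add: eval_nat_numeral mult_ac)
    qed
    finally show ?thesis .
  qed
  have "(\<integral>\<^sup>+r. ennreal (\<omega> r * split_gain f r) \<partial>lborel)
    \<le> (\<integral>\<^sup>+x. ennreal (2 * c) * ennreal ((1 + x) ^ (5 + j) * f x) \<partial>lborel)"
    unfolding nn_integral_split_gain[OF f assms(2) \<omega>(1), simplified]
  proof (rule nn_integral_mono)
    fix x
    show "ennreal (f x) * (\<integral>\<^sup>+y. ennreal (2 * pos_square (x - y) * pos_square y * \<omega> y) \<partial>lborel)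
      \<le> ennreal (2 * c) * ennreal ((1 + x) ^ (5 + j) * f x)"
    proof (cases "x > 0")
      case True
      have "ennreal (f x) * (\<integral>\<^sup>+y. ennreal (2 * pos_square (x - y) * pos_square y * \<omega> y) \<partial>lborel)
        \<le> ennreal (f x) * ennreal (2 * c * (1 + x) ^ (5 + j))"
        using inner[OF True] by (intro mult_left_mono) auto
      also have "\<dots> = ennreal (2 * c) * ennreal ((1 + x) ^ (5 + j) * f x)"
        using True c dens_nonneg[OF f, of x] by (simp add: ennreal_mult[symmetric] mult_ac)
      finally show ?thesis .
    qed (simp add: dens_zero[OF f])
  qed
  also have "\<dots> = ennreal (2 * c * mom (5 + j) f)"
    using j c by (simp add: nn_integral_cmult nn_integral_mom[OF f] ennreal_mult[symmetric] mom_nonneg[OF f])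
  finally have fin: "(\<integral>\<^sup>+r. ennreal (\<omega> r * split_gain f r) \<partial>lborel) \<le> ennreal (2 * c * mom (5 + j) f)" .
  have n0: "0 \<le> \<omega> r * split_gain f r" for r
    using split_gain_nonneg[OF f, of r] \<omega>(1)[of r] by (cases "r > 0") (auto simp: split_gain_def pos_square_def)
  have nn: "0 \<le> 2 * c * mom (5 + j) f" using c mom_nonneg f by simp
  show "integrable lborel (\<lambda>r. \<omega> r * split_gain f r)" "(LBINT r. \<omega> r * split_gain f r) \<le> 2 * c * mom (5 + j) f"
    by (rule nn_integral_bound_imp_integrable[OF _ n0 fin]; use nn in simp)+
qed

text \<open>The loss rate grows quadratically with a first moment as coefficient, and the weight
  adds one more power, so three moments of \<open>f\<close> suffice.\<close>

lemma loss_term_bound: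
  assumes f: "dens f" and g: "dens g" and [measurable]: "\<omega> \<in> borel_measurable borel"
    and \<omega>: "\<And>r. 0 < r \<Longrightarrow> 0 \<le> \<omega> r" "\<And>r. 0 < r \<Longrightarrow> \<omega> r \<le> c * (1 + r)" and c: "0 \<le> c"
  shows "integrable lborel (\<lambda>r. \<omega> r * (f r * loss g r))"
    and "(LBINT r. \<omega> r * (f r * loss g r)) \<le> 8 * c * mom 3 f * mom 3 g"
proof -
  note [measurable] = dens_meas[OF f] dens_meas[OF g]
  have le: "\<bar>\<omega> r * loss g r\<bar> \<le> (8 * c * mom 1 g) * (1 + r) ^ 3" if r: "0 < r" for r
  proof -
    have "\<bar>\<omega> r * loss g r\<bar> = \<omega> r * loss g r" using \<omega>(1)[OF r] loss_bounds(1)[OF g r] by simp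
    also have "\<dots> \<le> (c * (1 + r)) * (8 * (1 + r) ^ 2 * mom 1 g)"
      using \<omega>[OF r] loss_bounds[OF g r] r c by (intro mult_mono) auto
    finally show ?thesis by (simp add: power3_eq_cube power2_eq_square mult_ac)
  qed
  have eq: "(\<lambda>r. \<omega> r * (f r * loss g r)) = (\<lambda>r. \<omega> r * loss g r * f r)" by (simp add: fun_eq_iff mult_ac)
  show "integrable lborel (\<lambda>r. \<omega> r * (f r * loss g r))"
    unfolding eq by (rule dens_integral_le(1)[OF f _ le]) auto
  have "(LBINT r. \<omega> r * (f r * loss g r)) \<le> (8 * c * mom 1 g) * mom 3 f"
    unfolding eq by (rule dens_integral_le(2)[OF f _ le]) auto
  also have "\<dots> \<le> (8 * c * mom 3 g) * mom 3 f"
    using c mom_nonneg[OF f] mom_mono[OF g, of 1 3] by (intro mult_mono) (auto simp: mom_nonneg[OF g])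
  finally show "(LBINT r. \<omega> r * (f r * loss g r)) \<le> 8 * c * mom 3 f * mom 3 g" by (simp add: mult_ac)
qed

section \<open>Difference estimates for the collision operator\<close>

lemma integral_abs_product_diff:
  fixes a b p q :: "real \<Rightarrow> real"
  assumes "\<And>s. 0 \<le> a s" "\<And>s. 0 \<le> b s" "\<And>s. 0 \<le> p s" "\<And>s. 0 \<le> q s"
    and "integrable M (\<lambda>s. a s * b s)" "integrable M (\<lambda>s. p s * q s)"
    and "integrable M (\<lambda>s. \<bar>a s - p s\<bar> * (b s + q s))" "integrable M (\<lambda>s. (a s + p s) * \<bar>b s - q s\<bar>)"
  shows "\<bar>(LINT s|M. a s * b s) - (LINT s|M. p s * q s)\<bar>
    \<le> (LINT s|M. \<bar>a s - p s\<bar> * (b s + q s)) + (LINT s|M. (a s + p s) * \<bar>b s - q s\<bar>)"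
proof -
  have pt: "\<bar>a s * b s - p s * q s\<bar> \<le> \<bar>a s - p s\<bar> * (b s + q s) + (a s + p s) * \<bar>b s - q s\<bar>" for s
  proof -
    have "a s * b s - p s * q s = (a s - p s) * b s + p s * (b s - q s)" by (simp add: algebra_simps)
    hence "\<bar>a s * b s - p s * q s\<bar> \<le> \<bar>a s - p s\<bar> * b s + p s * \<bar>b s - q s\<bar>"
      using assms(1-4)[of s] by (metis abs_mult abs_of_nonneg abs_triangle_ineq)
    moreover have "\<bar>a s - p s\<bar> * b s \<le> \<bar>a s - p s\<bar> * (b s + q s)" "p s * \<bar>b s - q s\<bar> \<le> (a s + p s) * \<bar>b s - q s\<bar>"
      using assms(1-4)[of s] by (auto intro: mult_left_mono mult_right_mono)
    ultimately show ?thesis by linarith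
  qed
  have "\<bar>(LINT s|M. a s * b s) - (LINT s|M. p s * q s)\<bar> = \<bar>LINT s|M. a s * b s - p s * q s\<bar>"
    using assms by simp
  also have "\<dots> \<le> (LINT s|M. \<bar>a s * b s - p s * q s\<bar>)"
    by (rule integral_abs_bound)
  also have "\<dots> \<le> (LINT s|M. \<bar>a s - p s\<bar> * (b s + q s) + (a s + p s) * \<bar>b s - q s\<bar>)"
    using assms pt by (intro integral_mono) auto
  finally show ?thesis using assms by simp
qed

text \<open>Polarization: the difference of two diagonal values is dominated by mixed gains of the
  absolute difference and the sum. Positivity of both arguments keeps all earlier moment bounds
  applicable.\<close>

lemma gain_diff:
  assumes u: "dens u" and v: "dens v"
  shows "\<bar>gain u u r - gain v v r\<bar>
    \<le> gain (\<lambda>r. \<bar>u r - v r\<bar>) (\<lambda>r. u r + v r) r + gain (\<lambda>r. u r + v r) (\<lambda>r. \<bar>u r - v r\<bar>) r"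
proof -
  note w = dens_diff[OF u v] and U = dens_add[OF u v]
  note i = dens_conv_integrable dens_corr_integrable
  have 1: "\<bar>conv u u r - conv v v r\<bar> \<le> conv (\<lambda>r. \<bar>u r - v r\<bar>) (\<lambda>r. u r + v r) r + conv (\<lambda>r. u r + v r) (\<lambda>r. \<bar>u r - v r\<bar>) r"
    unfolding conv_def by (rule integral_abs_product_diff)
      (use i[OF u u] i[OF v v] i[OF w U] i[OF U w] dens_nonneg u v in auto)
  have 2: "\<bar>corr u u r - corr v v r\<bar> \<le> corr (\<lambda>r. \<bar>u r - v r\<bar>) (\<lambda>r. u r + v r) r + corr (\<lambda>r. u r + v r) (\<lambda>r. \<bar>u r - v r\<bar>) r"
    unfolding corr_def by (rule integral_abs_product_diff)
      (use i[OF u u] i[OF v v] i[OF w U] i[OF U w] dens_nonneg u v in auto)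
  have "\<bar>gain u u r - gain v v r\<bar> = pos_square r * \<bar>(conv u u r - conv v v r) + 2 * (corr u u r - corr v v r)\<bar>"
    unfolding gain_def right_diff_distrib[symmetric] abs_mult by (simp add: algebra_simps)
  also have "\<dots> \<le> pos_square r * (\<bar>conv u u r - conv v v r\<bar> + 2 * \<bar>corr u u r - corr v v r\<bar>)"
    by (intro mult_left_mono order_trans[OF abs_triangle_ineq])
      (simp_all only: abs_mult abs_numeral pos_square_nonneg order_refl)
  also have "\<dots> \<le> pos_square r * ((conv (\<lambda>r. \<bar>u r - v r\<bar>) (\<lambda>r. u r + v r) r + conv (\<lambda>r. u r + v r) (\<lambda>r. \<bar>u r - v r\<bar>) r)
    + 2 * (corr (\<lambda>r. \<bar>u r - v r\<bar>) (\<lambda>r. u r + v r) r + corr (\<lambda>r. u r + v r) (\<lambda>r. \<bar>u r - v r\<bar>) r))"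
    using 1 2 by (intro mult_left_mono) auto
  also have "\<dots> = gain (\<lambda>r. \<bar>u r - v r\<bar>) (\<lambda>r. u r + v r) r + gain (\<lambda>r. u r + v r) (\<lambda>r. \<bar>u r - v r\<bar>) r"
    by (simp add: gain_def algebra_simps)
  finally show ?thesis .
qed

lemma loss_diff:
  assumes u: "dens u" and v: "dens v" and r: "0 < r"
  shows "\<bar>u r * loss u r - v r * loss v r\<bar>
    \<le> \<bar>u r - v r\<bar> * loss (\<lambda>r. u r + v r) r + (u r + v r) * loss (\<lambda>r. \<bar>u r - v r\<bar>) r"
proof -
  note w = dens_diff[OF u v]
  have i: "integrable lborel (\<lambda>s. loss_kernel r s * u s)" "integrable lborel (\<lambda>s. loss_kernel r s * v s)"
    using dens_loss_integrable[OF u r] dens_loss_integrable[OF v r] .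
  have e: "\<bar>loss_kernel r s * u s - loss_kernel r s * v s\<bar> = loss_kernel r s * \<bar>u s - v s\<bar>" for s
    using loss_kernel_bounds(1)[OF r, of s] 
    by (cases "s > 0"; simp add: dens_zero[OF u] dens_zero[OF v] abs_mult flip: right_diff_distrib)
  have a1: "\<bar>loss u r - loss v r\<bar> \<le> loss (\<lambda>r. \<bar>u r - v r\<bar>) r"
    unfolding loss_def using integral_abs_bound[of lborel "\<lambda>s. loss_kernel r s * u s - loss_kernel r s * v s"] i
    by (simp add: e)
  have a2: "loss (\<lambda>r. u r + v r) r = loss u r + loss v r"
    unfolding loss_def using i by (simp add: distrib_left)
  have "u r * loss u r - v r * loss v r = (u r - v r) * loss u r + v r * (loss u r - loss v r)" by (simp add: algebra_simps)
  hence "\<bar>u r * loss u r - v r * loss v r\<bar> \<le> \<bar>u r - v r\<bar> * loss u r + v r * \<bar>loss u r - loss v r\<bar>"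
    using loss_bounds(1)[OF u r] dens_nonneg[OF v, of r] by (metis abs_mult abs_of_nonneg abs_triangle_ineq)
  also have "\<dots> \<le> \<bar>u r - v r\<bar> * (loss u r + loss v r) + (u r + v r) * loss (\<lambda>r. \<bar>u r - v r\<bar>) r"
    using a1 loss_bounds(1)[OF v r] loss_bounds(1)[OF w r] dens_nonneg[OF v, of r] dens_nonneg[OF u, of r]
    loss_bounds(1)[OF u r] by (intro add_mono mult_mono) auto
  finally show ?thesis by (simp add: a2)
qed

text \<open>The quadratic part is set apart because it is estimated in absolute value only, whereas
  in the linear part the cancellation between splitting gain and loss must be kept.\<close>

definition quad :: "(real \<Rightarrow> real) \<Rightarrow> real \<Rightarrow> real" where
  "quad u r = gain u u r - u r * loss u r"

lemma coll_eq_quad: "coll u r = quad u r + split_gain u r - r ^ 5 / 30 * u r"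
  by (simp add: coll_def quad_def algebra_simps)

lemma quad_meas [measurable]:
  assumes [measurable]: "u \<in> borel_measurable borel" shows "quad u \<in> borel_measurable borel"
  unfolding quad_def[abs_def] by measurable

text \<open>The constant 22 is 3 + 3 + 8 + 8, from two mixed gains and two mixed losses. The
  quadratic part costs just three powers of r, fewer than the five that the linear loss
  provides.\<close>

lemma quad_diff_bound:
  assumes u: "dens u" and v: "dens v" and [measurable]: "\<omega> \<in> borel_measurable borel"
    and \<omega>: "\<And>r. 0 < r \<Longrightarrow> 0 \<le> \<omega> r" "\<And>r. 0 < r \<Longrightarrow> \<omega> r \<le> c * (1 + r)" and c: "0 \<le> c"
  shows "integrable lborel (\<lambda>r. \<omega> r * \<bar>quad u r - quad v r\<bar>)"
    and "(LBINT r. \<omega> r * \<bar>quad u r - quad v r\<bar>)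
      \<le> 22 * c * (mom 3 u + mom 3 v) * mom 3 (\<lambda>r. \<bar>u r - v r\<bar>)"
proof -
  note w = dens_diff[OF u v] and U = dens_add[OF u v]
  note [measurable] = dens_meas[OF u] dens_meas[OF v]
  let ?w = "\<lambda>r. \<bar>u r - v r\<bar>" and ?U = "\<lambda>r. u r + v r"
  let ?D = "\<lambda>r. \<omega> r * gain ?w ?U r + \<omega> r * gain ?U ?w r + \<omega> r * (?w r * loss ?U r) + \<omega> r * (?U r * loss ?w r)"
  note G1 = gain_bound[OF w U _ \<omega> c, simplified] and G2 = gain_bound[OF U w _ \<omega> c, simplified]
    and L1 = loss_term_bound[OF w U _ \<omega> c, simplified] and L2 = loss_term_bound[OF U w _ \<omega> c, simplified]
  have i: "integrable lborel ?D" using G1 G2 L1 L2 by auto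
  have le: "\<bar>\<omega> r * \<bar>quad u r - quad v r\<bar>\<bar> \<le> ?D r" for r
  proof (cases "r > 0")
    case True
    have "\<bar>quad u r - quad v r\<bar> \<le> \<bar>gain u u r - gain v v r\<bar> + \<bar>u r * loss u r - v r * loss v r\<bar>"
      unfolding quad_def by linarith
    also have "\<dots> \<le> (gain ?w ?U r + gain ?U ?w r) + (?w r * loss ?U r + ?U r * loss ?w r)"
      by (intro add_mono gain_diff[OF u v] loss_diff[OF u v True])
    finally show ?thesis using mult_left_mono[OF _ \<omega>(1)[OF True]] \<omega>(1)[OF True] by (fastforce simp: algebra_simps abs_mult)
  qed (simp add: quad_def gain_def pos_square_def dens_zero[OF u] dens_zero[OF v])
  show i2: "integrable lborel (\<lambda>r. \<omega> r * \<bar>quad u r - quad v r\<bar>)"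
    by (rule Bochner_Integration.integrable_bound[OF i]) (use le in \<open>auto intro: order_trans[OF _ abs_ge_self]\<close>)
  have "(LBINT r. \<omega> r * \<bar>quad u r - quad v r\<bar>) \<le> (LBINT r. ?D r)"
    by (rule integral_mono[OF i2 i]) (use le in \<open>auto intro: order_trans[OF abs_ge_self]\<close>)
  also have "\<dots> = (LBINT r. \<omega> r * gain ?w ?U r) + (LBINT r. \<omega> r * gain ?U ?w r)
      + (LBINT r. \<omega> r * (?w r * loss ?U r)) + (LBINT r. \<omega> r * (?U r * loss ?w r))"
    using G1 G2 L1 L2 by simp
  also have "\<dots> \<le> 3 * c * mom 3 ?w * mom 3 ?U + 3 * c * mom 3 ?U * mom 3 ?w + 8 * c * mom 3 ?w * mom 3 ?U + 8 * c * mom 3 ?U * mom 3 ?w"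
    using G1 G2 L1 L2 by linarith
  also have "\<dots> = 22 * c * (mom 3 u + mom 3 v) * mom 3 ?w"
    by (simp add: mom_add[OF u v] algebra_simps)
  finally show "(LBINT r. \<omega> r * \<bar>quad u r - quad v r\<bar>) \<le> 22 * c * (mom 3 u + mom 3 v) * mom 3 ?w" .
qed

lemma split_gain_diff:
  assumes u: "dens u" and v: "dens v"
  shows "\<bar>split_gain u r - split_gain v r\<bar> \<le> split_gain (\<lambda>r. \<bar>u r - v r\<bar>) r"
proof (cases "r > 0")
  case True
  note i = dens_split_integrable[OF u True] dens_split_integrable[OF v True]
  have "\<bar>corr u pos_square r - corr v pos_square r\<bar> \<le> corr (\<lambda>r. \<bar>u r - v r\<bar>) pos_square r"
    unfolding corr_def
    using integral_abs_bound[of lborel "\<lambda>s. u (r + s) * pos_square s - v (r + s) * pos_square s"] i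
    by (simp add: abs_mult left_diff_distrib[symmetric] del: left_diff_distrib) (simp add: left_diff_distrib)
  thus ?thesis
    by (simp add: split_gain_def abs_mult mult_left_mono flip: right_diff_distrib)
qed (simp add: split_gain_def pos_square_def)

text \<open>The difference is measured with 5 + j powers on the right and j on the left. Because of
  this loss of moments the estimate gives continuity, but no contraction. The summand 3 is 2 for the
  splitting gain plus 1 for the linear loss.\<close>

lemma coll_diff_bound:
  assumes u: "dens u" and v: "dens v" and [measurable]: "\<omega> \<in> borel_measurable borel"
    and \<omega>: "\<And>r. 0 < r \<Longrightarrow> 0 \<le> \<omega> r" "\<And>r. 0 < r \<Longrightarrow> \<omega> r \<le> c * (1 + r) ^ j" and c: "0 \<le> c" and j: "j \<le> 1"
  shows "integrable lborel (\<lambda>r. \<omega> r * \<bar>coll u r - coll v r\<bar>)"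
    and "(LBINT r. \<omega> r * \<bar>coll u r - coll v r\<bar>)
      \<le> c * (22 * (mom 3 u + mom 3 v) + 3) * mom (5 + j) (\<lambda>r. \<bar>u r - v r\<bar>)"
proof -
  note w = dens_diff[OF u v]
  note [measurable] = dens_meas[OF u] dens_meas[OF v]
  let ?w = "\<lambda>r. \<bar>u r - v r\<bar>" and ?D = "\<lambda>r. \<omega> r * \<bar>quad u r - quad v r\<bar> + \<omega> r * split_gain (\<lambda>r. \<bar>u r - v r\<bar>) r + \<omega> r * r ^ 5 / 30 * \<bar>u r - v r\<bar>"
  have "\<omega> r \<le> c * (1 + r)" if "0 < r" for r
  proof -
    have "c * (1 + r) ^ j \<le> c * (1 + r) ^ 1" using c that j by (intro mult_left_mono power_increasing) auto
    thus ?thesis using \<omega>(2)[OF that] by simp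
  qed
  note Q = quad_diff_bound[OF u v assms(3) \<omega>(1) this c, simplified]
  note S = split_gain_bound[OF w assms(3) \<omega> c j, simplified]
  have le: "\<bar>\<omega> r * r ^ 5 / 30\<bar> \<le> c * (1 + r) ^ (5 + j)" if r: "0 < r" for r
  proof -
    have "\<bar>\<omega> r * r ^ 5 / 30\<bar> = \<omega> r * (r ^ 5 / 30)" using \<omega>(1)[OF r] r by simp
    also have "\<dots> \<le> (c * (1 + r) ^ j) * (1 + r) ^ 5"
    proof (intro mult_mono)
      have "r ^ 5 \<le> (1 + r) ^ 5" using r by (intro power_mono) auto
      thus "r ^ 5 / 30 \<le> (1 + r) ^ 5" using r zero_le_power[of r 5] by linarith
    qed (use \<omega>[OF r] r c in auto)
    finally show ?thesis by (simp add: power_add mult_ac)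
  qed
  have R: "integrable lborel (\<lambda>r. \<omega> r * r ^ 5 / 30 * ?w r)" "(LBINT r. \<omega> r * r ^ 5 / 30 * ?w r) \<le> c * mom (5 + j) ?w"
    using dens_integral_le[OF w _ le] j by auto
  have i: "integrable lborel ?D" using Q S R by (intro Bochner_Integration.integrable_add) auto
  have le: "\<bar>\<omega> r * \<bar>coll u r - coll v r\<bar>\<bar> \<le> ?D r" for r
  proof (cases "r > 0")
    case True
    have "\<bar>coll u r - coll v r\<bar> \<le> \<bar>quad u r - quad v r\<bar> + \<bar>split_gain u r - split_gain v r\<bar> + \<bar>r ^ 5 / 30 * (u r - v r)\<bar>"
      unfolding coll_eq_quad right_diff_distrib by linarith
    also have "\<dots> \<le> \<bar>quad u r - quad v r\<bar> + split_gain ?w r + r ^ 5 / 30 * ?w r"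
      using True split_gain_diff[OF u v, of r] by (simp add: abs_mult)
    finally show ?thesis using mult_left_mono[OF _ \<omega>(1)[OF True]] \<omega>(1)[OF True] by (fastforce simp: algebra_simps abs_mult)
  qed (simp add: coll_def quad_def gain_def split_gain_def pos_square_def dens_zero[OF u] dens_zero[OF v])
  show i2: "integrable lborel (\<lambda>r. \<omega> r * \<bar>coll u r - coll v r\<bar>)"
    by (rule Bochner_Integration.integrable_bound[OF i]) (use le in \<open>auto intro: order_trans[OF _ abs_ge_self]\<close>)
  have "(LBINT r. \<omega> r * \<bar>coll u r - coll v r\<bar>) \<le> (LBINT r. ?D r)"
    by (rule integral_mono[OF i2 i]) (use le in \<open>auto intro: order_trans[OF abs_ge_self]\<close>)
  also have "\<dots> = (LBINT r. \<omega> r * \<bar>quad u r - quad v r\<bar>) + (LBINT r. \<omega> r * split_gain ?w r) + (LBINT r. \<omega> r * r ^ 5 / 30 * ?w r)"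
    using Q S R by (subst Bochner_Integration.integral_add; (intro Bochner_Integration.integrable_add)?; simp)+
  also have "\<dots> \<le> 22 * c * (mom 3 u + mom 3 v) * mom 3 ?w + 2 * c * mom (5 + j) ?w + c * mom (5 + j) ?w"
    using Q S R by linarith
  also have "\<dots> \<le> 22 * c * (mom 3 u + mom 3 v) * mom (5 + j) ?w + 2 * c * mom (5 + j) ?w + c * mom (5 + j) ?w"
    using c j mom_nonneg[OF u] mom_nonneg[OF v] mom_mono[OF w, of 3 "5 + j"]
    by (intro add_mono mult_left_mono) auto
  finally show "(LBINT r. \<omega> r * \<bar>coll u r - coll v r\<bar>) \<le> c * (22 * (mom 3 u + mom 3 v) + 3) * mom (5 + j) ?w"
    by (simp add: algebra_simps)
qed

lemma dens_0: "dens (\<lambda>_. 0)"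
  by (auto simp: dens_def)

lemma coll_0: "coll (\<lambda>_. 0) r = 0"
  by (simp add: coll_def gain_def split_gain_def conv_def corr_def)

text \<open>The zero density is admissible and is mapped to zero, so the size of
  \<open>coll u\<close> is a special case of the difference estimate.\<close>

lemma coll_bound:
  assumes u: "dens u" and [measurable]: "\<omega> \<in> borel_measurable borel"
    and \<omega>: "\<And>r. 0 < r \<Longrightarrow> 0 \<le> \<omega> r" "\<And>r. 0 < r \<Longrightarrow> \<omega> r \<le> c * (1 + r) ^ j" and c: "0 \<le> c" and j: "j \<le> 1"
  shows "integrable lborel (\<lambda>r. \<omega> r * \<bar>coll u r\<bar>)" and "integrable lborel (\<lambda>r. \<omega> r * coll u r)"
    and "(LBINT r. \<omega> r * \<bar>coll u r\<bar>) \<le> c * (22 * mom 3 u + 3) * mom (5 + j) u"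
proof -
  note [measurable] = dens_meas[OF u]
  note * = coll_diff_bound[OF u dens_0 assms(2) \<omega> c j, simplified]
  show 1: "integrable lborel (\<lambda>r. \<omega> r * \<bar>coll u r\<bar>)" using * by (simp add: coll_0)
  show "integrable lborel (\<lambda>r. \<omega> r * coll u r)"
    by (rule Bochner_Integration.integrable_bound[OF 1]) (auto simp: abs_mult)
  show "(LBINT r. \<omega> r * \<bar>coll u r\<bar>) \<le> c * (22 * mom 3 u + 3) * mom (5 + j) u"
    using *(2) dens_nonneg[OF u] by (simp add: coll_0 mom_def)
qed

lemma coll_nonpos: "dens u \<Longrightarrow> r \<le> 0 \<Longrightarrow> coll u r = 0"
  by (simp add: coll_def gain_def split_gain_def pos_square_def dens_zero)

lemma coll_integrable: "dens u \<Longrightarrow> integrable lborel (coll u)"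
  using coll_bound(2)[of u "\<lambda>_. 1" 1 0] by simp

section \<open>Energy balance and bounded weights\<close>

text \<open>Beta integrals. The first value is the total splitting rate of a particle of energy z;
  the second is z times that rate, because the two fragments together carry energy z.\<close>

lemma pos_square_convolution:
  assumes z: "0 < z"
  shows "has_bochner_integral lborel (\<lambda>y. pos_square (z - y) * pos_square y) (z ^ 5 / 30)"
    and "(\<integral>\<^sup>+y. ennreal (2 * pos_square (z - y) * pos_square y * y) \<partial>lborel) = ennreal (z ^ 6 / 30)"
proof -
  have "has_bochner_integral lborel (\<lambda>y. ((z - y)\<^sup>2 * y\<^sup>2) * indicator {0..z} y)
     ((z\<^sup>2 * z ^ 3 / 3 - 2 * z * z ^ 4 / 4 + z ^ 5 / 5) - (z\<^sup>2 * 0 ^ 3 / 3 - 2 * z * 0 ^ 4 / 4 + 0 ^ 5 / 5))"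
    by (rule has_bochner_integral_FTC_Icc_real)
      (use z in \<open>auto intro!: derivative_eq_intros continuous_intros simp: field_simps power2_eq_square power3_eq_cube eval_nat_numeral\<close>)
  also have "(\<lambda>y. ((z - y)\<^sup>2 * y\<^sup>2) * indicator {0..z} y) = (\<lambda>y. pos_square (z - y) * pos_square y)"
    by (auto simp: fun_eq_iff pos_square_def indicator_def)
  also have "(z\<^sup>2 * z ^ 3 / 3 - 2 * z * z ^ 4 / 4 + z ^ 5 / 5) - (z\<^sup>2 * 0 ^ 3 / 3 - 2 * z * 0 ^ 4 / 4 + 0 ^ 5 / 5) = z ^ 5 / 30"
    by (simp add: field_simps eval_nat_numeral)
  finally show "has_bochner_integral lborel (\<lambda>y. pos_square (z - y) * pos_square y) (z ^ 5 / 30)" .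
  have "(\<integral>\<^sup>+y. ennreal (2 * (z - y)\<^sup>2 * y ^ 3) * indicator {0..z} y \<partial>lborel)
    = ennreal ((z\<^sup>2 * z ^ 4 / 2 - 4 * z * z ^ 5 / 5 + z ^ 6 / 3) - (z\<^sup>2 * 0 ^ 4 / 2 - 4 * z * 0 ^ 5 / 5 + 0 ^ 6 / 3))"
  proof (rule nn_integral_FTC_Icc)
    fix y :: real assume "y \<in> {0..z}"
    thus "0 \<le> 2 * (z - y)\<^sup>2 * y ^ 3" by simp
  qed (use z in \<open>auto intro!: derivative_eq_intros simp: field_simps power2_eq_square power3_eq_cube eval_nat_numeral\<close>)
  also have "(\<lambda>y. ennreal (2 * (z - y)\<^sup>2 * y ^ 3) * indicator {0..z} y) = (\<lambda>y. ennreal (2 * pos_square (z - y) * pos_square y * y))"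
    by (auto simp: fun_eq_iff pos_square_def indicator_def eval_nat_numeral mult_ac)
  also have "(z\<^sup>2 * z ^ 4 / 2 - 4 * z * z ^ 5 / 5 + z ^ 6 / 3) - (z\<^sup>2 * 0 ^ 4 / 2 - 4 * z * 0 ^ 5 / 5 + 0 ^ 6 / 3) = z ^ 6 / 30"
    by (simp add: field_simps eval_nat_numeral)
  finally show "(\<integral>\<^sup>+y. ennreal (2 * pos_square (z - y) * pos_square y * y) \<partial>lborel) = ennreal (z ^ 6 / 30)" .
qed

text \<open>Splitting conserves energy: what the fragments receive equals r times the loss rate r^5
  / 30, integrated against the density.\<close>

lemma energy_split_gain:
  assumes f: "dens f"
  shows "(LBINT r. r * split_gain f r) = (LBINT r. r ^ 6 * f r) / 30"
proof -
  note [measurable] = dens_meas[OF f]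
  have "(\<integral>\<^sup>+r. ennreal (r * split_gain f r) \<partial>lborel)
    = (\<integral>\<^sup>+x. ennreal (f x) * (\<integral>\<^sup>+y. ennreal (2 * pos_square (x - y) * pos_square y * y) \<partial>lborel) \<partial>lborel)"
    by (rule nn_integral_split_gain[OF f]) auto
  also have "\<dots> = (\<integral>\<^sup>+x. ennreal (x ^ 6 * f x / 30) \<partial>lborel)"
  proof (rule nn_integral_cong)
    fix x
    show "ennreal (f x) * (\<integral>\<^sup>+y. ennreal (2 * pos_square (x - y) * pos_square y * y) \<partial>lborel) = ennreal (x ^ 6 * f x / 30)"
    proof (cases "x > 0")
      case True
      thus ?thesis using pos_square_convolution(2)[OF True] dens_nonneg[OF f, of x]
        by (simp add: ennreal_mult[symmetric] mult_ac)
    qed (simp add: dens_zero[OF f])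
  qed
  also have "\<dots> = ennreal ((LBINT r. r ^ 6 * f r) / 30)"
    using nn_integral_eq_integral[of lborel "\<lambda>x. x ^ 6 * f x / 30"] pow_integrable[OF f, of 6] dens_nonneg[OF f] by simp
  finally have e: "(\<integral>\<^sup>+r. ennreal (r * split_gain f r) \<partial>lborel) = ennreal ((LBINT r. r ^ 6 * f r) / 30)" .
  have n0: "0 \<le> r * split_gain f r" for r
    using split_gain_nonneg[OF f, of r] by (cases "r > 0") (auto simp: split_gain_def pos_square_def)
  have "(\<integral>\<^sup>+r. ennreal (r * split_gain f r) \<partial>lborel) = ennreal (LBINT r. r * split_gain f r)"
    by (rule nn_integral_eq_integral) (use n0 split_gain_bound(1)[OF f, of "\<lambda>r. r" 1 1] in auto)
  moreover have "0 \<le> (LBINT r. r ^ 6 * f r)" "0 \<le> (LBINT r. r * split_gain f r)"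
    using n0 dens_nonneg[OF f] by (auto intro!: Bochner_Integration.integral_nonneg)
  ultimately show ?thesis using e by simp
qed

text \<open>Both sides are double integrals against \<open>f x * f y\<close>, and their kernels
  agree only after symmetrization. Since every value is finite, the common factor 2 can be cancelled
  in the extended reals at the end.\<close>

lemma energy_gain:
  assumes f: "dens f"
  shows "(LBINT r. r * gain f f r) = (LBINT r. r * (f r * loss f r))"
proof -
  note [measurable] = dens_meas[OF f]
  define \<phi> where "\<phi> r = pos_square r * r" for r :: real
  have [measurable]: "\<phi> \<in> borel_measurable borel" unfolding \<phi>_def[abs_def] by measurable
  have \<phi>0: "0 \<le> \<phi> r" for r by (auto simp: \<phi>_def pos_square_def)
  let ?F = "\<lambda>k. \<integral>\<^sup>+x. \<integral>\<^sup>+y. ennreal (f x * f y) * ennreal (k x y) \<partial>lborel \<partial>lborel"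
  have eq: "ennreal (r * gain f f r) = ennreal (\<phi> r) * ennreal (conv f f r)
      + ennreal (\<phi> r) * ennreal (corr f f r) + ennreal (\<phi> r) * ennreal (corr f f r)" for r
  proof -
    have "r * gain f f r = \<phi> r * conv f f r + \<phi> r * corr f f r + \<phi> r * corr f f r"
      by (simp add: gain_def \<phi>_def algebra_simps)
    thus ?thesis
      using \<phi>0[of r] conv_nonneg[OF f f, of r] corr_nonneg[OF f f, of r]
      by (simp add: ennreal_mult[symmetric] ennreal_plus[symmetric] del: ennreal_plus)
  qed
  have n1: "0 \<le> r * gain f f r" for r
    using gain_nonneg[OF f f, of r] by (cases "r > 0") (auto simp: gain_def pos_square_def)
  have n2: "0 \<le> r * (f r * loss f r)" for r
    using loss_bounds(1)[OF f, of r] dens_nonneg[OF f, of r] by (cases "r > 0") (auto simp: dens_zero[OF f])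
  have i1: "integrable lborel (\<lambda>r. r * gain f f r)" using gain_bound(1)[OF f f, of "\<lambda>r. r" 1] by simp
  have i2: "integrable lborel (\<lambda>r. r * (f r * loss f r))" using loss_term_bound(1)[OF f f, of "\<lambda>r. r" 1] by simp
  have swap: "?F k = ?F (\<lambda>x y. k y x)" if [measurable]: "case_prod k \<in> borel_measurable (borel \<Otimes>\<^sub>M borel)" for k
    by (subst lborel_pair.Fubini') (auto simp: mult.commute)
  have A: "ennreal (LBINT r. r * gain f f r) = ?F (\<lambda>x y. \<phi> (x + y)) + ?F (\<lambda>x y. \<phi> (x - y)) + ?F (\<lambda>x y. \<phi> (x - y))"
    unfolding nn_integral_eq_integral[OF i1, symmetric, simplified n1] 
    using nn_integral_eq_integral[OF i1] n1 
      nn_integral_conv[OF f f, of "\<lambda>r. ennreal (\<phi> r)"] nn_integral_dens_corr[OF f f, of "\<lambda>r. ennreal (\<phi> r)"]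
    by (simp add: eq nn_integral_add)
  have "ennreal (LBINT r. r * (f r * loss f r)) = (\<integral>\<^sup>+r. ennreal (r * (f r * loss f r)) \<partial>lborel)"
    using nn_integral_eq_integral[OF i2] n2 by simp
  also have "\<dots> = ?F (\<lambda>x y. x * loss_kernel x y)"
  proof (rule nn_integral_cong)
    fix x
    show "ennreal (x * (f x * loss f x)) = (\<integral>\<^sup>+y. ennreal (f x * f y) * ennreal (x * loss_kernel x y) \<partial>lborel)"
    proof (cases "x > 0")
      case True
      have k: "0 \<le> loss_kernel x y * f y" for y
        by (cases "y > 0") (auto simp: dens_zero[OF f] dens_nonneg[OF f] loss_kernel_bounds True)
      have "ennreal (x * (f x * loss f x)) = ennreal (x * f x) * ennreal (loss f x)"
        using True dens_nonneg[OF f, of x] loss_bounds(1)[OF f True] by (simp add: ennreal_mult[symmetric] mult_ac)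
      also have "ennreal (loss f x) = (\<integral>\<^sup>+y. ennreal (loss_kernel x y * f y) \<partial>lborel)"
        unfolding loss_def using nn_integral_eq_integral[OF dens_loss_integrable[OF f True]] k by simp
      also have "ennreal (x * f x) * \<dots> = (\<integral>\<^sup>+y. ennreal (x * f x) * ennreal (loss_kernel x y * f y) \<partial>lborel)"
        by (rule nn_integral_cmult[symmetric]) measurable
      also have "\<dots> = (\<integral>\<^sup>+y. ennreal (f x * f y) * ennreal (x * loss_kernel x y) \<partial>lborel)"
      proof (rule nn_integral_cong)
        fix y
        show "ennreal (x * f x) * ennreal (loss_kernel x y * f y) = ennreal (f x * f y) * ennreal (x * loss_kernel x y)"
          using True dens_nonneg[OF f, of x] dens_nonneg[OF f, of y] loss_kernel_bounds(1)[OF True, of y]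
          by (cases "y > 0") (auto simp: ennreal_mult[symmetric] dens_zero[OF f] mult_ac)
      qed
      finally show ?thesis .
    qed (simp add: dens_zero[OF f])
  qed
  finally have B: "ennreal (LBINT r. r * (f r * loss f r)) = ?F (\<lambda>x y. x * loss_kernel x y)" .
  \<comment> \<open>Microscopic energy balance, after symmetrizing in the two collision partners.\<close>
  have key: "2 * (\<phi> (x + y) + \<phi> (x - y) + \<phi> (y - x)) = x * loss_kernel x y + y * loss_kernel y x" if "0 < x" "0 < y" for x y
  proof (cases rule: linorder_cases[of x y])
    case less thus ?thesis using that
      by (simp add: \<phi>_def pos_square_def loss_kernel_def power2_eq_square power3_eq_cube algebra_simps)
  next
    case equal thus ?thesis using that
      by (simp add: \<phi>_def pos_square_def loss_kernel_def power2_eq_square power3_eq_cube algebra_simps)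
  next
    case greater thus ?thesis using that
      by (simp add: \<phi>_def pos_square_def loss_kernel_def power2_eq_square power3_eq_cube algebra_simps)
  qed
  have m [measurable]: "(\<lambda>(x, y). x * loss_kernel x y) \<in> borel_measurable (borel \<Otimes>\<^sub>M borel)"
     "(\<lambda>(x, y). y * loss_kernel y x) \<in> borel_measurable (borel \<Otimes>\<^sub>M borel)" by measurable
  have "?F (\<lambda>x y. x * loss_kernel x y) + ?F (\<lambda>x y. y * loss_kernel y x)
    = (\<integral>\<^sup>+x. \<integral>\<^sup>+y. ennreal (f x * f y) * ennreal (x * loss_kernel x y) + ennreal (f x * f y) * ennreal (y * loss_kernel y x) \<partial>lborel \<partial>lborel)"
    by (simp add: nn_integral_add)
  also have "\<dots> = (\<integral>\<^sup>+x. \<integral>\<^sup>+y. 2 * (ennreal (f x * f y) * ennreal (\<phi> (x + y)) + ennreal (f x * f y) * ennreal (\<phi> (x - y)) + ennreal (f x * f y) * ennreal (\<phi> (y - x))) \<partial>lborel \<partial>lborel)"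
  proof (intro nn_integral_cong)
    fix x y
    show "ennreal (f x * f y) * ennreal (x * loss_kernel x y) + ennreal (f x * f y) * ennreal (y * loss_kernel y x)
      = 2 * (ennreal (f x * f y) * ennreal (\<phi> (x + y)) + ennreal (f x * f y) * ennreal (\<phi> (x - y)) + ennreal (f x * f y) * ennreal (\<phi> (y - x)))"
    proof (cases "0 < x \<and> 0 < y")
      case True
      have "ennreal (x * loss_kernel x y) + ennreal (y * loss_kernel y x) = 2 * (ennreal (\<phi> (x + y)) + ennreal (\<phi> (x - y)) + ennreal (\<phi> (y - x)))"
      proof -
        have "ennreal (x * loss_kernel x y) + ennreal (y * loss_kernel y x) = ennreal (2 * (\<phi> (x + y) + \<phi> (x - y) + \<phi> (y - x)))"
          using True loss_kernel_bounds(1)[of x y] loss_kernel_bounds(1)[of y x]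
          by (subst key) auto
        also have "\<dots> = ennreal 2 * ennreal (\<phi> (x + y) + \<phi> (x - y) + \<phi> (y - x))"
          using \<phi>0 by (intro ennreal_mult) auto
        finally show ?thesis using \<phi>0 by simp
      qed
      thus ?thesis by (metis (no_types, lifting) distrib_left mult.left_commute)
    qed (auto simp: not_less dens_zero[OF f])
  qed
  also have "\<dots> = 2 * (?F (\<lambda>x y. \<phi> (x + y)) + ?F (\<lambda>x y. \<phi> (x - y)) + ?F (\<lambda>x y. \<phi> (y - x)))"
    by (simp add: nn_integral_add nn_integral_cmult)
  finally have C: "2 * ?F (\<lambda>x y. x * loss_kernel x y) = 2 * (?F (\<lambda>x y. \<phi> (x + y)) + ?F (\<lambda>x y. \<phi> (x - y)) + ?F (\<lambda>x y. \<phi> (x - y)))"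
    using swap[of "\<lambda>x y. x * loss_kernel x y"] swap[of "\<lambda>x y. \<phi> (x - y)"] by (simp add: mult_2)
  have "2 * ennreal (LBINT r. r * (f r * loss f r)) = 2 * ennreal (LBINT r. r * gain f f r)"
    unfolding A B C ..
  moreover have "0 \<le> (LBINT r. r * gain f f r)" "0 \<le> (LBINT r. r * (f r * loss f r))"
    using n1 n2 by (auto intro!: Bochner_Integration.integral_nonneg)
  ultimately show ?thesis
    by (simp add: ennreal_mult[symmetric] ennreal_numeral[symmetric] del: ennreal_numeral)
qed

lemma coll_energy:
  assumes f: "dens f"
  shows "(LBINT r. r * coll f r) = 0"
proof -
  note [measurable] = dens_meas[OF f]
  have "(LBINT r. r * coll f r) = (LBINT r. r * gain f f r + r * split_gain f r - r * (f r * loss f r) - r ^ 6 * f r / 30)"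
    by (rule Bochner_Integration.integral_cong) (auto simp: coll_def algebra_simps eval_nat_numeral)
  also have "\<dots> = (LBINT r. r * gain f f r) + (LBINT r. r * split_gain f r) - (LBINT r. r * (f r * loss f r)) - (LBINT r. r ^ 6 * f r / 30)"
    using gain_bound(1)[OF f f, of "\<lambda>r. r" 1] loss_term_bound(1)[OF f f, of "\<lambda>r. r" 1]
      split_gain_bound(1)[OF f, of "\<lambda>r. r" 1 1] pow_integrable[OF f, of 6] by simp
  also have "\<dots> = 0" using energy_split_gain[OF f] energy_gain[OF f] by simp
  finally show ?thesis .
qed

section \<open>Bounded weights that are nearly affine\<close>

definition slow :: "real \<Rightarrow> real \<Rightarrow> real" where
  "slow \<kappa> r = r / (1 + \<kappa> * ln (1 + r))"

text \<open>\<open>slow\<close> is increasing, nearly additive and yet of smaller order than r; the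
  last point will allow it to be cut off at a high level. Monotonicity and the defect bound both
  rest on r (ln (1 + s) - ln (1 + r)) <= s - r.\<close>

lemma slow_props:
  assumes k: "0 < \<kappa>" "\<kappa> \<le> 1"
  shows slow_nonneg: "0 \<le> r \<Longrightarrow> 0 \<le> slow \<kappa> r" and slow_le: "0 \<le> r \<Longrightarrow> slow \<kappa> r \<le> r"
    and slow_mono: "0 \<le> r \<Longrightarrow> r \<le> s \<Longrightarrow> slow \<kappa> r \<le> slow \<kappa> s"
    and slow_defect: "0 \<le> r \<Longrightarrow> 0 \<le> s \<Longrightarrow> slow \<kappa> r + slow \<kappa> s \<le> slow \<kappa> (r + s) + 2 * \<kappa> * (r + s)"
proof -
  have d: "1 \<le> 1 + \<kappa> * ln (1 + r)" if "0 \<le> r" for r using k that by simp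
  have lnd: "ln (1 + s) - ln (1 + r) \<le> (s - r) / (1 + r)" if "0 \<le> r" "r \<le> s" for r s :: real
  proof -
    have "ln (1 + s) - ln (1 + r) = ln ((1 + s) / (1 + r))" using that by (simp add: ln_div)
    also have "\<dots> \<le> (1 + s) / (1 + r) - 1" using that by (intro ln_le_minus_one) auto
    also have "\<dots> = (s - r) / (1 + r)" using that by (simp add: field_simps)
    finally show ?thesis .
  qed
  have rl: "r * (ln (1 + s) - ln (1 + r)) \<le> s - r" if "0 \<le> r" "r \<le> s" for r s :: real
  proof -
    have "r * (ln (1 + s) - ln (1 + r)) \<le> r * ((s - r) / (1 + r))"
      using lnd[OF that] that by (intro mult_left_mono) auto
    also have "\<dots> = (r / (1 + r)) * (s - r)" by simp
    also have "\<dots> \<le> 1 * (s - r)" using that by (intro mult_right_mono) auto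
    finally show ?thesis by simp
  qed
  show "0 \<le> slow \<kappa> r" if "0 \<le> r" using d[OF that] that by (simp add: slow_def)
  show "slow \<kappa> r \<le> r" if "0 \<le> r" 
    using divide_left_mono[OF d[OF that] that] d[OF that] by (simp add: slow_def)
  show "slow \<kappa> r \<le> slow \<kappa> s" if rs: "0 \<le> r" "r \<le> s"
  proof -
    have "\<kappa> * (r * (ln (1 + s) - ln (1 + r))) \<le> 1 * (s - r)"
      using rl[OF rs] k rs by (intro mult_mono) (auto intro!: mult_nonneg_nonneg)
    moreover have "0 \<le> (s - r) * (\<kappa> * ln (1 + r))" using rs k by simp
    ultimately have "r * (1 + \<kappa> * ln (1 + s)) \<le> s * (1 + \<kappa> * ln (1 + r))"
      by (simp add: algebra_simps)
    moreover have "r / a \<le> s / b" if "1 \<le> a" "1 \<le> b" "r * b \<le> s * a" for a b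
      using that by (simp add: field_simps)
    ultimately show ?thesis unfolding slow_def using d[of r] d[of s] rs by simp
  qed
  \<comment> \<open>With one common denominator the fractions would be exactly additive. Replacing
    the denominator at r by the one at s costs at most \<open>\<kappa> * s\<close> per
    fragment.\<close>
  have half: "slow \<kappa> r \<le> r / (1 + \<kappa> * ln (1 + s)) + \<kappa> * s" if rs: "0 \<le> r" "r \<le> s" for r s
  proof -
    let ?a = "1 + \<kappa> * ln (1 + r)" and ?b = "1 + \<kappa> * ln (1 + s)"
    have ab: "1 \<le> ?a" "1 \<le> ?b" using d rs by auto
    have "slow \<kappa> r - r / ?b = (\<kappa> * (r * (ln (1 + s) - ln (1 + r)))) / (?a * ?b)"
      using ab unfolding slow_def by (simp add: diff_frac_eq) (simp add: algebra_simps)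
    also have "\<dots> \<le> \<kappa> * (r * (ln (1 + s) - ln (1 + r)))"
    proof -
      have "0 \<le> \<kappa> * (r * (ln (1 + s) - ln (1 + r)))" using k rs by simp
      moreover have "1 \<le> ?a * ?b" using ab by (metis mult_mono' mult_1 zero_le_one)
      ultimately show ?thesis by (metis divide_le_eq mult_left_mono mult.right_neutral less_le_trans zero_less_one)
    qed
    also have "\<dots> \<le> \<kappa> * (s - r)" using rl[OF rs] k by (intro mult_left_mono) auto
    also have "\<dots> \<le> \<kappa> * s" using k rs by (intro mult_left_mono) auto
    finally show ?thesis by simp
  qed
  show "slow \<kappa> r + slow \<kappa> s \<le> slow \<kappa> (r + s) + 2 * \<kappa> * (r + s)" if "0 \<le> r" "0 \<le> s"
  proof -
    have "slow \<kappa> (r + s) = r / (1 + \<kappa> * ln (1 + (r + s))) + s / (1 + \<kappa> * ln (1 + (r + s)))"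
      by (simp add: slow_def add_divide_distrib)
    thus ?thesis using half[of r "r + s"] half[of s "r + s"] that by simp
  qed
qed

text \<open>The weight is close to an affine function \<open>4 r - 1\<close> on a long initial interval, so that
  splitting a particle decreases it by about one, but it is bounded: the fractional cut-off grows so
  slowly that the defect of superadditivity stays below \<open>\<epsilon> z\<close>.  The sixth moment
  then controls the error.\<close>

definition is_weight :: "real \<Rightarrow> real \<Rightarrow> (real \<Rightarrow> real) \<Rightarrow> bool" where
  "is_weight \<epsilon> P \<psi> \<longleftrightarrow> \<psi> \<in> borel_measurable borel \<and> (\<forall>r. 1 \<le> \<psi> r \<and> \<psi> r \<le> P) \<and> (\<forall>r>0. \<psi> r \<le> 4 * (1 + r))
     \<and> (\<forall>z>0. (LBINT y. 2 * pos_square (z - y) * pos_square y * \<psi> y) \<le> (\<psi> z + \<epsilon> * z - 1) * z ^ 5 / 30 + 8 * z\<^sup>2)"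

lemma pos_square_product_integrable:
  assumes z: "0 < z" and m [measurable]: "g \<in> borel_measurable borel" and b: "\<And>y. \<bar>g y\<bar> \<le> P"
  shows "integrable lborel (\<lambda>y. pos_square (z - y) * pos_square y * g y)"
proof (rule Bochner_Integration.integrable_bound)
  show "integrable lborel (\<lambda>y. P * (pos_square (z - y) * pos_square y))"
    using pos_square_convolution(1)[OF z] by (simp add: has_bochner_integral_iff)
  show "AE y in lborel. norm (pos_square (z - y) * pos_square y * g y) \<le> norm (P * (pos_square (z - y) * pos_square y))"
    by (auto simp: abs_mult mult.commute intro!: AE_I2 mult_right_mono order_trans[OF b abs_ge_self])
qed auto

text \<open>The pair inequality may fail by 4 for each fragment below 1. Such fragments occupy an
  interval of length at most 1 at either end, where the rate is at most z^2; this gives 4 z^2 + 4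
  z^2.\<close>

lemma weight_split_integral:
  assumes z: "0 < z" and m [measurable]: "\<psi> \<in> borel_measurable borel" and b: "\<And>y. \<bar>\<psi> y\<bar> \<le> P"
    and key: "\<And>s t. 0 < s \<Longrightarrow> 0 < t \<Longrightarrow> s + t = z \<Longrightarrow> 
      \<psi> s + \<psi> t \<le> K + (if s < 1 then 4 else 0) + (if t < 1 then 4 else 0)"
  shows "(LBINT y. 2 * pos_square (z - y) * pos_square y * \<psi> y) \<le> K * z ^ 5 / 30 + 8 * z\<^sup>2"
proof -
  have i1: "integrable lborel (\<lambda>y. pos_square (z - y) * pos_square y * \<psi> y)"
    by (rule pos_square_product_integrable[OF z m b])
  have i2: "integrable lborel (\<lambda>y. pos_square (z - y) * pos_square y * \<psi> (z - y))"
    by (rule pos_square_product_integrable[OF z _ b]) measurable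
  \<comment> \<open>By this reflection twice the weighted integral sees the weight at both
    fragments, which is what the pair inequality bounds.\<close>
  have refl: "(LBINT y. pos_square (z - y) * pos_square y * \<psi> y) = (LBINT y. pos_square (z - y) * pos_square y * \<psi> (z - y))"
    by (subst lborel_integral_real_affine[where c = "-1" and t = z]) (simp_all add: mult_ac)
  have "(LBINT y. 2 * pos_square (z - y) * pos_square y * \<psi> y) = 2 * (LBINT y. pos_square (z - y) * pos_square y * \<psi> y)"
    by (simp add: mult.assoc)
  also have "\<dots> = (LBINT y. pos_square (z - y) * pos_square y * \<psi> y) + (LBINT y. pos_square (z - y) * pos_square y * \<psi> (z - y))"
    using refl by simp
  also have "\<dots> = (LBINT y. pos_square (z - y) * pos_square y * \<psi> y + pos_square (z - y) * pos_square y * \<psi> (z - y))"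
    using i1 i2 by simp
  also have "\<dots> \<le> (LBINT y. K * (pos_square (z - y) * pos_square y) + (4 * z\<^sup>2) * indicator {0..1} y + (4 * z\<^sup>2) * indicator {z - 1..z} y)"
  proof (rule integral_mono)
    show "integrable lborel (\<lambda>y. pos_square (z - y) * pos_square y * \<psi> y + pos_square (z - y) * pos_square y * \<psi> (z - y))"
      using i1 i2 by simp
    show "integrable lborel (\<lambda>y. K * (pos_square (z - y) * pos_square y) + (4 * z\<^sup>2) * indicator {0..1} y + (4 * z\<^sup>2) * indicator {z - 1..z} y)"
      using pos_square_convolution(1)[OF z] by (auto simp: has_bochner_integral_iff)
    fix y
    show "pos_square (z - y) * pos_square y * \<psi> y + pos_square (z - y) * pos_square y * \<psi> (z - y)
      \<le> K * (pos_square (z - y) * pos_square y) + (4 * z\<^sup>2) * indicator {0..1} y + (4 * z\<^sup>2) * indicator {z - 1..z} y"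
    proof (cases "0 < y \<and> y < z")
      case True
      have "pos_square (z - y) * pos_square y * (\<psi> y + \<psi> (z - y))
        \<le> pos_square (z - y) * pos_square y * (K + (if y < 1 then 4 else 0) + (if z - y < 1 then 4 else 0))"
        using key[of y "z - y"] True by (intro mult_left_mono) auto
      also have "\<dots> = K * (pos_square (z - y) * pos_square y) + 4 * ((if y < 1 then 1 else 0) * (pos_square (z - y) * pos_square y))
         + 4 * ((if z - y < 1 then 1 else 0) * (pos_square (z - y) * pos_square y))"
        by (auto simp: algebra_simps)
      also have "\<dots> \<le> K * (pos_square (z - y) * pos_square y) + 4 * (z\<^sup>2 * indicator {0..1} y) + 4 * (z\<^sup>2 * indicator {z - 1..z} y)"
      proof -
        have "pos_square (z - y) \<le> z\<^sup>2" "pos_square y \<le> z\<^sup>2" using True by (auto simp: pos_square_def intro!: power_mono)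
        moreover have "y < 1 \<Longrightarrow> pos_square y \<le> 1" "z - y < 1 \<Longrightarrow> pos_square (z - y) \<le> 1"
          using True by (auto simp: pos_square_def intro!: power_le_one)
        ultimately have "y < 1 \<Longrightarrow> pos_square (z - y) * pos_square y \<le> z\<^sup>2 * 1" "z - y < 1 \<Longrightarrow> pos_square (z - y) * pos_square y \<le> 1 * z\<^sup>2"
          by (metis mult_mono pos_square_nonneg zero_le_one zero_le_power2)+
        thus ?thesis using True by (intro add_mono order_refl mult_left_mono) (auto simp: indicator_def)
      qed
      finally show ?thesis by (simp add: algebra_simps)
    qed (auto simp: pos_square_def)
  qed
  also have "\<dots> = K * (z ^ 5 / 30) + 4 * z\<^sup>2 + 4 * z\<^sup>2"
    using pos_square_convolution(1)[OF z] by (auto simp: has_bochner_integral_iff)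
  finally show ?thesis by simp
qed

text \<open>The weight is essentially 4 r - 1. Subtracting 1 from an almost additive function makes
  two fragments weigh one unit less than their parent; slope 4 makes the value at r = 1 large enough
  for the lower cut-off at 1 to be inactive beyond it.\<close>

lemma weight_exists:
  assumes e: "0 < \<epsilon>" shows "\<exists>P \<psi>. is_weight \<epsilon> P \<psi>"
proof -
  \<comment> \<open>Four times the defect \<open>2 * \<kappa>\<close> of \<open>slow\<close> must
    not exceed \<open>\<epsilon>\<close>.\<close>
  define \<kappa> where "\<kappa> = min 1 (\<epsilon> / 8)"
  have k: "0 < \<kappa>" "\<kappa> \<le> 1" "8 * \<kappa> \<le> \<epsilon>" using e by (auto simp: \<kappa>_def)
  note sp = slow_props[OF k(1,2)]
  \<comment> \<open>Beyond this energy \<open>\<kappa> * ln (1 + z)\<close> is at least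
    \<open>4 / \<epsilon>\<close>, hence \<open>4 * slow \<kappa> z \<le> \<epsilon> * z\<close>.
    The cut-off at height Z then violates superadditivity by no more than the allowed
    \<open>\<epsilon> * z\<close>.\<close>
  define Z where "Z = exp (4 / (\<epsilon> * \<kappa>))"
  have Z1: "1 \<le> Z" using e k by (simp add: Z_def)
  define \<theta> where "\<theta> r = min (4 * Z) (4 * slow \<kappa> (max 0 r))" for r
  define \<psi> where "\<psi> r = max 1 (\<theta> r - 1)" for r
  have [measurable]: "\<psi> \<in> borel_measurable borel" unfolding \<psi>_def[abs_def] \<theta>_def[abs_def] slow_def[abs_def] by measurable
  have mono: "\<theta> r \<le> \<theta> s" if "0 < r" "r \<le> s" for r s
    using sp(3)[of r s] that unfolding \<theta>_def by auto
  have up: "\<theta> r \<le> 4 * r" if "0 < r" for r using sp(2)[of r] that unfolding \<theta>_def by auto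
  \<comment> \<open>So that \<open>\<theta> r - 1\<close> is at least 1 and the maximum in
    \<open>\<psi>\<close> is attained by it.\<close>
  have low: "2 \<le> \<theta> r" if "1 \<le> r" for r
  proof -
    have "ln (1 + 1 :: real) \<le> 1" using ln_le_minus_one[of "2 :: real"] by simp
    hence "\<kappa> * ln (1 + 1) \<le> 1 * 1" using k by (intro mult_mono) auto
    moreover have "0 \<le> \<kappa> * ln (1 + 1)" using k by simp
    moreover have "1 / 2 \<le> 1 / a" if "1 \<le> a" "a \<le> 2" for a :: real using that by (simp add: field_simps)
    ultimately have "1 / 2 \<le> slow \<kappa> 1" unfolding slow_def by simp
    also have "\<dots> \<le> slow \<kappa> r" using sp(3)[of 1 r] that by auto
    finally show ?thesis using Z1 that unfolding \<theta>_def by auto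
  qed
  have defect: "\<theta> s + \<theta> t \<le> \<theta> (s + t) + \<epsilon> * (s + t)" if st: "0 < s" "0 < t" for s t
  proof (cases "4 * slow \<kappa> (s + t) \<le> 4 * Z")
    case True
    hence "\<theta> (s + t) = 4 * slow \<kappa> (s + t)" using st by (simp add: \<theta>_def)
    moreover have "\<theta> s \<le> 4 * slow \<kappa> s" "\<theta> t \<le> 4 * slow \<kappa> t" using st by (auto simp: \<theta>_def)
    moreover have "(8 * \<kappa>) * (s + t) \<le> \<epsilon> * (s + t)" using k st by (intro mult_right_mono) auto
    moreover have "slow \<kappa> s + slow \<kappa> t \<le> slow \<kappa> (s + t) + 2 * \<kappa> * (s + t)" using sp(4)[of s t] st by auto
    ultimately show ?thesis by (simp add: algebra_simps)
  next
    case False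
    let ?z = "s + t"
    have "Z \<le> ?z" using False sp(2)[of ?z] st by auto
    hence "ln Z \<le> ln (1 + ?z)" using Z1 by (subst ln_le_cancel_iff) auto
    hence "4 / \<epsilon> \<le> \<kappa> * ln (1 + ?z)" using k e by (simp add: Z_def field_simps)
    moreover have "4 / (1 + L) \<le> \<epsilon>" if "4 / \<epsilon> \<le> L" for L
    proof -
      have "0 < 4 / \<epsilon>" using e by simp
      hence "0 < L" using that by linarith
      moreover have "4 \<le> \<epsilon> * L" using that e by (simp add: pos_divide_le_eq mult.commute)
      ultimately show ?thesis using e by (simp add: pos_divide_le_eq distrib_left)
    qed
    ultimately have "4 / (1 + \<kappa> * ln (1 + ?z)) \<le> \<epsilon>" by blast
    hence "4 * slow \<kappa> ?z \<le> \<epsilon> * ?z" unfolding slow_def using st mult_right_mono[of "4 / (1 + \<kappa> * ln (1 + ?z))" \<epsilon> ?z] by simp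
    moreover have "\<theta> ?z = 4 * Z" using False st by (simp add: \<theta>_def)
    moreover have "\<theta> s \<le> 4 * Z" "\<theta> t \<le> 4 * Z" by (auto simp: \<theta>_def)
    ultimately show ?thesis using False by simp
  qed
  have b: "1 \<le> \<psi> r" "\<psi> r \<le> 4 * Z" for r using Z1 by (auto simp: \<psi>_def \<theta>_def)
  have "is_weight \<epsilon> (4 * Z) \<psi>"
    unfolding is_weight_def
  proof (intro conjI allI impI)
    fix r :: real assume "0 < r" thus "\<psi> r \<le> 4 * (1 + r)" using up[of r] by (simp add: \<psi>_def)
  next
    fix z :: real assume z: "0 < z"
    show "(LBINT y. 2 * pos_square (z - y) * pos_square y * \<psi> y) \<le> (\<psi> z + \<epsilon> * z - 1) * z ^ 5 / 30 + 8 * z\<^sup>2"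
    proof (rule weight_split_integral[OF z, where P = "4 * Z"])
      fix s t :: real assume st: "0 < s" "0 < t" "s + t = z"
      have m: "\<theta> s \<le> \<theta> z" "\<theta> t \<le> \<theta> z" using mono[of s z] mono[of t z] st by auto
      have ez: "0 < \<epsilon> * z" using e z by simp
      show "\<psi> s + \<psi> t \<le> \<psi> z + \<epsilon> * z - 1 + (if s < 1 then 4 else 0) + (if t < 1 then 4 else 0)"
      \<comment> \<open>A fragment below 1 has weight at most 3 and the other at most that of the
        parent, which fits into the allowance of 4. If both are at least 1, the two subtracted units
        against the single one of the parent give the -1.\<close>
      proof (cases "s < 1 \<or> t < 1")
        case True
        thus ?thesis using m ez up[of s] up[of t] st unfolding \<psi>_def by (auto simp: max_def)
      next
        case False
        hence "2 \<le> \<theta> s" "2 \<le> \<theta> t" "2 \<le> \<theta> z" using low st by auto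
        thus ?thesis using False defect[OF st(1,2)] st unfolding \<psi>_def by (auto simp: max_def)
      qed
    qed (use b in \<open>auto simp: abs_le_iff intro: order_trans[of _ 1]\<close>, smt (verit) b)
  qed (use b in auto)
  thus ?thesis by blast
qed

section \<open>Stability of approximate solutions\<close>

text \<open>Only right-hand growth at interior times is assumed and y need not be differentiable. A
  strict supersolution is compared with y at the last time where y is still below it.\<close>

lemma dini_gronwall:
  fixes y :: "real \<Rightarrow> real"
  assumes cont: "continuous_on {0..T} y" and C: "0 \<le> C" and y0: "0 \<le> y 0" and e: "0 \<le> \<epsilon>"
    and step: "\<And>t \<eta>. 0 < t \<Longrightarrow> t < T \<Longrightarrow> 0 < \<eta> \<Longrightarrow> eventually (\<lambda>h. y (t + h) \<le> y t + h * (C * y t + \<epsilon> + \<eta>)) (at_right 0)"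
    and t: "t \<in> {0..T}"
  shows "y t \<le> exp (C * t) * (y 0 + \<epsilon> * t)"
proof -
  have "y t \<le> exp (C * t) * (y 0 + \<eta> + (\<epsilon> + 2 * \<eta>) * t)" if \<eta>: "0 < \<eta>" for \<eta>
  proof (rule ccontr)
    \<comment> \<open>The slack \<open>\<eta>\<close> in the initial value makes the first contact
      time positive; \<open>2 * \<eta>\<close> in the slope strictly exceeds the growth allowed to
      y.\<close>
    define F where "F s = exp (C * s) * (y 0 + \<eta> + (\<epsilon> + 2 * \<eta>) * s)" for s
    assume "\<not> ?thesis"
    hence bad: "F t < y t" by (simp add: F_def)
    have contF: "continuous_on A F" for A unfolding F_def[abs_def] by (intro continuous_intros)
    define A where "A = {s \<in> {0..t}. y s \<le> F s}"
    have A0: "0 \<in> A" using \<eta> t by (auto simp: A_def F_def)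
    have "closed A"
      unfolding A_def
      by (rule continuous_on_closed_Collect_le) (use contF cont t in \<open>auto intro: continuous_on_subset\<close>)
    moreover have "bdd_above A" by (auto simp: A_def bdd_above_def)
    ultimately have s: "Sup A \<in> A" using A0 by (intro closed_contains_Sup) auto
    define s where "s = Sup A"
    have sA: "s \<in> A" using s by (simp add: s_def)
    have st: "0 \<le> s" "s \<le> t" "y s \<le> F s" using sA by (auto simp: A_def)
    have "s \<noteq> t" using bad st by auto
    hence s_lt: "s < t" using st by simp
    have above: "F r < y r" if "s < r" "r \<le> t" for r
    proof (rule ccontr)
      assume "\<not> F r < y r"
      hence "r \<in> A" using that st by (auto simp: A_def)
      hence "r \<le> s" unfolding s_def using \<open>bdd_above A\<close> by (rule cSup_upper)
      thus False using that by simp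
    qed
    have Fs: "F s \<le> y s"
    proof (rule tendsto_le[OF trivial_limit_at_right_real])
      have "continuous_on {s..t} y" using cont t st by (auto intro: continuous_on_subset)
      thus "(y \<longlongrightarrow> y s) (at_right s)" using s_lt by (simp add: continuous_on_Icc_at_rightD)
      show "(F \<longlongrightarrow> F s) (at_right s)" using contF[of UNIV]
        unfolding continuous_on_def by (blast intro: tendsto_within_subset)
      show "eventually (\<lambda>r. F r \<le> y r) (at_right s)"
        unfolding eventually_at_right[OF s_lt] using above s_lt by (intro exI[of _ t]) (simp add: less_imp_le)
    qed
    have ys: "y s = F s" using Fs st by simp
    have s0: "0 < s"
    proof (rule ccontr)
      assume "\<not> 0 < s"
      hence "s = 0" using st by simp
      thus False using ys \<eta> by (simp add: F_def)
    qed
    have "eventually (\<lambda>h. y (s + h) \<le> y s + h * (C * y s + \<epsilon> + \<eta>)) (at_right 0)"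
      using step[OF s0 _ \<eta>] s_lt t by auto
    moreover have "eventually (\<lambda>h. h < t - s) (at_right 0)"
      using s_lt by (intro order_tendstoD(2)[OF tendsto_ident_at]) simp
    moreover have "eventually (\<lambda>h. 0 < h) (at_right (0 :: real))" by (rule eventually_at_right_less)
    ultimately have "eventually (\<lambda>h :: real. False) (at_right 0)"
    proof eventually_elim
      case (elim h)
      have "F (s + h) < y (s + h)" using above elim by auto
      also have "\<dots> \<le> F s + h * (C * F s + \<epsilon> + \<eta>)" using elim ys by simp
      also have "\<dots> \<le> F s + h * (C * F s + \<epsilon> + 2 * \<eta>)" using elim \<eta> by (simp add: mult_left_mono)
      also have "\<dots> \<le> F (s + h)"
      proof -
        define G where "G = y 0 + \<eta> + (\<epsilon> + 2 * \<eta>) * s"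
        have G0: "0 \<le> G" using y0 \<eta> e st by (simp add: G_def)
        have F1: "F s = exp (C * s) * G" by (simp add: F_def G_def)
        have e1: "1 + C * h \<le> exp (C * h)" by (rule exp_ge_add_one_self)
        have e2: "1 \<le> exp (C * (s + h))" using C st elim by simp
        have "F (s + h) = exp (C * h) * F s + exp (C * (s + h)) * ((\<epsilon> + 2 * \<eta>) * h)"
          by (simp add: F_def distrib_left exp_add algebra_simps)
        moreover have "(1 + C * h) * F s \<le> exp (C * h) * F s"
          using e1 G0 by (intro mult_right_mono) (auto simp: F1)
        moreover have "1 * ((\<epsilon> + 2 * \<eta>) * h) \<le> exp (C * (s + h)) * ((\<epsilon> + 2 * \<eta>) * h)"
          using e2 e \<eta> elim by (intro mult_right_mono) auto
        ultimately show ?thesis by (simp add: algebra_simps)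
      qed
      finally show False by simp
    qed
    thus False by simp
  qed
  note main = this
  show ?thesis
  proof (rule tendsto_le[OF trivial_limit_at_right_real])
    show "((\<lambda>\<eta>. exp (C * t) * (y 0 + \<eta> + (\<epsilon> + 2 * \<eta>) * t)) \<longlongrightarrow> exp (C * t) * (y 0 + \<epsilon> * t)) (at_right 0)"
      by (auto intro!: tendsto_eq_intros)
    show "((\<lambda>_. y t) \<longlongrightarrow> y t) (at_right 0)" by simp
    show "eventually (\<lambda>\<eta>. y t \<le> exp (C * t) * (y 0 + \<eta> + (\<epsilon> + 2 * \<eta>) * t)) (at_right 0)"
      using eventually_at_right_less[of "0 :: real"] by eventually_elim (rule main)
  qed
qed

section \<open>Dissipativity in the weighted L^1 norm\<close>

lemma is_weight_meas: "is_weight \<epsilon> P \<psi> \<Longrightarrow> \<psi> \<in> borel_measurable borel"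
  and is_weight_ge1: "is_weight \<epsilon> P \<psi> \<Longrightarrow> 1 \<le> \<psi> r"
  and is_weight_le: "is_weight \<epsilon> P \<psi> \<Longrightarrow> \<psi> r \<le> P"
  and is_weight_le_affine: "is_weight \<epsilon> P \<psi> \<Longrightarrow> 0 < r \<Longrightarrow> \<psi> r \<le> 4 * (1 + r)"
  and is_weight_split: "is_weight \<epsilon> P \<psi> \<Longrightarrow> 0 < z \<Longrightarrow>
    (LBINT y. 2 * pos_square (z - y) * pos_square y * \<psi> y) \<le> (\<psi> z + \<epsilon> * z - 1) * z ^ 5 / 30 + 8 * z\<^sup>2"
  by (auto simp: is_weight_def)

definition growth_const :: "real \<Rightarrow> real" where
  "growth_const B = (176 * B + 8) * (1 + (1 + 240 * (176 * B + 8))) ^ 3"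

text \<open>With a = 176 B + 8 the positive terms are at most a (1 + r)^3, and for r >= 1 this is at
  most 8 a r^3 = 240 a r^3 / 30. Beyond 1 + 240 a it is therefore beaten by r^5 / 30; below, the
  cubic is bounded by its value at the threshold.\<close>

lemma growth_const_bound:
  assumes B: "0 \<le> B" and r: "0 < r"
  shows "176 * B * (1 + r) ^ 3 + 8 * r\<^sup>2 - r ^ 5 / 30 \<le> growth_const B"
proof -
  define a where "a = 176 * B + 8"
  have a: "8 \<le> a" using B by (simp add: a_def)
  have "r\<^sup>2 \<le> (1 + r) ^ 3" using r by (simp add: power2_eq_square power3_eq_cube algebra_simps)
  hence le: "176 * B * (1 + r) ^ 3 + 8 * r\<^sup>2 \<le> a * (1 + r) ^ 3" by (simp add: a_def algebra_simps)
  show ?thesis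
  proof (cases "r \<le> 1 + 240 * a")
    case True
    have "a * (1 + r) ^ 3 \<le> a * (1 + (1 + 240 * a)) ^ 3"
      using True r a by (intro mult_left_mono power_mono) auto
    moreover have "0 \<le> r ^ 5 / 30" using r by simp
    ultimately show ?thesis using le unfolding growth_const_def a_def[symmetric] by linarith
  next
    case False
    hence r1: "1 \<le> r" "240 * a \<le> r" using a by auto
    have "a * (1 + r) ^ 3 \<le> a * (2 * r) ^ 3" using r1 a by (intro mult_left_mono power_mono) auto
    also have "\<dots> = 240 * a * r ^ 3 / 30" by (simp add: power_mult_distrib)
    also have "\<dots> \<le> (r * r) * r ^ 3 / 30"
      using r1 mult_mono[of 1 r "240 * a" r] a by (intro divide_right_mono mult_right_mono) auto
    also have "\<dots> = r ^ 5 / 30" by (simp add: eval_nat_numeral)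
    finally have "176 * B * (1 + r) ^ 3 + 8 * r\<^sup>2 - r ^ 5 / 30 \<le> 0" using le by linarith
    moreover have "0 \<le> growth_const B" using B by (simp add: growth_const_def)
    ultimately show ?thesis by linarith
  qed
qed

text \<open>The one-particle splitting inequality of the weight, integrated against the density.
  Boundedness of the weight makes the right-hand side integrable with six moments only.\<close>

lemma weighted_split_gain:
  assumes w: "dens w" and W: "is_weight \<epsilon> P \<psi>" and e: "0 \<le> \<epsilon>"
  shows "(LBINT r. \<psi> r * split_gain w r) \<le> (LBINT r. ((\<psi> r + \<epsilon> * r - 1) * r ^ 5 / 30 + 8 * r\<^sup>2) * w r)"
    and "integrable lborel (\<lambda>r. ((\<psi> r + \<epsilon> * r - 1) * r ^ 5 / 30 + 8 * r\<^sup>2) * w r)"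
proof -
  note [measurable] = dens_meas[OF w] is_weight_meas[OF W]
  have p1: "1 \<le> \<psi> r" "\<psi> r \<le> P" for r using is_weight_ge1[OF W] is_weight_le[OF W] by auto
  have P1: "1 \<le> P" using p1[of 0] by linarith
  let ?R = "\<lambda>r. (\<psi> r + \<epsilon> * r - 1) * r ^ 5 / 30 + 8 * r\<^sup>2"
  have Rle: "\<bar>?R r\<bar> \<le> (P + \<epsilon> + 8) * (1 + r) ^ 6" if r: "0 < r" for r
  proof -
    have "0 \<le> \<epsilon> * r" using e r by simp
    hence R0: "0 \<le> (\<psi> r + \<epsilon> * r - 1) * r ^ 5" using p1[of r] r by (intro mult_nonneg_nonneg) auto
    have "(\<psi> r + \<epsilon> * r - 1) * r ^ 5 \<le> (P * (1 + r) + \<epsilon> * (1 + r)) * (1 + r) ^ 5"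
    proof (intro mult_mono power_mono)
      have "P * 1 \<le> P * (1 + r)" using P1 r by (intro mult_left_mono) auto
      thus "\<psi> r + \<epsilon> * r - 1 \<le> P * (1 + r) + \<epsilon> * (1 + r)" using p1[of r] e by (simp add: algebra_simps)
    qed (use r e P1 in auto)
    also have "\<dots> = (P + \<epsilon>) * (1 + r) ^ 6" by (simp add: algebra_simps eval_nat_numeral)
    finally have 1: "(\<psi> r + \<epsilon> * r - 1) * r ^ 5 \<le> (P + \<epsilon>) * (1 + r) ^ 6" .
    have "r\<^sup>2 \<le> (1 + r)\<^sup>2" using r by (intro power_mono) auto
    also have "\<dots> \<le> (1 + r) ^ 6" using r by (intro power_increasing) auto
    finally have "r\<^sup>2 \<le> (1 + r) ^ 6" .
    hence "?R r \<le> (P + \<epsilon>) * (1 + r) ^ 6 + 8 * (1 + r) ^ 6" using 1 R0 by linarith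
    moreover have "0 \<le> ?R r" using R0 by simp
    ultimately show ?thesis by (simp add: algebra_simps)
  qed
  show i: "integrable lborel (\<lambda>r. ?R r * w r)"
    by (rule dens_integrable[OF w _ Rle]) measurable
  have nnR: "0 \<le> ?R r * w r" for r
  proof (cases "r > 0")
    case True
    hence "0 \<le> \<epsilon> * r" using e by simp
    hence "0 \<le> (\<psi> r + \<epsilon> * r - 1) * r ^ 5" using p1[of r] True by (intro mult_nonneg_nonneg) auto
    thus ?thesis using dens_nonneg[OF w, of r] by simp
  qed (simp add: dens_zero[OF w])
  have "(\<integral>\<^sup>+r. ennreal (\<psi> r * split_gain w r) \<partial>lborel)
    = (\<integral>\<^sup>+x. ennreal (w x) * (\<integral>\<^sup>+y. ennreal (2 * pos_square (x - y) * pos_square y * \<psi> y) \<partial>lborel) \<partial>lborel)"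
    by (rule nn_integral_split_gain[OF w]) (use p1 in \<open>auto intro: order_trans[OF zero_le_one]\<close>)
  also have "\<dots> \<le> (\<integral>\<^sup>+x. ennreal (?R x * w x) \<partial>lborel)"
  proof (rule nn_integral_mono)
    fix x
    show "ennreal (w x) * (\<integral>\<^sup>+y. ennreal (2 * pos_square (x - y) * pos_square y * \<psi> y) \<partial>lborel) \<le> ennreal (?R x * w x)"
    proof (cases "x > 0")
      case True
      have "\<bar>\<psi> y\<bar> \<le> P" for y using p1[of y] by simp
      hence "integrable lborel (\<lambda>y. 2 * pos_square (x - y) * pos_square y * \<psi> y)"
        using pos_square_product_integrable[OF True, of \<psi> P] by (simp add: mult.assoc)
      hence "(\<integral>\<^sup>+y. ennreal (2 * pos_square (x - y) * pos_square y * \<psi> y) \<partial>lborel) = ennreal (LBINT y. 2 * pos_square (x - y) * pos_square y * \<psi> y)"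
        using p1 by (intro nn_integral_eq_integral) (auto intro!: AE_I2 mult_nonneg_nonneg intro: order_trans[OF zero_le_one])
      also have "\<dots> \<le> ennreal (?R x)" by (intro ennreal_leI is_weight_split[OF W True])
      finally have "ennreal (w x) * (\<integral>\<^sup>+y. ennreal (2 * pos_square (x - y) * pos_square y * \<psi> y) \<partial>lborel) \<le> ennreal (w x) * ennreal (?R x)"
        by (rule mult_left_mono) simp
      also have "\<dots> = ennreal (w x * ?R x)" using dens_nonneg[OF w, of x] by (simp add: ennreal_mult'[symmetric])
      finally show ?thesis by (simp add: mult.commute)
    qed (simp add: dens_zero[OF w])
  qed
  also have "\<dots> = ennreal (LBINT r. ?R r * w r)" by (rule nn_integral_eq_integral[OF i]) (simp add: nnR)
  finally have fin: "(\<integral>\<^sup>+r. ennreal (\<psi> r * split_gain w r) \<partial>lborel) \<le> ennreal (LBINT r. ?R r * w r)" .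
  show "(LBINT r. \<psi> r * split_gain w r) \<le> (LBINT r. ?R r * w r)"
  proof (rule nn_integral_bound_imp_integrable(2)[OF _ _ fin])
    fix r show "0 \<le> \<psi> r * split_gain w r" using p1(1)[of r] split_gain_nonneg[OF w, of r] by simp
  qed (use nnR in \<open>auto intro!: Bochner_Integration.integral_nonneg\<close>)
qed

text \<open>The terms \<open>\<psi> r * r ^ 5 / 30\<close> cancel between gain and loss, leaving
  \<open>- r ^ 5 / 30\<close> to absorb the cubic. Here 176 is 22 * 4 * 2: the difference bound, the
  slope of the weight, two moments below \<open>B\<close>. The weight defect costs
  \<open>\<epsilon>\<close> times the sixth moment of the difference, at most
  \<open>2 * B\<close>.\<close>

lemma dissipative_estimate:
  assumes u: "dens u" and v: "dens v" and B: "mom 6 u \<le> B" "mom 6 v \<le> B"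
    and W: "is_weight \<epsilon> P \<psi>" and e: "0 \<le> \<epsilon>"
  defines "w \<equiv> \<lambda>r. \<bar>u r - v r\<bar>"
  shows "(LBINT r. \<psi> r * \<bar>quad u r - quad v r\<bar>) + (LBINT r. \<psi> r * split_gain w r) - (LBINT r. \<psi> r * (r ^ 5 / 30 * w r))
    \<le> growth_const B * (LBINT r. \<psi> r * w r) + \<epsilon> * (2 * B)"
    and "integrable lborel (\<lambda>r. \<psi> r * \<bar>quad u r - quad v r\<bar>)" "integrable lborel (\<lambda>r. \<psi> r * split_gain w r)"
    "integrable lborel (\<lambda>r. \<psi> r * (r ^ 5 / 30 * w r))" "integrable lborel (\<lambda>r. \<psi> r * w r)"
proof -
  have w: "dens w" unfolding w_def by (rule dens_diff[OF u v])
  note [measurable] = dens_meas[OF u] dens_meas[OF v] dens_meas[OF w] is_weight_meas[OF W]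
  have p1: "1 \<le> \<psi> r" "\<psi> r \<le> P" for r using is_weight_ge1[OF W] is_weight_le[OF W] by auto
  have P1: "1 \<le> P" using p1[of 0] by linarith
  have B0: "0 \<le> B" using mom_nonneg[OF u, of 6] B by linarith
  have p0: "0 \<le> \<psi> r" for r using p1(1)[of r] by linarith
  note p4 = is_weight_le_affine[OF W]
  show iq: "integrable lborel (\<lambda>r. \<psi> r * \<bar>quad u r - quad v r\<bar>)"
    by (rule quad_diff_bound(1)[OF u v, of _ 4]) (use p0 p4 in auto)
  have q: "(LBINT r. \<psi> r * \<bar>quad u r - quad v r\<bar>) \<le> 22 * 4 * (mom 3 u + mom 3 v) * mom 3 w"
    unfolding w_def by (rule quad_diff_bound(2)[OF u v, of _ 4]) (use p0 p4 in auto)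
  also have "\<dots> \<le> 22 * 4 * (B + B) * mom 3 w"
    using mom_mono[OF u, of 3 6] mom_mono[OF v, of 3 6] B mom_nonneg[OF w] by (intro mult_left_mono mult_right_mono add_mono) auto
  finally have q: "(LBINT r. \<psi> r * \<bar>quad u r - quad v r\<bar>) \<le> (LBINT r. 176 * B * ((1 + r) ^ 3 * w r))"
    by (simp add: mom_def)
  show "integrable lborel (\<lambda>r. \<psi> r * split_gain w r)"
    by (rule split_gain_bound(1)[OF w, of _ 4 1]) (use p0 p4 in auto)
  have le5: "\<bar>\<psi> r * (r ^ 5 / 30)\<bar> \<le> P * (1 + r) ^ 6" if r: "0 < r" for r
  proof -
    have "r ^ 5 \<le> (1 + r) ^ 5" using r by (intro power_mono) auto
    also have "\<dots> \<le> (1 + r) ^ 6" using r by (intro power_increasing) auto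
    finally have "r ^ 5 / 30 \<le> (1 + r) ^ 6" using r zero_le_power[of r 5] by linarith
    hence "\<psi> r * (r ^ 5 / 30) \<le> P * (1 + r) ^ 6" using p1[of r] P1 r by (intro mult_mono) auto
    thus ?thesis using p0[of r] r by simp
  qed
  have "integrable lborel (\<lambda>r. (\<psi> r * (r ^ 5 / 30)) * w r)"
    by (rule dens_integrable[OF w _ le5]) measurable
  thus i5: "integrable lborel (\<lambda>r. \<psi> r * (r ^ 5 / 30 * w r))" by (simp add: mult.assoc)
  show iw: "integrable lborel (\<lambda>r. \<psi> r * w r)"
    by (rule dens_integral_le(1)[OF w, of _ P 0]) (use p0 p1 in auto)
  note i3 = mom_integrable[OF w, of 3, simplified] and i6 = pow_integrable[OF w, of 6, simplified]
  have "(LBINT r. \<psi> r * \<bar>quad u r - quad v r\<bar>) + (LBINT r. \<psi> r * split_gain w r) - (LBINT r. \<psi> r * (r ^ 5 / 30 * w r))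
    \<le> (LBINT r. 176 * B * ((1 + r) ^ 3 * w r)) + (LBINT r. ((\<psi> r + \<epsilon> * r - 1) * r ^ 5 / 30 + 8 * r\<^sup>2) * w r) - (LBINT r. \<psi> r * (r ^ 5 / 30 * w r))"
    using q weighted_split_gain(1)[OF w W e] by linarith
  also have "\<dots> = (LBINT r. 176 * B * ((1 + r) ^ 3 * w r) + ((\<psi> r + \<epsilon> * r - 1) * r ^ 5 / 30 + 8 * r\<^sup>2) * w r - \<psi> r * (r ^ 5 / 30 * w r))"
    using i3 i5 weighted_split_gain(2)[OF w W e] by simp
  also have "\<dots> \<le> (LBINT r. growth_const B * (\<psi> r * w r) + \<epsilon> * (r ^ 6 * w r))"
  proof (rule integral_mono)
    show "integrable lborel (\<lambda>r. 176 * B * ((1 + r) ^ 3 * w r) + ((\<psi> r + \<epsilon> * r - 1) * r ^ 5 / 30 + 8 * r\<^sup>2) * w r - \<psi> r * (r ^ 5 / 30 * w r))"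
      using i3 i5 weighted_split_gain(2)[OF w W e] by simp
    show "integrable lborel (\<lambda>r. growth_const B * (\<psi> r * w r) + \<epsilon> * (r ^ 6 * w r))" using i6 iw by simp
    fix r
    show "176 * B * ((1 + r) ^ 3 * w r) + ((\<psi> r + \<epsilon> * r - 1) * r ^ 5 / 30 + 8 * r\<^sup>2) * w r - \<psi> r * (r ^ 5 / 30 * w r)
      \<le> growth_const B * (\<psi> r * w r) + \<epsilon> * (r ^ 6 * w r)" (is "?goal")
    proof (cases "r > 0")
      case True
      have "176 * B * (1 + r) ^ 3 + ((\<psi> r + \<epsilon> * r - 1) * r ^ 5 / 30 + 8 * r\<^sup>2) - \<psi> r * (r ^ 5 / 30)
        = (176 * B * (1 + r) ^ 3 + 8 * r\<^sup>2 - r ^ 5 / 30) + \<epsilon> * r ^ 6 / 30" by (simp add: field_simps eval_nat_numeral)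
      also have "\<dots> \<le> growth_const B + \<epsilon> * r ^ 6 / 30" using growth_const_bound[OF B0 True] by simp
      also have "\<dots> \<le> growth_const B * \<psi> r + \<epsilon> * r ^ 6"
      proof -
        have "0 \<le> \<epsilon> * r ^ 6" using e True by simp
        moreover have "growth_const B * 1 \<le> growth_const B * \<psi> r" using B0 p1 by (intro mult_left_mono) (auto simp: growth_const_def)
        ultimately show ?thesis by linarith
      qed
      finally have "(176 * B * (1 + r) ^ 3 + ((\<psi> r + \<epsilon> * r - 1) * r ^ 5 / 30 + 8 * r\<^sup>2) - \<psi> r * (r ^ 5 / 30)) * w r
        \<le> (growth_const B * \<psi> r + \<epsilon> * r ^ 6) * w r" by (intro mult_right_mono dens_nonneg[OF w])
      thus ?thesis by (simp add: algebra_simps)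
    qed (simp add: dens_zero[OF w])
  qed
  also have "\<dots> = growth_const B * (LBINT r. \<psi> r * w r) + \<epsilon> * (LBINT r. r ^ 6 * w r)"
    using i6 iw by simp
  also have "(LBINT r. r ^ 6 * w r) \<le> 1 * mom 6 w"
    by (rule dens_integral_le(2)[OF w]) (auto intro!: power_mono)
  also have "mom 6 w \<le> 2 * B"
    using mom_diff_le[OF u v, of 6] B by (simp add: w_def)
  finally show "(LBINT r. \<psi> r * \<bar>quad u r - quad v r\<bar>) + (LBINT r. \<psi> r * split_gain w r) - (LBINT r. \<psi> r * (r ^ 5 / 30 * w r))
    \<le> growth_const B * (LBINT r. \<psi> r * w r) + \<epsilon> * (2 * B)" using e by (simp add: mult_left_mono)
qed

definition ldist :: "(real \<Rightarrow> real) \<Rightarrow> (real \<Rightarrow> real) \<Rightarrow> real" where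
  "ldist u v = (LBINT r. \<bar>u r - v r\<bar>)"

lemma integral_sum5:
  fixes f1 f2 f3 f4 f5 :: "'a \<Rightarrow> real"
  assumes "integrable M f1" "integrable M f2" "integrable M f3" "integrable M f4" "integrable M f5"
  shows "(LINT x|M. f1 x + h * f2 x + h * f3 x + f4 x + f5 x) = integral\<^sup>L M f1 + h * integral\<^sup>L M f2 + h * integral\<^sup>L M f3 + integral\<^sup>L M f4 + integral\<^sup>L M f5"
  using assms by simp

text \<open>Differentiating |u - v| along an L^1 path is replaced by one explicit step. The linear
  loss rate is unbounded, so 1 - h a r^5 / 30 is negative at large r for every h. That region is
  pushed beyond L, where its contribution is paid by the sixth moment. The step bound does not
  depend on u and v.\<close>

lemma comparison_step:
  assumes W: "is_weight \<epsilon> P \<psi>" and e: "0 \<le> \<epsilon>" and B: "0 \<le> B" and a: "0 \<le> a" and \<eta>: "0 < \<eta>"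
  shows "\<exists>h0>0. \<forall>h u v. 0 < h \<longrightarrow> h < h0 \<longrightarrow> dens u \<longrightarrow> dens v \<longrightarrow> mom 6 u \<le> B \<longrightarrow> mom 6 v \<le> B \<longrightarrow>
    (LBINT r. \<psi> r * \<bar>(u r - v r) + h * a * (coll u r - coll v r)\<bar>)
      \<le> (LBINT r. \<psi> r * \<bar>u r - v r\<bar>) + h * (a * (growth_const B * (LBINT r. \<psi> r * \<bar>u r - v r\<bar>) + \<epsilon> * (2 * B)) + \<eta>)"
proof -
  have p1: "1 \<le> \<psi> r" "\<psi> r \<le> P" for r using is_weight_ge1[OF W] is_weight_le[OF W] by auto
  have P1: "1 \<le> P" using p1[of 0] by linarith
  \<comment> \<open>Chosen so that the tail beyond L, at most \<open>2 * a * P / (1 + L)\<close>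
    times the sixth moment \<open>2 * B\<close>, stays below \<open>\<eta>\<close>.\<close>
  define L where "L = 4 * P * B * a / \<eta>"
  have L0: "0 \<le> L" using P1 B a \<eta> by (simp add: L_def)
  have L\<eta>: "2 * a * P / (1 + L) * (2 * B) \<le> \<eta>"
  proof -
    have "4 * P * B * a = \<eta> * L" using \<eta> by (simp add: L_def)
    hence "2 * a * P * (2 * B) \<le> \<eta> * (1 + L)" using \<eta> by (simp add: algebra_simps)
    thus ?thesis using L0 by (simp add: pos_divide_le_eq)
  qed
  \<comment> \<open>Ensures \<open>h * a * r ^ 5 / 30 \<le> 1\<close> for r below L;
    \<open>a + 1\<close> instead of \<open>a\<close> covers the case of a vanishing rate.\<close>
  define h0 where "h0 = 30 / ((a + 1) * (1 + L) ^ 5)"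
  have h0: "0 < h0" using a L0 by (simp add: h0_def)
  have "(LBINT r. \<psi> r * \<bar>(u r - v r) + h * a * (coll u r - coll v r)\<bar>)
      \<le> (LBINT r. \<psi> r * \<bar>u r - v r\<bar>) + h * (a * (growth_const B * (LBINT r. \<psi> r * \<bar>u r - v r\<bar>) + \<epsilon> * (2 * B)) + \<eta>)"
    if h: "0 < h" "h < h0" and u: "dens u" and v: "dens v" and Bu: "mom 6 u \<le> B" and Bv: "mom 6 v \<le> B" for h u v
  proof -
    let ?w = "\<lambda>r. \<bar>u r - v r\<bar>"
    have w: "dens ?w" by (rule dens_diff[OF u v])
    note [measurable] = dens_meas[OF u] dens_meas[OF v] is_weight_meas[OF W]
    note D = dissipative_estimate[OF u v Bu Bv W e]
    let ?c = "2 * a * P / (1 + L)"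
    define F1 where "F1 r = \<psi> r * ?w r" for r
    define F2 where "F2 r = \<psi> r * \<bar>quad u r - quad v r\<bar>" for r
    define F3 where "F3 r = \<psi> r * split_gain ?w r" for r
    define F4 where "F4 r = \<psi> r * (r ^ 5 / 30 * ?w r)" for r
    define F5 where "F5 r = (1 + r) ^ 6 * ?w r" for r
    note F_defs = F1_def F2_def F3_def F4_def F5_def
    let ?R = "\<lambda>r. F1 r + h * a * F2 r + h * a * F3 r - h * a * F4 r + h * (?c * F5 r)"
    have iF: "integrable lborel F1" "integrable lborel F2" "integrable lborel F3" "integrable lborel F4" "integrable lborel F5"
      using D(2-5) mom_integrable[OF w, of 6] unfolding F_defs[abs_def] by auto
    have iR: "integrable lborel ?R" using iF by simp
    have c0: "0 \<le> ?c" using a P1 L0 by simp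
    have pt: "\<psi> r * \<bar>(u r - v r) + h * a * (coll u r - coll v r)\<bar> \<le> ?R r" for r
    proof (cases "r > 0")
      case r: True
      define l where "l = r ^ 5 / 30"
      have l0: "0 \<le> l" using r by (simp add: l_def)
      define X where "X = (quad u r - quad v r) + (split_gain u r - split_gain v r)"
      have Xle: "\<bar>X\<bar> \<le> \<bar>quad u r - quad v r\<bar> + split_gain ?w r"
        using split_gain_diff[OF u v, of r] unfolding X_def by linarith
      have "(u r - v r) + h * a * (coll u r - coll v r) = (1 - h * a * l) * (u r - v r) + h * a * X"
        by (simp add: coll_eq_quad X_def l_def field_simps)
      hence "\<bar>(u r - v r) + h * a * (coll u r - coll v r)\<bar> \<le> \<bar>1 - h * a * l\<bar> * ?w r + h * a * \<bar>X\<bar>"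
        using h a by (metis abs_mult abs_of_nonneg abs_triangle_ineq mult_nonneg_nonneg less_imp_le)
      also have "\<dots> \<le> \<bar>1 - h * a * l\<bar> * ?w r + h * a * (\<bar>quad u r - quad v r\<bar> + split_gain ?w r)"
        using Xle h a by (intro add_left_mono mult_left_mono) auto
      finally have 1: "\<psi> r * \<bar>(u r - v r) + h * a * (coll u r - coll v r)\<bar>
         \<le> \<psi> r * (\<bar>1 - h * a * l\<bar> * ?w r + h * a * (\<bar>quad u r - quad v r\<bar> + split_gain ?w r))"
        using p1(1)[of r] by (intro mult_left_mono) auto
      have 2: "\<psi> r * (\<bar>1 - h * a * l\<bar> * ?w r) \<le> \<psi> r * ?w r - h * a * (\<psi> r * (l * ?w r)) + h * (?c * ((1 + r) ^ 6 * ?w r))"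
      proof (cases "h * a * l \<le> 1")
        case True
        have "0 \<le> h * (?c * ((1 + r) ^ 6 * ?w r))"
          using h c0 r by (intro mult_nonneg_nonneg) auto
        thus ?thesis using True by (simp add: algebra_simps)
      next
        case False
        have rL: "L \<le> r"
        proof (rule ccontr)
          assume "\<not> L \<le> r"
          hence "r ^ 5 \<le> (1 + L) ^ 5" using r by (intro power_mono) auto
          hence "h * a * l \<le> h0 * (a + 1) * ((1 + L) ^ 5 / 30)"
            using h a l0 h0 unfolding l_def by (intro mult_mono) auto
          also have "\<dots> = 1" using a L0 unfolding h0_def by simp
          finally show False using False by simp
        qed
        \<comment> \<open>The estimate continues as if the factor were positive. The excess
          \<open>2 * (h * a * l)\<close> is supported on r >= L only.\<close>
        have "\<bar>1 - h * a * l\<bar> = 1 - h * a * l + 2 * (h * a * l - 1)" using False by simp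
        also have "\<dots> \<le> 1 - h * a * l + 2 * (h * a * l)" by simp
        finally have "\<psi> r * (\<bar>1 - h * a * l\<bar> * ?w r) \<le> \<psi> r * ((1 - h * a * l + 2 * (h * a * l)) * ?w r)"
          using p1(1)[of r] by (intro mult_left_mono mult_right_mono) auto
        also have "\<dots> = \<psi> r * ?w r - h * a * (\<psi> r * (l * ?w r)) + h * (2 * a) * ((\<psi> r * l) * ?w r)"
          by (simp add: algebra_simps)
        also have "h * (2 * a) * ((\<psi> r * l) * ?w r) \<le> h * (2 * a) * ((P * (1 + r) ^ 6 / (1 + L)) * ?w r)"
        proof (intro mult_left_mono mult_right_mono)
          have "r ^ 5 \<le> (1 + r) ^ 5" using r by (intro power_mono) auto
          hence "l \<le> (1 + r) ^ 5" unfolding l_def using zero_le_power[of r 5] r by linarith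
          also have "\<dots> = (1 + r) ^ 6 / (1 + r)" using r by (simp add: eval_nat_numeral)
          also have "\<dots> \<le> (1 + r) ^ 6 / (1 + L)" using rL L0 r by (intro divide_left_mono) auto
          finally have "\<psi> r * l \<le> P * ((1 + r) ^ 6 / (1 + L))" using p1[of r] P1 l0 by (intro mult_mono) auto
          thus "\<psi> r * l \<le> P * (1 + r) ^ 6 / (1 + L)" by simp
        qed (use h a in auto)
        also have "h * (2 * a) * ((P * (1 + r) ^ 6 / (1 + L)) * ?w r) = h * (?c * ((1 + r) ^ 6 * ?w r))"
          by (simp add: mult_ac)
        finally show ?thesis by simp
      qed
      show ?thesis using 1 2 unfolding l_def F_defs by (simp add: algebra_simps)
    qed (simp add: F_defs coll_nonpos[OF u] coll_nonpos[OF v] dens_zero[OF u] dens_zero[OF v] split_gain_def pos_square_def quad_def gain_def)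
    have "(LBINT r. \<psi> r * \<bar>(u r - v r) + h * a * (coll u r - coll v r)\<bar>) \<le> (LBINT r. ?R r)"
    proof (rule integral_mono[OF _ iR pt])
      show "integrable lborel (\<lambda>r. \<psi> r * \<bar>u r - v r + h * a * (coll u r - coll v r)\<bar>)"
        by (rule Bochner_Integration.integrable_bound[OF iR])
          (use pt p1 in \<open>auto simp: abs_mult intro!: AE_I2 intro: order_trans[OF _ abs_ge_self] simp: abs_of_nonneg[OF order_trans[OF zero_le_one p1(1)]]\<close>)
    qed
    also have "\<dots> = (LBINT r. F1 r) + h * a * ((LBINT r. F2 r) + (LBINT r. F3 r) - (LBINT r. F4 r)) + h * (?c * (LBINT r. F5 r))"
      using iF by (simp add: right_diff_distrib distrib_left)
    also have "\<dots> = (LBINT r. \<psi> r * ?w r) + h * a * ((LBINT r. \<psi> r * \<bar>quad u r - quad v r\<bar>) + (LBINT r. \<psi> r * split_gain ?w r) - (LBINT r. \<psi> r * (r ^ 5 / 30 * ?w r))) + h * (?c * mom 6 ?w)"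
      by (simp only: F_defs mom_def)
    also have "\<dots> \<le> (LBINT r. \<psi> r * ?w r) + h * a * (growth_const B * (LBINT r. \<psi> r * ?w r) + \<epsilon> * (2 * B)) + h * \<eta>"
    proof (intro add_mono order_refl mult_left_mono)
      have "?c * mom 6 ?w \<le> ?c * (2 * B)"
        using mom_diff_le[OF u v, of 6] Bu Bv c0 by (intro mult_left_mono) auto
      thus "?c * mom 6 ?w \<le> \<eta>" using L\<eta> by simp
    qed (use h a D(1) in auto)
    finally show ?thesis by (simp add: algebra_simps)
  qed
  thus ?thesis using h0 by blast
qed

text \<open>One notion for both uses: Euler paths, with \<open>a = 1\<close> and a small defect, and
  exact solutions in physical time, with \<open>a = \<kappa>0 / nc\<close> and defect 0. The factor
  \<open>4 * (1 + r)\<close> in the defect is the common bound for all weights, so the defect does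
  not see the weight chosen later.\<close>

definition approx_solution :: "real \<Rightarrow> (real \<Rightarrow> real) \<Rightarrow> real \<Rightarrow> real \<Rightarrow> (real \<Rightarrow> real \<Rightarrow> real) \<Rightarrow> bool" where
  "approx_solution B a \<epsilon> T u \<longleftrightarrow>
     (\<forall>t\<in>{0..T}. dens (u t) \<and> mom 6 (u t) \<le> B \<and> ((\<lambda>s. ldist (u s) (u t)) \<longlongrightarrow> 0) (at t within {0..T}))
     \<and> (\<forall>t\<in>{0<..<T}. \<exists>b. integrable lborel b \<and> (\<forall>r\<le>0. b r = 0)
          \<and> ((\<lambda>h. (LBINT r. \<bar>u (t + h) r - u t r - h * b r\<bar>) / h) \<longlongrightarrow> 0) (at_right 0)
          \<and> integrable lborel (\<lambda>r. (1 + r) * \<bar>b r - a t * coll (u t) r\<bar>)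
          \<and> (LBINT r. 4 * (1 + r) * \<bar>b r - a t * coll (u t) r\<bar>) \<le> \<epsilon>)"

lemma approx_solution_deriv:
  "approx_solution B a \<epsilon> T u \<Longrightarrow> 0 < t \<Longrightarrow> t < T \<Longrightarrow> \<exists>b. integrable lborel b \<and> (\<forall>r\<le>0. b r = 0)
          \<and> ((\<lambda>h. (LBINT r. \<bar>u (t + h) r - u t r - h * b r\<bar>) / h) \<longlongrightarrow> 0) (at_right 0)
          \<and> integrable lborel (\<lambda>r. (1 + r) * \<bar>b r - a t * coll (u t) r\<bar>)
          \<and> (LBINT r. 4 * (1 + r) * \<bar>b r - a t * coll (u t) r\<bar>) \<le> \<epsilon>"
  by (simp add: approx_solution_def)

lemma ldist_nonneg: "0 \<le> ldist u v"
  by (simp add: ldist_def)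

text \<open>Paths are continuous in plain L^1 only; a bounded weight carries this over to the
  weighted distance.\<close>

lemma weighted_dist_continuous:
  assumes W: "is_weight \<epsilon> P \<psi>"
    and u: "\<And>t. t \<in> {0..T} \<Longrightarrow> dens (u t) \<and> ((\<lambda>s. ldist (u s) (u t)) \<longlongrightarrow> 0) (at t within {0..T})"
    and v: "\<And>t. t \<in> {0..T} \<Longrightarrow> dens (v t) \<and> ((\<lambda>s. ldist (v s) (v t)) \<longlongrightarrow> 0) (at t within {0..T})"
  shows "continuous_on {0..T} (\<lambda>t. LBINT r. \<psi> r * \<bar>u t r - v t r\<bar>)"
  unfolding continuous_on_def
proof
  fix t assume t: "t \<in> {0..T}"
  have p1: "1 \<le> \<psi> r" "\<psi> r \<le> P" for r using is_weight_ge1[OF W] is_weight_le[OF W] by auto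
  have P1: "1 \<le> P" using p1[of 0] by linarith
  note [measurable] = is_weight_meas[OF W]
  let ?y = "\<lambda>t. LBINT r. \<psi> r * \<bar>u t r - v t r\<bar>"
  have le: "\<bar>?y s - ?y t\<bar> \<le> P * (ldist (u s) (u t) + ldist (v s) (v t))" if s: "s \<in> {0..T}" for s
  proof -
    have d: "dens (u s)" "dens (v s)" "dens (u t)" "dens (v t)" using u[OF s] v[OF s] u[OF t] v[OF t] by auto
    have i: "integrable lborel (\<lambda>r. \<psi> r * \<bar>f r - g r\<bar>)" if "dens f" "dens g" for f g
      by (rule dens_integral_le(1)[OF dens_diff[OF that], of _ P 0]) (use p1 in \<open>auto simp: abs_of_nonneg[OF order_trans[OF zero_le_one p1(1)]]\<close>)
    have i1: "integrable lborel (\<lambda>r. \<bar>f r - g r\<bar>)" if "dens f" "dens g" for f g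
      using dens_integrable_self[OF dens_diff[OF that]] .
    have "?y s - ?y t = (LBINT r. \<psi> r * \<bar>u s r - v s r\<bar> - \<psi> r * \<bar>u t r - v t r\<bar>)"
      using i d by simp
    hence "\<bar>?y s - ?y t\<bar> \<le> (LBINT r. \<bar>\<psi> r * \<bar>u s r - v s r\<bar> - \<psi> r * \<bar>u t r - v t r\<bar>\<bar>)"
      by (simp add: integral_abs_bound)
    also have "\<dots> \<le> (LBINT r. P * \<bar>u s r - u t r\<bar> + P * \<bar>v s r - v t r\<bar>)"
    proof (rule integral_mono)
      fix r
      have "\<bar>\<psi> r * \<bar>u s r - v s r\<bar> - \<psi> r * \<bar>u t r - v t r\<bar>\<bar> = \<psi> r * \<bar>\<bar>u s r - v s r\<bar> - \<bar>u t r - v t r\<bar>\<bar>"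
        using p1(1)[of r] by (simp add: abs_mult flip: right_diff_distrib)
      also have "\<dots> \<le> P * (\<bar>u s r - u t r\<bar> + \<bar>v s r - v t r\<bar>)"
        using p1[of r] P1 by (intro mult_mono) auto
      finally show "\<bar>\<psi> r * \<bar>u s r - v s r\<bar> - \<psi> r * \<bar>u t r - v t r\<bar>\<bar> \<le> P * \<bar>u s r - u t r\<bar> + P * \<bar>v s r - v t r\<bar>"
        by (simp add: distrib_left)
    qed (use i i1 d in auto)
    also have "\<dots> = P * (ldist (u s) (u t) + ldist (v s) (v t))"
      using i1 d by (simp add: ldist_def distrib_left)
    finally show ?thesis .
  qed
  have "((\<lambda>s. P * (ldist (u s) (u t) + ldist (v s) (v t))) \<longlongrightarrow> P * (0 + 0)) (at t within {0..T})"
    using u[OF t] v[OF t] by (intro tendsto_intros) auto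
  hence lim: "((\<lambda>s. P * (ldist (u s) (u t) + ldist (v s) (v t))) \<longlongrightarrow> 0) (at t within {0..T})" by simp
  have "((\<lambda>s. ?y s - ?y t) \<longlongrightarrow> 0) (at t within {0..T})"
  proof (rule Lim_null_comparison[OF _ lim])
    show "eventually (\<lambda>s. norm (?y s - ?y t) \<le> P * (ldist (u s) (u t) + ldist (v s) (v t))) (at t within {0..T})"
      using le by (auto simp: eventually_at_filter)
  qed
  thus "(?y \<longlongrightarrow> ?y t) (at t within {0..T})" by (rule LIM_zero_cancel)
qed

text \<open>For a fixed weight the Gronwall lemma applies to the weighted distance. The weight is
  removed at both ends by 1 <= psi <= 4 (1 + r), so its bound P disappears from the result and the
  weight parameter can be sent to zero.\<close>

theorem approx_solution_stability:
  assumes u: "approx_solution B a \<epsilon>1 T u" and v: "approx_solution B a \<epsilon>2 T v"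
    and a: "\<And>t. t \<in> {0<..<T} \<Longrightarrow> 0 \<le> a t \<and> a t \<le> A" and A: "0 \<le> A" and e12: "0 \<le> \<epsilon>1" "0 \<le> \<epsilon>2" and t: "t \<in> {0..T}"
  shows "ldist (u t) (v t) \<le> exp (A * growth_const B * t) * (4 * mom 1 (\<lambda>r. \<bar>u 0 r - v 0 r\<bar>) + (\<epsilon>1 + \<epsilon>2) * t)"
proof -
  have ud: "dens (u t)" "mom 6 (u t) \<le> B" and vd: "dens (v t)" "mom 6 (v t) \<le> B" if "t \<in> {0..T}" for t
    using u v that by (auto simp: approx_solution_def)
  have 0: "0 \<in> {0..T}" using t by auto
  have B0: "0 \<le> B" using mom_nonneg[OF ud(1)[OF 0], of 6] ud(2)[OF 0] by linarith
  have gc: "0 \<le> growth_const B" using B0 by (simp add: growth_const_def)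
  have main: "ldist (u t) (v t) \<le> exp (A * growth_const B * t) * (4 * mom 1 (\<lambda>r. \<bar>u 0 r - v 0 r\<bar>) + (\<epsilon>1 + \<epsilon>2 + A * (\<epsilon> * (2 * B))) * t)"
    if e: "0 < \<epsilon>" for \<epsilon>
  proof -
    obtain P \<psi> where W: "is_weight \<epsilon> P \<psi>" using weight_exists[OF e] by blast
    have p1: "1 \<le> \<psi> r" "\<psi> r \<le> P" for r using is_weight_ge1[OF W] is_weight_le[OF W] by auto
    have p0: "0 \<le> \<psi> r" for r using p1(1)[of r] by linarith
    have P1: "1 \<le> P" using p1[of 0] by linarith
    note [measurable] = is_weight_meas[OF W]
    define y where "y t = (LBINT r. \<psi> r * \<bar>u t r - v t r\<bar>)" for t
    have y0: "0 \<le> y t" for t unfolding y_def using p0 by simp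
    have i\<psi>: "integrable lborel (\<lambda>r. \<psi> r * \<bar>f r\<bar>)" "(LBINT r. \<psi> r * \<bar>f r\<bar>) \<le> P * (LBINT r. \<bar>f r\<bar>)" if f: "integrable lborel f" for f
    proof -
      note [measurable] = borel_measurable_integrable[OF f]
      show i: "integrable lborel (\<lambda>r. \<psi> r * \<bar>f r\<bar>)"
        by (rule Bochner_Integration.integrable_bound[of _ "\<lambda>r. P * \<bar>f r\<bar>"]) (use f p0 p1 P1 in \<open>auto simp: abs_mult intro!: AE_I2 mult_right_mono\<close>)
      have "(LBINT r. \<psi> r * \<bar>f r\<bar>) \<le> (LBINT r. P * \<bar>f r\<bar>)"
        by (rule integral_mono[OF i]) (use f p1 in \<open>auto intro!: mult_right_mono\<close>)
      thus "(LBINT r. \<psi> r * \<bar>f r\<bar>) \<le> P * (LBINT r. \<bar>f r\<bar>)" by simp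
    qed
    have "y t \<le> exp (A * growth_const B * t) * (y 0 + (\<epsilon>1 + \<epsilon>2 + A * (\<epsilon> * (2 * B))) * t)"
    proof (rule dini_gronwall[OF _ _ y0 _ _ t])
      show "continuous_on {0..T} y"
        unfolding y_def by (rule weighted_dist_continuous[OF W]) (use u v in \<open>auto simp: approx_solution_def\<close>)
      fix t \<eta> :: real assume t: "0 < t" "t < T" and \<eta>: "0 < \<eta>"
      have ti: "t \<in> {0<..<T}" "t \<in> {0..T}" using t by auto
      obtain b where b: "integrable lborel b" "\<forall>r\<le>0. b r = 0"
          "((\<lambda>h. (LBINT r. \<bar>u (t + h) r - u t r - h * b r\<bar>) / h) \<longlongrightarrow> 0) (at_right 0)"
          "integrable lborel (\<lambda>r. (1 + r) * \<bar>b r - a t * coll (u t) r\<bar>)"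
          "(LBINT r. 4 * (1 + r) * \<bar>b r - a t * coll (u t) r\<bar>) \<le> \<epsilon>1"
        using approx_solution_deriv[OF u t] by (elim exE conjE)
      obtain c where c: "integrable lborel c" "\<forall>r\<le>0. c r = 0"
          "((\<lambda>h. (LBINT r. \<bar>v (t + h) r - v t r - h * c r\<bar>) / h) \<longlongrightarrow> 0) (at_right 0)"
          "integrable lborel (\<lambda>r. (1 + r) * \<bar>c r - a t * coll (v t) r\<bar>)"
          "(LBINT r. 4 * (1 + r) * \<bar>c r - a t * coll (v t) r\<bar>) \<le> \<epsilon>2"
        using approx_solution_deriv[OF v t] by (elim exE conjE)
      have at: "0 \<le> a t" "a t \<le> A" using a[OF ti(1)] by auto
      \<comment> \<open>One third goes to the explicit step and one third to each first-order
        remainder. The remainders are small in plain L^1, so they are required below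
        \<open>\<eta> / (3 * P)\<close> to survive the weight.\<close>
      have "0 < \<eta> / 3" using \<eta> by simp
      from comparison_step[OF W less_imp_le[OF e] B0 at(1) this] obtain h0 where h0: "0 < h0"
        and step: "\<And>h u v. 0 < h \<Longrightarrow> h < h0 \<Longrightarrow> dens u \<Longrightarrow> dens v \<Longrightarrow> mom 6 u \<le> B \<Longrightarrow> mom 6 v \<le> B \<Longrightarrow>
    (LBINT r. \<psi> r * \<bar>(u r - v r) + h * a t * (coll u r - coll v r)\<bar>)
      \<le> (LBINT r. \<psi> r * \<bar>u r - v r\<bar>) + h * (a t * (growth_const B * (LBINT r. \<psi> r * \<bar>u r - v r\<bar>) + \<epsilon> * (2 * B)) + \<eta> / 3)"
        by blast
      have q: "0 < \<eta> / (3 * P)" using \<eta> P1 by simp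
      have "eventually (\<lambda>h. (LBINT r. \<bar>u (t + h) r - u t r - h * b r\<bar>) / h < \<eta> / (3 * P)) (at_right 0)"
        using order_tendstoD(2)[OF b(3) q] .
      moreover have "eventually (\<lambda>h. (LBINT r. \<bar>v (t + h) r - v t r - h * c r\<bar>) / h < \<eta> / (3 * P)) (at_right 0)"
        using order_tendstoD(2)[OF c(3) q] .
      moreover have "eventually (\<lambda>h. h < min h0 (T - t)) (at_right 0)"
        using h0 t by (intro order_tendstoD(2)[OF tendsto_ident_at]) simp
      moreover have "eventually (\<lambda>h. 0 < h) (at_right (0 :: real))" by (rule eventually_at_right_less)
      ultimately show "eventually (\<lambda>h. y (t + h) \<le> y t + h * (A * growth_const B * y t + (\<epsilon>1 + \<epsilon>2 + A * (\<epsilon> * (2 * B))) + \<eta>)) (at_right 0)"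
      proof eventually_elim
        case (elim h)
        have th: "t + h \<in> {0..T}" using elim t by auto
        note d = ud(1)[OF th] vd(1)[OF th] ud(1)[OF ti(2)] vd(1)[OF ti(2)]
        note iu = d[THEN dens_integrable_self]
        note ic = d[THEN coll_integrable]
        let ?Ru = "\<lambda>r. u (t + h) r - u t r - h * b r" and ?Rv = "\<lambda>r. v (t + h) r - v t r - h * c r"
        let ?S = "\<lambda>r. (u t r - v t r) + h * a t * (coll (u t) r - coll (v t) r)"
        let ?E = "\<lambda>r. 4 * (1 + r) * \<bar>b r - a t * coll (u t) r\<bar>" and ?E' = "\<lambda>r. 4 * (1 + r) * \<bar>c r - a t * coll (v t) r\<bar>"
        have iE: "integrable lborel ?E" "integrable lborel ?E'"
          using integrable_mult_right[OF b(4), of 4] integrable_mult_right[OF c(4), of 4] by (simp_all only: mult.assoc)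
        have iR: "integrable lborel ?Ru" "integrable lborel ?Rv" "integrable lborel ?S"
          by (intro Bochner_Integration.integrable_diff Bochner_Integration.integrable_add integrable_mult_right iu ic b(1) c(1))+
        note iR' = i\<psi>(1)[OF iR(1)] i\<psi>(1)[OF iR(2)] i\<psi>(1)[OF iR(3)]
        have tri: "\<bar>p + q - q' + s - s'\<bar> \<le> \<bar>p\<bar> + \<bar>q\<bar> + \<bar>q'\<bar> + \<bar>s\<bar> + \<bar>s'\<bar>" for p q q' s s' :: real by linarith
        have pt: "\<psi> r * \<bar>u (t + h) r - v (t + h) r\<bar> \<le> \<psi> r * \<bar>?S r\<bar> + h * ?E r + h * ?E' r + \<psi> r * \<bar>?Ru r\<bar> + \<psi> r * \<bar>?Rv r\<bar>" for r
        proof (cases "r > 0")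
          case True
          let ?x = "b r - a t * coll (u t) r" and ?x' = "c r - a t * coll (v t) r"
          have "u (t + h) r - v (t + h) r = ?S r + h * ?x - h * ?x' + ?Ru r - ?Rv r" by (simp add: algebra_simps)
          hence "\<bar>u (t + h) r - v (t + h) r\<bar> = \<bar>?S r + h * ?x - h * ?x' + ?Ru r - ?Rv r\<bar>" by (rule arg_cong)
          also have "\<dots> \<le> \<bar>?S r\<bar> + \<bar>h * ?x\<bar> + \<bar>h * ?x'\<bar> + \<bar>?Ru r\<bar> + \<bar>?Rv r\<bar>" by (rule tri)
          also have "\<dots> = \<bar>?S r\<bar> + h * \<bar>?x\<bar> + h * \<bar>?x'\<bar> + \<bar>?Ru r\<bar> + \<bar>?Rv r\<bar>"
            using elim by (simp only: abs_mult abs_of_pos)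
          finally have "\<psi> r * \<bar>u (t + h) r - v (t + h) r\<bar> \<le> \<psi> r * (\<bar>?S r\<bar> + h * \<bar>?x\<bar> + h * \<bar>?x'\<bar> + \<bar>?Ru r\<bar> + \<bar>?Rv r\<bar>)"
            using p0 by (intro mult_left_mono)
          also have "\<dots> = \<psi> r * \<bar>?S r\<bar> + h * (\<psi> r * \<bar>?x\<bar>) + h * (\<psi> r * \<bar>?x'\<bar>) + \<psi> r * \<bar>?Ru r\<bar> + \<psi> r * \<bar>?Rv r\<bar>"
            by (simp only: distrib_left mult_ac)
          also have "\<dots> \<le> \<psi> r * \<bar>?S r\<bar> + h * ?E r + h * ?E' r + \<psi> r * \<bar>?Ru r\<bar> + \<psi> r * \<bar>?Rv r\<bar>"
            using is_weight_le_affine[OF W True] elim by (intro add_mono order_refl mult_left_mono mult_right_mono) auto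
          finally show ?thesis .
        qed (simp add: b(2) c(2) dens_zero[OF d(1)] dens_zero[OF d(2)] dens_zero[OF d(3)] dens_zero[OF d(4)] coll_nonpos[OF d(3)] coll_nonpos[OF d(4)])
        have "y (t + h) \<le> (LBINT r. \<psi> r * \<bar>?S r\<bar> + h * ?E r + h * ?E' r + \<psi> r * \<bar>?Ru r\<bar> + \<psi> r * \<bar>?Rv r\<bar>)"
          unfolding y_def
          by (rule integral_mono[OF i\<psi>(1) _ pt])
            (intro Bochner_Integration.integrable_add Bochner_Integration.integrable_diff integrable_mult_right iu iR' iE)+
        also have "\<dots> = (LBINT r. \<psi> r * \<bar>?S r\<bar>) + h * (LBINT r. ?E r) + h * (LBINT r. ?E' r) + (LBINT r. \<psi> r * \<bar>?Ru r\<bar>) + (LBINT r. \<psi> r * \<bar>?Rv r\<bar>)"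
          by (rule integral_sum5[OF iR'(3) iE iR'(1,2)])
        also have "\<dots> \<le> (y t + h * (a t * (growth_const B * y t + \<epsilon> * (2 * B)) + \<eta> / 3)) + h * \<epsilon>1 + h * \<epsilon>2 + h * (\<eta> / 3) + h * (\<eta> / 3)"
        proof (intro add_mono)
          show "(LBINT r. \<psi> r * \<bar>?S r\<bar>) \<le> y t + h * (a t * (growth_const B * y t + \<epsilon> * (2 * B)) + \<eta> / 3)"
            unfolding y_def using elim d ud(2)[OF ti(2)] vd(2)[OF ti(2)] by (intro step) auto
          have "P * (LBINT r. \<bar>?Ru r\<bar>) \<le> P * (h * (\<eta> / (3 * P)))"
            using elim P1 by (intro mult_left_mono) (auto simp: pos_divide_less_eq mult.commute)
          moreover have "P * (LBINT r. \<bar>?Rv r\<bar>) \<le> P * (h * (\<eta> / (3 * P)))"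
            using elim P1 by (intro mult_left_mono) (auto simp: pos_divide_less_eq mult.commute)
          moreover have "P * (h * (\<eta> / (3 * P))) = h * (\<eta> / 3)" using P1 by simp
          ultimately show "(LBINT r. \<psi> r * \<bar>?Ru r\<bar>) \<le> h * (\<eta> / 3)" "(LBINT r. \<psi> r * \<bar>?Rv r\<bar>) \<le> h * (\<eta> / 3)"
            using i\<psi>(2)[OF iR(1)] i\<psi>(2)[OF iR(2)] by linarith+
          show "h * (LBINT r. ?E r) \<le> h * \<epsilon>1" "h * (LBINT r. ?E' r) \<le> h * \<epsilon>2"
            using elim by (intro mult_left_mono b(5) c(5) less_imp_le; simp)+
        qed
        also have "\<dots> = y t + h * (a t * (growth_const B * y t + \<epsilon> * (2 * B)) + \<epsilon>1 + \<epsilon>2 + \<eta>)"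
          by (simp add: algebra_simps)
        also have "\<dots> \<le> y t + h * (A * (growth_const B * y t + \<epsilon> * (2 * B)) + \<epsilon>1 + \<epsilon>2 + \<eta>)"
        proof -
          have "0 \<le> growth_const B * y t + \<epsilon> * (2 * B)" using gc y0[of t] e B0 by simp
          from mult_right_mono[OF at(2) this] show ?thesis using elim by (simp add: mult_left_mono)
        qed
        finally show ?case by (simp add: algebra_simps)
      qed
    qed (use A gc e12 e B0 in auto)
    also have "\<dots> \<le> exp (A * growth_const B * t) * (4 * mom 1 (\<lambda>r. \<bar>u 0 r - v 0 r\<bar>) + (\<epsilon>1 + \<epsilon>2 + A * (\<epsilon> * (2 * B))) * t)"
    proof -
      have "y 0 \<le> 4 * mom 1 (\<lambda>r. \<bar>u 0 r - v 0 r\<bar>)"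
        unfolding y_def by (rule dens_integral_le(2)[OF dens_diff[OF ud(1)[OF 0] vd(1)[OF 0]]])
          (use p0 is_weight_le_affine[OF W] in auto)
      thus ?thesis by (intro mult_left_mono add_right_mono) auto
    qed
    finally have "y t \<le> exp (A * growth_const B * t) * (4 * mom 1 (\<lambda>r. \<bar>u 0 r - v 0 r\<bar>) + (\<epsilon>1 + \<epsilon>2 + A * (\<epsilon> * (2 * B))) * t)" .
    moreover have "ldist (u t) (v t) \<le> y t"
      unfolding ldist_def y_def
    proof (rule integral_mono)
      have i: "integrable lborel (\<lambda>r. u t r - v t r)" using ud(1)[OF t] vd(1)[OF t] by (auto intro: dens_integrable_self)
      thus "integrable lborel (\<lambda>r. \<bar>u t r - v t r\<bar>)" "integrable lborel (\<lambda>r. \<psi> r * \<bar>u t r - v t r\<bar>)"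
        using i\<psi>(1)[OF i] by auto
      show "\<bar>u t r - v t r\<bar> \<le> \<psi> r * \<bar>u t r - v t r\<bar>" for r using p1(1)[of r] mult_right_mono[of 1 "\<psi> r"] by simp
    qed
    ultimately show ?thesis by linarith
  qed
  show ?thesis
  proof (rule tendsto_le[OF trivial_limit_at_right_real])
    show "((\<lambda>\<epsilon>. exp (A * growth_const B * t) * (4 * mom 1 (\<lambda>r. \<bar>u 0 r - v 0 r\<bar>) + (\<epsilon>1 + \<epsilon>2 + A * (\<epsilon> * (2 * B))) * t))
      \<longlongrightarrow> exp (A * growth_const B * t) * (4 * mom 1 (\<lambda>r. \<bar>u 0 r - v 0 r\<bar>) + (\<epsilon>1 + \<epsilon>2) * t)) (at_right 0)"
      by (auto intro!: tendsto_eq_intros)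
    show "((\<lambda>_. ldist (u t) (v t)) \<longlongrightarrow> ldist (u t) (v t)) (at_right 0)" by simp
    show "eventually (\<lambda>\<epsilon>. ldist (u t) (v t) \<le> exp (A * growth_const B * t) * (4 * mom 1 (\<lambda>r. \<bar>u 0 r - v 0 r\<bar>) + (\<epsilon>1 + \<epsilon>2 + A * (\<epsilon> * (2 * B))) * t)) (at_right 0)"
      using eventually_at_right_less[of "0 :: real"] by eventually_elim (rule main)
  qed
qed

section \<open>Pointwise bounds\<close>

lemma corr_shift:
  "corr f g r = (LBINT s. f s * g (s - r))"
  unfolding corr_def by (subst (2) lborel_integral_real_affine[where c = 1 and t = r]) simp_all

text \<open>Inside the integrals agreement almost everywhere is enough, but f also occurs as a
  factor at r itself, hence the separate hypothesis there. Each integral yields a common factor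
  r^2.\<close>

lemma collision_eq_coll:
  assumes u: "dens u" and [measurable]: "f \<in> borel_measurable borel"
    and ae: "AE s in lborel. 0 < s \<longrightarrow> f s * s\<^sup>2 = u s" and r: "0 < r" and fr: "f r * r\<^sup>2 = u r"
  shows "collision f r = coll u r / r\<^sup>2"
proof -
  note [measurable] = dens_meas[OF u]
  have ae2: "AE s in lborel. 0 < r - s \<longrightarrow> f (r - s) * (r - s)\<^sup>2 = u (r - s)"
    using AE_borel_affine[of "-1" "\<lambda>s. 0 < s \<longrightarrow> f s * s\<^sup>2 = u s" r] ae by simp
  have ae3: "AE s in lborel. 0 < s - r \<longrightarrow> f (s - r) * (s - r)\<^sup>2 = u (s - r)"
    using AE_borel_affine[of 1 "\<lambda>s. 0 < s \<longrightarrow> f s * s\<^sup>2 = u s" "-r"] ae by simp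
  have k: "collision_kernel r (s - r) = r\<^sup>2 * ((s - r)\<^sup>2 * s\<^sup>2)" "collision_kernel s (r - s) = r\<^sup>2 * (s\<^sup>2 * (r - s)\<^sup>2)" for s
    by (simp_all add: collision_kernel_def mult_ac)
  have T1: "(LBINT s:{0..r}. collision_kernel s (r - s) * f s * f (r - s)) = r\<^sup>2 * conv u u r"
  proof -
    have "(LBINT s:{0..r}. collision_kernel s (r - s) * f s * f (r - s)) = (LBINT s. r\<^sup>2 * (u s * u (r - s)))"
      unfolding set_lebesgue_integral_def
    proof (rule integral_cong_AE)
      show "AE s in lborel. indicator {0..r} s *\<^sub>R (collision_kernel s (r - s) * f s * f (r - s)) = r\<^sup>2 * (u s * u (r - s))"
        using ae ae2
      proof eventually_elim
        case (elim s)
        show ?case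
        proof (cases "0 < s \<and> s < r")
          case True
          hence "r\<^sup>2 * (u s * u (r - s)) = r\<^sup>2 * ((f s * s\<^sup>2) * (f (r - s) * (r - s)\<^sup>2))" using elim by simp
          thus ?thesis using True by (simp add: k mult_ac)
        next
          case False
          hence "u s * u (r - s) = 0" using dens_zero[OF u, of s] dens_zero[OF u, of "r - s"] by (cases "s \<le> 0") auto
          moreover have "s = 0 \<or> s = r \<or> s \<notin> {0..r}" using False by auto
          ultimately show ?thesis by (auto simp: k)
        qed
      qed
    qed (unfold collision_kernel_def, measurable)
    thus ?thesis by (simp add: conv_def)
  qed
  have T2: "(LBINT s:{r..}. collision_kernel r (s - r) * f s * f (s - r)) = r\<^sup>2 * corr u u r"
  proof -
    have "(LBINT s:{r..}. collision_kernel r (s - r) * f s * f (s - r)) = (LBINT s. r\<^sup>2 * (u s * u (s - r)))"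
      unfolding set_lebesgue_integral_def
    proof (rule integral_cong_AE)
      show "AE s in lborel. indicator {r..} s *\<^sub>R (collision_kernel r (s - r) * f s * f (s - r)) = r\<^sup>2 * (u s * u (s - r))"
        using ae ae3
      proof eventually_elim
        case (elim s)
        show ?case
        proof (cases "r < s")
          case True
          hence "r\<^sup>2 * ((f s * s\<^sup>2) * (f (s - r) * (s - r)\<^sup>2)) = r\<^sup>2 * (u s * u (s - r))" using elim r by simp
          thus ?thesis using True by (simp add: k mult_ac)
        next
          case False
          hence "u (s - r) = 0" using dens_zero[OF u, of "s - r"] by auto
          moreover have "s = r \<or> s \<notin> {r..}" using False by auto
          ultimately show ?thesis by (auto simp: k)
        qed
      qed
    qed (unfold collision_kernel_def, measurable)
    thus ?thesis by (simp add: corr_shift)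
  qed
  have T3: "(LBINT s:{r..}. collision_kernel r (s - r) * f s) = r\<^sup>2 * corr u pos_square r"
  proof -
    have "(LBINT s:{r..}. collision_kernel r (s - r) * f s) = (LBINT s. r\<^sup>2 * (u s * pos_square (s - r)))"
      unfolding set_lebesgue_integral_def
    proof (rule integral_cong_AE)
      show "AE s in lborel. indicator {r..} s *\<^sub>R (collision_kernel r (s - r) * f s) = r\<^sup>2 * (u s * pos_square (s - r))"
        using ae
      proof eventually_elim
        case (elim s)
        show ?case
        proof (cases "r < s")
          case True
          hence "r\<^sup>2 * ((f s * s\<^sup>2) * (s - r)\<^sup>2) = r\<^sup>2 * (u s * pos_square (s - r))" using elim r by (simp add: pos_square_def)
          thus ?thesis using True by (simp add: k mult_ac)
        next
          case False
          moreover have "s = r \<or> s \<notin> {r..}" using False by auto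
          ultimately show ?thesis by (auto simp: k pos_square_def)
        qed
      qed
    qed (unfold collision_kernel_def, measurable)
    thus ?thesis by (simp add: corr_shift)
  qed
  have T4: "(LBINT s:{0..r}. collision_kernel s (r - s) * f s) = (LBINT s. r\<^sup>2 * (pos_square (r - s) * u s))"
    unfolding set_lebesgue_integral_def
  proof (rule integral_cong_AE)
    show "AE s in lborel. indicator {0..r} s *\<^sub>R (collision_kernel s (r - s) * f s) = r\<^sup>2 * (pos_square (r - s) * u s)"
      using ae
    proof eventually_elim
      case (elim s)
      show ?case
      proof (cases "0 < s \<and> s < r")
        case True
        hence "r\<^sup>2 * (pos_square (r - s) * u s) = r\<^sup>2 * ((r - s)\<^sup>2 * (f s * s\<^sup>2))" using elim r by (simp add: pos_square_def)
        thus ?thesis using True by (simp add: k mult_ac)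
      next
        case False
        hence "pos_square (r - s) * u s = 0" using dens_zero[OF u, of s] by (cases "s \<le> 0") (auto simp: pos_square_def)
        moreover have "s = 0 \<or> s = r \<or> s \<notin> {0..r}" using False by auto
        ultimately show ?thesis by (auto simp: k)
      qed
    qed
  qed (unfold collision_kernel_def, measurable)
  have T5: "(LBINT s:{0..}. collision_kernel r s * f s) = (LBINT s. r\<^sup>2 * ((r + s)\<^sup>2 * u s))"
    unfolding set_lebesgue_integral_def
  proof (rule integral_cong_AE)
    show "AE s in lborel. indicator {0..} s *\<^sub>R (collision_kernel r s * f s) = r\<^sup>2 * ((r + s)\<^sup>2 * u s)"
      using ae
    proof eventually_elim
      case (elim s)
      show ?case
      proof (cases "0 < s")
        case True
        hence "r\<^sup>2 * ((r + s)\<^sup>2 * (f s * s\<^sup>2)) = r\<^sup>2 * ((r + s)\<^sup>2 * u s)" using elim by simp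
        thus ?thesis using True by (simp add: collision_kernel_def mult_ac)
      next
        case False
        moreover have "s = 0 \<or> s \<notin> {0..}" using False by auto
        ultimately show ?thesis using dens_zero[OF u, of s] by (auto simp: collision_kernel_def)
      qed
    qed
  qed (unfold collision_kernel_def, measurable)
  have T6: "(LBINT s:{0..r}. collision_kernel s (r - s)) = r\<^sup>2 * (r ^ 5 / 30)"
  proof -
    have "(LBINT s:{0..r}. collision_kernel s (r - s)) = (LBINT s. r\<^sup>2 * (pos_square (r - s) * pos_square s))"
      unfolding set_lebesgue_integral_def
      by (rule Bochner_Integration.integral_cong) (auto simp: k pos_square_def indicator_def)
    also have "\<dots> = r\<^sup>2 * (r ^ 5 / 30)"
      by (simp only: integral_mult_right_zero has_bochner_integral_integral_eq[OF pos_square_convolution(1)[OF r]])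
    finally show ?thesis .
  qed
  have i3: "integrable lborel (\<lambda>s. u s * pos_square (s - r))"
  proof -
    have "integrable lborel (\<lambda>s. u (r + s) * pos_square s)" by (rule dens_split_integrable[OF u r])
    from lborel_integrable_real_affine[OF this, of 1 "-r"] show ?thesis by simp
  qed
  have psq: "\<bar>pos_square (r - s)\<bar> \<le> (1 + r)\<^sup>2 * (1 + s) ^ 0" if "0 < s" for s
    using that r by (auto simp: pos_square_def intro!: power_mono)
  have i4: "integrable lborel (\<lambda>s. pos_square (r - s) * u s)"
    by (rule dens_integral_le(1)[OF u _ psq]) auto
  have sq: "\<bar>(r + s)\<^sup>2\<bar> \<le> (1 + r)\<^sup>2 * (1 + s)\<^sup>2" if "0 < s" for s
  proof -
    have "r + s \<le> (1 + r) * (1 + s)" using that r by (simp add: algebra_simps)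
    hence "(r + s)\<^sup>2 \<le> ((1 + r) * (1 + s))\<^sup>2" using that r by (intro power_mono) auto
    thus ?thesis by (simp add: power_mult_distrib)
  qed
  have i5: "integrable lborel (\<lambda>s. (r + s)\<^sup>2 * u s)"
    by (rule dens_integral_le(1)[OF u _ sq]) auto
  have loss: "loss u r = 2 * ((LBINT s. pos_square (r - s) * u s) + (LBINT s. (r + s)\<^sup>2 * u s) - corr u pos_square r)"
  proof -
    have "loss u r = (LBINT s. 2 * (pos_square (r - s) * u s + (r + s)\<^sup>2 * u s - u s * pos_square (s - r)))"
      unfolding loss_def
      by (rule Bochner_Integration.integral_cong) (auto simp: loss_kernel_def pos_square_def power2_eq_square algebra_simps)
    also have "\<dots> = 2 * ((LBINT s. pos_square (r - s) * u s) + (LBINT s. (r + s)\<^sup>2 * u s) - (LBINT s. u s * pos_square (s - r)))"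
      using i3 i4 i5 by simp
    finally show ?thesis by (simp add: corr_shift)
  qed
  have "quadratic_collision f r + linear_collision f r
    = r\<^sup>2 * conv u u r + 2 * (r\<^sup>2 * corr u u r)
      + 2 * (f r * r\<^sup>2) * (corr u pos_square r - (LBINT s. pos_square (r - s) * u s) - (LBINT s. (r + s)\<^sup>2 * u s))
      + 2 * (r\<^sup>2 * corr u pos_square r) - (f r * r\<^sup>2) * (r ^ 5 / 30)"
    unfolding quadratic_collision_def linear_collision_def T1 T2 T3 T4 T5 T6 integral_mult_right_zero by (simp add: algebra_simps)
  also have "\<dots> = coll u r"
    unfolding fr coll_def gain_def split_gain_def loss using r by (simp add: pos_square_def algebra_simps)
  finally show ?thesis by (simp add: collision_def)
qed

section \<open>Moment interpolation and invariant levels\<close>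

lemma mom6_le:
  assumes u: "dens u" and M: "\<And>r. u r \<le> M" and h8: "(LBINT r. r ^ 6 * u r) \<le> h8"
  shows "mom 6 u \<le> 64 * (M + h8)"
proof -
  note i6 = pow_integrable[OF u, of 6, simplified]
  have M0: "0 \<le> M" using M[of 0] dens_nonneg[OF u, of 0] by linarith
  have "mom 6 u \<le> (LBINT r. 64 * M * indicator {0..1} r + 64 * (r ^ 6 * u r))"
    unfolding mom_def
  proof (rule integral_mono)
    show "integrable lborel (\<lambda>r. 64 * M * indicator {0..1} r + 64 * (r ^ 6 * u r))" using i6 by simp
    fix r
    show "(1 + r) ^ 6 * u r \<le> 64 * M * indicator {0..1} r + 64 * (r ^ 6 * u r)"
    proof (cases "0 < r")
      case True
      show ?thesis
      proof (cases "r \<le> 1")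
        case le: True
        have "(1 + r) ^ 6 \<le> 2 ^ 6" using True le by (intro power_mono) auto
        hence "(1 + r) ^ 6 * u r \<le> 64 * M" using M[of r] M0 dens_nonneg[OF u, of r] by (intro mult_mono) auto
        moreover have "0 \<le> r ^ 6 * u r" using True dens_nonneg[OF u, of r] by simp
        ultimately show ?thesis using True le by simp
      next
        case False
        have "(1 + r) ^ 6 \<le> (2 * r) ^ 6" using False by (intro power_mono) auto
        also have "\<dots> = 64 * r ^ 6" by (simp add: power_mult_distrib)
        finally have "(1 + r) ^ 6 * u r \<le> 64 * r ^ 6 * u r" using dens_nonneg[OF u, of r] by (intro mult_right_mono)
        thus ?thesis using False M0 by simp
      qed
    qed (use M0 in \<open>simp add: dens_zero[OF u]\<close>)
  qed (use u in \<open>auto intro: mom_integrable\<close>)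
  also have "\<dots> = 64 * M + 64 * (LBINT r. r ^ 6 * u r)" using i6 by simp
  finally show ?thesis using h8 by simp
qed

text \<open>Below R one has r^2 <= R r, above it r^2 <= r^6 / R^4. The radius stays free because the
  level condition is used with an R depending on the point r.\<close>

lemma second_moment_interpolation:
  assumes u: "dens u" and R: "0 < R"
  shows "(LBINT r. r\<^sup>2 * u r) \<le> R * (LBINT r. r * u r) + (LBINT r. r ^ 6 * u r) / R ^ 4"
proof -
  have i: "integrable lborel (\<lambda>r. r * u r)" "integrable lborel (\<lambda>r. r\<^sup>2 * u r)" "integrable lborel (\<lambda>r. r ^ 6 * u r)"
    using pow_integrable[OF u, of 1] pow_integrable[OF u, of 2] pow_integrable[OF u, of 6] by auto
  have "(LBINT r. r\<^sup>2 * u r) \<le> (LBINT r. R * (r * u r) + (r ^ 6 * u r) / R ^ 4)"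
  proof (rule integral_mono)
    fix r
    show "r\<^sup>2 * u r \<le> R * (r * u r) + (r ^ 6 * u r) / R ^ 4"
    proof (cases "0 < r")
      case True
      have "r\<^sup>2 \<le> R * r + r ^ 6 / R ^ 4"
      proof (cases "r \<le> R")
        case le: True
        thus ?thesis using True R by (simp add: power2_eq_square mult_right_mono add_increasing2)
      next
        case False
        have "r\<^sup>2 * R ^ 4 \<le> r\<^sup>2 * r ^ 4" using False R by (intro mult_left_mono power_mono) auto
        hence "r\<^sup>2 \<le> r ^ 6 / R ^ 4" using R by (simp add: pos_le_divide_eq flip: power_add)
        thus ?thesis using True R by (simp add: add_increasing)
      qed
      from mult_right_mono[OF this dens_nonneg[OF u, of r]] show ?thesis by (simp add: algebra_simps)
    qed (simp add: dens_zero[OF u])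
  qed (use i in auto)
  thus ?thesis using i by simp
qed

text \<open>The condition under which the bound \<open>u \<le> M\<close> is propagated: it says that the linear gain at radius
  \<open>r\<close> is dominated by the losses of a profile touching the level \<open>M\<close>.\<close>

definition level_condition :: "real \<Rightarrow> (real \<Rightarrow> real) \<Rightarrow> bool" where
  "level_condition M u \<longleftrightarrow> (\<forall>r>0. 2 * r * (LBINT s. s\<^sup>2 * u s) \<le> M * (6 * (LBINT s. s * u s) + r ^ 4 / 30))"

lemma pow_moment_nonneg: "dens u \<Longrightarrow> 0 \<le> (LBINT r. r ^ k * u r)"
  by (rule Bochner_Integration.integral_nonneg, case_tac "x > 0") (auto simp: dens_nonneg dens_zero)

text \<open>Shows that a level determined by \<open>h3\<close> and \<open>h8\<close> alone is always
  admissible. For r >= 1 the quartic on the right beats the linear growth; for small r the energy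
  term has to do the work, with a second moment interpolated at a large radius.\<close>

lemma level_condition_large:
  assumes u: "dens u" and h3: "(LBINT r. r * u r) \<le> h3" and h8: "(LBINT r. r ^ 6 * u r) \<le> h8"
    and M: "60 * (h3 + h8) + 1 \<le> M"
  shows "level_condition M u"
  unfolding level_condition_def
proof (intro allI impI)
  fix r :: real assume r: "0 < r"
  let ?m1 = "LBINT s. s * u s" and ?m2 = "LBINT s. s\<^sup>2 * u s" and ?m6 = "LBINT s. s ^ 6 * u s"
  have m1: "0 \<le> ?m1" and m6: "0 \<le> ?m6" using pow_moment_nonneg[OF u, of 1] pow_moment_nonneg[OF u, of 6] by auto
  have h0: "0 \<le> h3" "0 \<le> h8" using order_trans[OF m1 h3] order_trans[OF m6 h8] by auto
  hence M1: "1 \<le> M" using M by (simp add: distrib_left)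
  show "2 * r * ?m2 \<le> M * (6 * ?m1 + r ^ 4 / 30)"
  proof (cases "1 \<le> r")
    case True
    have "2 * r * ?m2 \<le> 2 * r * (?m1 + ?m6)"
      using second_moment_interpolation[OF u, of 1] r by (intro mult_left_mono) auto
    also have "\<dots> \<le> 2 * r * (M / 60)" using r h3 h8 M by (intro mult_left_mono) auto
    also have "\<dots> = M * (r / 30)" by simp
    also have "\<dots> \<le> M * (6 * ?m1 + r ^ 4 / 30)"
      using True M1 m1 power_increasing[of 1 4 r] by (intro mult_left_mono) auto
    finally show ?thesis .
  next
    case False
    \<comment> \<open>The radius \<open>3 * M / r\<close> makes the first part of the interpolation
      equal to the energy term \<open>M * (6 * ?m1)\<close>; the rest is of order r^5 and fits below
      \<open>M * r ^ 4 / 30\<close>.\<close>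
    have "2 * r * ?m2 \<le> 2 * r * ((3 * M / r) * ?m1 + ?m6 / (3 * M / r) ^ 4)"
      using second_moment_interpolation[OF u, of "3 * M / r"] r M1 by (intro mult_left_mono) auto
    also have "\<dots> = M * (6 * ?m1) + 2 * r ^ 5 * ?m6 / (81 * M ^ 4)"
      using r M1 by (simp add: field_simps power_mult_distrib eval_nat_numeral)
    also have "2 * r ^ 5 * ?m6 / (81 * M ^ 4) \<le> M * (r ^ 4 / 30)"
    proof -
      have "60 * ?m6 \<le> 60 * h8" using h8 by simp
      also have "\<dots> \<le> M" using h0 M by (simp add: distrib_left)
      also have "M * 1 \<le> M * M ^ 4" using M1 by (intro mult_left_mono one_le_power) auto
      finally have "60 * ?m6 \<le> M ^ 5" by (simp add: eval_nat_numeral)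
      moreover have "r * (60 * ?m6) \<le> 1 * (60 * ?m6)" using False r m6 by (intro mult_right_mono) auto
      moreover have "0 \<le> M ^ 5" using M1 by simp
      ultimately have "60 * r * ?m6 \<le> 81 * M ^ 5" by linarith
      hence "r ^ 4 * (60 * r * ?m6) \<le> r ^ 4 * (81 * M ^ 5)" using r by (intro mult_left_mono) auto
      thus ?thesis using M1 by (simp add: divide_le_eq eval_nat_numeral mult_ac) 
    qed
    finally show ?thesis by (simp add: distrib_left)
  qed
qed

text \<open>With u <= M each gain integral is linearized by bounding one factor by M. The loss
  kernel exceeds the linearized gain by at least 6 r s, and this surplus is what later compensates
  the linear gain.\<close>

lemma quadratic_dissipation:
  assumes u: "dens u" and M: "\<And>r. u r \<le> M" and r: "0 < r"
  shows "gain u u r + 6 * r * M * (LBINT s. s * u s) \<le> M * loss u r"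
proof -
  note [measurable] = dens_meas[OF u]
  note iu = dens_integrable_self[OF u]
  have M0: "0 \<le> M" using M[of 0] dens_nonneg[OF u, of 0] by linarith
  have i1: "integrable lborel (\<lambda>s. indicator {..r} s * u s)" "integrable lborel (\<lambda>s. indicator {r<..} s * u s)"
    using integrable_mult_indicator[OF _ iu, of "{..r}"] integrable_mult_indicator[OF _ iu, of "{r<..}"] by auto
  have "conv u u r \<le> (LBINT s. M * (indicator {..r} s * u s))"
    unfolding conv_def
  proof (rule integral_mono[OF dens_conv_integrable[OF u u]])
    fix s show "u s * u (r - s) \<le> M * (indicator {..r} s * u s)"
      using mult_left_mono[OF M[of "r - s"] dens_nonneg[OF u, of s]] dens_zero[OF u, of "r - s"]
      by (cases "s \<le> r") (auto simp: mult.commute)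
  qed (use i1 in simp)
  hence c: "conv u u r \<le> M * (LBINT s. indicator {..r} s * u s)" by simp
  have "corr u u r \<le> (LBINT s. M * (indicator {r<..} s * u s))"
    unfolding corr_shift
  proof (rule integral_mono)
    show "integrable lborel (\<lambda>s. u s * u (s - r))"
      using lborel_integrable_real_affine[OF dens_corr_integrable[OF u u, of r], of 1 "-r"] by simp
    fix s show "u s * u (s - r) \<le> M * (indicator {r<..} s * u s)"
      using mult_left_mono[OF M[of "s - r"] dens_nonneg[OF u, of s]] dens_zero[OF u, of "s - r"]
      by (cases "r < s") (auto simp: mult.commute)
  qed (use i1 in simp)
  hence d: "corr u u r \<le> M * (LBINT s. indicator {r<..} s * u s)" by simp
  have "gain u u r \<le> r\<^sup>2 * (M * (LBINT s. indicator {..r} s * u s) + 2 * (M * (LBINT s. indicator {r<..} s * u s)))"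
    using c d r by (simp add: gain_def pos_square_def)
  hence "gain u u r + 6 * r * M * (LBINT s. s * u s)
    \<le> M * (r\<^sup>2 * (LBINT s. indicator {..r} s * u s) + 2 * r\<^sup>2 * (LBINT s. indicator {r<..} s * u s) + 6 * r * (LBINT s. s * u s))"
    (is "?A \<le> M * (_ * ?X + _ * ?Y + _ * ?Z)")
  proof -
    assume *: "gain u u r \<le> r\<^sup>2 * (M * ?X + 2 * (M * ?Y))"
    have "g + 6 * r * M * Z \<le> M * (r\<^sup>2 * X + 2 * r\<^sup>2 * Y + 6 * r * Z)" if "g \<le> r\<^sup>2 * (M * X + 2 * (M * Y))" for g X Y Z
      using that by (simp add: algebra_simps)
    from this[OF *] show ?thesis .
  qed
  also have "\<dots> = M * ((LBINT s. r\<^sup>2 * (indicator {..r} s * u s)) + (LBINT s. 2 * r\<^sup>2 * (indicator {r<..} s * u s)) + (LBINT s. 6 * r * (s * u s)))"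
    by simp
  also have "\<dots> = M * (LBINT s. r\<^sup>2 * (indicator {..r} s * u s) + 2 * r\<^sup>2 * (indicator {r<..} s * u s) + 6 * r * (s * u s))"
    using i1 pow_integrable[OF u, of 1] by simp
  also have "\<dots> \<le> M * (LBINT s. loss_kernel r s * u s)"
  proof (intro mult_left_mono[OF _ M0] integral_mono dens_loss_integrable[OF u r])
    show "integrable lborel (\<lambda>s. r\<^sup>2 * (indicator {..r} s * u s) + 2 * r\<^sup>2 * (indicator {r<..} s * u s) + 6 * r * (s * u s))"
      using i1 pow_integrable[OF u, of 1] by simp
    fix s
    show "r\<^sup>2 * (indicator {..r} s * u s) + 2 * r\<^sup>2 * (indicator {r<..} s * u s) + 6 * r * (s * u s) \<le> loss_kernel r s * u s"
    proof (cases "s \<le> r")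
      case True
      \<comment> \<open>This is 4 (r^2 + s^2) - r^2 - 6 r s with the square completed; it fixes the
        constant 6.\<close>
      have "0 \<le> 3 * (r - s)\<^sup>2 + s\<^sup>2" by simp
      hence "r\<^sup>2 + 6 * r * s \<le> 4 * (r\<^sup>2 + s\<^sup>2)" by (simp add: power2_eq_square algebra_simps)
      from mult_right_mono[OF this dens_nonneg[OF u, of s]] show ?thesis
        using True by (simp add: loss_kernel_def algebra_simps)
    next
      case False
      have "r * r \<le> r * s" using False r by (intro mult_left_mono) auto
      hence "2 * r\<^sup>2 + 6 * r * s \<le> 8 * r * s" by (simp add: power2_eq_square)
      from mult_right_mono[OF this dens_nonneg[OF u, of s]] show ?thesis
        using False by (simp add: loss_kernel_def algebra_simps)
    qed
  qed
  finally show ?thesis by (simp add: loss_def)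
qed

lemma split_gain_le:
  assumes u: "dens u" and r: "0 < r"
  shows "split_gain u r \<le> 2 * r\<^sup>2 * (LBINT s. s\<^sup>2 * u s)"
proof -
  have i: "integrable lborel (\<lambda>s. s\<^sup>2 * u s)" using pow_integrable[OF u, of 2] by simp
  have "corr u pos_square r \<le> (LBINT s. s\<^sup>2 * u s)"
    unfolding corr_shift
  proof (rule integral_mono[OF _ i])
    show "integrable lborel (\<lambda>s. u s * pos_square (s - r))"
      using lborel_integrable_real_affine[OF dens_split_integrable[OF u r], of 1 "-r"] by simp
    fix s show "u s * pos_square (s - r) \<le> s\<^sup>2 * u s"
      using r dens_nonneg[OF u, of s] power_mono[of "s - r" s 2] by (auto simp: pos_square_def mult.commute intro!: mult_left_mono)
  qed
  thus ?thesis using r by (simp add: split_gain_def pos_square_def mult_left_mono)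
qed

text \<open>With l the total loss rate, positivity only needs h l <= 1. The level condition gives
  \<open>coll u r \<le> (M - u r) * l\<close>, so the step covers at most the remaining gap to
  M.\<close>

lemma euler_step_bounds:
  assumes u: "dens u" and M: "\<And>r. u r \<le> M" and r: "0 < r" and L: "level_condition M u"
    and h: "0 \<le> h" "h * (loss u r + r ^ 5 / 30) \<le> 1"
  shows "0 \<le> u r + h * coll u r" "u r + h * coll u r \<le> M"
proof -
  let ?l = "loss u r + r ^ 5 / 30"
  have "0 \<le> (1 - h * ?l) * u r" using h(2) dens_nonneg[OF u, of r] by (intro mult_nonneg_nonneg) auto
  moreover have "0 \<le> h * (gain u u r + split_gain u r)"
    using h gain_nonneg[OF u u, of r] split_gain_nonneg[OF u, of r] by simp
  ultimately show "0 \<le> u r + h * coll u r" by (simp add: coll_def algebra_simps)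
  have "2 * r * (LBINT s. s\<^sup>2 * u s) \<le> M * (6 * (LBINT s. s * u s) + r ^ 4 / 30)"
    using L r by (simp add: level_condition_def)
  from mult_left_mono[OF this, of r] r
  have "2 * r\<^sup>2 * (LBINT s. s\<^sup>2 * u s) \<le> 6 * r * M * (LBINT s. s * u s) + M * (r ^ 5 / 30)"
    by (simp add: power2_eq_square algebra_simps eval_nat_numeral)
  hence "coll u r \<le> M * ?l - u r * ?l"
    unfolding coll_def using quadratic_dissipation[OF u M r] split_gain_le[OF u r] by (simp add: distrib_left)
  hence "h * coll u r \<le> h * ((M - u r) * ?l)" using h by (intro mult_left_mono) (auto simp: left_diff_distrib)
  also have "\<dots> = (h * ?l) * (M - u r)" by simp
  also have "\<dots> \<le> 1 * (M - u r)" using h M[of r] by (intro mult_right_mono) auto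
  finally show "u r + h * coll u r \<le> M" by simp
qed

section \<open>The truncated Euler scheme\<close>

definition trunc_coll :: "real \<Rightarrow> (real \<Rightarrow> real) \<Rightarrow> real \<Rightarrow> real" where
  "trunc_coll n u r = (if 1 / n \<le> r \<and> r \<le> n then coll u r else 0)"

text \<open>The support in a compact interval away from 0 gives u / r^2 all line-moments. Energy is
  bounded, not prescribed, since truncation dissipates it.\<close>

definition euler_set :: "real \<Rightarrow> real \<Rightarrow> real \<Rightarrow> real \<Rightarrow> (real \<Rightarrow> real) set" where
  "euler_set n M h3 h8 = {u. u \<in> borel_measurable borel \<and> (\<forall>r. 0 \<le> u r \<and> u r \<le> M) \<and> (\<forall>r. r \<notin> {1 / n..n} \<longrightarrow> u r = 0)
     \<and> (LBINT r. r * u r) \<le> h3 \<and> (LBINT r. r ^ 6 * u r) \<le> h8}"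

lemma trunc_coll_meas [measurable]:
  assumes [measurable]: "u \<in> borel_measurable borel" shows "trunc_coll n u \<in> borel_measurable borel"
  unfolding trunc_coll_def[abs_def] by measurable

lemma recip_le_imp_pos: "1 \<le> n \<Longrightarrow> 1 / n \<le> r \<Longrightarrow> 0 < r" for n r :: real
  by (rule less_le_trans[of 0 "1 / n"]) auto

lemma integrable_indicator_Icc: "integrable lborel (indicator {a..c} :: real \<Rightarrow> real)"
  by (rule integrable_real_indicator) (auto simp: emeasure_lborel_Icc_eq)

lemma integral_zero_fun:
  fixes f :: "'a \<Rightarrow> real"
  shows "(\<And>x. f x = 0) \<Longrightarrow> integral\<^sup>L M f = 0"
  by (simp add: fun_eq_iff[symmetric] cong: Bochner_Integration.integral_cong)

lemma bounded_support_integrable: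
  fixes f :: "real \<Rightarrow> real"
  assumes [measurable]: "f \<in> borel_measurable borel" and b: "\<And>r. r \<in> {a..c} \<Longrightarrow> \<bar>f r\<bar> \<le> K" and z: "\<And>r. r \<notin> {a..c} \<Longrightarrow> f r = 0"
  shows "integrable lborel f"
proof (rule Bochner_Integration.integrable_bound)
  show "integrable lborel (\<lambda>r. K * indicator {a..c} r)" by (intro integrable_mult_right integrable_indicator_Icc)
  show "AE r in lborel. norm (f r) \<le> norm (K * indicator {a..c} r)"
  proof (intro AE_I2)
    fix r show "norm (f r) \<le> norm (K * indicator {a..c} r)"
      using b[of r] z[of r] by (cases "r \<in> {a..c}") (auto simp: indicator_def)
  qed
qed simp

lemma euler_set_dens:
  assumes u: "u \<in> euler_set n M h3 h8" and n: "1 \<le> n"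
  shows "dens u"
proof -
  have 1: "u \<in> borel_measurable borel" "\<And>r. 0 \<le> u r" "\<And>r. u r \<le> M" "\<And>r. r \<notin> {1 / n..n} \<Longrightarrow> u r = 0"
    using u by (auto simp: euler_set_def)
  have M0: "0 \<le> M" using 1(2,3)[of 0] by linarith
  note [measurable] = 1(1)
  have "integrable lborel (\<lambda>r. (1 + r) ^ 6 * u r)"
  proof (rule bounded_support_integrable[where a = "1 / n" and c = n and K = "(1 + n) ^ 6 * M"])
    fix r assume r: "r \<in> {1 / n..n}"
    hence "0 \<le> r" using recip_le_imp_pos[OF n, of r] by auto
    thus "\<bar>(1 + r) ^ 6 * u r\<bar> \<le> (1 + n) ^ 6 * M"
      using 1(2,3)[of r] r M0 by (auto simp: abs_mult intro!: mult_mono power_mono)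
  qed (use 1(4) in auto)
  moreover have "\<forall>r\<le>0. u r = 0" using 1(4) recip_le_imp_pos[OF n] by (metis atLeastAtMost_iff not_le)
  ultimately show ?thesis using 1(1-3) unfolding dens_def by blast
qed

lemma euler_setD:
  assumes "u \<in> euler_set n M h3 h8"
  shows "0 \<le> u r" "u r \<le> M" "r \<notin> {1 / n..n} \<Longrightarrow> u r = 0" "(LBINT r. r * u r) \<le> h3" "(LBINT r. r ^ 6 * u r) \<le> h8"
  using assms by (auto simp: euler_set_def)

lemma euler_set_mom6: "u \<in> euler_set n M h3 h8 \<Longrightarrow> 1 \<le> n \<Longrightarrow> mom 6 u \<le> 64 * (M + h8)"
  by (rule mom6_le) (auto dest: euler_set_dens euler_setD)

lemma trunc_coll_integrable:
  assumes u: "dens u" and n: "1 \<le> n"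
  shows "integrable lborel (\<lambda>r. r ^ k * trunc_coll n u r)"
    and "integrable lborel (\<lambda>r. (1 + r) ^ k * \<bar>trunc_coll n u r\<bar>)"
    and "(LBINT r. (1 + r) ^ k * \<bar>trunc_coll n u r\<bar>) \<le> (1 + n) ^ k * (LBINT r. \<bar>coll u r\<bar>)"
proof -
  note [measurable] = dens_meas[OF u]
  have n0: "0 < 1 / n" using n by simp
  have c: "integrable lborel (\<lambda>r. (1 + n) ^ k * \<bar>coll u r\<bar>)" using coll_integrable[OF u] by simp
  have 1: "(1 + r) ^ k * \<bar>trunc_coll n u r\<bar> \<le> (1 + n) ^ k * \<bar>coll u r\<bar>" for r
  proof (cases "1 / n \<le> r \<and> r \<le> n")
    case True
    hence "0 \<le> r" using n0 by linarith
    thus ?thesis using True by (auto simp: trunc_coll_def intro!: mult_right_mono power_mono)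
  qed (use n in \<open>auto simp: trunc_coll_def\<close>)
  have 3: "0 \<le> (1 + r) ^ k * \<bar>trunc_coll n u r\<bar>" for r
  proof (cases "1 / n \<le> r \<and> r \<le> n")
    case True
    hence "0 \<le> r" using n0 by linarith
    thus ?thesis by simp
  qed (auto simp: trunc_coll_def)
  have 2: "\<bar>r ^ k * trunc_coll n u r\<bar> \<le> (1 + n) ^ k * \<bar>coll u r\<bar>" for r
  proof (cases "1 / n \<le> r \<and> r \<le> n")
    case True
    hence "0 \<le> r" using n0 by linarith
    thus ?thesis using True by (auto simp: trunc_coll_def abs_mult intro!: mult_right_mono power_mono)
  qed (use n in \<open>auto simp: trunc_coll_def\<close>)
  show "integrable lborel (\<lambda>r. r ^ k * trunc_coll n u r)"
    by (rule Bochner_Integration.integrable_bound[OF c]) (use 2 in \<open>auto intro!: AE_I2 intro: order_trans[OF _ abs_ge_self]\<close>)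
  show i: "integrable lborel (\<lambda>r. (1 + r) ^ k * \<bar>trunc_coll n u r\<bar>)"
  proof (rule Bochner_Integration.integrable_bound[OF c])
    show "AE r in lborel. norm ((1 + r) ^ k * \<bar>trunc_coll n u r\<bar>) \<le> norm ((1 + n) ^ k * \<bar>coll u r\<bar>)"
      by (intro AE_I2) (metis 1 3 abs_of_nonneg order_trans real_norm_def)
  qed measurable
  have "(LBINT r. (1 + r) ^ k * \<bar>trunc_coll n u r\<bar>) \<le> (LBINT r. (1 + n) ^ k * \<bar>coll u r\<bar>)"
    by (rule integral_mono[OF i c 1])
  thus "(LBINT r. (1 + r) ^ k * \<bar>trunc_coll n u r\<bar>) \<le> (1 + n) ^ k * (LBINT r. \<bar>coll u r\<bar>)" by simp
qed

lemma coll_L1_bound: "dens u \<Longrightarrow> mom 6 u \<le> B \<Longrightarrow> (LBINT r. \<bar>coll u r\<bar>) \<le> (22 * B + 3) * B"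
proof -
  assume u: "dens u" and B: "mom 6 u \<le> B"
  have "(LBINT r. \<bar>coll u r\<bar>) \<le> (22 * mom 3 u + 3) * mom 5 u"
    using coll_bound(3)[OF u, of "\<lambda>_. 1" 1 0] by simp
  also have "\<dots> \<le> (22 * B + 3) * B"
    using B mom_mono[OF u, of 3 6] mom_mono[OF u, of 5 6] mom_nonneg[OF u, of 3] mom_nonneg[OF u, of 5]
    by (intro mult_mono) auto
  finally show ?thesis .
qed

text \<open>Where no particles are present there is no loss. Truncation outside the support
  therefore discards gain only and can but lower the energy and the sixth moment.\<close>

lemma coll_outside_nonneg: "dens u \<Longrightarrow> u r = 0 \<Longrightarrow> 0 \<le> coll u r"
  by (simp add: coll_def gain_nonneg split_gain_nonneg)

text \<open>The hypothesis is applied to u / r^2, whose eighth line-moments are sixth moments of u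
  and \<open>coll u\<close>. It speaks of the full operator; the truncated one has a smaller sixth
  moment.\<close>

lemma sixth_moment_dissipation:
  assumes C: "eighth_moment_constants C8 c8" and u: "u \<in> euler_set n M h3 h8" and n: "1 \<le> n"
  shows "(LBINT r. r ^ 6 * trunc_coll n u r)
    \<le> (C8 * (LBINT r. r * u r) powr (9 / 2) - c8 * (LBINT r. r ^ 6 * u r)\<^sup>2) / (LBINT r. r * u r)"
proof -
  note d = euler_set_dens[OF u n] and D = euler_setD[OF u]
  note [measurable] = dens_meas[OF d]
  have M0: "0 \<le> M" using D(1,2)[of 0] by linarith
  define g where "g r = u r / r\<^sup>2" for r
  have [measurable]: "g \<in> borel_measurable borel" unfolding g_def[abs_def] by measurable
  have gg: "g r * r\<^sup>2 = u r" if "0 < r" for r using that by (simp add: g_def)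
  have gz: "g r = 0" if "r \<notin> {1 / n..n}" for r using D(3)[OF that] by (simp add: g_def)
  have lm: "line_moment k g = (LBINT r. r ^ j * u r)" if "k = j + 2" for k j
    unfolding line_moment_def set_lebesgue_integral_def
  proof (rule Bochner_Integration.integral_cong)
    fix r show "indicator {0..} r *\<^sub>R (g r * r ^ k) = r ^ j * u r"
    proof (cases "0 < r")
      case True
      have "r ^ j * u r = g r * (r ^ j * r\<^sup>2)" by (simp add: gg[OF True, symmetric])
      also have "r ^ j * r\<^sup>2 = r ^ k" unfolding that by (simp only: power_add)
      finally show ?thesis using True by simp
    next
      case False
      hence "u r = 0" using dens_zero[OF d, of r] by simp
      thus ?thesis by (simp add: g_def)
    qed
  qed simp
  have fin: "finite_line_moment k g" for k
    unfolding finite_line_moment_def set_integrable_def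
  proof (rule bounded_support_integrable[where a = "1 / n" and c = n and K = "(M * n\<^sup>2) * n ^ k"])
    fix r assume r: "r \<in> {1 / n..n}"
    hence r0: "0 < r" using recip_le_imp_pos[OF n, of r] by auto
    have "1 / r \<le> n" using r r0 n by (simp add: field_simps)
    hence "(1 / r)\<^sup>2 \<le> n\<^sup>2" using r0 by (intro power_mono) auto
    hence "u r * (1 / r)\<^sup>2 \<le> M * n\<^sup>2" using D(1,2)[of r] M0 by (intro mult_mono) auto
    hence "g r \<le> M * n\<^sup>2" "0 \<le> g r" using D(1)[of r] by (auto simp: g_def power_divide)
    moreover have "r ^ k \<le> n ^ k" using r r0 by (intro power_mono) auto
    ultimately have "g r * r ^ k \<le> (M * n\<^sup>2) * n ^ k" "0 \<le> g r * r ^ k" using r0 M0 n by (auto intro!: mult_mono)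
    thus "\<bar>indicator {0..} r *\<^sub>R (g r * r ^ k)\<bar> \<le> (M * n\<^sup>2) * n ^ k" using r0 by simp
  qed (auto simp: gz)
  have "line_moment 8 (collision g) \<le> (C8 * line_moment 3 g powr (9/2) - c8 * (line_moment 8 g)\<^sup>2) / line_moment 3 g"
    using C[unfolded eighth_moment_constants_def, rule_format, of g] fin D(1) by (simp add: radial_def g_def)
  moreover have "line_moment 8 (collision g) = (LBINT r. r ^ 6 * coll u r)"
    unfolding line_moment_def set_lebesgue_integral_def
  proof (rule Bochner_Integration.integral_cong)
    fix r show "indicator {0..} r *\<^sub>R (collision g r * r ^ 8) = r ^ 6 * coll u r"
    proof (cases "0 < r")
      case True
      have "collision g r = coll u r / r\<^sup>2" by (rule collision_eq_coll[OF d _ _ True]) (use gg True in auto)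
      thus ?thesis using True by (simp add: eval_nat_numeral)
    next
      case False
      hence "coll u r = 0" using coll_nonpos[OF d] by simp
      moreover have "r = 0 \<or> r \<notin> {0..}" using False by auto
      ultimately show ?thesis by auto
    qed
  qed simp
  moreover have "(LBINT r. r ^ 6 * trunc_coll n u r) \<le> (LBINT r. r ^ 6 * coll u r)"
  proof (rule integral_mono[OF trunc_coll_integrable(1)[OF d n]])
    fix r show "r ^ 6 * trunc_coll n u r \<le> r ^ 6 * coll u r"
      using coll_outside_nonneg[OF d D(3)[of r]] by (auto simp: trunc_coll_def)
  next
    \<comment> \<open>Mergers of particles of energy at most n stay below 2 n, so
      \<open>coll u\<close> vanishes beyond and r^6 may be replaced by a bounded weight
      there.\<close>
    define \<omega> where "\<omega> r = (if r \<le> 2 * n then r ^ 6 else 0)" for r :: real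
    have [measurable]: "\<omega> \<in> borel_measurable borel" unfolding \<omega>_def[abs_def] by measurable
    have "integrable lborel (\<lambda>r. \<omega> r * coll u r)"
    proof (rule coll_bound(2)[OF d, where c = "(2 * n) ^ 6" and j = 0])
      fix r :: real assume "0 < r"
      thus "0 \<le> \<omega> r" by (simp add: \<omega>_def)
      have "r ^ 6 \<le> (2 * n) ^ 6" if "r \<le> 2 * n" using that \<open>0 < r\<close> by (intro power_mono) auto
      thus "\<omega> r \<le> (2 * n) ^ 6 * (1 + r) ^ 0" using n by (auto simp: \<omega>_def)
    qed (use n in auto)
    moreover have "\<omega> r * coll u r = r ^ 6 * coll u r" for r
    proof (cases "r \<le> 2 * n")
      case False
      have 0: "u (r + s) = 0" if "s > 0" for s using D(3)[of "r + s"] False that n by auto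
      have "u s * u (r - s) = 0" for s
        using D(3)[of s] D(3)[of "r - s"] False by (cases "s \<le> n") auto
      hence "conv u u r = 0" unfolding conv_def by (rule integral_zero_fun)
      moreover have "u (r + s) * u s = 0" "u (r + s) * pos_square s = 0" for s
        using 0[of s] dens_zero[OF d, of s] by (cases "s > 0"; simp add: pos_square_def)+
      hence "corr u u r = 0" "corr u pos_square r = 0"
        unfolding corr_def by (simp_all only: integral_zero_fun)
      moreover have "u r = 0" using D(3)[of r] False n by auto
      ultimately show ?thesis by (simp add: coll_def gain_def split_gain_def)
    qed (simp add: \<omega>_def)
    ultimately show "integrable lborel (\<lambda>r. r ^ 6 * coll u r)" by simp
  qed
  ultimately show ?thesis using lm[of 3 1] lm[of 8 6] by simp
qed

definition trunc_const :: "real \<Rightarrow> real \<Rightarrow> real" where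
  "trunc_const M B = 12 * B\<^sup>2 + 8 * (3 * M + 2) * B"

text \<open>Two discarded regions. Below 1 / n the gain is bounded by (3 M + 2) B on an interval of
  length 1 / n. Above n only mergers contribute, as splitting cannot raise the energy, and the sixth
  moment makes them small.\<close>

lemma trunc_error:
  assumes u: "u \<in> euler_set n M h3 h8" and n: "1 \<le> n" and B: "mom 6 u \<le> B"
  shows "integrable lborel (\<lambda>r. (1 + r) * \<bar>trunc_coll n u r - coll u r\<bar>)"
    and "(LBINT r. 4 * (1 + r) * \<bar>trunc_coll n u r - coll u r\<bar>) \<le> trunc_const M B / n"
proof -
  note d = euler_set_dens[OF u n] and D = euler_setD[OF u]
  note [measurable] = dens_meas[OF d]
  have n0: "0 < 1 / n" using n by simp
  have B0: "0 \<le> B" using mom_nonneg[OF d, of 6] B by linarith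
  have M0: "0 \<le> M" using D(1,2)[of 0] by linarith
  \<comment> \<open>On r > n three spare powers of 1 + r are traded for the factor 1 / n^3. Order
    four is the largest for which \<open>gain_bound_pow\<close> stays within six moments.\<close>
  define \<omega> where "\<omega> r = (if n < r then 4 * (1 + r) else 0)" for r :: real
  have [measurable]: "\<omega> \<in> borel_measurable borel" unfolding \<omega>_def[abs_def] by measurable
  have w1: "0 \<le> \<omega> r" "\<omega> r \<le> (4 / n ^ 3) * (1 + r) ^ 4" if "0 < r" for r
  proof -
    show "0 \<le> \<omega> r" using that by (simp add: \<omega>_def)
    have "1 \<le> (1 + r) ^ 3 / n ^ 3" if "n < r"
      using that n power_mono[of n "1 + r" 3] by (simp add: pos_le_divide_eq)
    hence "4 * (1 + r) * 1 \<le> 4 * (1 + r) * ((1 + r) ^ 3 / n ^ 3)" if "n < r"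
      using that \<open>0 < r\<close> by (intro mult_left_mono) auto
    thus "\<omega> r \<le> (4 / n ^ 3) * (1 + r) ^ 4" using that n by (auto simp: \<omega>_def eval_nat_numeral mult_ac)
  qed
  have g: "integrable lborel (\<lambda>r. \<omega> r * gain u u r)" "(LBINT r. \<omega> r * gain u u r) \<le> 3 * (4 / n ^ 3) * mom 6 u * mom 6 u"
    using gain_bound_pow[OF d d _ w1, of 6] n by auto
  let ?c = "8 * (3 * M + 2) * B"
  have pt: "4 * (1 + r) * \<bar>trunc_coll n u r - coll u r\<bar> \<le> \<omega> r * gain u u r + ?c * indicator {0..1 / n} r"
    and pt0: "0 \<le> 4 * (1 + r) * \<bar>trunc_coll n u r - coll u r\<bar>" for r
  proof -
    consider "r \<le> 0" | "0 < r" "r < 1 / n" | "1 / n \<le> r" "r \<le> n" | "n < r" by linarith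
    hence "4 * (1 + r) * \<bar>trunc_coll n u r - coll u r\<bar> \<le> \<omega> r * gain u u r + ?c * indicator {0..1 / n} r
      \<and> 0 \<le> 4 * (1 + r) * \<bar>trunc_coll n u r - coll u r\<bar>"
    proof cases
      case 1
      thus ?thesis using n n0 B0 M0 coll_nonpos[OF d 1] gain_nonneg[OF d d, of r] by (auto simp: trunc_coll_def \<omega>_def indicator_def)
    next
      case 2
      have ur: "u r = 0" using D(3)[of r] 2 by auto
      have r1: "r \<le> 1" using 2 n by (auto intro: order_trans[OF less_imp_le])
      have m0: "(LBINT s. u s) \<le> B" using mom_mono[OF d, of 0 6] B by (simp add: mom_def)
      have "conv u u r \<le> (LBINT s. u s * M)" unfolding conv_def
        by (rule integral_mono[OF dens_conv_integrable[OF d d]]) (use D(1,2) dens_integrable_self[OF d] in \<open>auto intro: mult_left_mono\<close>)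
      hence c1: "conv u u r \<le> M * B" using mult_left_mono[OF m0 M0] by (simp add: mult.commute)
      have "corr u u r \<le> (LBINT s. M * u s)" unfolding corr_def
        by (rule integral_mono[OF dens_corr_integrable[OF d d]]) (use D(1,2) dens_integrable_self[OF d] in \<open>auto intro: mult_right_mono\<close>)
      hence c2: "corr u u r \<le> M * B" using mult_left_mono[OF m0 M0] by simp
      have p: "pos_square r \<le> 1" using 2 r1 by (simp add: pos_square_def power_le_one)
      have "gain u u r \<le> 1 * (M * B + M * B + M * B)"
        unfolding gain_def using c1 c2 p conv_nonneg[OF d d, of r] corr_nonneg[OF d d, of r] by (intro mult_mono add_mono) auto
      moreover have "split_gain u r \<le> 2 * B"
      proof -
        have "(LBINT s. s\<^sup>2 * u s) \<le> 1 * mom 2 u" by (rule dens_integral_le(2)[OF d]) (auto intro!: power_mono)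
        also have "\<dots> \<le> B" using mom_mono[OF d, of 2 6] B by simp
        finally have "2 * r\<^sup>2 * (LBINT s. s\<^sup>2 * u s) \<le> 2 * 1 * B"
          using r1 2 pow_moment_nonneg[OF d, of 2] by (intro mult_mono) (auto intro: power_le_one)
        thus ?thesis using split_gain_le[OF d, of r] 2 by simp
      qed
      ultimately have "coll u r \<le> (3 * M + 2) * B" using ur by (simp add: coll_def algebra_simps)
      moreover have "0 \<le> coll u r" by (rule coll_outside_nonneg[OF d ur])
      ultimately have "4 * (1 + r) * \<bar>coll u r\<bar> \<le> 8 * ((3 * M + 2) * B)" using r1 2 by (intro mult_mono) auto
      moreover have "\<omega> r = 0" "trunc_coll n u r = 0" using r1 n 2 by (auto simp: \<omega>_def trunc_coll_def)
      moreover have "0 \<le> 4 * (1 + r) * \<bar>coll u r\<bar>" using 2 by simp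
      moreover have "r \<in> {0..1 / n}" using 2 by simp
      ultimately show ?thesis by (simp only: diff_0 abs_minus_cancel indicator_simps mult_zero_left mult_1_right add_0 mult.assoc)
    next
      case 3
      have "0 \<le> r" using 3 n0 by linarith
      hence "0 \<le> \<omega> r * gain u u r" using gain_nonneg[OF d d, of r] by (auto simp: \<omega>_def)
      thus ?thesis using 3 B0 M0 by (simp add: trunc_coll_def indicator_def)
    next
      case 4
      have "u r = 0" using D(3)[of r] 4 by auto
      moreover have "u (r + s) * pos_square s = 0" for s using D(3)[of "r + s"] 4 by (cases "s > 0") (auto simp: pos_square_def)
      hence "corr u pos_square r = 0" unfolding corr_def by (rule integral_zero_fun)
      ultimately have "coll u r = gain u u r" by (simp add: coll_def split_gain_def)
      thus ?thesis using 4 gain_nonneg[OF d d, of r] n B0 M0 by (auto simp: trunc_coll_def \<omega>_def indicator_def)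
    qed
    thus "4 * (1 + r) * \<bar>trunc_coll n u r - coll u r\<bar> \<le> \<omega> r * gain u u r + ?c * indicator {0..1 / n} r"
      "0 \<le> 4 * (1 + r) * \<bar>trunc_coll n u r - coll u r\<bar>" by auto
  qed
  have iR: "integrable lborel (\<lambda>r. \<omega> r * gain u u r + ?c * indicator {0..1 / n} r)"
    by (intro Bochner_Integration.integrable_add g(1) integrable_mult_right integrable_indicator_Icc)
  have i: "integrable lborel (\<lambda>r. 4 * (1 + r) * \<bar>trunc_coll n u r - coll u r\<bar>)"
  proof (rule Bochner_Integration.integrable_bound[OF iR])
    show "AE r in lborel. norm (4 * (1 + r) * \<bar>trunc_coll n u r - coll u r\<bar>) \<le> norm (\<omega> r * gain u u r + ?c * indicator {0..1 / n} r)"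
      by (intro AE_I2) (metis pt pt0 abs_of_nonneg order_trans real_norm_def)
  qed measurable
  have "integrable lborel (\<lambda>r. (1 / 4) * (4 * (1 + r) * \<bar>trunc_coll n u r - coll u r\<bar>))" using i by (rule integrable_mult_right)
  also have "(\<lambda>r. (1 / 4) * (4 * (1 + r) * \<bar>trunc_coll n u r - coll u r\<bar>)) = (\<lambda>r. (1 + r) * \<bar>trunc_coll n u r - coll u r\<bar>)"
    by (simp add: fun_eq_iff field_simps)
  finally show "integrable lborel (\<lambda>r. (1 + r) * \<bar>trunc_coll n u r - coll u r\<bar>)" .
  have "(LBINT r. 4 * (1 + r) * \<bar>trunc_coll n u r - coll u r\<bar>) \<le> (LBINT r. \<omega> r * gain u u r + ?c * indicator {0..1 / n} r)"
    by (rule integral_mono[OF i iR pt])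
  also have "\<dots> = (LBINT r. \<omega> r * gain u u r) + (LBINT r. ?c * indicator {0..1 / n} r)"
    by (intro Bochner_Integration.integral_add g(1) integrable_mult_right integrable_indicator_Icc)
  also have "(LBINT r. ?c * indicator {0..1 / n} r) = ?c * (1 / n)" using n by simp
  also have "(LBINT r. \<omega> r * gain u u r) \<le> 12 * B\<^sup>2 / n"
  proof -
    have "3 * (4 / n ^ 3) * mom 6 u * mom 6 u \<le> 3 * (4 / n) * B * B"
      using B B0 mom_nonneg[OF d, of 6] n power_increasing[of 1 3 n] by (intro mult_mono divide_left_mono) auto
    thus ?thesis using g(2) by (simp add: power2_eq_square)
  qed
  finally show "(LBINT r. 4 * (1 + r) * \<bar>trunc_coll n u r - coll u r\<bar>) \<le> trunc_const M B / n"
    by (simp add: trunc_const_def add_divide_distrib)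
qed

text \<open>The full operator conserves energy, so the truncated one loses exactly what is
  discarded, and that loss is of order 1 / n.\<close>

lemma trunc_energy:
  assumes u: "u \<in> euler_set n M h3 h8" and n: "1 \<le> n" and B: "mom 6 u \<le> B"
  shows "(LBINT r. r * trunc_coll n u r) \<le> 0" "- (trunc_const M B / n) \<le> (LBINT r. r * trunc_coll n u r)"
proof -
  note d = euler_set_dens[OF u n] and D = euler_setD[OF u]
  have i1: "integrable lborel (\<lambda>r. r * trunc_coll n u r)" using trunc_coll_integrable(1)[OF d n, of 1] by simp
  have i2: "integrable lborel (\<lambda>r. r * coll u r)" by (rule coll_bound(2)[OF d, where c = 1 and j = 1]) auto
  have z: "coll u r = 0" "trunc_coll n u r = 0" if "r \<le> 0" for r
    using coll_nonpos[OF d that] by (auto simp: trunc_coll_def)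
  have "r * trunc_coll n u r \<le> r * coll u r" for r
    using coll_outside_nonneg[OF d D(3)[of r]] z[of r]
    by (cases "r \<le> 0") (auto simp: trunc_coll_def)
  hence "(LBINT r. r * trunc_coll n u r) \<le> (LBINT r. r * coll u r)" using i1 i2 by (intro integral_mono) auto
  thus "(LBINT r. r * trunc_coll n u r) \<le> 0" using coll_energy[OF d] by simp
  have "(LBINT r. r * coll u r - r * trunc_coll n u r) \<le> (LBINT r. 4 * (1 + r) * \<bar>trunc_coll n u r - coll u r\<bar>)"
  proof (rule integral_mono)
    show "integrable lborel (\<lambda>r. 4 * (1 + r) * \<bar>trunc_coll n u r - coll u r\<bar>)"
      using integrable_mult_right[OF trunc_error(1)[OF u n B], of 4] by (simp only: mult.assoc)
    fix r show "r * coll u r - r * trunc_coll n u r \<le> 4 * (1 + r) * \<bar>trunc_coll n u r - coll u r\<bar>"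
    proof (cases "r \<le> 0")
      case True
      thus ?thesis using z[of r] by simp
    next
      case False
      have "r * coll u r - r * trunc_coll n u r \<le> r * \<bar>trunc_coll n u r - coll u r\<bar>"
        using False by (simp flip: right_diff_distrib)
      also have "\<dots> \<le> 4 * (1 + r) * \<bar>trunc_coll n u r - coll u r\<bar>" using False by (intro mult_right_mono) auto
      finally show ?thesis .
    qed
  qed (use i1 i2 in simp)
  also have "\<dots> \<le> trunc_const M B / n" by (rule trunc_error(2)[OF u n B])
  finally show "- (trunc_const M B / n) \<le> (LBINT r. r * trunc_coll n u r)" using i1 i2 coll_energy[OF d] by simp
qed

text \<open>The sixth moment does not increase once it is at or above \<open>h_star\<close>. From
  below \<open>h_star\<close> a single step adds at most another \<open>h_star\<close>, by the third
  condition on h. Hence the requirement that \<open>h8\<close> be at least twice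
  \<open>h_star\<close>. The second conclusion concerns an arbitrary further level
  \<open>M'\<close>, as needed for the sharp one.\<close>

lemma euler_step_invariant:
  assumes C: "eighth_moment_constants C8 c8" "0 < C8" "0 < c8" and h3: "0 < h3" and h8: "2 * h_star C8 c8 h3 \<le> h8"
    and M: "60 * (h3 + h8) + 1 \<le> M" and n: "1 \<le> n"
  defines "B \<equiv> 64 * (M + h8)"
  assumes h: "0 \<le> h" "h * (8 * (1 + n)\<^sup>2 * B + n ^ 5) \<le> 1" "h * (C8 * h3 powr (7 / 2)) \<le> h_star C8 c8 h3"
    and u: "u \<in> euler_set n M h3 h8"
  shows "(\<lambda>r. u r + h * trunc_coll n u r) \<in> euler_set n M h3 h8"
    and "level_condition M' u \<Longrightarrow> (\<And>r. u r \<le> M') \<Longrightarrow> u r + h * trunc_coll n u r \<le> M'"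
proof -
  note d = euler_set_dens[OF u n] and D = euler_setD[OF u]
  note [measurable] = dens_meas[OF d]
  have B: "mom 6 u \<le> B" unfolding B_def by (rule euler_set_mom6[OF u n])
  have small: "h * (loss u r + r ^ 5 / 30) \<le> 1" if r: "0 < r" "r \<le> n" for r
  proof -
    have "loss u r \<le> 8 * (1 + r)\<^sup>2 * mom 1 u" by (rule loss_bounds(2)[OF d r(1)])
    also have "\<dots> \<le> 8 * (1 + n)\<^sup>2 * B"
      using r B mom_mono[OF d, of 1 6] mom_nonneg[OF d, of 1] by (intro mult_mono power_mono) auto
    finally have 1: "loss u r \<le> 8 * (1 + n)\<^sup>2 * B" .
    have "r ^ 5 \<le> n ^ 5" using r by (intro power_mono) auto
    moreover have "0 \<le> r ^ 5" using r by simp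
    ultimately have "loss u r + r ^ 5 / 30 \<le> 8 * (1 + n)\<^sup>2 * B + n ^ 5" using 1 by linarith
    from mult_left_mono[OF this h(1)] show ?thesis using h(2) by linarith
  qed
  show up: "u r + h * trunc_coll n u r \<le> M'" if "level_condition M' u" "\<And>r. u r \<le> M'" for r M'
    using euler_step_bounds(2)[OF d that(2) _ that(1) h(1), of r] small[of r] that(2)[of r] recip_le_imp_pos[OF n, of r]
    by (auto simp: trunc_coll_def)
  have L: "level_condition M u" by (rule level_condition_large[OF d D(4,5) M])
  have low: "0 \<le> u r + h * trunc_coll n u r" for r
    using euler_step_bounds(1)[OF d D(2) _ L h(1), of r] small[of r] D(1)[of r] recip_le_imp_pos[OF n, of r]
    by (auto simp: trunc_coll_def)
  have sp: "u r + h * trunc_coll n u r = 0" if "r \<notin> {1 / n..n}" for r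
    using D(3)[OF that] that by (auto simp: trunc_coll_def)
  have i1: "integrable lborel (\<lambda>r. r * u r)" "integrable lborel (\<lambda>r. r * trunc_coll n u r)"
    using pow_integrable[OF d, of 1] trunc_coll_integrable(1)[OF d n, of 1] by auto
  have "(LBINT r. r * (u r + h * trunc_coll n u r)) = (LBINT r. r * u r + h * (r * trunc_coll n u r))"
    by (simp add: algebra_simps)
  also have "\<dots> = (LBINT r. r * u r) + h * (LBINT r. r * trunc_coll n u r)"
    using i1 by simp
  also have "\<dots> \<le> h3" using D(4) mult_left_mono[OF trunc_energy(1)[OF u n B] h(1)] by simp
  finally have m1: "(LBINT r. r * (u r + h * trunc_coll n u r)) \<le> h3" .
  have i6: "integrable lborel (\<lambda>r. r ^ 6 * u r)" "integrable lborel (\<lambda>r. r ^ 6 * trunc_coll n u r)"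
    using pow_integrable[OF d, of 6] trunc_coll_integrable(1)[OF d n, of 6] by auto
  have "(LBINT r. r ^ 6 * (u r + h * trunc_coll n u r)) = (LBINT r. r ^ 6 * u r + h * (r ^ 6 * trunc_coll n u r))"
    by (simp add: algebra_simps)
  also have "\<dots> = (LBINT r. r ^ 6 * u r) + h * (LBINT r. r ^ 6 * trunc_coll n u r)"
    using i6 by simp
  also have "\<dots> \<le> h8"
  proof -
    let ?m = "LBINT r. r * u r" and ?X = "LBINT r. r ^ 6 * u r" and ?hs = "h_star C8 c8 h3"
    have m0: "0 \<le> ?m" using pow_moment_nonneg[OF d, of 1] by simp
    have hs0: "0 < ?hs" using C h3 by (simp add: h_star_def)
    \<comment> \<open>\<open>h_star\<close> is the value at which the production and damping terms
      of the eighth moment hypothesis balance for energy \<open>h3\<close>.\<close>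
    have hs2: "c8 * ?hs\<^sup>2 = C8 * h3 powr (9 / 2)"
    proof -
      have "?hs\<^sup>2 = (C8 / c8) powr (1 / 2 + 1 / 2) * h3 powr (9 / 4 + 9 / 4)"
        unfolding h_star_def power2_eq_square powr_add by (simp add: mult_ac)
      thus ?thesis using C h3 by simp
    qed
    have le: "?m powr (9 / 2) \<le> h3 powr (9 / 2)" using m0 D(4) by (intro powr_mono2) auto
    note S = sixth_moment_dissipation[OF C(1) u n]
    show ?thesis
    proof (cases "?hs \<le> ?X")
      case True
      hence "?hs\<^sup>2 \<le> ?X\<^sup>2" using hs0 by (intro power_mono) auto
      hence "C8 * ?m powr (9 / 2) \<le> c8 * ?X\<^sup>2"
        using hs2 mult_left_mono[OF le, of C8] mult_left_mono[of "?hs\<^sup>2" "?X\<^sup>2" c8] C by linarith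
      hence "(LBINT r. r ^ 6 * trunc_coll n u r) \<le> 0" using S m0 by (smt (verit) divide_nonpos_nonneg)
      thus ?thesis using D(5) h(1) by (smt (verit) mult_nonneg_nonpos)
    next
      case False
      \<comment> \<open>The energy may have dropped below \<open>h3\<close>, even to 0, where the
        quotient is 0 by convention. Otherwise dividing by the energy turns the exponent 9/2 into
        7/2, which is monotone in the energy.\<close>
      have "(C8 * ?m powr (9 / 2) - c8 * ?X\<^sup>2) / ?m \<le> C8 * h3 powr (7 / 2)"
      proof (cases "?m = 0")
        case False
        have "(C8 * ?m powr (9 / 2) - c8 * ?X\<^sup>2) / ?m \<le> C8 * ?m powr (9 / 2) / ?m"
          using C m0 by (intro divide_right_mono) auto
        also have "\<dots> = C8 * ?m powr (7 / 2)"
        proof -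
          have "?m powr (9 / 2) = ?m powr (7 / 2) * ?m" using powr_add[of ?m "7 / 2" 1] m0 by simp
          thus ?thesis using False by simp
        qed
        also have "\<dots> \<le> C8 * h3 powr (7 / 2)" using m0 D(4) C by (intro mult_left_mono powr_mono2) auto
        finally show ?thesis .
      qed (use C in simp)
      hence "h * (LBINT r. r ^ 6 * trunc_coll n u r) \<le> ?hs"
        using S h(1,3) mult_left_mono[OF order_trans[OF S], of "C8 * h3 powr (7 / 2)" h] by linarith
      thus ?thesis using False h8 by linarith
    qed
  qed
  finally have m6: "(LBINT r. r ^ 6 * (u r + h * trunc_coll n u r)) \<le> h8" .
  show "(\<lambda>r. u r + h * trunc_coll n u r) \<in> euler_set n M h3 h8"
    unfolding euler_set_def using low up[OF L D(2)] sp m1 m6 by auto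
qed

section \<open>Euler polygons\<close>

primrec euler :: "real \<Rightarrow> real \<Rightarrow> (real \<Rightarrow> real) \<Rightarrow> nat \<Rightarrow> real \<Rightarrow> real" where
  "euler n h u0 0 = u0"
| "euler n h u0 (Suc k) = (\<lambda>r. euler n h u0 k r + h * trunc_coll n (euler n h u0 k) r)"

definition euler_path :: "real \<Rightarrow> real \<Rightarrow> (real \<Rightarrow> real) \<Rightarrow> real \<Rightarrow> real \<Rightarrow> real" where
  "euler_path n h u0 t r = (let k = nat \<lfloor>t / h\<rfloor> in euler n h u0 k r + (t - real k * h) * trunc_coll n (euler n h u0 k) r)"

text \<open>Holds on the closed cell: at the right end the floor has already moved to the next
  index, and the formulas of both cells agree there. This makes the path continuous.\<close>

lemma euler_path_cell:
  assumes h: "0 < h" and t: "real k * h \<le> t" "t \<le> real (Suc k) * h"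
  shows "euler_path n h u0 t r = euler n h u0 k r + (t - real k * h) * trunc_coll n (euler n h u0 k) r"
proof (cases "t < real (Suc k) * h")
  case True
  have "real k \<le> t / h" "t / h < real k + 1" using t True h by (simp_all add: field_simps)
  hence "nat \<lfloor>t / h\<rfloor> = k" by linarith
  thus ?thesis by (simp add: euler_path_def)
next
  case False
  hence te: "t = real (Suc k) * h" using t by simp
  hence "t / h = real (Suc k)" using h by simp
  hence "nat \<lfloor>t / h\<rfloor> = Suc k" by (metis floor_of_nat nat_int)
  thus ?thesis by (simp add: euler_path_def te algebra_simps)
qed

lemma cell_exists:
  fixes h t :: real
  assumes "0 < h" "0 \<le> t" obtains k where "real k * h \<le> t" "t < real (Suc k) * h"
proof
  have "0 \<le> t / h" using assms by simp
  hence 1: "real (nat \<lfloor>t / h\<rfloor>) \<le> t / h" "t / h < real (Suc (nat \<lfloor>t / h\<rfloor>))" by linarith+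
  show "real (nat \<lfloor>t / h\<rfloor>) * h \<le> t" using 1(1) unfolding pos_le_divide_eq[OF assms(1)] .
  show "t < real (Suc (nat \<lfloor>t / h\<rfloor>)) * h" using 1(2) unfolding pos_divide_less_eq[OF assms(1)] .
qed

lemma ldist_triangle:
  assumes "dens u" "dens v" "dens w" shows "ldist u w \<le> ldist u v + ldist v w"
proof -
  have i: "integrable lborel (\<lambda>r. \<bar>u r - v r\<bar>)" "integrable lborel (\<lambda>r. \<bar>v r - w r\<bar>)" "integrable lborel (\<lambda>r. \<bar>u r - w r\<bar>)"
    using dens_integrable_self[OF dens_diff] assms by auto
  have "ldist u w \<le> (LBINT r. \<bar>u r - v r\<bar> + \<bar>v r - w r\<bar>)"
    unfolding ldist_def by (rule integral_mono) (use i in auto)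
  thus ?thesis using i by (simp add: ldist_def)
qed

lemma ldist_commute: "ldist u v = ldist v u"
  by (simp add: ldist_def abs_minus_commute)

text \<open>Each path is affine to the right of every time, so its right derivative b is exact on a
  short interval. The level clause asks for the level condition along the path itself, to be
  verified later through the limit.\<close>

lemma euler_path_exists:
  assumes C: "eighth_moment_constants C8 c8" "0 < C8" "0 < c8" and h3: "0 < h3" and h8: "2 * h_star C8 c8 h3 \<le> h8"
    and M: "60 * (h3 + h8) + 1 \<le> M" and n: "1 \<le> n" and u0: "u0 \<in> euler_set n M h3 h8"
  defines "B \<equiv> 64 * (M + h8)"
  shows "\<exists>u. u 0 = u0 \<and> (\<forall>t\<ge>0. u t \<in> euler_set n M h3 h8)
    \<and> (\<forall>s t. 0 \<le> s \<longrightarrow> s \<le> t \<longrightarrow> ldist (u s) (u t) \<le> (22 * B + 3) * B * (t - s))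
    \<and> (\<forall>t\<ge>0. \<exists>b \<delta>. 0 < \<delta> \<and> (\<forall>h r. 0 \<le> h \<longrightarrow> h < \<delta> \<longrightarrow> u (t + h) r = u t r + h * b r) \<and> integrable lborel b \<and> (\<forall>r\<le>0. b r = 0)
         \<and> integrable lborel (\<lambda>r. (1 + r) * \<bar>b r - coll (u t) r\<bar>)
         \<and> (LBINT r. 4 * (1 + r) * \<bar>b r - coll (u t) r\<bar>) \<le> (trunc_const M B + 1) / n)
    \<and> (\<forall>t\<ge>0. (LBINT r. r * u0 r) - t * (trunc_const M B / n) \<le> (LBINT r. r * u t r))
    \<and> (\<forall>T M'. (\<forall>r. u0 r \<le> M') \<longrightarrow> (\<forall>s\<in>{0..T}. level_condition M' (u s)) \<longrightarrow> (\<forall>s\<in>{0..T}. \<forall>r. u s r \<le> M'))"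
proof -
  have hs0: "0 < h_star C8 c8 h3" using C h3 by (simp add: h_star_def)
  have M1: "1 \<le> M" using M h3 h8 hs0 by (simp add: distrib_left)
  have B0: "0 < B" using M1 h8 hs0 by (simp add: B_def)
  \<comment> \<open>Three restrictions on the step: \<open>c1\<close> for positivity and levels,
    \<open>c2\<close> for the sixth moment, \<open>c3\<close> for consistency, since the slope is
    frozen at the left node and must stay within 1 / n of \<open>coll\<close> at the current
    time.\<close>
  define c1 where "c1 = 8 * (1 + n)\<^sup>2 * B + n ^ 5"
  define c2 where "c2 = C8 * h3 powr (7 / 2) / h_star C8 c8 h3"
  define c3 where "c3 = n * (4 * (44 * B + 3) * ((1 + n) ^ 6 * ((22 * B + 3) * B)))"
  have c0: "0 < c1" "0 < c2" "0 < c3"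
    using n B0 C h3 hs0 unfolding c1_def c2_def c3_def
    by (intro add_pos_pos mult_pos_pos divide_pos_pos zero_less_power; simp)+
  define h where "h = 1 / (c1 + c2 + c3)"
  have h: "0 < h" using c0 by (simp add: h_def)
  have hc: "h * c1 \<le> 1" "h * c2 \<le> 1" "h * c3 \<le> 1" using c0 by (auto simp: h_def pos_divide_le_eq)
  \<comment> \<open>Stated for every step length up to h: each point of a polygon is itself an Euler
    step from the preceding node, so the bounds hold at all times.\<close>
  have step: "(\<lambda>r. u r + k * trunc_coll n u r) \<in> euler_set n M h3 h8"
    "level_condition M' u \<Longrightarrow> (\<And>r. u r \<le> M') \<Longrightarrow> u r + k * trunc_coll n u r \<le> M'"
    if "0 \<le> k" "k \<le> h" "u \<in> euler_set n M h3 h8" for k u M' r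
  proof -
    have "k * c1 \<le> h * c1" "k * c2 \<le> h * c2" using that c0 by (auto intro: mult_right_mono)
    hence "k * c1 \<le> 1" "k * c2 \<le> 1" using hc by linarith+
    hence *: "k * (8 * (1 + n)\<^sup>2 * (64 * (M + h8)) + n ^ 5) \<le> 1" "k * (C8 * h3 powr (7 / 2)) \<le> h_star C8 c8 h3"
      using hs0 by (auto simp: c1_def c2_def B_def pos_divide_le_eq)
    show "(\<lambda>r. u r + k * trunc_coll n u r) \<in> euler_set n M h3 h8"
      by (rule euler_step_invariant(1)[OF C h3 h8 M n that(1) * that(3)])
    show "level_condition M' u \<Longrightarrow> (\<And>r. u r \<le> M') \<Longrightarrow> u r + k * trunc_coll n u r \<le> M'"
      by (rule euler_step_invariant(2)[OF C h3 h8 M n that(1) * that(3)])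
  qed
  define e where "e = euler n h u0"
  define u where "u = euler_path n h u0"
  have e0: "e 0 = u0" and eS: "e (Suc k) = (\<lambda>r. e k r + h * trunc_coll n (e k) r)" for k by (auto simp: e_def)
  have eE: "e k \<in> euler_set n M h3 h8" for k
  proof (induction k)
    case (Suc k) thus ?case unfolding eS using step(1)[of h "e k"] h by simp
  qed (simp add: e0 u0)
  note ed = euler_set_dens[OF eE n]
  have eB: "mom 6 (e k) \<le> B" for k unfolding B_def by (rule euler_set_mom6[OF eE n])
  have cell: "u t r = e k r + (t - real k * h) * trunc_coll n (e k) r" if "real k * h \<le> t" "t \<le> real (Suc k) * h" for k t r
    unfolding u_def e_def by (rule euler_path_cell[OF h that])
  have uE: "u t \<in> euler_set n M h3 h8" if t: "0 \<le> t" for t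
  proof -
    obtain k where k: "real k * h \<le> t" "t < real (Suc k) * h" using cell_exists[OF h t] .
    have "u t = (\<lambda>r. e k r + (t - real k * h) * trunc_coll n (e k) r)" using cell[of k t] k by auto
    thus ?thesis using step(1)[OF _ _ eE, of "t - real k * h" k] k by (simp add: algebra_simps)
  qed
  note ud = euler_set_dens[OF uE n]
  have tL1: "(LBINT r. \<bar>trunc_coll n (e k) r\<bar>) \<le> (22 * B + 3) * B" for k
    using trunc_coll_integrable(3)[OF ed n, of 0 k] coll_L1_bound[OF ed eB, of k] by simp
  have lip_cell: "ldist (u s) (u t) \<le> (22 * B + 3) * B * (t - s)" if "real k * h \<le> s" "s \<le> t" "t \<le> real (Suc k) * h" for s t k
  proof -
    have "ldist (u s) (u t) = (LBINT r. (t - s) * \<bar>trunc_coll n (e k) r\<bar>)"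
      unfolding ldist_def
    proof (rule Bochner_Integration.integral_cong)
      fix r
      have "u s r - u t r = (s - t) * trunc_coll n (e k) r"
        using cell[of k s r] cell[of k t r] that by (simp add: algebra_simps)
      thus "\<bar>u s r - u t r\<bar> = (t - s) * \<bar>trunc_coll n (e k) r\<bar>" using that by (simp add: abs_mult)
    qed simp
    also have "\<dots> = (t - s) * (LBINT r. \<bar>trunc_coll n (e k) r\<bar>)" by simp
    also have "\<dots> \<le> (t - s) * ((22 * B + 3) * B)" using tL1 that by (intro mult_left_mono) auto
    finally show ?thesis by (simp add: mult.commute)
  qed
  have lip: "ldist (u s) (u t) \<le> (22 * B + 3) * B * (t - s)" if "0 \<le> s" "s \<le> t" "t \<le> real k * h" for s t k
    using that
  proof (induction k arbitrary: s t)
    case 0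
    hence "t = s" by simp
    thus ?case by (simp add: ldist_def)
  next
    case (Suc k)
    show ?case
    proof (cases "t \<le> real k * h")
      case True thus ?thesis using Suc by blast
    next
      case t: False
      show ?thesis
      proof (cases "real k * h \<le> s")
        case True thus ?thesis using lip_cell[of k s t] Suc.prems by blast
      next
        case False
        have k0: "0 \<le> real k * h" using h by simp
        have "ldist (u s) (u t) \<le> ldist (u s) (u (real k * h)) + ldist (u (real k * h)) (u t)"
          using Suc.prems k0 by (intro ldist_triangle ud) auto
        also have "\<dots> \<le> (22 * B + 3) * B * (real k * h - s) + (22 * B + 3) * B * (t - real k * h)"
          using Suc.IH[of s "real k * h"] lip_cell[of k "real k * h" t] Suc.prems False t by (intro add_mono) auto
        finally show ?thesis by (simp add: algebra_simps)
      qed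
    qed
  qed
  have P3: "ldist (u s) (u t) \<le> (22 * B + 3) * B * (t - s)" if "0 \<le> s" "s \<le> t" for s t
  proof -
    have "0 \<le> t" using that by linarith
    then obtain k where "t < real (Suc k) * h" using cell_exists[OF h] by blast
    thus ?thesis using lip[OF that, of "Suc k"] by simp
  qed
  have P4: "\<exists>b \<delta>. 0 < \<delta> \<and> (\<forall>h r. 0 \<le> h \<longrightarrow> h < \<delta> \<longrightarrow> u (t + h) r = u t r + h * b r) \<and> integrable lborel b \<and> (\<forall>r\<le>0. b r = 0)
         \<and> integrable lborel (\<lambda>r. (1 + r) * \<bar>b r - coll (u t) r\<bar>)
         \<and> (LBINT r. 4 * (1 + r) * \<bar>b r - coll (u t) r\<bar>) \<le> (trunc_const M B + 1) / n" if t: "0 \<le> t" for t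
  proof -
    obtain k where k: "real k * h \<le> t" "t < real (Suc k) * h" using cell_exists[OF h t] .
    let ?b = "trunc_coll n (e k)"
    have 1: "u (t + \<eta>) r = u t r + \<eta> * ?b r" if "0 \<le> \<eta>" "\<eta> < real (Suc k) * h - t" for \<eta> r
      using cell[of k t r] cell[of k "t + \<eta>" r] k that by (simp add: algebra_simps)
    have 2: "integrable lborel ?b" using trunc_coll_integrable(1)[OF ed n, of 0 k] by simp
    have 3: "\<forall>r\<le>0. ?b r = 0" using coll_nonpos[OF ed] by (auto simp: trunc_coll_def)
    note E = trunc_error[OF eE n eB, of k]
    have diff: "\<bar>e k r - u t r\<bar> = (t - real k * h) * \<bar>?b r\<bar>" for r
      using cell[of k t r] k by (simp add: abs_mult)
    have chi: "0 \<le> 4 * (1 + r)" "4 * (1 + r) \<le> 4 * (1 + r) ^ 1" if "0 < r" for r :: real using that by auto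
    note L = coll_diff_bound[OF ed[of k] ud[OF t], of "\<lambda>r. 4 * (1 + r)" 4 1, OF _ chi]
    have L1: "integrable lborel (\<lambda>r. 4 * (1 + r) * \<bar>coll (e k) r - coll (u t) r\<bar>)" using L(1) by simp
    have uB: "mom 6 (u t) \<le> B" unfolding B_def by (rule euler_set_mom6[OF uE[OF t] n])
    have "(LBINT r. 4 * (1 + r) * \<bar>coll (e k) r - coll (u t) r\<bar>) \<le> 4 * (22 * (mom 3 (e k) + mom 3 (u t)) + 3) * mom 6 (\<lambda>r. \<bar>e k r - u t r\<bar>)"
      using L(2) by simp
    also have "\<dots> \<le> 4 * (44 * B + 3) * ((1 + n) ^ 6 * ((22 * B + 3) * B) * h)"
    proof (intro mult_mono)
      show "22 * (mom 3 (e k) + mom 3 (u t)) + 3 \<le> 44 * B + 3"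
        using mom_mono[OF ed, of 3 6 k] mom_mono[OF ud[OF t], of 3 6] eB[of k] uB by simp
      have "mom 6 (\<lambda>r. \<bar>e k r - u t r\<bar>) = (t - real k * h) * (LBINT r. (1 + r) ^ 6 * \<bar>?b r\<bar>)"
        unfolding mom_def diff by (simp add: mult.left_commute)
      also have "\<dots> \<le> h * ((1 + n) ^ 6 * ((22 * B + 3) * B))"
      proof (rule mult_mono)
        have "(LBINT r. (1 + r) ^ 6 * \<bar>?b r\<bar>) \<le> (1 + n) ^ 6 * (LBINT r. \<bar>coll (e k) r\<bar>)"
          by (rule trunc_coll_integrable(3)[OF ed n])
        also have "\<dots> \<le> (1 + n) ^ 6 * ((22 * B + 3) * B)"
          using coll_L1_bound[OF ed eB, of k] n by (intro mult_left_mono) auto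
        finally show "(LBINT r. (1 + r) ^ 6 * \<bar>?b r\<bar>) \<le> (1 + n) ^ 6 * ((22 * B + 3) * B)" .
        have "0 \<le> (1 + r) ^ 6 * \<bar>?b r\<bar>" for r by simp
        thus "0 \<le> (LBINT r. (1 + r) ^ 6 * \<bar>?b r\<bar>)" by simp
      qed (use k h in \<open>auto simp: algebra_simps\<close>)
      finally show "mom 6 (\<lambda>r. \<bar>e k r - u t r\<bar>) \<le> (1 + n) ^ 6 * ((22 * B + 3) * B) * h" by (simp add: mult_ac)
    qed (use B0 mom_nonneg[OF ed] mom_nonneg[OF ud[OF t]] mom_nonneg[OF dens_diff[OF ed[of k] ud[OF t]]] in auto)
    also have "\<dots> = h * c3 / n" using n by (simp add: c3_def)
    also have "\<dots> \<le> 1 / n" using hc n by (intro divide_right_mono) auto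
    finally have L2: "(LBINT r. 4 * (1 + r) * \<bar>coll (e k) r - coll (u t) r\<bar>) \<le> 1 / n" .
    have E1: "integrable lborel (\<lambda>r. 4 * (1 + r) * \<bar>?b r - coll (e k) r\<bar>)"
      using integrable_mult_right[OF E(1), of 4] by (simp only: mult.assoc)
    have z: "?b r = 0" "coll (e k) r = 0" "coll (u t) r = 0" if "r \<le> 0" for r
      using 3 coll_nonpos[OF ed that] coll_nonpos[OF ud[OF t] that] that by auto
    have pt: "4 * (1 + r) * \<bar>?b r - coll (u t) r\<bar> \<le> 4 * (1 + r) * \<bar>?b r - coll (e k) r\<bar> + 4 * (1 + r) * \<bar>coll (e k) r - coll (u t) r\<bar>"
      and pt0: "0 \<le> 4 * (1 + r) * \<bar>?b r - coll (u t) r\<bar>" for r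
    proof -
      have "4 * (1 + r) * \<bar>?b r - coll (u t) r\<bar> \<le> 4 * (1 + r) * (\<bar>?b r - coll (e k) r\<bar> + \<bar>coll (e k) r - coll (u t) r\<bar>)" if "0 < r"
        using that by (intro mult_left_mono) auto
      thus "4 * (1 + r) * \<bar>?b r - coll (u t) r\<bar> \<le> 4 * (1 + r) * \<bar>?b r - coll (e k) r\<bar> + 4 * (1 + r) * \<bar>coll (e k) r - coll (u t) r\<bar>"
        using z[of r] by (cases "0 < r") (auto simp: distrib_left)
      show "0 \<le> 4 * (1 + r) * \<bar>?b r - coll (u t) r\<bar>" using z[of r] by (cases "0 < r") auto
    qed
    note [measurable] = dens_meas[OF ed[of k]] dens_meas[OF ud[OF t]]
    have i: "integrable lborel (\<lambda>r. 4 * (1 + r) * \<bar>?b r - coll (u t) r\<bar>)"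
    proof (rule Bochner_Integration.integrable_bound[OF Bochner_Integration.integrable_add[OF E1 L1]])
      show "AE r in lborel. norm (4 * (1 + r) * \<bar>?b r - coll (u t) r\<bar>) \<le> norm (4 * (1 + r) * \<bar>?b r - coll (e k) r\<bar> + 4 * (1 + r) * \<bar>coll (e k) r - coll (u t) r\<bar>)"
        by (intro AE_I2) (metis pt pt0 abs_of_nonneg order_trans real_norm_def)
    qed measurable
    have "(LBINT r. 4 * (1 + r) * \<bar>?b r - coll (u t) r\<bar>)
      \<le> (LBINT r. 4 * (1 + r) * \<bar>?b r - coll (e k) r\<bar> + 4 * (1 + r) * \<bar>coll (e k) r - coll (u t) r\<bar>)"
      by (rule integral_mono[OF i Bochner_Integration.integrable_add[OF E1 L1] pt])
    also have "\<dots> = (LBINT r. 4 * (1 + r) * \<bar>?b r - coll (e k) r\<bar>) + (LBINT r. 4 * (1 + r) * \<bar>coll (e k) r - coll (u t) r\<bar>)"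
      by (rule Bochner_Integration.integral_add[OF E1 L1])
    also have "\<dots> \<le> trunc_const M B / n + 1 / n" using E(2) L2 by (rule add_mono)
    finally have 5: "(LBINT r. 4 * (1 + r) * \<bar>?b r - coll (u t) r\<bar>) \<le> (trunc_const M B + 1) / n" by (simp add: add_divide_distrib)
    have "integrable lborel (\<lambda>r. (1 / 4) * (4 * (1 + r) * \<bar>?b r - coll (u t) r\<bar>))" using i by (rule integrable_mult_right)
    also have "(\<lambda>r. (1 / 4) * (4 * (1 + r) * \<bar>?b r - coll (u t) r\<bar>)) = (\<lambda>r. (1 + r) * \<bar>?b r - coll (u t) r\<bar>)"
      by (simp add: fun_eq_iff field_simps)
    finally have 4: "integrable lborel (\<lambda>r. (1 + r) * \<bar>?b r - coll (u t) r\<bar>)" .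
    have "0 < real (Suc k) * h - t" using k by linarith
    thus ?thesis
      by (intro exI[of _ ?b] exI[of _ "real (Suc k) * h - t"] conjI allI impI) (use 3 in \<open>simp_all only: 1 2 4 5\<close>)
  qed
  have i1: "integrable lborel (\<lambda>r. r * e k r)" "integrable lborel (\<lambda>r. r * trunc_coll n (e k) r)" for k
    using pow_integrable[OF ed, of 1 k] trunc_coll_integrable(1)[OF ed n, of 1 k] by auto
  have mstep: "(LBINT r. r * e k r) - s * (trunc_const M B / n) \<le> (LBINT r. r * (e k r + s * trunc_coll n (e k) r))" if "0 \<le> s" for s k
  proof -
    have "(LBINT r. r * (e k r + s * trunc_coll n (e k) r)) = (LBINT r. r * e k r + s * (r * trunc_coll n (e k) r))"
      by (simp add: algebra_simps)
    also have "\<dots> = (LBINT r. r * e k r) + s * (LBINT r. r * trunc_coll n (e k) r)" using i1 by simp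
    finally show ?thesis using mult_left_mono[OF trunc_energy(2)[OF eE n eB, of k] that] by simp
  qed
  have me: "(LBINT r. r * u0 r) - (real k * h) * (trunc_const M B / n) \<le> (LBINT r. r * e k r)" for k
  proof (induction k)
    case (Suc k)
    thus ?case using mstep[of h k] h unfolding eS by (simp add: algebra_simps add_divide_distrib)
  qed (simp add: e0)
  have P5: "(LBINT r. r * u0 r) - t * (trunc_const M B / n) \<le> (LBINT r. r * u t r)" if t: "0 \<le> t" for t
  proof -
    obtain k where k: "real k * h \<le> t" "t < real (Suc k) * h" using cell_exists[OF h t] .
    have 1: "(LBINT r. r * u t r) = (LBINT r. r * (e k r + (t - real k * h) * trunc_coll n (e k) r))"
      using cell[of k t] k by simp
    have 2: "real k * h * K + (t - real k * h) * K = t * K" for K by (simp add: algebra_simps)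
    show ?thesis using me[of k] mstep[of "t - real k * h" k] k 1 2[of "trunc_const M B / n"] by linarith
  qed
  have ue: "u (real k * h) = e k" for k using cell[of k "real k * h"] h by (auto simp: algebra_simps)
  have P6: "\<forall>s\<in>{0..T}. \<forall>r. u s r \<le> M'" if M': "\<forall>r. u0 r \<le> M'" "\<forall>s\<in>{0..T}. level_condition M' (u s)" for T M'
  proof -
    have ek: "\<forall>r. e k r \<le> M'" if "real k * h \<le> T" for k
      using that
    proof (induction k)
      case (Suc k)
      have kT: "real k * h \<le> T" using Suc.prems h by (simp add: algebra_simps)
      have "level_condition M' (e k)" using M'(2) kT h ue[of k] by (metis atLeastAtMost_iff mult_nonneg_nonneg of_nat_0_le_iff less_imp_le)
      thus ?case unfolding eS using step(2)[OF _ _ eE, of h M' k] Suc.IH[OF kT] h by auto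
    qed (use M' e0 in auto)
    show ?thesis
    proof (intro ballI allI)
      fix s r assume s: "s \<in> {0..T}"
      obtain k where k: "real k * h \<le> s" "s < real (Suc k) * h" using cell_exists[OF h, of s] s by auto
      have kT: "real k * h \<le> T" using k s by auto
      have "level_condition M' (e k)" using M'(2) kT h ue[of k] by (metis atLeastAtMost_iff mult_nonneg_nonneg of_nat_0_le_iff less_imp_le)
      moreover have "s - real k * h \<le> h" using k by (simp add: algebra_simps)
      ultimately show "u s r \<le> M'"
        using step(2)[OF _ _ eE, of "s - real k * h" M' k r] ek[OF kT] k cell[of k s r] by simp
    qed
  qed
  have P6': "\<forall>T M'. (\<forall>r. u0 r \<le> M') \<longrightarrow> (\<forall>s\<in>{0..T}. level_condition M' (u s)) \<longrightarrow> (\<forall>s\<in>{0..T}. \<forall>r. u s r \<le> M')"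
    using P6 by blast
  have u00: "u 0 = u0" using ue[of 0] e0 by simp
  show ?thesis
    by (intro exI[of _ u] conjI P6' allI impI u00 uE P3 P4 P5)
qed

section \<open>Passage to the limit\<close>

lemma mom5_interpolation:
  assumes u: "dens u" and v: "dens v" and B: "mom 6 u \<le> B" "mom 6 v \<le> B" and L: "0 \<le> L"
  shows "mom 5 (\<lambda>r. \<bar>u r - v r\<bar>) \<le> (1 + L) ^ 5 * ldist u v + 2 * B / (1 + L)"
proof -
  let ?w = "\<lambda>r. \<bar>u r - v r\<bar>"
  have w: "dens ?w" by (rule dens_diff[OF u v])
  have i: "integrable lborel ?w" "integrable lborel (\<lambda>r. (1 + r) ^ 6 * ?w r)" "integrable lborel (\<lambda>r. (1 + r) ^ 5 * ?w r)"
    using dens_integrable_self[OF w] mom_integrable[OF w] by auto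
  have "mom 5 ?w \<le> (LBINT r. (1 + L) ^ 5 * ?w r + (1 / (1 + L)) * ((1 + r) ^ 6 * ?w r))"
    unfolding mom_def
  proof (rule integral_mono[OF i(3)])
    show "integrable lborel (\<lambda>r. (1 + L) ^ 5 * ?w r + (1 / (1 + L)) * ((1 + r) ^ 6 * ?w r))"
      by (intro Bochner_Integration.integrable_add integrable_mult_right i)
    fix r
    show "(1 + r) ^ 5 * ?w r \<le> (1 + L) ^ 5 * ?w r + (1 / (1 + L)) * ((1 + r) ^ 6 * ?w r)"
    proof (cases "0 < r")
      case True
      have "(1 + r) ^ 5 \<le> (1 + L) ^ 5 + (1 / (1 + L)) * (1 + r) ^ 6"
      proof (cases "r \<le> L")
        case le: True
        have "(1 + r) ^ 5 \<le> (1 + L) ^ 5" using le True by (intro power_mono) auto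
        moreover have "0 \<le> (1 / (1 + L)) * (1 + r) ^ 6" using L by simp
        ultimately show ?thesis by linarith
      next
        case False
        have "(1 + r) ^ 5 * (1 + L) \<le> (1 + r) ^ 5 * (1 + r)" using False True by (intro mult_left_mono) auto
        hence "(1 + r) ^ 5 \<le> (1 / (1 + L)) * (1 + r) ^ 6" using L by (simp add: pos_le_divide_eq eval_nat_numeral mult_ac)
        moreover have "0 \<le> (1 + L) ^ 5" using L by simp
        ultimately show ?thesis by linarith
      qed
      from mult_right_mono[OF this, of "?w r"] show ?thesis by (simp only: distrib_right mult.assoc abs_ge_zero)
    qed (simp add: dens_zero[OF u] dens_zero[OF v])
  qed
  also have "\<dots> = (LBINT r. (1 + L) ^ 5 * ?w r) + (LBINT r. (1 / (1 + L)) * ((1 + r) ^ 6 * ?w r))"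
    by (intro Bochner_Integration.integral_add integrable_mult_right i)
  also have "\<dots> = (1 + L) ^ 5 * ldist u v + (1 / (1 + L)) * mom 6 ?w"
    by (simp only: integral_mult_right_zero ldist_def mom_def)
  also have "(1 / (1 + L)) * mom 6 ?w \<le> (1 / (1 + L)) * (2 * B)"
    using mom_diff_le[OF u v, of 6] B L by (intro mult_left_mono) auto
  finally show ?thesis by simp
qed

lemma mom5_small:
  assumes B: "0 \<le> B" and \<eta>: "0 < \<eta>"
  shows "\<exists>\<delta>>0. \<forall>u v. dens u \<longrightarrow> dens v \<longrightarrow> mom 6 u \<le> B \<longrightarrow> mom 6 v \<le> B \<longrightarrow> ldist u v < \<delta> \<longrightarrow> mom 5 (\<lambda>r. \<bar>u r - v r\<bar>) < \<eta>"
proof -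
  define L where "L = 4 * B / \<eta>"
  have L0: "0 \<le> L" using B \<eta> by (simp add: L_def)
  have "4 * B = \<eta> * L" using \<eta> by (simp add: L_def)
  hence "2 * B \<le> \<eta> / 2 * (1 + L)" using \<eta> by (simp add: algebra_simps)
  hence L: "2 * B / (1 + L) \<le> \<eta> / 2" using L0 by (simp add: pos_divide_le_eq)
  define \<delta> where "\<delta> = \<eta> / (2 * (1 + L) ^ 5)"
  have \<delta>: "0 < \<delta>" "(1 + L) ^ 5 * \<delta> = \<eta> / 2" using \<eta> L0 by (auto simp: \<delta>_def)
  have "mom 5 (\<lambda>r. \<bar>u r - v r\<bar>) < \<eta>" if "dens u" "dens v" "mom 6 u \<le> B" "mom 6 v \<le> B" "ldist u v < \<delta>" for u v
  proof -
    have "(1 + L) ^ 5 * ldist u v < (1 + L) ^ 5 * \<delta>" using that(5) L0 by (intro mult_strict_left_mono) auto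
    thus ?thesis using mom5_interpolation[OF that(1-4) L0] L \<delta> by linarith
  qed
  thus ?thesis using \<delta> by blast
qed

text \<open>The five lost powers are recovered by interpolating between L^1 and the sixth moment. On
  sets with bounded sixth moment \<open>coll\<close> is thus uniformly continuous from L^1 to
  L^1.\<close>

lemma coll_uniformly_continuous:
  assumes B: "0 \<le> B" and \<eta>: "0 < \<eta>"
  shows "\<exists>\<delta>>0. \<forall>u v. dens u \<longrightarrow> dens v \<longrightarrow> mom 6 u \<le> B \<longrightarrow> mom 6 v \<le> B \<longrightarrow> ldist u v < \<delta> \<longrightarrow> (LBINT r. \<bar>coll u r - coll v r\<bar>) < \<eta>"
proof -
  let ?K = "44 * B + 3"
  have K: "0 < ?K" using B by simp
  obtain \<delta> where \<delta>: "0 < \<delta>" "\<And>u v. dens u \<Longrightarrow> dens v \<Longrightarrow> mom 6 u \<le> B \<Longrightarrow> mom 6 v \<le> B \<Longrightarrow> ldist u v < \<delta> \<Longrightarrow> mom 5 (\<lambda>r. \<bar>u r - v r\<bar>) < \<eta> / ?K"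
    using mom5_small[OF B, of "\<eta> / ?K"] \<eta> K by (auto simp: field_simps)
  have "(LBINT r. \<bar>coll u r - coll v r\<bar>) < \<eta>" if "dens u" "dens v" "mom 6 u \<le> B" "mom 6 v \<le> B" "ldist u v < \<delta>" for u v
  proof -
    have "(LBINT r. \<bar>coll u r - coll v r\<bar>) \<le> (22 * (mom 3 u + mom 3 v) + 3) * mom 5 (\<lambda>r. \<bar>u r - v r\<bar>)"
      using coll_diff_bound(2)[OF that(1,2), of "\<lambda>_. 1" 1 0] by simp
    also have "\<dots> \<le> ?K * mom 5 (\<lambda>r. \<bar>u r - v r\<bar>)"
      using mom_mono[OF that(1), of 3 6] mom_mono[OF that(2), of 3 6] that(3,4) mom_nonneg[OF dens_diff[OF that(1,2)]]
      by (intro mult_right_mono) auto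
    also have "\<dots> < ?K * (\<eta> / ?K)" using \<delta>(2)[OF that] K by (intro mult_strict_left_mono) auto
    finally show ?thesis using K by simp
  qed
  thus ?thesis using \<delta>(1) by blast
qed

text \<open>Moments up to order five are continuous under L^1 convergence with bounded sixth moment;
  order six itself is only semicontinuous and is treated by Fatou.\<close>

lemma pow_moment_diff:
  assumes u: "dens u" and v: "dens v" and k: "k \<le> 5"
  shows "\<bar>(LBINT r. r ^ k * u r) - (LBINT r. r ^ k * v r)\<bar> \<le> mom 5 (\<lambda>r. \<bar>u r - v r\<bar>)"
proof -
  have i: "integrable lborel (\<lambda>r. r ^ k * u r)" "integrable lborel (\<lambda>r. r ^ k * v r)"
    using pow_integrable[OF u, of k] pow_integrable[OF v, of k] k by auto
  have "\<bar>(LBINT r. r ^ k * u r) - (LBINT r. r ^ k * v r)\<bar> = \<bar>LBINT r. r ^ k * u r - r ^ k * v r\<bar>" using i by simp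
  also have "\<dots> \<le> (LBINT r. \<bar>r ^ k * u r - r ^ k * v r\<bar>)" by (rule integral_abs_bound)
  also have "\<dots> = (LBINT r. \<bar>r ^ k\<bar> * \<bar>u r - v r\<bar>)" by (simp add: abs_mult flip: right_diff_distrib)
  also have "\<dots> \<le> 1 * mom 5 (\<lambda>r. \<bar>u r - v r\<bar>)"
  proof (rule dens_integral_le(2)[OF dens_diff[OF u v]])
    fix r :: real assume r: "0 < r"
    have "r ^ k \<le> (1 + r) ^ k" using r by (intro power_mono) auto
    also have "\<dots> \<le> (1 + r) ^ 5" using r k by (intro power_increasing) auto
    finally show "\<bar>\<bar>r ^ k\<bar>\<bar> \<le> 1 * (1 + r) ^ 5" using r by simp
  qed auto
  finally show ?thesis by simp
qed

section \<open>Limits of densities\<close>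

lemma moment_fatou:
  fixes f :: "nat \<Rightarrow> real \<Rightarrow> real" and g \<phi> :: "real \<Rightarrow> real"
  assumes m: "\<And>j. f j \<in> borel_measurable borel" "g \<in> borel_measurable borel" "\<phi> \<in> borel_measurable borel"
    and nn: "\<And>j r. 0 \<le> \<phi> r * f j r" "\<And>r. 0 \<le> \<phi> r * g r" and lim: "AE r in lborel. (\<lambda>j. f j r) \<longlonglongrightarrow> g r"
    and i: "\<And>j. integrable lborel (\<lambda>r. \<phi> r * f j r)" and b: "eventually (\<lambda>j. (LBINT r. \<phi> r * f j r) \<le> C) sequentially"
  shows "integrable lborel (\<lambda>r. \<phi> r * g r)" "(LBINT r. \<phi> r * g r) \<le> C"
proof -
  note [measurable] = m
  obtain j0 where j0: "\<And>j. j0 \<le> j \<Longrightarrow> (LBINT r. \<phi> r * f j r) \<le> C" using b unfolding eventually_sequentially by blast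
  have "0 \<le> (LBINT r. \<phi> r * f j0 r)" using nn(1) by (rule Bochner_Integration.integral_nonneg)
  hence C0: "0 \<le> C" using j0[OF order_refl] by linarith
  have "(\<integral>\<^sup>+r. ennreal (\<phi> r * g r) \<partial>lborel) = (\<integral>\<^sup>+r. liminf (\<lambda>j. ennreal (\<phi> r * f j r)) \<partial>lborel)"
  proof (rule nn_integral_cong_AE)
    show "AE r in lborel. ennreal (\<phi> r * g r) = liminf (\<lambda>j. ennreal (\<phi> r * f j r))"
      using lim
    proof eventually_elim
      case (elim r)
      have "(\<lambda>j. ennreal (\<phi> r * f j r)) \<longlonglongrightarrow> ennreal (\<phi> r * g r)"
        using elim by (intro tendsto_ennrealI tendsto_mult_left)
      thus ?case by (intro lim_imp_Liminf[symmetric]) auto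
    qed
  qed
  also have "\<dots> \<le> liminf (\<lambda>j. \<integral>\<^sup>+r. ennreal (\<phi> r * f j r) \<partial>lborel)"
    by (rule nn_integral_liminf) measurable
  also have "\<dots> \<le> liminf (\<lambda>j :: nat. ennreal C)"
  proof (rule Liminf_mono)
    show "eventually (\<lambda>j. (\<integral>\<^sup>+r. ennreal (\<phi> r * f j r) \<partial>lborel) \<le> ennreal C) sequentially"
      using b
    proof eventually_elim
      case (elim j)
      have "(\<integral>\<^sup>+r. ennreal (\<phi> r * f j r) \<partial>lborel) = ennreal (LBINT r. \<phi> r * f j r)"
        by (rule nn_integral_eq_integral[OF i]) (simp add: nn)
      thus ?case using elim by (simp add: ennreal_leI)
    qed
  qed
  also have "\<dots> = ennreal C" by (simp add: Liminf_const)
  finally have fin: "(\<integral>\<^sup>+r. ennreal (\<phi> r * g r) \<partial>lborel) \<le> ennreal C" .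
  show "integrable lborel (\<lambda>r. \<phi> r * g r)" "(LBINT r. \<phi> r * g r) \<le> C"
    by (rule nn_integral_bound_imp_integrable[OF _ nn(2) fin C0]; measurable)+
qed

text \<open>With the value 0 where the limit fails to exist, the limit inherits bounds and vanishing
  on the negative axis at every point, as \<open>dens\<close> demands, and not merely almost
  everywhere.\<close>

definition plim :: "(nat \<Rightarrow> real \<Rightarrow> real) \<Rightarrow> real \<Rightarrow> real" where
  "plim f r = (if convergent (\<lambda>j. f j r) then lim (\<lambda>j. f j r) else 0)"

lemma plim_meas:
  assumes m: "\<And>j. f j \<in> borel_measurable borel"
  shows "plim f \<in> borel_measurable borel"
proof -
  have c: "{r \<in> space borel. convergent (\<lambda>j. f j r)} \<in> sets borel"
    unfolding Cauchy_convergent_iff[symmetric] by (rule sets_Collect_Cauchy[OF m])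
  show ?thesis unfolding plim_def[abs_def]
    by (rule measurable_If[OF borel_measurable_lim_metric[OF m] measurable_const c]) simp
qed

lemma plim_cases: "(\<lambda>j. f j r) \<longlonglongrightarrow> plim f r \<or> plim f r = 0"
  by (auto simp: plim_def convergent_LIMSEQ_iff)

lemma plim_le:
  assumes "eventually (\<lambda>j. f j r \<le> M) sequentially" "0 \<le> M" shows "plim f r \<le> M"
proof (cases "plim f r = 0")
  case False
  hence "(\<lambda>j. f j r) \<longlonglongrightarrow> plim f r" using plim_cases[of f r] by blast
  from tendsto_upperbound[OF this assms(1)] show ?thesis by simp
qed (use assms in simp)

lemma plim_nonneg:
  assumes "\<And>j. 0 \<le> f j r" shows "0 \<le> plim f r"
proof (cases "plim f r = 0")
  case False
  hence "(\<lambda>j. f j r) \<longlonglongrightarrow> plim f r" using plim_cases[of f r] by blast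
  from LIMSEQ_le_const[OF this, of 0] show ?thesis using assms by blast
qed simp

text \<open>The geometric rate makes the L^1 increments summable, so the whole sequence converges
  almost everywhere without passing to a subsequence. The same sequence then serves every time
  t.\<close>

lemma plim_dens:
  assumes f: "\<And>j. dens (f j)" and M: "\<And>j r. f j r \<le> M" and B: "\<And>j. mom 6 (f j) \<le> B"
    and E: "0 \<le> E" and cauchy: "\<And>i j. j \<le> i \<Longrightarrow> ldist (f j) (f i) \<le> E / 2 ^ j"
  shows "dens (plim f)" "mom 6 (plim f) \<le> B" "AE r in lborel. (\<lambda>j. f j r) \<longlonglongrightarrow> plim f r"
    "ldist (f j) (plim f) \<le> E / 2 ^ j"
proof -
  note [measurable] = dens_meas[OF f]
  have [measurable]: "plim f \<in> borel_measurable borel" by (rule plim_meas[OF dens_meas[OF f]])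
  have M0: "0 \<le> M" using M[of 0 0] dens_nonneg[OF f, of 0 0] by linarith
  have p0: "0 \<le> plim f r" for r
    by (rule plim_nonneg) (rule dens_nonneg[OF f])
  have pM: "plim f r \<le> M" for r by (rule plim_le) (use M M0 in auto)
  have pz: "plim f r = 0" if "r \<le> 0" for r
    using dens_zero[OF f that] by (simp add: plim_def)
  have i: "integrable lborel (\<lambda>r. \<bar>f j r - f i r\<bar>)" for i j using dens_integrable_self[OF dens_diff[OF f f]] .
  have "(\<integral>\<^sup>+r. (\<Sum>j. ennreal \<bar>f j r - f (Suc j) r\<bar>) \<partial>lborel) = (\<Sum>j. \<integral>\<^sup>+r. ennreal \<bar>f j r - f (Suc j) r\<bar> \<partial>lborel)"
    by (rule nn_integral_suminf) measurable
  also have "\<dots> \<le> (\<Sum>j. ennreal (E * (1 / 2) ^ j))"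
  proof (rule suminf_le)
    fix j
    have "(\<integral>\<^sup>+r. ennreal \<bar>f j r - f (Suc j) r\<bar> \<partial>lborel) = ennreal (ldist (f j) (f (Suc j)))"
      unfolding ldist_def by (rule nn_integral_eq_integral[OF i]) simp
    also have "\<dots> \<le> ennreal (E * (1 / 2) ^ j)"
      using cauchy[of j "Suc j"] by (intro ennreal_leI) (simp add: power_divide)
    finally show "(\<integral>\<^sup>+r. ennreal \<bar>f j r - f (Suc j) r\<bar> \<partial>lborel) \<le> ennreal (E * (1 / 2) ^ j)" .
  qed auto
  also have "\<dots> = ennreal (\<Sum>j. E * (1 / 2) ^ j)"
    using E by (intro suminf_ennreal2) (auto intro!: summable_mult summable_geometric)
  also have "\<dots> < \<infinity>" by simp
  finally have "AE r in lborel. (\<Sum>j. ennreal \<bar>f j r - f (Suc j) r\<bar>) \<noteq> \<infinity>"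
    by (intro nn_integral_noteq_infinite) auto
  thus lim: "AE r in lborel. (\<lambda>j. f j r) \<longlonglongrightarrow> plim f r"
  proof eventually_elim
    case (elim r)
    have "summable (\<lambda>j. \<bar>f j r - f (Suc j) r\<bar>)"
      by (rule summable_suminf_not_top) (use elim in \<open>simp_all add: infinity_ennreal_def\<close>)
    hence "summable (\<lambda>j. f (Suc j) r - f j r)"
      by (subst (asm) abs_minus_commute) (rule summable_rabs_cancel)
    hence "convergent (\<lambda>n. \<Sum>j<n. f (Suc j) r - f j r)" by (simp add: summable_iff_convergent)
    hence "convergent (\<lambda>n. f n r - f 0 r)" by (simp only: sum_lessThan_telescope[of "\<lambda>j. f j r"])
    then obtain l where "(\<lambda>n. f n r - f 0 r) \<longlonglongrightarrow> l" unfolding convergent_def by blast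
    from tendsto_add[OF this tendsto_const[of "f 0 r"]] have "(\<lambda>n. f n r) \<longlonglongrightarrow> l + f 0 r" by simp
    hence "convergent (\<lambda>n. f n r)" by (rule convergentI)
    thus ?case by (simp add: plim_def convergent_LIMSEQ_iff)
  qed
  have w: "0 \<le> (1 + r) ^ 6 * f j r" "0 \<le> (1 + r) ^ 6 * plim f r" for j r
    using dens_nonneg[OF f] p0 by auto
  have F: "integrable lborel (\<lambda>r. (1 + r) ^ 6 * plim f r)" "(LBINT r. (1 + r) ^ 6 * plim f r) \<le> B"
  proof -
    have m: "eventually (\<lambda>j. (LBINT r. (1 + r) ^ 6 * f j r) \<le> B) sequentially"
      using B by (intro always_eventually allI) (simp add: mom_def)
    have i6: "integrable lborel (\<lambda>r. (1 + r) ^ 6 * f j r)" for j by (rule mom_integrable[OF f]) simp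
    note F = moment_fatou[where f = f and g = "plim f" and \<phi> = "\<lambda>r. (1 + r) ^ 6" and C = B, OF _ _ _ w lim i6 m]
    show "integrable lborel (\<lambda>r. (1 + r) ^ 6 * plim f r)" by (rule F(1)) measurable
    show "(LBINT r. (1 + r) ^ 6 * plim f r) \<le> B" by (rule F(2)) measurable
  qed
  show d: "dens (plim f)" unfolding dens_def using p0 pM pz F(1) by auto
  show "mom 6 (plim f) \<le> B" using F(2) by (simp add: mom_def)
  have "AE r in lborel. (\<lambda>i. \<bar>f j r - f i r\<bar>) \<longlonglongrightarrow> \<bar>f j r - plim f r\<bar>"    using lim by eventually_elim (intro tendsto_rabs tendsto_diff tendsto_const)
  hence lim': "AE r in lborel. (\<lambda>i. \<bar>f j r - f i r\<bar>) \<longlonglongrightarrow> \<bar>f j r - plim f r\<bar>" .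
  have ev: "eventually (\<lambda>i. (LBINT r. 1 * \<bar>f j r - f i r\<bar>) \<le> E / 2 ^ j) sequentially"
    using eventually_ge_at_top[of j] by eventually_elim (use cauchy[of j] in \<open>simp add: ldist_def\<close>)
  have i': "integrable lborel (\<lambda>r. 1 * \<bar>f j r - f k r\<bar>)" for k using i by simp
  have "(LBINT r. 1 * \<bar>f j r - plim f r\<bar>) \<le> E / 2 ^ j"
    by (rule moment_fatou(2)[where f = "\<lambda>i r. \<bar>f j r - f i r\<bar>" and g = "\<lambda>r. \<bar>f j r - plim f r\<bar>" and \<phi> = "\<lambda>_. 1",
      OF _ _ _ _ _ lim' i' ev]) simp_all
  thus "ldist (f j) (plim f) \<le> E / 2 ^ j" by (simp add: ldist_def)
qed

lemma ldist_eq_0_iff_AE: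
  assumes "dens u" "dens v" shows "ldist u v = 0 \<longleftrightarrow> (AE r in lborel. u r = v r)"
proof -
  have "ldist u v = 0 \<longleftrightarrow> (AE r in lborel. \<bar>u r - v r\<bar> = 0)"
    unfolding ldist_def
    by (subst integral_nonneg_eq_0_iff_AE[of lborel "\<lambda>r. \<bar>u r - v r\<bar>", OF dens_integrable_self[OF dens_diff[OF assms]]])
      (rule AE_I2, rule abs_ge_zero, rule refl)
  also have "\<dots> \<longleftrightarrow> (AE r in lborel. u r = v r)"
    unfolding abs_eq_0 right_minus_eq ..
  finally show ?thesis .
qed

lemma approx_solution_path:
  assumes u: "\<And>t. 0 \<le> t \<Longrightarrow> dens (u t) \<and> mom 6 (u t) \<le> B" and K: "0 \<le> K"
    and lip: "\<And>s t. 0 \<le> s \<Longrightarrow> s \<le> t \<Longrightarrow> ldist (u s) (u t) \<le> K * (t - s)"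
    and step: "\<And>t. 0 \<le> t \<Longrightarrow> \<exists>b \<delta>. 0 < \<delta> \<and> (\<forall>h r. 0 \<le> h \<longrightarrow> h < \<delta> \<longrightarrow> u (t + h) r = u t r + h * b r) \<and> integrable lborel b \<and> (\<forall>r\<le>0. b r = 0)
         \<and> integrable lborel (\<lambda>r. (1 + r) * \<bar>b r - coll (u t) r\<bar>)
         \<and> (LBINT r. 4 * (1 + r) * \<bar>b r - coll (u t) r\<bar>) \<le> \<epsilon>"
  shows "approx_solution B (\<lambda>_. 1) \<epsilon> T u"
  unfolding approx_solution_def
proof (intro conjI ballI)
  fix t assume t: "t \<in> {0..T}"
  show "dens (u t)" "mom 6 (u t) \<le> B" using u t by auto
  have le: "ldist (u s) (u t) \<le> K * \<bar>s - t\<bar>" if "0 \<le> s" for s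
    using lip[of s t] lip[of t s] that t ldist_commute[of "u s" "u t"] by (cases "s \<le> t") auto
  have "((\<lambda>s. K * \<bar>s - t\<bar>) \<longlongrightarrow> K * \<bar>t - t\<bar>) (at t within {0..T})" by (intro tendsto_intros)
  hence "((\<lambda>s. K * \<bar>s - t\<bar>) \<longlongrightarrow> 0) (at t within {0..T})" by simp
  thus "((\<lambda>s. ldist (u s) (u t)) \<longlongrightarrow> 0) (at t within {0..T})"
    by (rule Lim_null_comparison[rotated]) (use le in \<open>auto simp: eventually_at_filter ldist_nonneg\<close>)
next
  fix t assume t: "t \<in> {0<..<T}"
  hence "0 \<le> t" by simp
  from step[OF this] obtain b \<delta> where b: "0 < \<delta>" "\<forall>h r. 0 \<le> h \<longrightarrow> h < \<delta> \<longrightarrow> u (t + h) r = u t r + h * b r" "integrable lborel b" "\<forall>r\<le>0. b r = 0"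
       "integrable lborel (\<lambda>r. (1 + r) * \<bar>b r - coll (u t) r\<bar>)"
       "(LBINT r. 4 * (1 + r) * \<bar>b r - coll (u t) r\<bar>) \<le> \<epsilon>"
    by (elim exE conjE) (rule that)
  have "eventually (\<lambda>h. h < \<delta>) (at_right 0)" using b(1) by (intro order_tendstoD(2)[OF tendsto_ident_at]) 
  moreover have "eventually (\<lambda>h. 0 < h) (at_right (0 :: real))" by (rule eventually_at_right_less)
  ultimately have "eventually (\<lambda>h. (LBINT r. \<bar>u (t + h) r - u t r - h * b r\<bar>) / h = 0) (at_right 0)"
  proof eventually_elim
    case (elim h)
    have "\<bar>u (t + h) r - u t r - h * b r\<bar> = 0" for r using b(2)[rule_format, of h r] elim by simp
    hence "(LBINT r. \<bar>u (t + h) r - u t r - h * b r\<bar>) = 0" by (rule integral_zero_fun)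
    thus ?case by simp
  qed
  hence "((\<lambda>h. (LBINT r. \<bar>u (t + h) r - u t r - h * b r\<bar>) / h) \<longlongrightarrow> 0) (at_right 0)"
    by (rule tendsto_eventually)
  thus "\<exists>b. integrable lborel b \<and> (\<forall>r\<le>0. b r = 0)
          \<and> ((\<lambda>h. (LBINT r. \<bar>u (t + h) r - u t r - h * b r\<bar>) / h) \<longlongrightarrow> 0) (at_right 0)
          \<and> integrable lborel (\<lambda>r. (1 + r) * \<bar>b r - 1 * coll (u t) r\<bar>)
          \<and> (LBINT r. 4 * (1 + r) * \<bar>b r - 1 * coll (u t) r\<bar>) \<le> \<epsilon>"
    unfolding mult_1 by (intro exI[of _ b] conjI b)
qed

text \<open>The error is measured with the weight 1 + r, the norm in which initial data enter the
  stability estimate.\<close>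

lemma initial_truncation:
  assumes u: "dens u" and M: "\<And>r. u r \<le> M" and B: "mom 6 u \<le> B" and n: "1 \<le> n"
  shows "mom 1 (\<lambda>r. \<bar>indicator {1 / n..n} r * u r - u r\<bar>) \<le> (2 * M + B) / n"
    and "dens (\<lambda>r. indicator {1 / n..n} r * u r)"
proof -
  have M0: "0 \<le> M" using M[of 0] dens_nonneg[OF u, of 0] by linarith
  note [measurable] = dens_meas[OF u]
  have i6: "integrable lborel (\<lambda>r. (1 + r) ^ 6 * u r)" using mom_integrable[OF u] by simp
  have "integrable lborel (\<lambda>r. (1 + r) ^ 6 * (indicator {1 / n..n} r * u r))"
    using integrable_mult_indicator[OF _ i6, of "{1 / n..n}"] by (simp add: mult_ac)
  moreover have "indicator {1 / n..n} r * u r \<le> M" for r using M[of r] M0 by (auto simp: indicator_def)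
  ultimately show d: "dens (\<lambda>r. indicator {1 / n..n} r * u r)"
    using dens_nonneg[OF u] dens_zero[OF u] unfolding dens_def by auto
  have le: "(1 + r) ^ 1 * \<bar>indicator {1 / n..n} r * u r - u r\<bar> \<le> 2 * M * indicator {0..1 / n} r + (1 / n) * ((1 + r) ^ 6 * u r)" for r
  proof -
    have nn: "0 \<le> 2 * M * indicator {0..1 / n} r" "0 \<le> (1 / n) * ((1 + r) ^ 6 * u r)" for r
      using M0 n dens_nonneg[OF u, of r] by auto
    consider "r \<le> 0" | "0 < r" "r < 1 / n" | "1 / n \<le> r" "r \<le> n" | "n < r" by linarith
    thus ?thesis
    proof cases
      case 1 thus ?thesis using nn[of r] dens_zero[OF u 1] by simp
    next
      case 2
      have "r \<le> 1" using 2 n by (auto intro: order_trans[OF less_imp_le])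
      hence "(1 + r) ^ 1 * \<bar>indicator {1 / n..n} r * u r - u r\<bar> \<le> 2 * M"
        using 2 M[of r] M0 dens_nonneg[OF u, of r] by (intro mult_mono) auto
      thus ?thesis using 2 nn(2)[of r] by simp
    next
      case 3 thus ?thesis using nn[of r] by simp
    next
      case 4
      have "(1 + r) * n \<le> (1 + r) * (1 + r)" using 4 n by (intro mult_left_mono) auto
      also have "\<dots> = (1 + r) ^ 2" by (simp add: power2_eq_square)
      also have "\<dots> \<le> (1 + r) ^ 6" using 4 n by (intro power_increasing) auto
      finally have "(1 + r) \<le> (1 / n) * (1 + r) ^ 6" using n by (simp add: pos_le_divide_eq)
      from mult_right_mono[OF this dens_nonneg[OF u, of r]] show ?thesis
        using 4 nn(1)[of r] dens_nonneg[OF u, of r] by (simp add: mult.assoc)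
    qed
  qed
  have "mom 1 (\<lambda>r. \<bar>indicator {1 / n..n} r * u r - u r\<bar>) \<le> (LBINT r. 2 * M * indicator {0..1 / n} r + (1 / n) * ((1 + r) ^ 6 * u r))"
    unfolding mom_def
    by (rule integral_mono[OF mom_integrable[OF dens_diff[OF d u]] _ le], simp)
      (intro Bochner_Integration.integrable_add integrable_mult_right integrable_indicator_Icc i6)
  also have "\<dots> = (LBINT r. 2 * M * indicator {0..1 / n} r) + (LBINT r. (1 / n) * ((1 + r) ^ 6 * u r))"
    by (intro Bochner_Integration.integral_add integrable_mult_right integrable_indicator_Icc i6)
  also have "\<dots> = 2 * M * (1 / n) + (1 / n) * mom 6 u" using n by (simp add: mom_def)
  also have "\<dots> \<le> 2 * M * (1 / n) + (1 / n) * B" using B n by (intro add_left_mono mult_left_mono) auto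
  finally show "mom 1 (\<lambda>r. \<bar>indicator {1 / n..n} r * u r - u r\<bar>) \<le> (2 * M + B) / n"
    by (simp add: add_divide_distrib)
qed

lemma lipschitz_imp_continuous_on:
  fixes y :: "real \<Rightarrow> real"
  assumes L: "0 \<le> L" and le: "\<And>s t. s \<in> S \<Longrightarrow> t \<in> S \<Longrightarrow> s \<le> t \<Longrightarrow> \<bar>y s - y t\<bar> \<le> L * (t - s)"
  shows "continuous_on S y"
proof -
  have "L-lipschitz_on S y"
  proof (rule lipschitz_onI[OF _ L])
    fix s t assume st: "s \<in> S" "t \<in> S"
    show "dist (y s) (y t) \<le> L * dist s t"
      using le[OF st] le[OF st(2,1)] by (cases "s \<le> t") (auto simp: dist_real_def abs_minus_commute)
  qed
  thus ?thesis by (rule lipschitz_on_continuous_on)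
qed

text \<open>The Gronwall lemma with rate 0, applied to the L^1 norm of u (c + s) - u c - s b. This
  bypasses integrals of L^1-valued functions, and the resulting inequality passes to limits.\<close>

lemma L1_path_mean_value:
  assumes u: "\<And>t. 0 \<le> t \<Longrightarrow> dens (u t)" and K: "0 \<le> K"
    and lip: "\<And>s t. 0 \<le> s \<Longrightarrow> s \<le> t \<Longrightarrow> ldist (u s) (u t) \<le> K * (t - s)"
    and c: "0 \<le> c" "c \<le> d" and b: "integrable lborel b" and e: "0 \<le> \<epsilon>"
    and step: "\<And>t. c \<le> t \<Longrightarrow> t \<le> d \<Longrightarrow> \<exists>\<beta> \<delta>. 0 < \<delta> \<and> (\<forall>h r. 0 \<le> h \<longrightarrow> h < \<delta> \<longrightarrow> u (t + h) r = u t r + h * \<beta> r)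
        \<and> integrable lborel \<beta> \<and> (LBINT r. \<bar>\<beta> r - b r\<bar>) \<le> \<epsilon>"
  shows "(LBINT r. \<bar>u d r - u c r - (d - c) * b r\<bar>) \<le> (d - c) * \<epsilon>"
proof -
  define y where "y s = (LBINT r. \<bar>u (c + s) r - u c r - s * b r\<bar>)" for s
  have iu: "integrable lborel (u t)" if "0 \<le> t" for t using u[OF that] by (rule dens_integrable_self)
  have iy: "integrable lborel (\<lambda>r. u (c + s) r - u c r - s * b r)" if "0 \<le> s" for s
    using that c by (intro Bochner_Integration.integrable_diff integrable_mult_right iu b) auto
  have "y (d - c) \<le> exp (0 * (d - c)) * (y 0 + \<epsilon> * (d - c))"
  proof (rule dini_gronwall[where T = "d - c"])
    show "continuous_on {0..d - c} y"
    proof (rule lipschitz_imp_continuous_on[where L = "K + (LBINT r. \<bar>b r\<bar>)"])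
      show "0 \<le> K + (LBINT r. \<bar>b r\<bar>)" using K by simp
      fix s t assume st: "s \<in> {0..d - c}" "t \<in> {0..d - c}" "s \<le> t"
      have 0: "0 \<le> s" "0 \<le> t" using st by auto
      have "\<bar>y s - y t\<bar> = \<bar>LBINT r. \<bar>u (c + s) r - u c r - s * b r\<bar> - \<bar>u (c + t) r - u c r - t * b r\<bar>\<bar>"
        unfolding y_def
        by (subst Bochner_Integration.integral_diff[OF integrable_abs[OF iy[OF 0(1)]] integrable_abs[OF iy[OF 0(2)]]]) (rule refl)
      also have "\<dots> \<le> (LBINT r. \<bar>\<bar>u (c + s) r - u c r - s * b r\<bar> - \<bar>u (c + t) r - u c r - t * b r\<bar>\<bar>)"
        by (rule integral_abs_bound)
      also have "\<dots> \<le> (LBINT r. \<bar>u (c + s) r - u (c + t) r\<bar> + (t - s) * \<bar>b r\<bar>)"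
      proof (rule integral_mono)
        show "integrable lborel (\<lambda>r. \<bar>\<bar>u (c + s) r - u c r - s * b r\<bar> - \<bar>u (c + t) r - u c r - t * b r\<bar>\<bar>)"
          by (rule integrable_abs[OF Bochner_Integration.integrable_diff[OF integrable_abs[OF iy[OF 0(1)]] integrable_abs[OF iy[OF 0(2)]]]])
        show "integrable lborel (\<lambda>r. \<bar>u (c + s) r - u (c + t) r\<bar> + (t - s) * \<bar>b r\<bar>)"
          using 0 c by (intro Bochner_Integration.integrable_add integrable_abs Bochner_Integration.integrable_diff integrable_mult_right iu b) auto
        fix r
        have "\<bar>\<bar>x - p\<bar> - \<bar>x' - p'\<bar>\<bar> \<le> \<bar>x - x'\<bar> + \<bar>p' - p\<bar>" for x x' p p' :: real by linarith
        from this[of "u (c + s) r" "u c r + s * b r" "u (c + t) r" "u c r + t * b r"]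
        have "\<bar>\<bar>u (c + s) r - u c r - s * b r\<bar> - \<bar>u (c + t) r - u c r - t * b r\<bar>\<bar> \<le> \<bar>u (c + s) r - u (c + t) r\<bar> + \<bar>(t - s) * b r\<bar>"
          by (simp add: algebra_simps)
        also have "\<bar>(t - s) * b r\<bar> = (t - s) * \<bar>b r\<bar>" using st by (simp add: abs_mult)
        finally show "\<bar>\<bar>u (c + s) r - u c r - s * b r\<bar> - \<bar>u (c + t) r - u c r - t * b r\<bar>\<bar> \<le> \<bar>u (c + s) r - u (c + t) r\<bar> + (t - s) * \<bar>b r\<bar>" .
      qed
      also have "\<dots> = ldist (u (c + s)) (u (c + t)) + (t - s) * (LBINT r. \<bar>b r\<bar>)"
        using iu[of "c + s"] iu[of "c + t"] 0 c b by (simp add: ldist_def)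
      also have "\<dots> \<le> K * (t - s) + (t - s) * (LBINT r. \<bar>b r\<bar>)"
        using lip[of "c + s" "c + t"] st 0 c by simp
      finally show "\<bar>y s - y t\<bar> \<le> (K + (LBINT r. \<bar>b r\<bar>)) * (t - s)" by (simp add: algebra_simps)
    qed
    show "0 \<le> y 0" by (simp add: y_def)
    fix t \<eta> :: real assume t: "0 < t" "t < d - c" and \<eta>: "0 < \<eta>"
    have ct: "c \<le> c + t" "c + t \<le> d" "0 \<le> c + t" using t c by auto
    from step[OF ct(1,2)] obtain \<beta> \<delta> where \<beta>: "0 < \<delta>" "\<forall>h r. 0 \<le> h \<longrightarrow> h < \<delta> \<longrightarrow> u (c + t + h) r = u (c + t) r + h * \<beta> r"
        "integrable lborel \<beta>" "(LBINT r. \<bar>\<beta> r - b r\<bar>) \<le> \<epsilon>"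
      by (elim exE conjE) (rule that)
    have "eventually (\<lambda>h. h < \<delta>) (at_right 0)" using \<beta>(1) by (intro order_tendstoD(2)[OF tendsto_ident_at])
    moreover have "eventually (\<lambda>h. 0 < h) (at_right (0 :: real))" by (rule eventually_at_right_less)
    ultimately show "eventually (\<lambda>h. y (t + h) \<le> y t + h * (0 * y t + \<epsilon> + \<eta>)) (at_right 0)"
    proof eventually_elim
      case (elim h)
      have i\<beta>: "integrable lborel (\<lambda>r. \<bar>\<beta> r - b r\<bar>)" using \<beta>(3) b by simp
      have "y (t + h) \<le> (LBINT r. \<bar>u (c + t) r - u c r - t * b r\<bar> + h * \<bar>\<beta> r - b r\<bar>)"
        unfolding y_def
      proof (rule integral_mono)
        show "integrable lborel (\<lambda>r. \<bar>u (c + (t + h)) r - u c r - (t + h) * b r\<bar>)"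
          using t elim by (intro integrable_abs iy) auto
        show "integrable lborel (\<lambda>r. \<bar>u (c + t) r - u c r - t * b r\<bar> + h * \<bar>\<beta> r - b r\<bar>)"
          using t by (intro Bochner_Integration.integrable_add integrable_mult_right i\<beta> integrable_abs iy) auto
        fix r
        have "u (c + (t + h)) r - u c r - (t + h) * b r = (u (c + t) r - u c r - t * b r) + h * (\<beta> r - b r)"
        proof -
          have s: "u (c + (t + h)) r = u (c + t) r + h * \<beta> r" using \<beta>(2)[rule_format, of h r] elim by (simp add: add.assoc)
          show ?thesis unfolding s by (simp add: algebra_simps)
        qed
        hence "\<bar>u (c + (t + h)) r - u c r - (t + h) * b r\<bar> \<le> \<bar>u (c + t) r - u c r - t * b r\<bar> + \<bar>h * (\<beta> r - b r)\<bar>"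
          by (simp only: abs_triangle_ineq)
        thus "\<bar>u (c + (t + h)) r - u c r - (t + h) * b r\<bar> \<le> \<bar>u (c + t) r - u c r - t * b r\<bar> + h * \<bar>\<beta> r - b r\<bar>"
          using elim by (simp add: abs_mult)
      qed
      also have "\<dots> = y t + h * (LBINT r. \<bar>\<beta> r - b r\<bar>)"
        unfolding y_def using iy[of t] t i\<beta> by simp
      also have "\<dots> \<le> y t + h * (\<epsilon> + \<eta>)" using \<beta>(4) elim \<eta> by (intro add_left_mono mult_left_mono) auto
      finally show ?case by simp
    qed
  qed (use e c in auto)
  thus ?thesis using c by (simp add: y_def mult.commute)
qed

section \<open>Existence for the autonomous equation\<close>

lemma mom_triangle:
  assumes "dens u" "dens v" "dens w" "k \<le> 6"
  shows "mom k (\<lambda>r. \<bar>u r - w r\<bar>) \<le> mom k (\<lambda>r. \<bar>u r - v r\<bar>) + mom k (\<lambda>r. \<bar>v r - w r\<bar>)"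
proof -
  note i = mom_integrable[OF dens_diff[OF assms(1,2)] assms(4)] mom_integrable[OF dens_diff[OF assms(2,3)] assms(4)]
    mom_integrable[OF dens_diff[OF assms(1,3)] assms(4)]
  have "mom k (\<lambda>r. \<bar>u r - w r\<bar>) \<le> (LBINT r. (1 + r) ^ k * \<bar>u r - v r\<bar> + (1 + r) ^ k * \<bar>v r - w r\<bar>)"
    unfolding mom_def
  proof (rule integral_mono[OF i(3)])
    fix r
    show "(1 + r) ^ k * \<bar>u r - w r\<bar> \<le> (1 + r) ^ k * \<bar>u r - v r\<bar> + (1 + r) ^ k * \<bar>v r - w r\<bar>"
    proof (cases "0 < r")
      case True
      have "\<bar>u r - w r\<bar> \<le> \<bar>u r - v r\<bar> + \<bar>v r - w r\<bar>" by linarith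
      from mult_left_mono[OF this, of "(1 + r) ^ k"] show ?thesis using True by (simp add: distrib_left)
    qed (simp add: dens_zero[OF assms(1)] dens_zero[OF assms(2)] dens_zero[OF assms(3)])
  qed (use i in simp)
  thus ?thesis using i by (simp add: mom_def)
qed

text \<open>The inequality 4 a^3 b <= 3 a^4 + b^4 with a^4 = h3 and b^4 = r^4 / 30. It is the origin
  of the powers 3/4 and 1/4 in the threshold.\<close>

lemma am_gm_level:
  fixes h3 M r m :: real
  assumes h: "0 < h3" and M: "0 \<le> M" and r: "0 < r" and m: "m \<le> M * h3 powr (3 / 4) * (1 / 30) powr (1 / 4)"
  shows "4 * r * m \<le> M * (3 * h3 + r ^ 4 / 30)"
proof -
  define a b where "a = h3 powr (1 / 4)" and "b = (1 / 30) powr (1 / 4) * r"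
  have b0: "0 \<le> b" using r by (simp add: b_def)
  have a4: "a ^ 4 = h3" and a3: "a ^ 3 = h3 powr (3 / 4)" using h by (simp_all add: a_def powr_power)
  have "((1 / 30 :: real) powr (1 / 4)) ^ 4 = 1 / 30" by (simp add: powr_power)
  hence b4: "b ^ 4 = r ^ 4 / 30" by (simp add: b_def power_mult_distrib)
  \<comment> \<open>Factorization of 3 a^4 + b^4 - 4 a^3 b, which has a double zero at a =
    b.\<close>
  have "0 \<le> (a - b)\<^sup>2 * (3 * a\<^sup>2 + 2 * a * b + b\<^sup>2)" using b0 by (intro mult_nonneg_nonneg add_nonneg_nonneg) (auto simp: a_def)
  also have "\<dots> = 3 * a ^ 4 + b ^ 4 - 4 * a ^ 3 * b" by (simp add: power2_eq_square eval_nat_numeral algebra_simps)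
  finally have "4 * a ^ 3 * b \<le> 3 * h3 + r ^ 4 / 30" by (simp add: a4 b4)
  from mult_left_mono[OF this M] have "M * (4 * a ^ 3 * b) \<le> M * (3 * h3 + r ^ 4 / 30)" .
  moreover have "4 * r * m \<le> 4 * r * (M * h3 powr (3 / 4) * (1 / 30) powr (1 / 4))" using m r by (intro mult_left_mono) auto
  moreover have "4 * r * (M * h3 powr (3 / 4) * (1 / 30) powr (1 / 4)) = M * (4 * a ^ 3 * b)"
    by (simp add: a3 b_def)
  ultimately show ?thesis by linarith
qed

text \<open>The equation is delivered as a mean value inequality, the form that survives L^1 limits.
  In the last clause the level \<open>M'\<close> is conditional on a second moment bound for the
  limit, the fourth line-moment of f, because that bound becomes known only after the limit is
  recognized as a solution.\<close>

theorem autonomous_solution_exists: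
  assumes C: "eighth_moment_constants C8 c8" "0 < C8" "0 < c8" and h3: "0 < h3" and h8: "2 * h_star C8 c8 h3 \<le> h8"
    and M: "60 * (h3 + h8) + 1 \<le> M"
    and u0: "dens u0" "\<And>r. u0 r \<le> M" "(LBINT r. r * u0 r) = h3" "(LBINT r. r ^ 6 * u0 r) \<le> h8"
  defines "B \<equiv> 64 * (M + h8)"
  shows "\<exists>U. (\<forall>t\<ge>0. dens (U t) \<and> (\<forall>r. U t r \<le> M) \<and> (LBINT r. r * U t r) = h3 \<and> (LBINT r. r ^ 6 * U t r) \<le> h8)
    \<and> (AE r in lborel. U 0 r = u0 r)
    \<and> (\<forall>s t. 0 \<le> s \<longrightarrow> s \<le> t \<longrightarrow> ldist (U s) (U t) \<le> (22 * B + 3) * B * (t - s))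
    \<and> (\<forall>c d b \<sigma>. 0 \<le> c \<longrightarrow> c \<le> d \<longrightarrow> integrable lborel b \<longrightarrow> (\<forall>\<xi>\<in>{c..d}. (LBINT r. \<bar>coll (U \<xi>) r - b r\<bar>) \<le> \<sigma>)
         \<longrightarrow> (LBINT r. \<bar>U d r - U c r - (d - c) * b r\<bar>) \<le> (d - c) * \<sigma>)
    \<and> (\<forall>T m4 M'. 0 < m4 \<longrightarrow> (\<forall>r. u0 r \<le> M') \<longrightarrow> (\<forall>t\<in>{0..T}. (LBINT r. r\<^sup>2 * U t r) \<le> m4)
         \<longrightarrow> m4 \<le> M' * h3 powr (3 / 4) * (1 / 30) powr (1 / 4) \<longrightarrow> (\<forall>t\<in>{0..T}. \<forall>r. U t r \<le> M'))"
proof -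
  have hs0: "0 < h_star C8 c8 h3" using C h3 by (simp add: h_star_def)
  have M1: "1 \<le> M" using M h3 h8 hs0 by (simp add: distrib_left)
  have B0: "0 < B" using M1 h8 hs0 by (simp add: B_def)
  \<comment> \<open>Dyadic truncation turns errors of order 1 / n into the geometric rate required
    by \<open>plim_dens\<close>.\<close>
  define n where "n j = (2 :: real) ^ j" for j :: nat
  have n1: "1 \<le> n j" for j by (simp add: n_def)
  have n_mono: "n j \<le> n i" if "j \<le> i" for i j using that by (simp add: n_def)
  define K where "K = trunc_const M B + 1"
  have tc0: "0 \<le> trunc_const M B" using B0 M1 by (simp add: trunc_const_def)
  have K1: "1 \<le> K" using tc0 by (simp add: K_def)
  define v where "v j r = indicator {1 / n j..n j} r * u0 r" for j r
  have u0B: "mom 6 u0 \<le> B" unfolding B_def by (rule mom6_le[OF u0(1,2,4)])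
  have vd: "dens (v j)" and v1: "mom 1 (\<lambda>r. \<bar>v j r - u0 r\<bar>) \<le> (2 * M + B) / n j" for j
    using initial_truncation[OF u0(1,2) u0B n1[of j]] by (auto simp: v_def[abs_def])
  note u0n = dens_nonneg[OF u0(1)]
  have vle: "v j r \<le> u0 r" for j r using u0n[of r] by (auto simp: v_def indicator_def)
  have vE: "v j \<in> euler_set (n j) M h3 h8" for j
  proof -
    have "(LBINT r. r ^ k * v j r) \<le> (LBINT r. r ^ k * u0 r)" if "k \<le> 6" for k
    proof (rule integral_mono[OF pow_integrable[OF vd that] pow_integrable[OF u0(1) that]])
      fix r show "r ^ k * v j r \<le> r ^ k * u0 r"
        using vle[of j r] by (cases "0 < r") (auto simp: dens_zero[OF vd] dens_zero[OF u0(1)] intro!: mult_left_mono)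
    qed
    from this[of 1] this[of 6] have "(LBINT r. r * v j r) \<le> h3" "(LBINT r. r ^ 6 * v j r) \<le> h8" using u0 by auto
    moreover have "0 \<le> v j r" "v j r \<le> M" "r \<notin> {1 / n j..n j} \<Longrightarrow> v j r = 0" for r
      using vle[of j r] u0(2)[of r] dens_nonneg[OF vd, of j r] by (auto simp: v_def)
    ultimately show ?thesis using dens_meas[OF vd] unfolding euler_set_def by blast
  qed
  let ?Q = "\<lambda>j u. u 0 = v j \<and> (\<forall>t\<ge>0. u t \<in> euler_set (n j) M h3 h8)
    \<and> (\<forall>s t. 0 \<le> s \<longrightarrow> s \<le> t \<longrightarrow> ldist (u s) (u t) \<le> (22 * B + 3) * B * (t - s))
    \<and> (\<forall>t\<ge>0. \<exists>b \<delta>. 0 < \<delta> \<and> (\<forall>h r. 0 \<le> h \<longrightarrow> h < \<delta> \<longrightarrow> u (t + h) r = u t r + h * b r) \<and> integrable lborel b \<and> (\<forall>r\<le>0. b r = 0)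
         \<and> integrable lborel (\<lambda>r. (1 + r) * \<bar>b r - coll (u t) r\<bar>)
         \<and> (LBINT r. 4 * (1 + r) * \<bar>b r - coll (u t) r\<bar>) \<le> (trunc_const M B + 1) / n j)
    \<and> (\<forall>t\<ge>0. (LBINT r. r * v j r) - t * (trunc_const M B / n j) \<le> (LBINT r. r * u t r))
    \<and> (\<forall>T M'. (\<forall>r. v j r \<le> M') \<longrightarrow> (\<forall>s\<in>{0..T}. level_condition M' (u s)) \<longrightarrow> (\<forall>s\<in>{0..T}. \<forall>r. u s r \<le> M'))"
  have ex: "\<forall>j. \<exists>u. ?Q j u"
    unfolding B_def by (intro allI euler_path_exists[OF C h3 h8 M n1 vE])
  from choice[OF ex] obtain u where uQ: "\<forall>j. ?Q j (u j)" by (elim exE) (rule that)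
  note q = uQ[THEN spec] and q2 = uQ[THEN spec, THEN conjunct2] 
    and q3 = uQ[THEN spec, THEN conjunct2, THEN conjunct2] and q4 = uQ[THEN spec, THEN conjunct2, THEN conjunct2, THEN conjunct2]
    and q5 = uQ[THEN spec, THEN conjunct2, THEN conjunct2, THEN conjunct2, THEN conjunct2]
  note u = q[THEN conjunct1] q2[THEN conjunct1, THEN spec, THEN mp] q3[THEN conjunct1, THEN spec, THEN spec, THEN mp, THEN mp]
    q4[THEN conjunct1, THEN spec, THEN mp, folded K_def] q5[THEN conjunct1, THEN spec, THEN mp] q5[THEN conjunct2, THEN spec, THEN spec, THEN mp, THEN mp]
  have ud: "dens (u j t)" and uB: "mom 6 (u j t) \<le> B" if "0 \<le> t" for j t
    using euler_set_dens[OF u(2)[OF that] n1] euler_set_mom6[OF u(2)[OF that] n1] by (auto simp: B_def)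
  have L0: "0 \<le> (22 * B + 3) * B" using B0 by simp
  have approx: "approx_solution B (\<lambda>_. 1) (K / n j) T (u j)" for j T
    by (rule approx_solution_path[OF _ L0 u(3) u(4)]) (use ud uB in auto)
  \<comment> \<open>Collects the stability bound for two paths: initial errors
    \<open>(2 * M + B) / n\<close> with factor 4 and defects \<open>K / n\<close>, each counted
    twice since the finer path is no worse than the coarser one.\<close>
  define E where "E t = exp (growth_const B * t) * (8 * (2 * M + B) + 2 * K * t)" for t
  have gc: "0 \<le> growth_const B" using B0 by (simp add: growth_const_def)
  have E0: "0 \<le> E t" if "0 \<le> t" for t using that M1 B0 K1 by (simp add: E_def)
  have E_mono: "E s \<le> E t" if "0 \<le> s" "s \<le> t" for s t
  proof -
    have "exp (growth_const B * s) \<le> exp (growth_const B * t)" using that gc by (simp add: mult_left_mono)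
    moreover have "8 * (2 * M + B) + 2 * K * s \<le> 8 * (2 * M + B) + 2 * K * t" using that K1 by simp
    moreover have "0 \<le> 8 * (2 * M + B) + 2 * K * s" using that M1 B0 K1 by simp
    ultimately show ?thesis unfolding E_def by (intro mult_mono) simp_all
  qed
  have cauchy: "ldist (u j t) (u i t) \<le> E t / 2 ^ j" if "j \<le> i" "0 \<le> t" for i j t
  proof -
    have "ldist (u j t) (u i t) \<le> exp (1 * growth_const B * t) * (4 * mom 1 (\<lambda>r. \<bar>u j 0 r - u i 0 r\<bar>) + (K / n j + K / n i) * t)"
      by (rule approx_solution_stability[OF approx[of j t] approx[of i t]]) (use that K1 in \<open>simp_all add: n_def\<close>)
    also have "\<dots> \<le> exp (1 * growth_const B * t) * ((8 * (2 * M + B) + 2 * K * t) / n j)"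
    proof (intro mult_left_mono)
      have "mom 1 (\<lambda>r. \<bar>u j 0 r - u i 0 r\<bar>) \<le> mom 1 (\<lambda>r. \<bar>v j r - u0 r\<bar>) + mom 1 (\<lambda>r. \<bar>u0 r - v i r\<bar>)"
        unfolding u(1) by (rule mom_triangle[OF vd u0(1) vd]) simp
      also have "\<dots> \<le> (2 * M + B) / n j + (2 * M + B) / n i" using v1[of j] v1[of i] by (simp add: abs_minus_commute)
      also have "(2 * M + B) / n i \<le> (2 * M + B) / n j" using n_mono[OF that(1)] M1 B0 by (intro divide_left_mono) (simp_all add: n_def)
      finally have 1: "mom 1 (\<lambda>r. \<bar>u j 0 r - u i 0 r\<bar>) \<le> 2 * ((2 * M + B) / n j)" by simp
      have "K / n i \<le> K / n j" using n_mono[OF that(1)] K1 by (intro divide_left_mono) (simp_all add: n_def)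
      hence "(K / n j + K / n i) * t \<le> (2 * (K / n j)) * t" using that by (intro mult_right_mono) auto
      hence "4 * mom 1 (\<lambda>r. \<bar>u j 0 r - u i 0 r\<bar>) + (K / n j + K / n i) * t \<le> 8 * ((2 * M + B) / n j) + 2 * (K / n j) * t"
        using 1 by linarith
      also have "\<dots> = (8 * (2 * M + B) + 2 * K * t) / n j" by (simp add: add_divide_distrib)
      finally show "4 * mom 1 (\<lambda>r. \<bar>u j 0 r - u i 0 r\<bar>) + (K / n j + K / n i) * t \<le> (8 * (2 * M + B) + 2 * K * t) / n j" .
    qed simp
    finally show ?thesis by (simp add: E_def n_def)
  qed
  define U where "U t = plim (\<lambda>j. u j t)" for t
  have Up: "dens (U t)" "mom 6 (U t) \<le> B" "AE r in lborel. (\<lambda>j. u j t r) \<longlonglongrightarrow> U t r" "ldist (u j t) (U t) \<le> E t / 2 ^ j"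
    if "0 \<le> t" for t j
    unfolding U_def
    using plim_dens[of "\<lambda>j. u j t" M B "E t", OF ud[OF that] euler_setD(2)[OF u(2)[OF that]] uB[OF that] E0[OF that] cauchy[OF _ that]] by auto
  have UM: "U t r \<le> M" if "0 \<le> t" for t r
    unfolding U_def by (rule plim_le) (use euler_setD(2)[OF u(2)[OF that]] M1 in auto)
  have lim0: "(\<lambda>j. c / 2 ^ j) \<longlonglongrightarrow> 0" for c :: real
  proof -
    have "(\<lambda>j. c * (1 / 2) ^ j) \<longlonglongrightarrow> c * 0" by (intro tendsto_mult tendsto_const LIMSEQ_power_zero) simp
    thus ?thesis by (simp add: power_divide)
  qed
  have small: "\<exists>J. \<forall>j\<ge>J. \<forall>t\<in>{0..T}. ldist (u j t) (U t) < \<delta>" if \<delta>: "0 < \<delta>" for \<delta> T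
  proof (cases "0 \<le> T")
    case True
    from order_tendstoD(2)[OF lim0 \<delta>, of "E T"] obtain J where J: "\<And>j. J \<le> j \<Longrightarrow> E T / 2 ^ j < \<delta>"
      unfolding eventually_sequentially by blast
    have "ldist (u j t) (U t) < \<delta>" if "J \<le> j" "t \<in> {0..T}" for j t
    proof -
      have "ldist (u j t) (U t) \<le> E t / 2 ^ j" using that by (intro Up(4)) auto
      also have "\<dots> \<le> E T / 2 ^ j" using that by (intro divide_right_mono E_mono) auto
      also have "\<dots> < \<delta>" using J that by blast
      finally show ?thesis .
    qed
    thus ?thesis by blast
  qed auto
  have small5: "\<exists>J. \<forall>j\<ge>J. \<forall>t\<in>{0..T}. mom 5 (\<lambda>r. \<bar>u j t r - U t r\<bar>) < \<eta>" if \<eta>: "0 < \<eta>" for \<eta> T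
  proof -
    obtain \<delta> where \<delta>: "0 < \<delta>" "\<And>u v. dens u \<Longrightarrow> dens v \<Longrightarrow> mom 6 u \<le> B \<Longrightarrow> mom 6 v \<le> B \<Longrightarrow> ldist u v < \<delta> \<Longrightarrow> mom 5 (\<lambda>r. \<bar>u r - v r\<bar>) < \<eta>"
      using mom5_small[OF less_imp_le[OF B0] \<eta>] by blast
    obtain J where J: "\<And>j t. J \<le> j \<Longrightarrow> t \<in> {0..T} \<Longrightarrow> ldist (u j t) (U t) < \<delta>" using small[OF \<delta>(1), of T] by blast
    show ?thesis by (intro exI[of _ J] allI impI ballI \<delta>(2) J ud uB Up) auto
  qed
  have smallc: "\<exists>J. \<forall>j\<ge>J. \<forall>t\<in>{0..T}. (LBINT r. \<bar>coll (u j t) r - coll (U t) r\<bar>) < \<eta>" if \<eta>: "0 < \<eta>" for \<eta> T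
  proof -
    obtain \<delta> where \<delta>: "0 < \<delta>" "\<And>u v. dens u \<Longrightarrow> dens v \<Longrightarrow> mom 6 u \<le> B \<Longrightarrow> mom 6 v \<le> B \<Longrightarrow> ldist u v < \<delta> \<Longrightarrow> (LBINT r. \<bar>coll u r - coll v r\<bar>) < \<eta>"
      using coll_uniformly_continuous[OF less_imp_le[OF B0] \<eta>] by blast
    obtain J where J: "\<And>j t. J \<le> j \<Longrightarrow> t \<in> {0..T} \<Longrightarrow> ldist (u j t) (U t) < \<delta>" using small[OF \<delta>(1), of T] by blast
    show ?thesis by (intro exI[of _ J] allI impI ballI \<delta>(2) J ud uB Up) auto
  qed
  have UU0: "AE r in lborel. U 0 r = u0 r"
  proof -
    have "ldist (U 0) u0 \<le> (E 0 + (2 * M + B)) / 2 ^ j" for j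
    proof -
      have "ldist (U 0) u0 \<le> ldist (U 0) (u j 0) + ldist (u j 0) u0" by (intro ldist_triangle Up ud u0(1)) auto
      also have "ldist (U 0) (u j 0) \<le> E 0 / 2 ^ j" using Up(4)[of 0 j] by (simp add: ldist_commute)
      also have "ldist (u j 0) u0 \<le> mom 1 (\<lambda>r. \<bar>v j r - u0 r\<bar>)"
        using mom_mono[OF dens_diff[OF vd u0(1)], of 0 1 j] by (simp add: ldist_def mom_def u(1))
      also have "\<dots> \<le> (2 * M + B) / 2 ^ j" using v1[of j] by (simp add: n_def)
      finally show ?thesis by (simp add: add_divide_distrib)
    qed
    hence "ldist (U 0) u0 \<le> 0" using LIMSEQ_le_const[OF lim0[of "E 0 + (2 * M + B)"], of "ldist (U 0) u0"] by blast
    hence "ldist (U 0) u0 = 0" using ldist_nonneg[of "U 0" u0] by simp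
    thus ?thesis using ldist_eq_0_iff_AE[OF Up(1) u0(1), of 0] by simp
  qed
  have UL: "ldist (U s) (U t) \<le> (22 * B + 3) * B * (t - s)" if st: "0 \<le> s" "s \<le> t" for s t
  proof -
    have "ldist (U s) (U t) \<le> (22 * B + 3) * B * (t - s) + (E s + E t) / 2 ^ j" for j
    proof -
      have t0: "0 \<le> t" using st by simp
      have "ldist (U s) (U t) \<le> ldist (U s) (u j s) + ldist (u j s) (U t)" using st by (intro ldist_triangle Up ud) auto
      also have "ldist (u j s) (U t) \<le> ldist (u j s) (u j t) + ldist (u j t) (U t)" using st by (intro ldist_triangle Up ud) auto
      finally show ?thesis
        using Up(4)[OF st(1), of j] Up(4)[OF t0, of j] u(3)[OF st, of j] ldist_commute[of "U s" "u j s"] by (simp add: add_divide_distrib)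
    qed
    moreover have "(\<lambda>j. (22 * B + 3) * B * (t - s) + (E s + E t) / 2 ^ j) \<longlonglongrightarrow> (22 * B + 3) * B * (t - s) + 0"
      by (intro tendsto_add tendsto_const lim0)
    ultimately show ?thesis using LIMSEQ_le_const[of _ "(22 * B + 3) * B * (t - s) + 0" "ldist (U s) (U t)"] by auto
  qed
  have UD: "(LBINT r. \<bar>U d r - U c r - (d - c) * b r\<bar>) \<le> (d - c) * \<sigma>"
    if cd: "0 \<le> c" "c \<le> d" and b: "integrable lborel b" and \<sigma>: "\<forall>\<xi>\<in>{c..d}. (LBINT r. \<bar>coll (U \<xi>) r - b r\<bar>) \<le> \<sigma>" for c d b \<sigma>
  proof (rule field_le_epsilon)
    fix e :: real assume e: "0 < e"
    \<comment> \<open>One \<open>\<eta>\<close> for each end point of the interval, and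
      \<open>(d - c) * \<eta>\<close> from the inequality along the approximation.\<close>
    define D where "D = d - c + 2"
    define \<eta> where "\<eta> = e / (2 * D)"
    have "0 < D" using cd by (simp add: D_def)
    hence \<eta>: "0 < \<eta>" "D * \<eta> < e" using e by (simp_all add: \<eta>_def)
    have \<eta>2: "0 < \<eta> / 2" using \<eta> by simp
    have d0: "0 \<le> d" using cd by simp
    obtain J1 where J1: "\<And>j t. J1 \<le> j \<Longrightarrow> t \<in> {0..d} \<Longrightarrow> (LBINT r. \<bar>coll (u j t) r - coll (U t) r\<bar>) < \<eta> / 2"
      using smallc[OF \<eta>2, of d] by blast
    obtain J2 where J2: "\<And>j t. J2 \<le> j \<Longrightarrow> t \<in> {0..d} \<Longrightarrow> ldist (u j t) (U t) < \<eta>"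
      using small[OF \<eta>(1), of d] by blast
    from order_tendstoD(2)[OF lim0 \<eta>2, of K] obtain J3 where J3: "\<And>j. J3 \<le> j \<Longrightarrow> K / 2 ^ j < \<eta> / 2"
      unfolding eventually_sequentially by blast
    define j where "j = max J1 (max J2 J3)"
    have j: "J1 \<le> j" "J2 \<le> j" "J3 \<le> j" by (auto simp: j_def)
    have "c \<in> {c..d}" using cd by simp
    hence "(LBINT r. \<bar>coll (U c) r - b r\<bar>) \<le> \<sigma>" using \<sigma> by blast
    moreover have "0 \<le> (LBINT r. \<bar>coll (U c) r - b r\<bar>)" by simp
    ultimately have s0: "0 \<le> \<sigma>" by (rule order_trans[rotated])
    have mv: "(LBINT r. \<bar>u j d r - u j c r - (d - c) * b r\<bar>) \<le> (d - c) * (\<sigma> + \<eta>)"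
    proof (rule L1_path_mean_value[of "u j", OF ud L0 u(3) cd b])
      show "0 \<le> \<sigma> + \<eta>" using s0 \<eta> by simp
      fix t assume t: "c \<le> t" "t \<le> d"
      have t0: "0 \<le> t" using t cd by simp
      from u(4)[OF t0, of j] obtain \<beta> \<delta> where \<beta>: "0 < \<delta>" "\<forall>h r. 0 \<le> h \<longrightarrow> h < \<delta> \<longrightarrow> u j (t + h) r = u j t r + h * \<beta> r"
        "integrable lborel \<beta>" "\<forall>r\<le>0. \<beta> r = 0" "integrable lborel (\<lambda>r. (1 + r) * \<bar>\<beta> r - coll (u j t) r\<bar>)"
        "(LBINT r. 4 * (1 + r) * \<bar>\<beta> r - coll (u j t) r\<bar>) \<le> K / n j"
        by (elim exE conjE) (rule that)
      have ic: "integrable lborel (coll (u j t))" "integrable lborel (coll (U t))"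
        using coll_integrable ud[OF t0] Up(1)[OF t0] by auto
      have "(LBINT r. \<bar>\<beta> r - b r\<bar>) \<le> (LBINT r. 4 * (1 + r) * \<bar>\<beta> r - coll (u j t) r\<bar> + \<bar>coll (u j t) r - coll (U t) r\<bar> + \<bar>coll (U t) r - b r\<bar>)"
      proof (rule integral_mono)
        have "integrable lborel (\<lambda>r. 4 * (1 + r) * \<bar>\<beta> r - coll (u j t) r\<bar>)"
          using integrable_mult_right[OF \<beta>(5), of 4] by (simp only: mult.assoc)
        thus "integrable lborel (\<lambda>r. 4 * (1 + r) * \<bar>\<beta> r - coll (u j t) r\<bar> + \<bar>coll (u j t) r - coll (U t) r\<bar> + \<bar>coll (U t) r - b r\<bar>)"
          by (intro Bochner_Integration.integrable_add integrable_abs Bochner_Integration.integrable_diff ic b)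
        show "integrable lborel (\<lambda>r. \<bar>\<beta> r - b r\<bar>)" by (intro integrable_abs Bochner_Integration.integrable_diff \<beta>(3) b)
        fix r
        have "\<bar>\<beta> r - coll (u j t) r\<bar> \<le> 4 * (1 + r) * \<bar>\<beta> r - coll (u j t) r\<bar>"
        proof (cases "0 < r")
          case True
          thus ?thesis using mult_right_mono[of 1 "4 * (1 + r)" "\<bar>\<beta> r - coll (u j t) r\<bar>"] by simp
        qed (use \<beta>(4) coll_nonpos[OF ud[OF t0]] in simp)
        thus "\<bar>\<beta> r - b r\<bar> \<le> 4 * (1 + r) * \<bar>\<beta> r - coll (u j t) r\<bar> + \<bar>coll (u j t) r - coll (U t) r\<bar> + \<bar>coll (U t) r - b r\<bar>" by linarith
      qed
      also have "\<dots> = (LBINT r. 4 * (1 + r) * \<bar>\<beta> r - coll (u j t) r\<bar>) + (LBINT r. \<bar>coll (u j t) r - coll (U t) r\<bar>) + (LBINT r. \<bar>coll (U t) r - b r\<bar>)"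
      proof -
        have "integrable lborel (\<lambda>r. 4 * (1 + r) * \<bar>\<beta> r - coll (u j t) r\<bar>)"
          using integrable_mult_right[OF \<beta>(5), of 4] by (simp only: mult.assoc)
        thus ?thesis using ic b by (simp only: Bochner_Integration.integral_add Bochner_Integration.integrable_add integrable_abs Bochner_Integration.integrable_diff)
      qed
      also have "\<dots> \<le> K / n j + \<eta> / 2 + \<sigma>"
        using \<beta>(6) J1[OF j(1), of t] \<sigma> t t0 by (intro add_mono) auto
      also have "\<dots> \<le> \<sigma> + \<eta>" using J3[OF j(3)] unfolding n_def by linarith
      finally show "\<exists>\<beta> \<delta>. 0 < \<delta> \<and> (\<forall>h r. 0 \<le> h \<longrightarrow> h < \<delta> \<longrightarrow> u j (t + h) r = u j t r + h * \<beta> r) \<and> integrable lborel \<beta> \<and> (LBINT r. \<bar>\<beta> r - b r\<bar>) \<le> \<sigma> + \<eta>"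
        using \<beta>(1-3) by blast
    qed
    have il: "integrable lborel (\<lambda>r. \<bar>u j t r - U t r\<bar>)" if "0 \<le> t" for t
      using dens_integrable_self[OF dens_diff[OF ud[OF that] Up(1)[OF that]]] .
    have ib: "integrable lborel (\<lambda>r. \<bar>u j d r - u j c r - (d - c) * b r\<bar>)"
      using dens_integrable_self[OF ud[OF cd(1), of j]] dens_integrable_self[OF ud[OF d0, of j]] b by auto
    have "(LBINT r. \<bar>U d r - U c r - (d - c) * b r\<bar>) \<le> (LBINT r. \<bar>u j d r - U d r\<bar> + \<bar>u j c r - U c r\<bar> + \<bar>u j d r - u j c r - (d - c) * b r\<bar>)"
    proof (rule integral_mono)
      show "integrable lborel (\<lambda>r. \<bar>U d r - U c r - (d - c) * b r\<bar>)"
        using dens_integrable_self[OF Up(1)[OF cd(1)]] dens_integrable_self[OF Up(1)[OF d0]] b by auto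
      show "integrable lborel (\<lambda>r. \<bar>u j d r - U d r\<bar> + \<bar>u j c r - U c r\<bar> + \<bar>u j d r - u j c r - (d - c) * b r\<bar>)"
        by (intro Bochner_Integration.integrable_add il ib d0 cd)
    qed linarith
    also have "\<dots> = ldist (u j d) (U d) + ldist (u j c) (U c) + (LBINT r. \<bar>u j d r - u j c r - (d - c) * b r\<bar>)"
      using il[OF d0] il[OF cd(1)] ib by (simp only: ldist_def Bochner_Integration.integral_add Bochner_Integration.integrable_add)
    also have "\<dots> \<le> \<eta> + \<eta> + (d - c) * (\<sigma> + \<eta>)"
      using mv J2[OF j(2), of d] J2[OF j(2), of c] cd d0 by (intro add_mono) auto
    also have "\<dots> = (d - c) * \<sigma> + D * \<eta>" by (simp add: D_def algebra_simps)
    also have "\<dots> \<le> (d - c) * \<sigma> + e" using \<eta> by simp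
    finally show "(LBINT r. \<bar>U d r - U c r - (d - c) * b r\<bar>) \<le> (d - c) * \<sigma> + e" .
  qed
  have low1: "h3 - (2 * M + B) / n j - t * (trunc_const M B / n j) \<le> (LBINT r. r * u j t r)" if "0 \<le> t" for j t
  proof -
    have "\<bar>(LBINT r. r * v j r) - (LBINT r. r * u0 r)\<bar> \<le> (2 * M + B) / n j"
    proof -
      have i: "integrable lborel (\<lambda>r. r * v j r)" "integrable lborel (\<lambda>r. r * u0 r)" "integrable lborel (\<lambda>r. (1 + r) ^ 1 * \<bar>v j r - u0 r\<bar>)"
        using pow_integrable[OF vd, of 1 j] pow_integrable[OF u0(1), of 1] mom_integrable[OF dens_diff[OF vd u0(1)], of 1 j] by auto
      have "\<bar>(LBINT r. r * v j r) - (LBINT r. r * u0 r)\<bar> = \<bar>LBINT r. r * v j r - r * u0 r\<bar>" using i by simp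
      also have "\<dots> \<le> (LBINT r. \<bar>r * v j r - r * u0 r\<bar>)" by (rule integral_abs_bound)
      also have "\<dots> \<le> mom 1 (\<lambda>r. \<bar>v j r - u0 r\<bar>)"
        unfolding mom_def
      proof (rule integral_mono[OF _ i(3)])
        fix r
        show "\<bar>r * v j r - r * u0 r\<bar> \<le> (1 + r) ^ 1 * \<bar>v j r - u0 r\<bar>"
          by (cases "0 < r") (auto simp: abs_mult dens_zero[OF vd] dens_zero[OF u0(1)] intro!: mult_right_mono simp flip: right_diff_distrib)
      qed (use i in simp)
      finally show ?thesis using v1[of j] by linarith
    qed
    thus ?thesis using u(5)[OF that, of j] u0(3) by linarith
  qed
  have momk: "\<bar>(LBINT r. r ^ k * u j t r) - (LBINT r. r ^ k * U t r)\<bar> \<le> mom 5 (\<lambda>r. \<bar>u j t r - U t r\<bar>)" if "0 \<le> t" "k \<le> 5" for j t k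
    by (rule pow_moment_diff[OF ud[OF that(1)] Up(1)[OF that(1)] that(2)])
  \<comment> \<open>The approximations may lose energy, but at most of order (1 + t) / n, so the
    limit has it exactly.\<close>
  have U1: "(LBINT r. r * U t r) = h3" if t: "0 \<le> t" for t
  proof (rule antisym)
    show "(LBINT r. r * U t r) \<le> h3"
    proof (rule field_le_epsilon)
      fix e :: real assume "0 < e"
      from small5[OF this, of t] obtain J where J: "\<forall>j\<ge>J. \<forall>s\<in>{0..t}. mom 5 (\<lambda>r. \<bar>u j s r - U s r\<bar>) < e" by blast
      have "mom 5 (\<lambda>r. \<bar>u J t r - U t r\<bar>) < e" using J t by simp
      thus "(LBINT r. r * U t r) \<le> h3 + e" using momk[OF t, of 1 J] euler_setD(4)[OF u(2)[OF t], of J] by auto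
    qed
    show "h3 \<le> (LBINT r. r * U t r)"
    proof (rule field_le_epsilon)
      fix e :: real assume e: "0 < e"
      hence e2: "0 < e / 2" by simp
      from small5[OF e2, of t] obtain J where J: "\<forall>j\<ge>J. \<forall>s\<in>{0..t}. mom 5 (\<lambda>r. \<bar>u j s r - U s r\<bar>) < e / 2" by blast
      from order_tendstoD(2)[OF lim0 e2, of "2 * M + B + t * trunc_const M B"] obtain J3 where
        J3: "\<And>j. J3 \<le> j \<Longrightarrow> (2 * M + B + t * trunc_const M B) / 2 ^ j < e / 2"
        unfolding eventually_sequentially by blast
      define j where "j = max J J3"
      have j: "J \<le> j" "J3 \<le> j" by (auto simp: j_def)
      have "(2 * M + B) / n j + t * (trunc_const M B / n j) = (2 * M + B + t * trunc_const M B) / 2 ^ j"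
        by (simp add: n_def add_divide_distrib)
      hence 1: "(2 * M + B) / n j + t * (trunc_const M B / n j) < e / 2" using J3[OF j(2)] by (simp only:)
      have 2: "mom 5 (\<lambda>r. \<bar>u j t r - U t r\<bar>) < e / 2" using J j(1) t by (metis atLeastAtMost_iff order_refl)
      have 3: "\<bar>(LBINT r. r * u j t r) - (LBINT r. r * U t r)\<bar> \<le> mom 5 (\<lambda>r. \<bar>u j t r - U t r\<bar>)"
        using momk[OF t, of 1 j] by simp
      show "h3 \<le> (LBINT r. r * U t r) + e" using low1[OF t, of j] 1 2 3 by linarith
    qed
  qed
  \<comment> \<open>Sixth moments need not converge; Fatou preserves the inequality, which is all
    that the state set asks for.\<close>
  have U6: "(LBINT r. r ^ 6 * U t r) \<le> h8" if t: "0 \<le> t" for t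
  proof -
    have "eventually (\<lambda>j. (LBINT r. r ^ 6 * u j t r) \<le> h8) sequentially"
      using euler_setD(5)[OF u(2)[OF t]] by (intro always_eventually allI)
    from moment_fatou(2)[where f = "\<lambda>j. u j t" and g = "U t" and \<phi> = "\<lambda>r. r ^ 6", OF _ _ _ _ _ Up(3)[OF t] _ this]
    show ?thesis using dens_meas[OF ud[OF t]] dens_meas[OF Up(1)[OF t]] dens_nonneg[OF ud[OF t]] dens_nonneg[OF Up(1)[OF t]]
        pow_integrable[OF ud[OF t], of 6] by simp
  qed
  have UM': "\<forall>t\<in>{0..T}. \<forall>r. U t r \<le> M'"
    if m4: "0 < m4" and M': "\<forall>r. u0 r \<le> M'" and m2: "\<forall>t\<in>{0..T}. (LBINT r. r\<^sup>2 * U t r) \<le> m4"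
      and le: "m4 \<le> M' * h3 powr (3 / 4) * (1 / 30) powr (1 / 4)" for T m4 M'
  proof (cases "0 \<le> T")
    case T: True
    have M'0: "0 \<le> M'" using u0n[of 0] M' by (meson order_trans)
    \<comment> \<open>Late approximations have second moment at most twice \<open>m4\<close> and
      energy at least \<open>h3 / 2\<close>, uniformly on the time interval.
      \<open>am_gm_level\<close> is stated for these worsened values, which is why it has 4 and 3
      where the level condition has 2 and 6.\<close>
    have "0 < min m4 (h3 / 2)" using m4 h3 by simp
    from small5[OF this, of T] obtain J where J: "\<And>j t. J \<le> j \<Longrightarrow> t \<in> {0..T} \<Longrightarrow> mom 5 (\<lambda>r. \<bar>u j t r - U t r\<bar>) < min m4 (h3 / 2)" by blast
    have lev: "level_condition M' (u j t)" if "J \<le> j" "t \<in> {0..T}" for j t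
      unfolding level_condition_def
    proof (intro allI impI)
      fix r :: real assume r: "0 < r"
      have t: "0 \<le> t" using that by simp
      have m: "mom 5 (\<lambda>r. \<bar>u j t r - U t r\<bar>) < m4" "mom 5 (\<lambda>r. \<bar>u j t r - U t r\<bar>) < h3 / 2" using J[OF that] by auto
      have 2: "(LBINT s. s\<^sup>2 * u j t s) \<le> 2 * m4" using momk[OF t, of 2 j] m(1) m2 that(2) by (auto dest!: bspec[of _ _ t])
      have 1: "h3 / 2 \<le> (LBINT s. s * u j t s)" using momk[OF t, of 1 j] m(2) U1[OF t] by auto
      have "2 * r * (LBINT s. s\<^sup>2 * u j t s) \<le> 2 * r * (2 * m4)" using r 2 by (intro mult_left_mono) auto
      also have "\<dots> = 4 * r * m4" by simp
      also have "\<dots> \<le> M' * (3 * h3 + r ^ 4 / 30)" by (rule am_gm_level[OF h3 M'0 r le])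
      also have "\<dots> \<le> M' * (6 * (LBINT s. s * u j t s) + r ^ 4 / 30)" using 1 M'0 by (intro mult_left_mono) auto
      finally show "2 * r * (LBINT s. s\<^sup>2 * u j t s) \<le> M' * (6 * (LBINT s. s * u j t s) + r ^ 4 / 30)" .
    qed
    have "\<forall>r. v j r \<le> M'" for j using vle[of j] M' by (meson order_trans)
    hence "u j t r \<le> M'" if "J \<le> j" "t \<in> {0..T}" for j t r
      using u(6)[of j M' T] lev[OF that(1)] that(2) by blast
    thus ?thesis unfolding U_def by (intro ballI allI plim_le M'0) (auto simp: eventually_sequentially)
  qed auto
  have P5: "\<forall>T m4 M'. 0 < m4 \<longrightarrow> (\<forall>r. u0 r \<le> M') \<longrightarrow> (\<forall>t\<in>{0..T}. (LBINT r. r\<^sup>2 * U t r) \<le> m4)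
         \<longrightarrow> m4 \<le> M' * h3 powr (3 / 4) * (1 / 30) powr (1 / 4) \<longrightarrow> (\<forall>t\<in>{0..T}. \<forall>r. U t r \<le> M')"
    by (intro allI impI) (rule UM')
  have P4: "\<forall>c d b \<sigma>. 0 \<le> c \<longrightarrow> c \<le> d \<longrightarrow> integrable lborel b \<longrightarrow> (\<forall>\<xi>\<in>{c..d}. (LBINT r. \<bar>coll (U \<xi>) r - b r\<bar>) \<le> \<sigma>)
         \<longrightarrow> (LBINT r. \<bar>U d r - U c r - (d - c) * b r\<bar>) \<le> (d - c) * \<sigma>"
    by (intro allI impI) (rule UD)
  show ?thesis
    by (intro exI[of _ U] conjI P4 P5 allI impI UU0 UL Up(1) UM U1 U6)
qed

section \<open>Radial functions on Euclidean space\<close>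

text \<open>Polar coordinates for radial functions: half-lines form an intersection-stable
  generator, and on each of them both measures give the volume of a ball.\<close>

lemma distr_norm_lborel:
  "distr (lborel :: (real ^ 3) measure) borel norm = density lborel (\<lambda>r. ennreal (4 * pi * pos_square r))"
    (is "?M = ?N")
proof (rule measure_eqI_generator_eq[where E = "range atMost" and A = "\<lambda>i. {..real i}" and \<Omega> = UNIV])
  have M: "emeasure ?M {..a} = (if 0 \<le> a then ennreal (4 / 3 * pi * a ^ 3) else 0)" for a :: real
  proof -
    have "emeasure ?M {..a} = emeasure lborel (cball (0 :: real ^ 3) a)"
      by (subst emeasure_distr) (auto intro!: arg_cong[where f = "emeasure lborel"] simp: vimage_def)
    also have "\<dots> = (if 0 \<le> a then ennreal (4 / 3 * pi * a ^ 3) else 0)"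
      by (auto simp: emeasure_cball unit_ball_vol_3)
    finally show ?thesis .
  qed
  have N: "emeasure ?N {..a} = (if 0 \<le> a then ennreal (4 / 3 * pi * a ^ 3) else 0)" for a :: real
  proof -
    have "emeasure ?N {..a} = (\<integral>\<^sup>+r. ennreal (4 * pi * pos_square r) * indicator {..a} r \<partial>lborel)"
      by (rule emeasure_density) auto
    also have "\<dots> = (\<integral>\<^sup>+r. ennreal (4 * pi * r\<^sup>2) * indicator {0..a} r \<partial>lborel)"
      by (rule nn_integral_cong) (auto simp: pos_square_def indicator_def)
    also have "\<dots> = (if 0 \<le> a then ennreal (4 / 3 * pi * a ^ 3) else 0)"
    proof (cases "0 \<le> a")
      case True
      have "(\<integral>\<^sup>+r. ennreal (4 * pi * r\<^sup>2) * indicator {0..a} r \<partial>lborel) = ennreal (4 / 3 * pi * a ^ 3 - 4 / 3 * pi * 0 ^ 3)"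
        by (rule nn_integral_FTC_Icc) (use True in \<open>auto intro!: derivative_eq_intros\<close>)
      thus ?thesis using True by simp
    qed simp
    finally show ?thesis .
  qed
  show "Int_stable (range (atMost :: real \<Rightarrow> real set))" by (auto simp: Int_stable_def)
  show "range atMost \<subseteq> Pow (UNIV :: real set)" by simp
  show "emeasure ?M X = emeasure ?N X" if "X \<in> range atMost" for X using that M N by auto
  show "sets ?M = sigma_sets UNIV (range atMost)" by (simp add: borel_eq_atMost)
  show "sets ?N = sigma_sets UNIV (range atMost)" by (simp add: borel_eq_atMost)
  show "range (\<lambda>i. {..real i}) \<subseteq> range atMost" by auto
  show "(\<Union>i. {..real i}) = UNIV" by (auto intro: real_arch_simple)
  show "emeasure ?M {..real i} \<noteq> \<infinity>" for i unfolding M by simp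
qed

text \<open>A profile is arbitrary on the negative axis and may be nonmeasurable there, hence the
  absolute value. The converse evaluates the radial function along a ray.\<close>

lemma radial_meas_iff: "radial f \<in> borel_measurable borel \<longleftrightarrow> (\<lambda>r. f \<bar>r\<bar>) \<in> borel_measurable borel"
proof
  assume "(\<lambda>r. f \<bar>r\<bar>) \<in> borel_measurable borel"
  hence "(\<lambda>p :: real ^ 3. (\<lambda>r. f \<bar>r\<bar>) (norm p)) \<in> borel_measurable borel" by measurable
  thus "radial f \<in> borel_measurable borel" by (simp add: radial_def[abs_def])
next
  assume m: "radial f \<in> borel_measurable borel"
  have [measurable]: "(\<lambda>r. r *\<^sub>R axis 1 1 :: real ^ 3) \<in> borel_measurable borel"
    by (intro borel_measurable_continuous_onI continuous_intros)
  have "(\<lambda>r. radial f (r *\<^sub>R axis 1 1)) \<in> borel_measurable borel" using m by measurable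
  thus "(\<lambda>r. f \<bar>r\<bar>) \<in> borel_measurable borel" by (simp add: radial_def)
qed

lemma AE_radial_iff:
  assumes [measurable]: "Measurable.pred borel P"
  shows "(AE p in (lborel :: (real ^ 3) measure). P (norm p)) \<longleftrightarrow> (AE r in lborel. 0 < r \<longrightarrow> P r)"
proof -
  have "(AE p in (lborel :: (real ^ 3) measure). P (norm p)) \<longleftrightarrow> (AE r in distr (lborel :: (real ^ 3) measure) borel norm. P r)"
    by (subst AE_distr_iff) auto
  also have "\<dots> \<longleftrightarrow> (AE r in lborel. 0 < ennreal (4 * pi * pos_square r) \<longrightarrow> P r)"
    unfolding distr_norm_lborel by (subst AE_density) auto
  also have "\<dots> \<longleftrightarrow> (AE r in lborel. 0 < r \<longrightarrow> P r)"
    by (rule AE_cong) (auto simp: pos_square_def)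
  finally show ?thesis .
qed

lemma radial_integrable_iff:
  assumes [measurable]: "radial f \<in> borel_measurable borel"
  shows "integrable lborel (radial f) \<longleftrightarrow> integrable lborel (\<lambda>r. pos_square r * f r)"
    and "(LINT p|lborel. radial f p) = 4 * pi * (LBINT r. pos_square r * f r)"
proof -
  define g where "g r = f \<bar>r\<bar>" for r
  have [measurable]: "g \<in> borel_measurable borel" using assms unfolding radial_meas_iff g_def[abs_def] .
  have eq: "pos_square r * f r = pos_square r * g r" for r by (auto simp: g_def pos_square_def)
  have rg: "radial f = (\<lambda>p. g (norm p))" by (simp add: radial_def g_def fun_eq_iff)
  have "integrable lborel (radial f) \<longleftrightarrow> integrable (distr (lborel :: (real ^ 3) measure) borel norm) g"
    unfolding rg by (subst integrable_distr_eq) auto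
  also have "\<dots> \<longleftrightarrow> integrable lborel (\<lambda>r. 4 * pi * pos_square r * g r)"
    unfolding distr_norm_lborel by (subst integrable_density) auto
  also have "\<dots> \<longleftrightarrow> integrable lborel (\<lambda>r. pos_square r * g r)"
    by (simp add: mult.assoc)
  finally show "integrable lborel (radial f) \<longleftrightarrow> integrable lborel (\<lambda>r. pos_square r * f r)" unfolding eq .
  have "(LINT p|lborel. radial f p) = integral\<^sup>L (distr (lborel :: (real ^ 3) measure) borel norm) g"
    unfolding rg by (subst integral_distr) auto
  also have "\<dots> = (LBINT r. 4 * pi * pos_square r * g r)"
    unfolding distr_norm_lborel by (subst integral_density) auto
  also have "\<dots> = 4 * pi * (LBINT r. pos_square r * g r)" by (simp add: mult.assoc)
  finally show "(LINT p|lborel. radial f p) = 4 * pi * (LBINT r. pos_square r * f r)" unfolding eq .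
qed

text \<open>Ties a radial function, known up to null sets and with irrelevant values at negative
  arguments, to a line density with everywhere valid bounds. \<open>pos_square\<close> removes the
  negative arguments.\<close>

definition represents :: "(real \<Rightarrow> real) \<Rightarrow> (real \<Rightarrow> real) \<Rightarrow> bool" where
  "represents u f \<longleftrightarrow> dens u \<and> radial f \<in> borel_measurable borel \<and> (AE r in lborel. pos_square r * f r = u r)"

lemma AE_abs_pos:
  assumes "AE r in lborel. pos_square r * f r = u r" shows "AE r in lborel. 0 < r \<longrightarrow> f \<bar>r\<bar> * r\<^sup>2 = u r"
  using assms by eventually_elim (auto simp: pos_square_def mult.commute)

lemma represents_line_moment:
  assumes u: "represents u f" and k: "k = j + 2"
  shows "line_moment k f = (LBINT r. r ^ j * u r)" "finite_line_moment k f \<longleftrightarrow> integrable lborel (\<lambda>r. r ^ j * u r)"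
proof -
  have d: "dens u" and m: "(\<lambda>r. f \<bar>r\<bar>) \<in> borel_measurable borel" and ae: "AE r in lborel. pos_square r * f r = u r"
    using u by (auto simp: represents_def radial_meas_iff)
  note [measurable] = m dens_meas[OF d]
  have eq: "indicator {0..} r *\<^sub>R (f r * r ^ k) = indicator {0..} r *\<^sub>R (f \<bar>r\<bar> * r ^ k)" for r by (auto simp: indicator_def)
  have AE: "AE r in lborel. indicator {0..} r *\<^sub>R (f \<bar>r\<bar> * r ^ k) = r ^ j * u r"
    using ae
  proof eventually_elim
    case (elim r)
    show ?case
    proof (cases "0 < r")
      case True
      hence "r ^ j * u r = r ^ j * (r\<^sup>2 * f r)" using elim by (simp add: pos_square_def)
      also have "\<dots> = f r * (r ^ j * r\<^sup>2)" by (simp add: mult_ac)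
      also have "r ^ j * r\<^sup>2 = r ^ k" unfolding k by (simp only: power_add)
      finally show ?thesis using True by simp
    next
      case False
      hence "u r = 0" "indicator {0..} r * r ^ k = 0" using dens_zero[OF d, of r] k by (auto simp: indicator_def)
      thus ?thesis by (auto simp: indicator_def)
    qed
  qed
  show "line_moment k f = (LBINT r. r ^ j * u r)"
    unfolding line_moment_def set_lebesgue_integral_def eq
    by (rule integral_cong_AE[OF _ _ AE]) measurable
  show "finite_line_moment k f \<longleftrightarrow> integrable lborel (\<lambda>r. r ^ j * u r)"
    unfolding finite_line_moment_def set_integrable_def eq
    by (rule integrable_cong_AE[OF _ _ AE]) measurable
qed

lemma represents_integrable:
  assumes u: "represents u f" shows "integrable lborel (radial f)"
proof -
  have d: "dens u" and m: "radial f \<in> borel_measurable borel" and ae: "AE r in lborel. pos_square r * f r = u r"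
    using u by (auto simp: represents_def)
  have m2: "(\<lambda>r. pos_square r * f r) \<in> borel_measurable borel"
  proof -
    have "(\<lambda>r. pos_square r * f \<bar>r\<bar>) \<in> borel_measurable borel" using m unfolding radial_meas_iff by measurable
    also have "(\<lambda>r. pos_square r * f \<bar>r\<bar>) = (\<lambda>r. pos_square r * f r)" by (auto simp: fun_eq_iff pos_square_def)
    finally show ?thesis .
  qed
  have "integrable lborel (\<lambda>r. pos_square r * f r) \<longleftrightarrow> integrable lborel u"
    by (rule integrable_cong_AE) (use m2 dens_meas[OF d] ae in auto)
  thus ?thesis using radial_integrable_iff(1)[OF m] dens_integrable_self[OF d] by simp
qed

lemma L1_norm_radial:
  assumes m: "radial F \<in> borel_measurable borel" and ae: "AE r in lborel. pos_square r * F r = w r" and w: "w \<in> borel_measurable borel"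
  shows "L1_norm (radial F) = 4 * pi * (LBINT r. \<bar>w r\<bar>)"
proof -
  have m1: "radial (\<lambda>r. \<bar>F r\<bar>) \<in> borel_measurable borel" using m by (simp add: radial_def[abs_def])
  have "L1_norm (radial F) = (LINT p|lborel. radial (\<lambda>r. \<bar>F r\<bar>) p)" by (simp add: L1_norm_def radial_def)
  also have "\<dots> = 4 * pi * (LBINT r. pos_square r * \<bar>F r\<bar>)" by (rule radial_integrable_iff(2)[OF m1])
  also have "(LBINT r. pos_square r * \<bar>F r\<bar>) = (LBINT r. \<bar>w r\<bar>)"
  proof (rule integral_cong_AE)
    have "(\<lambda>r. pos_square r * \<bar>F \<bar>r\<bar>\<bar>) \<in> borel_measurable borel" using m unfolding radial_meas_iff by measurable
    also have "(\<lambda>r. pos_square r * \<bar>F \<bar>r\<bar>\<bar>) = (\<lambda>r. pos_square r * \<bar>F r\<bar>)" by (auto simp: fun_eq_iff pos_square_def)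
    finally show "(\<lambda>r. pos_square r * \<bar>F r\<bar>) \<in> borel_measurable lborel" by simp
    show "AE r in lborel. pos_square r * \<bar>F r\<bar> = \<bar>w r\<bar>"
      using ae by eventually_elim (metis abs_mult abs_of_nonneg pos_square_nonneg)
  qed (use w in simp)
  finally show ?thesis .
qed

text \<open>Almost everywhere only, since f itself multiplies the loss integrals and is pinned down
  off a null set.\<close>

lemma represents_collision:
  assumes u: "represents u f"
  shows "AE r in lborel. pos_square r * collision f r = coll u r"
proof -
  have d: "dens u" and m: "(\<lambda>r. f \<bar>r\<bar>) \<in> borel_measurable borel" and ae: "AE r in lborel. pos_square r * f r = u r"
    using u by (auto simp: represents_def radial_meas_iff)
  have c: "collision f r = collision (\<lambda>r. f \<bar>r\<bar>) r" if "0 < r" for r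
    using that unfolding collision_def quadratic_collision_def linear_collision_def set_lebesgue_integral_def
    by (intro arg_cong2[where f = "(/)"] arg_cong2[where f = "(+)"] arg_cong2[where f = "(-)"] arg_cong2[where f = "(*)"] refl Bochner_Integration.integral_cong)
      (auto simp: indicator_def)
  show ?thesis
    using ae
  proof eventually_elim
    case (elim r)
    show ?case
    proof (cases "0 < r")
      case True
      have "collision (\<lambda>r. f \<bar>r\<bar>) r = coll u r / r\<^sup>2"
        by (rule collision_eq_coll[OF d m AE_abs_pos[OF ae] True]) (use True elim in \<open>simp add: pos_square_def mult.commute\<close>)
      thus ?thesis using True c[OF True] by (simp add: pos_square_def)
    qed (simp add: pos_square_def coll_nonpos[OF d])
  qed
qed

lemma represents_profile:
  assumes u: "dens u" shows "represents u (\<lambda>r. u r / r\<^sup>2)"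
proof -
  note [measurable] = dens_meas[OF u]
  have "(\<lambda>r. u \<bar>r\<bar> / \<bar>r\<bar>\<^sup>2) \<in> borel_measurable borel" by measurable
  moreover have "pos_square r * (u r / r\<^sup>2) = u r" for r by (cases "0 < r") (auto simp: pos_square_def dens_zero[OF u])
  ultimately show ?thesis using u by (simp add: represents_def radial_meas_iff)
qed

text \<open>For the canonical profile u / r^2 the identity with \<open>coll\<close> holds at every r
  > 0, which gives measurability; an arbitrary representative offers no such pointwise
  identity.\<close>

lemma profile_collision_meas:
  assumes u: "dens u" shows "radial (collision (\<lambda>r. u r / r\<^sup>2)) \<in> borel_measurable borel"
proof -
  note [measurable] = dens_meas[OF u]
  have "collision (\<lambda>r. u r / r\<^sup>2) \<bar>r\<bar> = coll u \<bar>r\<bar> / r\<^sup>2" for r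
  proof (cases "r = 0")
    case True thus ?thesis by (simp add: collision_def)
  next
    case False
    hence r: "0 < \<bar>r\<bar>" by simp
    have "collision (\<lambda>r. u r / r\<^sup>2) \<bar>r\<bar> = coll u \<bar>r\<bar> / \<bar>r\<bar>\<^sup>2"
      by (rule collision_eq_coll[OF u _ _ r]) (use r in auto)
    thus ?thesis by simp
  qed
  thus ?thesis unfolding radial_meas_iff by simp
qed

lemma represents_collision_mass:
  assumes u: "represents u f" and m: "radial (collision f) \<in> borel_measurable borel"
  shows "collision_mass f = (LBINT r. coll u r)"
proof -
  have d: "dens u" using u by (simp add: represents_def)
  note [measurable] = dens_meas[OF d]
  have "collision_mass f = (LBINT r. pos_square r * collision f \<bar>r\<bar>)"
    unfolding collision_mass_def set_lebesgue_integral_def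
    by (rule Bochner_Integration.integral_cong) (auto simp: indicator_def pos_square_def mult.commute)
  also have "\<dots> = (LBINT r. coll u r)"
  proof (rule integral_cong_AE)
    show "(\<lambda>r. pos_square r * collision f \<bar>r\<bar>) \<in> borel_measurable lborel" using m unfolding radial_meas_iff by measurable
    show "AE r in lborel. pos_square r * collision f \<bar>r\<bar> = coll u r"
      using represents_collision[OF u] by eventually_elim (auto simp: pos_square_def split: if_splits)
  qed measurable
  finally show ?thesis .
qed

text \<open>The bound c is kept apart from \<open>hinf\<close> because the threshold involves the
  norm of the datum itself. The density is altered on a null set so that 0 <= u <= c holds at every
  point.\<close>

lemma state_set_profile:
  assumes f: "f \<in> state_set h3 h8 hinf" and c: "Linfty_norm (\<lambda>p. radial f p * (norm p)\<^sup>2) \<le> ereal c"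
  shows "\<exists>u. represents u f \<and> (\<forall>r. u r \<le> c) \<and> (LBINT r. r * u r) = h3 \<and> (LBINT r. r ^ 6 * u r) \<le> h8"
proof -
  have i: "integrable lborel (radial f)" and nn: "AE p in lborel. 0 \<le> radial f p"
    and m3: "line_moment 3 f = h3" and f8: "finite_line_moment 8 f" and m8: "line_moment 8 f \<le> h8"
    using f by (auto simp: state_set_def)
  have rm: "radial f \<in> borel_measurable borel" using borel_measurable_integrable[OF i] by simp
  hence m: "(\<lambda>r. f \<bar>r\<bar>) \<in> borel_measurable borel" unfolding radial_meas_iff .
  define g where "g r = f \<bar>r\<bar>" for r
  have [measurable]: "g \<in> borel_measurable borel" using m by (simp add: g_def[abs_def])
  have "AE p in lborel. ereal \<bar>radial f p * (norm p)\<^sup>2\<bar> \<le> Linfty_norm (\<lambda>p. radial f p * (norm p)\<^sup>2)"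
    unfolding Linfty_norm_def by (rule esssup_AE)
  hence "AE p in (lborel :: (real ^ 3) measure). 0 \<le> g (norm p) \<and> g (norm p) * (norm p)\<^sup>2 \<le> c"
    using nn
  proof eventually_elim
    case (elim p)
    have "ereal \<bar>radial f p * (norm p)\<^sup>2\<bar> \<le> ereal c" using elim(1) c by (rule order_trans)
    thus ?case using elim(2) by (simp add: g_def radial_def)
  qed
  hence ae: "AE r in lborel. 0 < r \<longrightarrow> 0 \<le> g r \<and> g r * r\<^sup>2 \<le> c"
    by (subst (asm) AE_radial_iff) auto
  \<comment> \<open>A negative c would contradict nonnegativity almost everywhere on an interval of
    positive length.\<close>
  have c0: "0 \<le> c"
  proof (rule ccontr)
    assume c: "\<not> 0 \<le> c"
    have "AE r in lborel. r \<notin> {0 :: real<..1}"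
      using ae
    proof eventually_elim
      case (elim r)
      have "\<not> 0 < r"
      proof
        assume "0 < r"
        hence "0 \<le> g r * r\<^sup>2" "g r * r\<^sup>2 \<le> c" using elim by auto
        thus False using c by linarith
      qed
      thus ?case by simp
    qed
    hence "emeasure lborel {0 :: real<..1} = 0" by (subst (asm) AE_iff_measurable[where N = "{0<..1}"]) auto
    thus False by simp
  qed
  define u where "u r = (if 0 < r \<and> 0 \<le> g r \<and> g r * r\<^sup>2 \<le> c then g r * r\<^sup>2 else 0)" for r
  have um [measurable]: "u \<in> borel_measurable borel" unfolding u_def[abs_def] by measurable
  have ub: "0 \<le> u r" "u r \<le> c" for r using c0 by (auto simp: u_def)
  have uz: "u r = 0" if "r \<le> 0" for r using that by (simp add: u_def)
  have aeu: "AE r in lborel. pos_square r * f r = u r"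
    using ae by eventually_elim (auto simp: u_def g_def pos_square_def)
  have i6: "integrable lborel (\<lambda>r. r ^ 6 * u r)"
  proof -
    have "integrable lborel (\<lambda>r. indicator {0..} r *\<^sub>R (g r * r ^ 8))"
      using f8 unfolding finite_line_moment_def set_integrable_def
      by (rule Bochner_Integration.integrable_cong[THEN iffD1, rotated -1]) (auto simp: g_def indicator_def)
    also have "?this \<longleftrightarrow> integrable lborel (\<lambda>r. r ^ 6 * u r)"
    proof (rule integrable_cong_AE)
      show "AE r in lborel. indicator {0..} r *\<^sub>R (g r * r ^ 8) = r ^ 6 * u r"
        using ae by eventually_elim (auto simp: u_def indicator_def eval_nat_numeral not_less)
    qed measurable
    finally show ?thesis .
  qed
  have "integrable lborel (\<lambda>r. (1 + r) ^ 6 * u r)"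
  proof (rule Bochner_Integration.integrable_bound)
    show "integrable lborel (\<lambda>r. 64 * c * indicator {0..1} r + 64 * (r ^ 6 * u r))"
      by (intro Bochner_Integration.integrable_add integrable_mult_right integrable_indicator_Icc i6)
    show "AE r in lborel. norm ((1 + r) ^ 6 * u r) \<le> norm (64 * c * indicator {0..1} r + 64 * (r ^ 6 * u r))"
    proof (rule AE_I2)
      fix r
      have "(1 + r) ^ 6 * u r \<le> 64 * c * indicator {0..1} r + 64 * (r ^ 6 * u r) \<and> 0 \<le> (1 + r) ^ 6 * u r"
      proof (cases "0 < r")
        case True
        show ?thesis
        proof (cases "r \<le> 1")
          case le: True
          have "(1 + r) ^ 6 \<le> 2 ^ 6" using True le by (intro power_mono) auto
          hence "(1 + r) ^ 6 * u r \<le> 64 * c" using ub[of r] c0 by (intro mult_mono) auto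
          thus ?thesis using True le ub[of r] by (simp add: add_increasing2)
        next
          case False
          have "(1 + r) ^ 6 \<le> (2 * r) ^ 6" using False by (intro power_mono) auto
          also have "\<dots> = 64 * r ^ 6" by (simp add: power_mult_distrib)
          finally have "(1 + r) ^ 6 * u r \<le> 64 * r ^ 6 * u r" using ub[of r] by (intro mult_right_mono)
          thus ?thesis using False c0 ub[of r] by simp
        qed
      qed (use c0 uz[of r] in simp)
      thus "norm ((1 + r) ^ 6 * u r) \<le> norm (64 * c * indicator {0..1} r + 64 * (r ^ 6 * u r))" by auto
    qed
  qed measurable
  hence d: "dens u" using um ub uz unfolding dens_def by blast
  have r: "represents u f" using d rm aeu by (simp add: represents_def)
  have "(LBINT r. r * u r) = h3" using represents_line_moment(1)[OF r, of 3 1] m3 by simp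
  moreover have "(LBINT r. r ^ 6 * u r) \<le> h8" using represents_line_moment(1)[OF r, of 8 6] m8 by simp
  ultimately show ?thesis using r ub by blast
qed

lemma profile_state_set:
  assumes u: "dens u" "\<And>r. u r \<le> hinf" "(LBINT r. r * u r) = h3" "(LBINT r. r ^ 6 * u r) \<le> h8"
  shows "(\<lambda>r. u r / r\<^sup>2) \<in> state_set h3 h8 hinf"
proof -
  let ?f = "\<lambda>r. u r / r\<^sup>2"
  have r: "represents u ?f" by (rule represents_profile[OF u(1)])
  have "integrable lborel (radial ?f)" by (rule represents_integrable[OF r])
  moreover have "AE p in lborel. 0 \<le> radial ?f p" using dens_nonneg[OF u(1)] by (simp add: radial_def)
  moreover have "finite_line_moment 3 ?f" "line_moment 3 ?f = h3"
    using represents_line_moment[OF r, of 3 1] pow_integrable[OF u(1), of 1] u(3) by auto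
  moreover have "finite_line_moment 8 ?f" "line_moment 8 ?f \<le> h8"
    using represents_line_moment[OF r, of 8 6] pow_integrable[OF u(1), of 6] u(4) by auto
  moreover have "Linfty_norm (\<lambda>p. radial ?f p * (norm p)\<^sup>2) \<le> ereal hinf"
    unfolding Linfty_norm_def
  proof (rule esssup_I)
    have "radial ?f \<in> borel_measurable borel" using r by (simp add: represents_def)
    thus "(\<lambda>p. ereal \<bar>radial ?f p * (norm p)\<^sup>2\<bar>) \<in> borel_measurable lborel" by measurable
    have "0 \<le> hinf" using u(2)[of 0] dens_nonneg[OF u(1), of 0] by linarith
    thus "AE p in lborel. ereal \<bar>radial ?f p * (norm p)\<^sup>2\<bar> \<le> ereal hinf"
      using u(2) dens_nonneg[OF u(1)] by (intro AE_I2) (auto simp: radial_def)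
  qed
  ultimately show ?thesis by (simp add: state_set_def)
qed

text \<open>The integrand is odd under reflection of p. Where it is not integrable, the integral is
  0 by convention.\<close>

lemma momentum_eq_0: "momentum f = 0"
proof (cases "integrable lborel (\<lambda>p :: real ^ 3. radial f p *\<^sub>R p)")
  case True
  have d: "distr lborel borel uminus = (lborel :: (real ^ 3) measure)"
    using lborel_affine[of "-1" "0 :: real ^ 3"] by (simp add: density_1)
  have "momentum f = (LINT p|distr lborel borel uminus. radial f p *\<^sub>R p)"
    unfolding d momentum_def ..
  also have "\<dots> = (LINT p|lborel. radial f (- p) *\<^sub>R (- p))"
    by (rule integral_distr) (use borel_measurable_integrable[OF True] in auto)
  also have "\<dots> = - momentum f" by (simp add: momentum_def radial_def)
  finally have "momentum f + momentum f = 0" by simp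
  hence "(2 :: real) *\<^sub>R momentum f = 0" by (simp only: scaleR_2)
  thus ?thesis by simp
qed (simp add: momentum_def not_integrable_integral_eq)

section \<open>Flows and the change of time\<close>

text \<open>The last clause is the differential equation \<open>U' = coll U\<close> in \<open>L\<^sup>1\<close>, in the form of a mean value
  inequality.\<close>

definition is_flow :: "real \<Rightarrow> real \<Rightarrow> real \<Rightarrow> (real \<Rightarrow> real \<Rightarrow> real) \<Rightarrow> bool" where
  "is_flow h3 h8 M U \<longleftrightarrow>
    (\<forall>t\<ge>0. dens (U t) \<and> (\<forall>r. U t r \<le> M) \<and> (LBINT r. r * U t r) = h3 \<and> (LBINT r. r ^ 6 * U t r) \<le> h8)
    \<and> (\<exists>L\<ge>0. \<forall>s t. 0 \<le> s \<longrightarrow> s \<le> t \<longrightarrow> ldist (U s) (U t) \<le> L * (t - s))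
    \<and> (\<forall>c d b \<sigma>. 0 \<le> c \<longrightarrow> c \<le> d \<longrightarrow> integrable lborel b \<longrightarrow> (\<forall>\<xi>\<in>{c..d}. (LBINT r. \<bar>coll (U \<xi>) r - b r\<bar>) \<le> \<sigma>)
         \<longrightarrow> (LBINT r. \<bar>U d r - U c r - (d - c) * b r\<bar>) \<le> (d - c) * \<sigma>)"

lemma is_flowD:
  assumes "is_flow h3 h8 M U" "0 \<le> t"
  shows "dens (U t)" "U t r \<le> M" "(LBINT r. r * U t r) = h3" "(LBINT r. r ^ 6 * U t r) \<le> h8" "mom 6 (U t) \<le> 64 * (M + h8)"
proof -
  show *: "dens (U t)" "U t r \<le> M" "(LBINT r. r * U t r) = h3" "(LBINT r. r ^ 6 * U t r) \<le> h8" for r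
    using assms by (simp_all add: is_flow_def)
  show "mom 6 (U t) \<le> 64 * (M + h8)" using * by (intro mom6_le)
qed

lemma is_flow_lipschitz:
  assumes "is_flow h3 h8 M U"
  obtains L where "0 \<le> L" "\<And>s t. 0 \<le> s \<Longrightarrow> 0 \<le> t \<Longrightarrow> ldist (U s) (U t) \<le> L * \<bar>s - t\<bar>"
proof -
  obtain L where L: "0 \<le> L" "\<And>s t. 0 \<le> s \<Longrightarrow> s \<le> t \<Longrightarrow> ldist (U s) (U t) \<le> L * (t - s)"
    using assms unfolding is_flow_def by blast
  have "ldist (U s) (U t) \<le> L * \<bar>s - t\<bar>" if "0 \<le> s" "0 \<le> t" for s t
    using L(2)[of s t] L(2)[of t s] that ldist_commute[of "U s" "U t"] by (cases "s \<le> t") auto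
  thus ?thesis using that L(1) by blast
qed

text \<open>Version without an order between c and d, as two-sided difference quotients
  require.\<close>

lemma is_flow_mean_value:
  assumes f: "is_flow h3 h8 M U" and cd: "0 \<le> c" "0 \<le> d" and b: "integrable lborel b"
    and \<sigma>: "\<And>\<xi>. min c d \<le> \<xi> \<Longrightarrow> \<xi> \<le> max c d \<Longrightarrow> (LBINT r. \<bar>coll (U \<xi>) r - b r\<bar>) \<le> \<sigma>"
  shows "(LBINT r. \<bar>U d r - U c r - (d - c) * b r\<bar>) \<le> \<bar>d - c\<bar> * \<sigma>"
proof -
  have mv: "(LBINT r. \<bar>U d r - U c r - (d - c) * b r\<bar>) \<le> (d - c) * \<sigma>"
    if "0 \<le> c" "c \<le> d" "\<forall>\<xi>\<in>{c..d}. (LBINT r. \<bar>coll (U \<xi>) r - b r\<bar>) \<le> \<sigma>" for c d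
    using f b that unfolding is_flow_def by blast
  show ?thesis
  proof (cases "c \<le> d")
    case True thus ?thesis using mv[of c d] cd \<sigma> by auto
  next
    case False
    have "(LBINT r. \<bar>U d r - U c r - (d - c) * b r\<bar>) = (LBINT r. \<bar>U c r - U d r - (c - d) * b r\<bar>)"
      by (rule Bochner_Integration.integral_cong) (auto simp: algebra_simps abs_minus_commute)
    thus ?thesis using mv[of d c] cd \<sigma> False by auto
  qed
qed

lemma is_flow_coll_continuous:
  assumes f: "is_flow h3 h8 M U" and t: "0 \<le> t" and e: "0 < e"
  shows "\<exists>\<delta>>0. \<forall>s\<ge>0. \<bar>s - t\<bar> < \<delta> \<longrightarrow> (LBINT r. \<bar>coll (U s) r - coll (U t) r\<bar>) < e"
proof -
  let ?B = "64 * (M + h8)"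
  have B0: "0 \<le> ?B" using is_flowD(5)[OF f t] mom_nonneg[OF is_flowD(1)[OF f t], of 6] by linarith
  obtain \<delta> where \<delta>: "0 < \<delta>" "\<And>u v. dens u \<Longrightarrow> dens v \<Longrightarrow> mom 6 u \<le> ?B \<Longrightarrow> mom 6 v \<le> ?B \<Longrightarrow> ldist u v < \<delta> \<Longrightarrow> (LBINT r. \<bar>coll u r - coll v r\<bar>) < e"
    using coll_uniformly_continuous[OF B0 e] by blast
  obtain L where L: "0 \<le> L" "\<And>s t. 0 \<le> s \<Longrightarrow> 0 \<le> t \<Longrightarrow> ldist (U s) (U t) \<le> L * \<bar>s - t\<bar>"
    by (rule is_flow_lipschitz[OF f]) (rule that)
  have "(LBINT r. \<bar>coll (U s) r - coll (U t) r\<bar>) < e" if s: "0 \<le> s" "\<bar>s - t\<bar> < \<delta> / (L + 1)" for s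
  proof (rule \<delta>(2))
    have "ldist (U s) (U t) \<le> (L + 1) * \<bar>s - t\<bar>" using L(2)[OF s(1) t] by (simp add: algebra_simps) 
    also have "\<dots> < (L + 1) * (\<delta> / (L + 1))" using s(2) L(1) by (intro mult_strict_left_mono) auto
    finally show "ldist (U s) (U t) < \<delta>" using L(1) by simp
  qed (use is_flowD[OF f] t s in auto)
  moreover have "0 < \<delta> / (L + 1)" using L(1) \<delta>(1) by simp
  ultimately show ?thesis by blast
qed

lemma is_flow_coll_bound:
  assumes f: "is_flow h3 h8 M U"
  obtains K where "0 \<le> K" "\<And>t. 0 \<le> t \<Longrightarrow> (LBINT r. \<bar>coll (U t) r\<bar>) \<le> K"
proof -
  let ?B = "64 * (M + h8)"
  have "0 \<le> ?B" using is_flowD(5)[OF f, of 0] mom_nonneg[OF is_flowD(1)[OF f, of 0], of 6] by linarith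
  hence "0 \<le> (22 * ?B + 3) * ?B" by simp
  thus ?thesis using that coll_L1_bound[OF is_flowD(1,5)[OF f]] by blast
qed

lemma tendsto_eventually_abs:
  fixes l d :: real
  assumes "(f \<longlongrightarrow> l) F" "0 < d" shows "eventually (\<lambda>x. \<bar>f x - l\<bar> < d) F"
  using tendstoD[OF assms] by (simp only: dist_real_def)

text \<open>The quotient splits into the deviation of U from its linearization, controlled by the
  mean value inequality, and the error of the scalar quotient times \<open>coll\<close>, whose L^1
  norm is bounded along the flow.\<close>

lemma is_flow_chain_rule:
  assumes f: "is_flow h3 h8 M U" and t: "t \<in> S" and pos: "\<And>s. s \<in> S \<Longrightarrow> 0 \<le> \<sigma> s"
    and d: "(\<sigma> has_real_derivative a) (at t within S)"
  shows "((\<lambda>s. LBINT r. \<bar>(U (\<sigma> s) r - U (\<sigma> t) r) / (s - t) - a * coll (U (\<sigma> t)) r\<bar>) \<longlongrightarrow> 0) (at t within S)"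
proof (rule order_tendstoI)
  fix e :: real assume "e < 0"
  thus "eventually (\<lambda>s. e < (LBINT r. \<bar>(U (\<sigma> s) r - U (\<sigma> t) r) / (s - t) - a * coll (U (\<sigma> t)) r\<bar>)) (at t within S)"
    by (intro always_eventually allI) (erule less_le_trans, simp)
next
  fix e :: real assume e: "0 < e"
  obtain K where K: "0 \<le> K" "\<And>t. 0 \<le> t \<Longrightarrow> (LBINT r. \<bar>coll (U t) r\<bar>) \<le> K" by (rule is_flow_coll_bound[OF f]) (rule that)
  \<comment> \<open>Half of e for either part. The second tolerance \<open>\<mu>\<close> is at most
    1, which bounds the scalar quotient by \<open>\<bar>a\<bar> + 1\<close>.\<close>
  define \<eta> where "\<eta> = e / (2 * (\<bar>a\<bar> + 1))"
  have \<eta>: "0 < \<eta>" "(\<bar>a\<bar> + 1) * \<eta> = e / 2" using e by (simp_all add: \<eta>_def field_simps)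
  define \<mu> where "\<mu> = min 1 (e / (2 * (K + 1)))"
  have \<mu>0: "0 < \<mu>" "\<mu> \<le> 1" using e K(1) by (auto simp: \<mu>_def)
  have "\<mu> * K < e / 2"
  proof -
    have "\<mu> * K \<le> e / (2 * (K + 1)) * K" using K(1) by (intro mult_right_mono) (auto simp: \<mu>_def)
    also have "\<dots> < e / (2 * (K + 1)) * (K + 1)" using e K(1) by (intro mult_strict_left_mono) auto
    also have "\<dots> = e / 2" using K(1) by (simp add: field_simps)
    finally show ?thesis .
  qed
  note \<mu> = \<mu>0 this
  have t0: "0 \<le> \<sigma> t" using pos t by blast
  obtain \<delta> where \<delta>: "0 < \<delta>" "\<And>s. 0 \<le> s \<Longrightarrow> \<bar>s - \<sigma> t\<bar> < \<delta> \<Longrightarrow> (LBINT r. \<bar>coll (U s) r - coll (U (\<sigma> t)) r\<bar>) < \<eta>"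
    using is_flow_coll_continuous[OF f t0 \<eta>(1)] by blast
  have "(\<sigma> \<longlongrightarrow> \<sigma> t) (at t within S)" using DERIV_continuous[OF d] by (simp add: continuous_within)
  hence "eventually (\<lambda>s. \<bar>\<sigma> s - \<sigma> t\<bar> < \<delta>) (at t within S)" using \<delta>(1) by (rule tendsto_eventually_abs)
  moreover have "((\<lambda>s. (\<sigma> s - \<sigma> t) / (s - t)) \<longlongrightarrow> a) (at t within S)"
    using d by (simp add: has_field_derivative_iff)
  hence "eventually (\<lambda>s. \<bar>(\<sigma> s - \<sigma> t) / (s - t) - a\<bar> < \<mu>) (at t within S)" using \<mu>(1) by (rule tendsto_eventually_abs)
  moreover have "eventually (\<lambda>s. s \<in> S \<and> s \<noteq> t) (at t within S)" by (simp add: eventually_at_filter)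
  ultimately show "eventually (\<lambda>s. (LBINT r. \<bar>(U (\<sigma> s) r - U (\<sigma> t) r) / (s - t) - a * coll (U (\<sigma> t)) r\<bar>) < e) (at t within S)"
  proof eventually_elim
    case (elim s)
    let ?b = "coll (U (\<sigma> t))" and ?q = "(\<sigma> s - \<sigma> t) / (s - t)"
    have s0: "0 \<le> \<sigma> s" using pos elim by blast
    have ib: "integrable lborel ?b" by (rule coll_integrable[OF is_flowD(1)[OF f t0]])
    have iU: "integrable lborel (U (\<sigma> s))" "integrable lborel (U (\<sigma> t))"
      using dens_integrable_self is_flowD(1)[OF f] s0 t0 by auto
    have 1: "(LBINT r. \<bar>U (\<sigma> s) r - U (\<sigma> t) r - (\<sigma> s - \<sigma> t) * ?b r\<bar>) \<le> \<bar>\<sigma> s - \<sigma> t\<bar> * \<eta>"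
    proof (rule is_flow_mean_value[OF f t0 s0 ib])
      fix \<xi> assume "min (\<sigma> t) (\<sigma> s) \<le> \<xi>" "\<xi> \<le> max (\<sigma> t) (\<sigma> s)"
      hence "0 \<le> \<xi>" "\<bar>\<xi> - \<sigma> t\<bar> < \<delta>" using elim(1) s0 t0 by (auto simp: min_def max_def split: if_splits)
      thus "(LBINT r. \<bar>coll (U \<xi>) r - ?b r\<bar>) \<le> \<eta>" by (rule less_imp_le[OF \<delta>(2)])
    qed
    have i1: "integrable lborel (\<lambda>r. (1 / \<bar>s - t\<bar>) * \<bar>U (\<sigma> s) r - U (\<sigma> t) r - (\<sigma> s - \<sigma> t) * ?b r\<bar>)"
      by (intro integrable_mult_right integrable_abs Bochner_Integration.integrable_diff iU ib)
    have i2: "integrable lborel (\<lambda>r. \<bar>?q - a\<bar> * \<bar>?b r\<bar>)" by (intro integrable_mult_right integrable_abs ib)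
    have "(LBINT r. \<bar>(U (\<sigma> s) r - U (\<sigma> t) r) / (s - t) - a * ?b r\<bar>)
      \<le> (LBINT r. (1 / \<bar>s - t\<bar>) * \<bar>U (\<sigma> s) r - U (\<sigma> t) r - (\<sigma> s - \<sigma> t) * ?b r\<bar> + \<bar>?q - a\<bar> * \<bar>?b r\<bar>)"
    proof (rule integral_mono[OF _ Bochner_Integration.integrable_add[OF i1 i2]])
      have "integrable lborel (\<lambda>r. (1 / (s - t)) * (U (\<sigma> s) r - U (\<sigma> t) r) - a * ?b r)"
        by (intro integrable_mult_right Bochner_Integration.integrable_diff iU ib)
      thus "integrable lborel (\<lambda>r. \<bar>(U (\<sigma> s) r - U (\<sigma> t) r) / (s - t) - a * ?b r\<bar>)" by (intro integrable_abs) simp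
      fix r
      have "(U (\<sigma> s) r - U (\<sigma> t) r) / (s - t) - a * ?b r = (U (\<sigma> s) r - U (\<sigma> t) r - (\<sigma> s - \<sigma> t) * ?b r) / (s - t) + (?q - a) * ?b r"
        by (simp add: diff_divide_distrib left_diff_distrib)
      hence "\<bar>(U (\<sigma> s) r - U (\<sigma> t) r) / (s - t) - a * ?b r\<bar> \<le> \<bar>(U (\<sigma> s) r - U (\<sigma> t) r - (\<sigma> s - \<sigma> t) * ?b r) / (s - t)\<bar> + \<bar>(?q - a) * ?b r\<bar>"
        by (simp only: abs_triangle_ineq)
      thus "\<bar>(U (\<sigma> s) r - U (\<sigma> t) r) / (s - t) - a * ?b r\<bar> \<le> (1 / \<bar>s - t\<bar>) * \<bar>U (\<sigma> s) r - U (\<sigma> t) r - (\<sigma> s - \<sigma> t) * ?b r\<bar> + \<bar>?q - a\<bar> * \<bar>?b r\<bar>"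
        by (simp only: abs_mult abs_divide times_divide_eq_left mult_1)
    qed
    also have "\<dots> = (1 / \<bar>s - t\<bar>) * (LBINT r. \<bar>U (\<sigma> s) r - U (\<sigma> t) r - (\<sigma> s - \<sigma> t) * ?b r\<bar>) + \<bar>?q - a\<bar> * (LBINT r. \<bar>?b r\<bar>)"
      by (simp only: Bochner_Integration.integral_add[OF i1 i2] integral_mult_right_zero)
    also have "\<dots> \<le> (1 / \<bar>s - t\<bar>) * (\<bar>\<sigma> s - \<sigma> t\<bar> * \<eta>) + \<mu> * K"
      using 1 elim(2) K(2)[OF t0] \<mu> by (intro add_mono mult_left_mono mult_mono) auto
    also have "(1 / \<bar>s - t\<bar>) * (\<bar>\<sigma> s - \<sigma> t\<bar> * \<eta>) = \<bar>?q\<bar> * \<eta>" by (simp add: abs_divide)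
    also have "\<bar>?q\<bar> * \<eta> \<le> (\<bar>a\<bar> + 1) * \<eta>" using elim(2) \<mu>(2) \<eta>(1) by (intro mult_right_mono) linarith+
    also have "(\<bar>a\<bar> + 1) * \<eta> + \<mu> * K < e" using \<eta>(2) \<mu>(3) by linarith
    finally show ?case by simp
  qed
qed

lemma is_flow_rate_continuous:
  assumes f: "is_flow h3 h8 M U" and t: "t \<in> S" and pos: "\<And>s. s \<in> S \<Longrightarrow> 0 \<le> \<sigma> s"
    and c: "(\<sigma> \<longlongrightarrow> \<sigma> t) (at t within S)" and a: "(a \<longlongrightarrow> a t) (at t within S)"
  shows "((\<lambda>s. LBINT r. \<bar>a s * coll (U (\<sigma> s)) r - a t * coll (U (\<sigma> t)) r\<bar>) \<longlongrightarrow> 0) (at t within S)"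
proof -
  obtain K where K: "0 \<le> K" "\<And>t. 0 \<le> t \<Longrightarrow> (LBINT r. \<bar>coll (U t) r\<bar>) \<le> K" by (rule is_flow_coll_bound[OF f]) (rule that)
  have t0: "0 \<le> \<sigma> t" using pos t by blast
  let ?D = "\<lambda>s. LBINT r. \<bar>coll (U (\<sigma> s)) r - coll (U (\<sigma> t)) r\<bar>"
  have D: "(?D \<longlongrightarrow> 0) (at t within S)"
  proof (rule order_tendstoI)
    fix e :: real assume e: "0 < e"
    obtain \<delta> where \<delta>: "0 < \<delta>" "\<And>s. 0 \<le> s \<Longrightarrow> \<bar>s - \<sigma> t\<bar> < \<delta> \<Longrightarrow> (LBINT r. \<bar>coll (U s) r - coll (U (\<sigma> t)) r\<bar>) < e"
      using is_flow_coll_continuous[OF f t0 e] by blast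
    have "eventually (\<lambda>s. \<bar>\<sigma> s - \<sigma> t\<bar> < \<delta>) (at t within S)" by (rule tendsto_eventually_abs[OF c \<delta>(1)])
    moreover have "eventually (\<lambda>s. s \<in> S) (at t within S)" by (simp add: eventually_at_filter)
    ultimately show "eventually (\<lambda>s. ?D s < e) (at t within S)" by eventually_elim (rule \<delta>(2)[OF pos])
  next
    fix e :: real assume e: "e < 0"
    show "eventually (\<lambda>s. e < ?D s) (at t within S)" using e
      by (intro always_eventually allI) (erule less_le_trans, simp)
  qed
  have "((\<lambda>s. \<bar>a s - a t\<bar> * K + \<bar>a t\<bar> * ?D s) \<longlongrightarrow> \<bar>a t - a t\<bar> * K + \<bar>a t\<bar> * 0) (at t within S)"
    by (intro tendsto_add tendsto_mult tendsto_rabs tendsto_diff tendsto_const a D)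
  hence lim: "((\<lambda>s. \<bar>a s - a t\<bar> * K + \<bar>a t\<bar> * ?D s) \<longlongrightarrow> 0) (at t within S)" by simp
  show ?thesis
  proof (rule Lim_null_comparison[OF _ lim])
    have "norm (LBINT r. \<bar>a s * coll (U (\<sigma> s)) r - a t * coll (U (\<sigma> t)) r\<bar>) \<le> \<bar>a s - a t\<bar> * K + \<bar>a t\<bar> * ?D s" if s: "s \<in> S" for s
    proof -
      have s0: "0 \<le> \<sigma> s" using pos s by blast
      have ib: "integrable lborel (coll (U (\<sigma> s)))" "integrable lborel (coll (U (\<sigma> t)))"
        using coll_integrable is_flowD(1)[OF f] s0 t0 by auto
      have i: "integrable lborel (\<lambda>r. \<bar>a s - a t\<bar> * \<bar>coll (U (\<sigma> s)) r\<bar>)" "integrable lborel (\<lambda>r. \<bar>a t\<bar> * \<bar>coll (U (\<sigma> s)) r - coll (U (\<sigma> t)) r\<bar>)"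
        by (intro integrable_mult_right integrable_abs Bochner_Integration.integrable_diff ib)+
      have "(LBINT r. \<bar>a s * coll (U (\<sigma> s)) r - a t * coll (U (\<sigma> t)) r\<bar>)
        \<le> (LBINT r. \<bar>a s - a t\<bar> * \<bar>coll (U (\<sigma> s)) r\<bar> + \<bar>a t\<bar> * \<bar>coll (U (\<sigma> s)) r - coll (U (\<sigma> t)) r\<bar>)"
      proof (rule integral_mono[OF _ Bochner_Integration.integrable_add[OF i]])
        show "integrable lborel (\<lambda>r. \<bar>a s * coll (U (\<sigma> s)) r - a t * coll (U (\<sigma> t)) r\<bar>)"
          by (intro integrable_abs Bochner_Integration.integrable_diff integrable_mult_right ib)
        fix r
        have "a s * coll (U (\<sigma> s)) r - a t * coll (U (\<sigma> t)) r = (a s - a t) * coll (U (\<sigma> s)) r + a t * (coll (U (\<sigma> s)) r - coll (U (\<sigma> t)) r)"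
          by (simp add: algebra_simps)
        thus "\<bar>a s * coll (U (\<sigma> s)) r - a t * coll (U (\<sigma> t)) r\<bar> \<le> \<bar>a s - a t\<bar> * \<bar>coll (U (\<sigma> s)) r\<bar> + \<bar>a t\<bar> * \<bar>coll (U (\<sigma> s)) r - coll (U (\<sigma> t)) r\<bar>"
          by (simp only: abs_mult[symmetric] abs_triangle_ineq)
      qed
      also have "\<dots> = \<bar>a s - a t\<bar> * (LBINT r. \<bar>coll (U (\<sigma> s)) r\<bar>) + \<bar>a t\<bar> * ?D s"
        by (simp only: Bochner_Integration.integral_add[OF i] integral_mult_right_zero)
      also have "\<dots> \<le> \<bar>a s - a t\<bar> * K + \<bar>a t\<bar> * ?D s" using K(2)[OF s0] by (intro add_mono mult_left_mono) auto
      finally show ?thesis by simp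
    qed
    thus "eventually (\<lambda>s. norm (LBINT r. \<bar>a s * coll (U (\<sigma> s)) r - a t * coll (U (\<sigma> t)) r\<bar>) \<le> \<bar>a s - a t\<bar> * K + \<bar>a t\<bar> * ?D s) (at t within S)"
      by (auto simp: eventually_at_filter)
  qed
qed

section \<open>Mass along a flow and the clock\<close>

abbreviation mass :: "(real \<Rightarrow> real) \<Rightarrow> real" where "mass u \<equiv> LBINT r. u r"

lemma mass_diff_le: "dens u \<Longrightarrow> dens v \<Longrightarrow> \<bar>mass u - mass v\<bar> \<le> ldist u v"
  unfolding ldist_def
  using integral_abs_bound[of lborel "\<lambda>r. u r - v r"] dens_integrable_self[of u] dens_integrable_self[of v] by simp

lemma is_flow_mass_continuous:
  assumes f: "is_flow h3 h8 M U" shows "continuous_on {0..} (\<lambda>t. mass (U t))"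
proof -
  obtain L where L: "0 \<le> L" "\<And>s t. 0 \<le> s \<Longrightarrow> 0 \<le> t \<Longrightarrow> ldist (U s) (U t) \<le> L * \<bar>s - t\<bar>"
    by (rule is_flow_lipschitz[OF f]) (rule that)
  show ?thesis
  proof (rule lipschitz_imp_continuous_on[OF L(1)])
    fix s t :: real assume "s \<in> {0..}" "t \<in> {0..}" "s \<le> t"
    thus "\<bar>mass (U s) - mass (U t)\<bar> \<le> L * (t - s)"
      using mass_diff_le[OF is_flowD(1)[OF f, of s] is_flowD(1)[OF f, of t]] L(2)[of s t] by auto
  qed
qed

text \<open>Total mass is a bounded linear functional on L^1, so the L^1 derivative passes through
  it.\<close>

lemma is_flow_mass_derivative:
  assumes f: "is_flow h3 h8 M U" and t: "t \<in> S" and pos: "\<And>s. s \<in> S \<Longrightarrow> 0 \<le> \<sigma> s"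
    and d: "(\<sigma> has_real_derivative a) (at t within S)"
  shows "((\<lambda>s. mass (U (\<sigma> s))) has_real_derivative a * (LBINT r. coll (U (\<sigma> t)) r)) (at t within S)"
  unfolding has_field_derivative_iff
proof (rule LIM_zero_cancel, rule Lim_null_comparison[OF _ is_flow_chain_rule[OF f t pos d]])
  have t0: "0 \<le> \<sigma> t" using pos t by blast
  have "norm ((mass (U (\<sigma> s)) - mass (U (\<sigma> t))) / (s - t) - a * (LBINT r. coll (U (\<sigma> t)) r))
    \<le> (LBINT r. \<bar>(U (\<sigma> s) r - U (\<sigma> t) r) / (s - t) - a * coll (U (\<sigma> t)) r\<bar>)" if s: "s \<in> S" for s
  proof -
    have s0: "0 \<le> \<sigma> s" using pos s by blast
    have ib: "integrable lborel (coll (U (\<sigma> t)))" using coll_integrable is_flowD(1)[OF f] t0 by auto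
    have iU: "integrable lborel (U (\<sigma> s))" "integrable lborel (U (\<sigma> t))"
      using dens_integrable_self is_flowD(1)[OF f] s0 t0 by auto
    have "(mass (U (\<sigma> s)) - mass (U (\<sigma> t))) / (s - t) - a * (LBINT r. coll (U (\<sigma> t)) r)
      = (LBINT r. (U (\<sigma> s) r - U (\<sigma> t) r) / (s - t) - a * coll (U (\<sigma> t)) r)"
      using ib iU by simp
    thus ?thesis using integral_abs_bound[of lborel "\<lambda>r. (U (\<sigma> s) r - U (\<sigma> t) r) / (s - t) - a * coll (U (\<sigma> t)) r"] by simp
  qed
  thus "eventually (\<lambda>s. norm ((mass (U (\<sigma> s)) - mass (U (\<sigma> t))) / (s - t) - a * (LBINT r. coll (U (\<sigma> t)) r))
    \<le> (LBINT r. \<bar>(U (\<sigma> s) r - U (\<sigma> t) r) / (s - t) - a * coll (U (\<sigma> t)) r\<bar>)) (at t within S)"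
    by (auto simp: eventually_at_filter)
qed

text \<open>F is physical time as a function of the autonomous time, with G = n_c / kappa_0, and the
  clock is its inverse. The lower bound on G makes F injective and onto [0, oo), so physical time is
  global and every autonomous time is reached.\<close>

lemma clock_exists:
  fixes G :: "real \<Rightarrow> real"
  assumes c: "continuous_on {0..} G" and \<delta>: "0 < \<delta>" and G: "\<And>t. 0 \<le> t \<Longrightarrow> \<delta> \<le> G t"
  defines "F \<equiv> \<lambda>t. integral {0..t} G"
  shows "\<exists>\<sigma>. \<sigma> 0 = 0 \<and> (\<forall>t\<ge>0. 0 \<le> \<sigma> t \<and> F (\<sigma> t) = t) \<and> (\<forall>\<tau>\<ge>0. 0 \<le> F \<tau> \<and> \<sigma> (F \<tau>) = \<tau>)
     \<and> continuous_on {0..} \<sigma> \<and> (\<forall>t>0. (\<sigma> has_real_derivative 1 / G (\<sigma> t)) (at t))"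
    and "\<And>\<tau>. 0 < \<tau> \<Longrightarrow> (F has_real_derivative G \<tau>) (at \<tau>)" and "\<And>T. continuous_on {0..T} F"
proof -
  have ci: "G integrable_on {a..b}" if "0 \<le> a" for a b
    using that by (intro integrable_continuous_real continuous_on_subset[OF c]) auto
  show Fd: "(F has_real_derivative G \<tau>) (at \<tau>)" if "0 < \<tau>" for \<tau>
  proof -
    have "(F has_real_derivative G \<tau>) (at \<tau> within {0..\<tau> + 1})"
      unfolding F_def by (rule integral_has_real_derivative) (use that in \<open>auto intro: continuous_on_subset[OF c]\<close>)
    thus ?thesis using that by (simp add: at_within_Icc_at)
  qed
  have F0: "F 0 = 0" by (simp add: F_def)
  have Fc: "continuous_on {0..T} F" for T
    unfolding F_def by (rule indefinite_integral_continuous_1[OF ci]) simp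
  show "continuous_on {0..T} F" for T by (rule Fc)
  have inc: "\<delta> * (t - s) \<le> F t - F s" if "0 \<le> s" "s \<le> t" for s t
  proof -
    have "F t = F s + integral {s..t} G"
      unfolding F_def using Henstock_Kurzweil_Integration.integral_combine[of 0 s t G] ci[of 0 t] that by simp
    moreover have "integral {s..t} (\<lambda>_. \<delta>) \<le> integral {s..t} G"
      using that G by (intro integral_le ci integrable_const_ivl) auto
    ultimately show ?thesis using that by (simp add: mult.commute)
  qed
  have inj: "s = t" if "0 \<le> s" "0 \<le> t" "F s = F t" for s t
  proof (cases "s \<le> t")
    case True
    hence "\<delta> * (t - s) \<le> 0" using inc[of s t] that by simp
    thus ?thesis using \<delta> True by (simp add: mult_le_0_iff)
  next
    case False
    hence "\<delta> * (s - t) \<le> 0" using inc[of t s] that by simp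
    thus ?thesis using \<delta> False by (simp add: mult_le_0_iff)
  qed
  have ex: "\<exists>\<tau>\<ge>0. F \<tau> = t" if "0 \<le> t" for t
  proof -
    have "t \<le> F (t / \<delta>)" using inc[of 0 "t / \<delta>"] F0 \<delta> that by simp
    moreover have "0 \<le> t / \<delta>" using that \<delta> by simp
    ultimately have "\<exists>x\<ge>0. x \<le> t / \<delta> \<and> F x = t" by (intro IVT' Fc) (simp_all add: F0 that)
    thus ?thesis by blast
  qed
  define \<sigma> where "\<sigma> t = (SOME \<tau>. 0 \<le> \<tau> \<and> F \<tau> = t)" for t
  have \<sigma>: "0 \<le> \<sigma> t \<and> F (\<sigma> t) = t" if "0 \<le> t" for t
    unfolding \<sigma>_def by (rule someI_ex) (use ex[OF that] in blast)
  have Fpos: "0 \<le> F \<tau>" if "0 \<le> \<tau>" for \<tau>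
  proof -
    have "0 \<le> \<delta> * \<tau>" using that \<delta> by simp
    thus ?thesis using inc[of 0 \<tau>] that F0 by simp
  qed
  have \<sigma>F: "\<sigma> (F \<tau>) = \<tau>" if "0 \<le> \<tau>" for \<tau>
    by (rule inj) (use \<sigma>[OF Fpos[OF that]] that in \<open>blast+\<close>)
  have \<sigma>0: "\<sigma> 0 = 0" using \<sigma>F[of 0] F0 by simp
  have \<sigma>mono: "\<sigma> s \<le> \<sigma> t" if "0 \<le> s" "s \<le> t" for s t
  proof (rule ccontr)
    assume "\<not> \<sigma> s \<le> \<sigma> t"
    hence "\<delta> * (\<sigma> s - \<sigma> t) \<le> s - t" "0 < \<delta> * (\<sigma> s - \<sigma> t)" using inc[of "\<sigma> t" "\<sigma> s"] \<sigma>[of s] \<sigma>[of t] that \<delta> by auto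
    thus False using that by linarith
  qed
  have \<sigma>c: "continuous_on {0..} \<sigma>"
  proof (rule lipschitz_imp_continuous_on[where L = "1 / \<delta>"])
    fix s t :: real assume st: "s \<in> {0..}" "t \<in> {0..}" "s \<le> t"
    have "\<delta> * (\<sigma> t - \<sigma> s) \<le> t - s" using inc[of "\<sigma> s" "\<sigma> t"] \<sigma>[of s] \<sigma>[of t] \<sigma>mono[of s t] st by auto
    hence "\<sigma> t - \<sigma> s \<le> 1 / \<delta> * (t - s)" using \<delta> by (simp add: field_simps)
    thus "\<bar>\<sigma> s - \<sigma> t\<bar> \<le> 1 / \<delta> * (t - s)" using \<sigma>mono[of s t] st by simp
  qed (use \<delta> in simp)
  have \<sigma>d: "(\<sigma> has_real_derivative 1 / G (\<sigma> t)) (at t)" if t: "0 < t" for t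
  proof -
    have "\<sigma> t \<noteq> 0" using \<sigma>[of t] F0 t by auto
    hence pos: "0 < \<sigma> t" using \<sigma>[of t] t by simp
    have "continuous_on {0<..} \<sigma>" by (rule continuous_on_subset[OF \<sigma>c]) auto
    hence cont: "isCont \<sigma> t" using t by (simp add: continuous_on_eq_continuous_at)
    have "G (\<sigma> t) \<noteq> 0" using G[of "\<sigma> t"] pos \<delta> by auto
    hence "(\<sigma> has_real_derivative inverse (G (\<sigma> t))) (at t)"
      using t \<sigma> cont by (intro DERIV_inverse_function[where f = F and g = \<sigma> and x = t and a = 0 and b = "t + 1", OF Fd[OF pos]]) auto
    thus ?thesis by (simp add: inverse_eq_divide)
  qed
  show "\<exists>\<sigma>. \<sigma> 0 = 0 \<and> (\<forall>t\<ge>0. 0 \<le> \<sigma> t \<and> F (\<sigma> t) = t) \<and> (\<forall>\<tau>\<ge>0. 0 \<le> F \<tau> \<and> \<sigma> (F \<tau>) = \<tau>)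
     \<and> continuous_on {0..} \<sigma> \<and> (\<forall>t>0. (\<sigma> has_real_derivative 1 / G (\<sigma> t)) (at t))"
    using \<sigma>0 \<sigma> Fpos \<sigma>F \<sigma>c \<sigma>d by (intro exI[of _ \<sigma>] conjI allI impI) simp_all
qed

section \<open>The coupled system\<close>

lemma representsD:
  assumes "represents u f"
  shows "dens u" "radial f \<in> borel_measurable borel" "AE r in lborel. pos_square r * f r = u r"
  using assms by (auto simp: represents_def)

lemma represents_AE_eq:
  assumes u: "represents u f" and v: "represents v g"
  shows "(AE p in lborel. radial f p = radial g p) \<longleftrightarrow> (AE r in lborel. u r = v r)"
proof -
  have [measurable]: "(\<lambda>r. f \<bar>r\<bar>) \<in> borel_measurable borel" "(\<lambda>r. g \<bar>r\<bar>) \<in> borel_measurable borel"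
    using representsD(2)[OF u] representsD(2)[OF v] by (simp_all add: radial_meas_iff)
  have "(AE p in lborel. radial f p = radial g p) \<longleftrightarrow> (AE p in (lborel :: (real ^ 3) measure). f \<bar>norm p\<bar> = g \<bar>norm p\<bar>)"
    by (simp add: radial_def)
  also have "\<dots> \<longleftrightarrow> (AE r in lborel. 0 < r \<longrightarrow> f \<bar>r\<bar> = g \<bar>r\<bar>)"
    by (rule AE_radial_iff) measurable
  also have "\<dots> \<longleftrightarrow> (AE r in lborel. u r = v r)"
  proof -
    have iff: "AE r in lborel. (0 < r \<longrightarrow> f \<bar>r\<bar> = g \<bar>r\<bar>) \<longleftrightarrow> u r = v r"
      using representsD(3)[OF u] representsD(3)[OF v]
    proof eventually_elim
      case (elim r)
      show ?case
      proof (cases "0 < r")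
        case True
        hence "u r = r\<^sup>2 * f r" "v r = r\<^sup>2 * g r" using elim by (auto simp: pos_square_def)
        thus ?thesis using True by simp
      qed (use dens_zero[OF representsD(1)[OF u], of r] dens_zero[OF representsD(1)[OF v], of r] in simp)
    qed
    show ?thesis
    proof
      assume "AE r in lborel. 0 < r \<longrightarrow> f \<bar>r\<bar> = g \<bar>r\<bar>"
      thus "AE r in lborel. u r = v r" using iff by eventually_elim blast
    next
      assume "AE r in lborel. u r = v r"
      thus "AE r in lborel. 0 < r \<longrightarrow> f \<bar>r\<bar> = g \<bar>r\<bar>" using iff by eventually_elim blast
    qed
  qed
  finally show ?thesis .
qed

lemma represents_energy:
  assumes u: "represents u f" shows "energy f = 4 * pi * (LBINT r. r * u r)"
proof -
  have [measurable]: "radial f \<in> borel_measurable borel" by (rule representsD(2)[OF u])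
  have [measurable]: "(\<lambda>r. f \<bar>r\<bar>) \<in> borel_measurable borel" using representsD(2)[OF u] by (simp add: radial_meas_iff)
  note [measurable] = dens_meas[OF representsD(1)[OF u]]
  have eq: "radial f p * norm p = radial (\<lambda>r. f r * r) p" for p by (simp add: radial_def)
  have m: "radial (\<lambda>r. f r * r) \<in> borel_measurable borel"
    unfolding eq[symmetric, abs_def] by measurable
  have "energy f = 4 * pi * (LBINT r. pos_square r * (f r * r))"
    unfolding energy_def eq by (rule radial_integrable_iff(2)[OF m])
  also have "(LBINT r. pos_square r * (f r * r)) = (LBINT r. pos_square r * (f \<bar>r\<bar> * r))"
    by (rule Bochner_Integration.integral_cong) (auto simp: pos_square_def)
  also have "\<dots> = (LBINT r. r * u r)"
  proof (rule integral_cong_AE)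
    show "AE r in lborel. pos_square r * (f \<bar>r\<bar> * r) = r * u r"
      using representsD(3)[OF u]
      by eventually_elim (auto simp: pos_square_def dens_zero[OF representsD(1)[OF u]] split: if_splits)
  qed measurable
  finally show ?thesis .
qed

text \<open>The threshold constant is the total splitting rate at unit energy, the same 1/30 as in
  the linear loss.\<close>

lemma c_zero_eq: "c_zero = 1 / 30"
proof -
  have "c_zero = (LBINT z. pos_square (1 - z) * pos_square z)"
    unfolding c_zero_def set_lebesgue_integral_def
    by (rule Bochner_Integration.integral_cong) (auto simp: indicator_def pos_square_def)
  also have "\<dots> = 1 / 30" using has_bochner_integral_integral_eq[OF pos_square_convolution(1)[of 1]] by simp
  finally show ?thesis .
qed

lemma represents_L1_dist:
  assumes u: "represents u f" and v: "represents v g"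
  shows "L1_norm (\<lambda>p. radial f p - radial g p) = 4 * pi * ldist u v"
proof -
  have "L1_norm (radial (\<lambda>r. f r - g r)) = 4 * pi * (LBINT r. \<bar>u r - v r\<bar>)"
  proof (rule L1_norm_radial)
    show "radial (\<lambda>r. f r - g r) \<in> borel_measurable borel"
      using representsD(2)[OF u] representsD(2)[OF v] by (simp add: radial_def[abs_def])
    show "AE r in lborel. pos_square r * (f r - g r) = u r - v r"
      using representsD(3)[OF u] representsD(3)[OF v] by eventually_elim (simp add: right_diff_distrib)
  qed (use dens_meas[OF representsD(1)[OF u]] dens_meas[OF representsD(1)[OF v]] in measurable)
  thus ?thesis by (simp add: radial_def[abs_def] ldist_def)
qed

lemma represents_L1_rate:
  assumes u: "represents u f" and v: "represents v g" and m: "radial (collision g) \<in> borel_measurable borel"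
  shows "L1_norm (\<lambda>p. (radial f p - radial g p) / h - a * radial (collision g) p)
    = 4 * pi * (LBINT r. \<bar>(u r - v r) / h - a * coll v r\<bar>)"
proof -
  note [measurable] = dens_meas[OF representsD(1)[OF u]] dens_meas[OF representsD(1)[OF v]]
  have "L1_norm (radial (\<lambda>r. (f r - g r) / h - a * collision g r)) = 4 * pi * (LBINT r. \<bar>(u r - v r) / h - a * coll v r\<bar>)"
  proof (rule L1_norm_radial)
    show "radial (\<lambda>r. (f r - g r) / h - a * collision g r) \<in> borel_measurable borel"
      using representsD(2)[OF u] representsD(2)[OF v] m by (simp add: radial_def[abs_def])
    show "AE r in lborel. pos_square r * ((f r - g r) / h - a * collision g r) = (u r - v r) / h - a * coll v r"
      using representsD(3)[OF u] representsD(3)[OF v] represents_collision[OF v]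
    proof eventually_elim
      case (elim r)
      show ?case unfolding elim[symmetric] by (simp add: right_diff_distrib diff_divide_distrib mult_ac)
    qed
  qed measurable
  thus ?thesis by (simp add: radial_def[abs_def])
qed

lemma represents_L1_collision_diff:
  assumes u: "represents u f" and v: "represents v g"
    and m: "radial (collision f) \<in> borel_measurable borel" "radial (collision g) \<in> borel_measurable borel"
  shows "L1_norm (\<lambda>p. a * radial (collision f) p - b * radial (collision g) p)
    = 4 * pi * (LBINT r. \<bar>a * coll u r - b * coll v r\<bar>)"
proof -
  note [measurable] = dens_meas[OF representsD(1)[OF u]] dens_meas[OF representsD(1)[OF v]]
  have "L1_norm (radial (\<lambda>r. a * collision f r - b * collision g r)) = 4 * pi * (LBINT r. \<bar>a * coll u r - b * coll v r\<bar>)"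
  proof (rule L1_norm_radial)
    show "radial (\<lambda>r. a * collision f r - b * collision g r) \<in> borel_measurable borel"
      using m by (simp add: radial_def[abs_def])
    show "AE r in lborel. pos_square r * (a * collision f r - b * collision g r) = a * coll u r - b * coll v r"
      using represents_collision[OF u] represents_collision[OF v]
    proof eventually_elim
      case (elim r)
      show ?case unfolding elim[symmetric] by (simp add: right_diff_distrib mult_ac)
    qed
  qed measurable
  thus ?thesis by (simp add: radial_def[abs_def])
qed

lemma represents_collision_integrable:
  assumes u: "represents u f" and m: "radial (collision f) \<in> borel_measurable borel"
  shows "integrable lborel (radial (collision f))"
proof -
  note [measurable] = dens_meas[OF representsD(1)[OF u]]
  have [measurable]: "(\<lambda>r. collision f \<bar>r\<bar>) \<in> borel_measurable borel" using m by (simp add: radial_meas_iff)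
  have "integrable lborel (\<lambda>r. pos_square r * collision f r) \<longleftrightarrow> integrable lborel (\<lambda>r. pos_square r * collision f \<bar>r\<bar>)"
    by (rule Bochner_Integration.integrable_cong) (auto simp: pos_square_def)
  also have "\<dots> \<longleftrightarrow> integrable lborel (coll u)"
  proof (rule integrable_cong_AE)
    show "AE r in lborel. pos_square r * collision f \<bar>r\<bar> = coll u r"
      using represents_collision[OF u] by eventually_elim (auto simp: pos_square_def split: if_splits)
  qed measurable
  finally show ?thesis using radial_integrable_iff(1)[OF m] coll_integrable[OF representsD(1)[OF u]] by simp
qed

lemma tendsto_zero_within_cong:
  fixes X Y :: "real \<Rightarrow> real"
  assumes "(X \<longlongrightarrow> 0) (at t within S)" "\<And>s. s \<in> S \<Longrightarrow> Y s = c * X s" shows "(Y \<longlongrightarrow> 0) (at t within S)"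
proof (rule Lim_transform_eventually)
  show "((\<lambda>s. c * X s) \<longlongrightarrow> 0) (at t within S)" using tendsto_mult_right_zero[OF assms(1)] .
  show "eventually (\<lambda>s. c * X s = Y s) (at t within S)" using assms(2) by (simp add: eventually_at_filter)
qed


lemma is_flow_rate_functional_continuous:
  assumes f: "is_flow h3 h8 M U" and t: "t \<in> S" and pos: "\<And>s. s \<in> S \<Longrightarrow> 0 \<le> \<sigma> s"
    and c: "(\<sigma> \<longlongrightarrow> \<sigma> t) (at t within S)" and a: "(a \<longlongrightarrow> a t) (at t within S)"
  shows "((\<lambda>s. a s * (LBINT r. coll (U (\<sigma> s)) r)) \<longlongrightarrow> a t * (LBINT r. coll (U (\<sigma> t)) r)) (at t within S)"
proof (rule LIM_zero_cancel, rule Lim_null_comparison[OF _ is_flow_rate_continuous[OF f t pos c a]])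
  have i: "integrable lborel (\<lambda>r. a s * coll (U (\<sigma> s)) r)" if "s \<in> S" for s
    using coll_integrable[OF is_flowD(1)[OF f pos[OF that]]] by simp
  have "norm (a s * (LBINT r. coll (U (\<sigma> s)) r) - a t * (LBINT r. coll (U (\<sigma> t)) r))
    \<le> (LBINT r. \<bar>a s * coll (U (\<sigma> s)) r - a t * coll (U (\<sigma> t)) r\<bar>)" if s: "s \<in> S" for s
  proof -
    have "a s * (LBINT r. coll (U (\<sigma> s)) r) - a t * (LBINT r. coll (U (\<sigma> t)) r)
      = (LBINT r. a s * coll (U (\<sigma> s)) r - a t * coll (U (\<sigma> t)) r)"
      using Bochner_Integration.integral_diff[OF i[OF s] i[OF t]] by simp
    thus ?thesis using integral_abs_bound[of lborel "\<lambda>r. a s * coll (U (\<sigma> s)) r - a t * coll (U (\<sigma> t)) r"] by simp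
  qed
  thus "eventually (\<lambda>s. norm (a s * (LBINT r. coll (U (\<sigma> s)) r) - a t * (LBINT r. coll (U (\<sigma> t)) r))
    \<le> (LBINT r. \<bar>a s * coll (U (\<sigma> s)) r - a t * coll (U (\<sigma> t)) r\<bar>)) (at t within S)"
    by (simp add: eventually_at_filter)
qed

lemma is_flow_compose_continuous:
  assumes fl: "is_flow h3 h8 M U" and t: "t \<in> S" and pos: "\<And>s. s \<in> S \<Longrightarrow> 0 \<le> \<sigma> s" and c: "(\<sigma> \<longlongrightarrow> \<sigma> t) (at t within S)"
  shows "((\<lambda>s. ldist (U (\<sigma> s)) (U (\<sigma> t))) \<longlongrightarrow> 0) (at t within S)"
proof -
  obtain L where L: "0 \<le> L" "\<And>s t. 0 \<le> s \<Longrightarrow> 0 \<le> t \<Longrightarrow> ldist (U s) (U t) \<le> L * \<bar>s - t\<bar>"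
    by (rule is_flow_lipschitz[OF fl]) (rule that)
  have "((\<lambda>s. L * \<bar>\<sigma> s - \<sigma> t\<bar>) \<longlongrightarrow> L * \<bar>\<sigma> t - \<sigma> t\<bar>) (at t within S)"
    by (intro tendsto_mult tendsto_const tendsto_rabs tendsto_diff c)
  hence "((\<lambda>s. L * \<bar>\<sigma> s - \<sigma> t\<bar>) \<longlongrightarrow> 0) (at t within S)" by simp
  thus ?thesis
  proof (rule Lim_null_comparison[rotated])
    have "norm (ldist (U (\<sigma> s)) (U (\<sigma> t))) \<le> L * \<bar>\<sigma> s - \<sigma> t\<bar>" if "s \<in> S" for s
      using L(2)[OF pos pos, of s t] that t ldist_nonneg by simp
    thus "eventually (\<lambda>s. norm (ldist (U (\<sigma> s)) (U (\<sigma> t))) \<le> L * \<bar>\<sigma> s - \<sigma> t\<bar>) (at t within S)"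
      by (simp add: eventually_at_filter)
  qed
qed

text \<open>n_c is defined as total mass minus the mass of the flow, so conservation is built in and
  its equation follows from the derivative of the mass. The relation between the clock and F is
  exported because uniqueness and the fourth moment bound refer to it.\<close>

lemma flow_solves_system:
  assumes fl: "is_flow h3 h8 M U" and \<kappa>: "0 < \<kappa>0" and \<delta>: "0 < \<delta>" and low: "\<And>\<tau>. 0 \<le> \<tau> \<Longrightarrow> \<delta> \<le> N - mass (U \<tau>)"
    and r0: "represents u0 f0" and u0: "AE r in lborel. U 0 r = u0 r" and N: "N = line_moment 2 f0 + n0"
  defines "F \<equiv> \<lambda>\<tau>. integral {0..\<tau>} (\<lambda>\<xi>. (N - mass (U \<xi>)) / \<kappa>0)"
  shows "\<exists>\<sigma>. (\<forall>t\<ge>0. 0 \<le> \<sigma> t) \<and> (\<forall>\<tau>\<ge>0. 0 \<le> F \<tau> \<and> \<sigma> (F \<tau>) = \<tau>)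
    \<and> (\<forall>T>0. regular_on (state_set h3 h8 M) T (\<lambda>t r. U (\<sigma> t) r / r\<^sup>2) (\<lambda>t. N - mass (U (\<sigma> t)))
          \<and> solves_system_on \<kappa>0 T f0 n0 (\<lambda>t r. U (\<sigma> t) r / r\<^sup>2) (\<lambda>t. N - mass (U (\<sigma> t))))
    \<and> conservative f0 n0 (\<lambda>t r. U (\<sigma> t) r / r\<^sup>2) (\<lambda>t. N - mass (U (\<sigma> t)))"
proof -
  define G where "G \<xi> = (N - mass (U \<xi>)) / \<kappa>0" for \<xi>
  have Gc: "continuous_on {0..} G"
    unfolding G_def using \<kappa> by (intro continuous_intros is_flow_mass_continuous[OF fl]) simp
  have Gl: "\<delta> / \<kappa>0 \<le> G \<xi>" if "0 \<le> \<xi>" for \<xi>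
    using low[OF that] \<kappa> unfolding G_def by (intro divide_right_mono) auto
  have "0 < \<delta> / \<kappa>0" using \<delta> \<kappa> by simp
  from clock_exists(1)[OF Gc this Gl] obtain \<sigma> where \<sigma>: "\<sigma> 0 = 0" "\<And>t. 0 \<le> t \<Longrightarrow> 0 \<le> \<sigma> t"
    "\<And>\<tau>. 0 \<le> \<tau> \<Longrightarrow> 0 \<le> F \<tau> \<and> \<sigma> (F \<tau>) = \<tau>" "continuous_on {0..} \<sigma>" "\<And>t. 0 < t \<Longrightarrow> (\<sigma> has_real_derivative 1 / G (\<sigma> t)) (at t)"
    unfolding F_def G_def[abs_def] by blast
  define f where "f t = (\<lambda>r. U (\<sigma> t) r / r\<^sup>2)" for t
  define nc where "nc t = N - mass (U (\<sigma> t))" for t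
  define a where "a t = \<kappa>0 / nc t" for t
  have d: "dens (U (\<sigma> t))" if "0 \<le> t" for t by (rule is_flowD(1)[OF fl \<sigma>(2)[OF that]])
  have rep: "represents (U (\<sigma> t)) (f t)" if "0 \<le> t" for t
    unfolding f_def by (rule represents_profile[OF d[OF that]])
  have cm: "radial (collision (f t)) \<in> borel_measurable borel" if "0 \<le> t" for t
    unfolding f_def by (rule profile_collision_meas[OF d[OF that]])
  have ncl: "\<delta> \<le> nc t" if "0 \<le> t" for t unfolding nc_def by (rule low[OF \<sigma>(2)[OF that]])
  have \<sigma>d: "(\<sigma> has_real_derivative a t) (at t within A)" if "0 < t" for t A
    using \<sigma>(5)[OF that] unfolding a_def nc_def G_def by (simp add: has_field_derivative_at_within)
  have mass_eq: "line_moment 2 (f t) = mass (U (\<sigma> t))" if "0 \<le> t" for t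
    using represents_line_moment(1)[OF rep[OF that], of 2 0] by simp
  have d0: "dens u0" by (rule representsD(1)[OF r0])
  note [measurable] = dens_meas[OF d0] dens_meas[OF is_flowD(1)[OF fl order_refl]]
  have m0: "line_moment 2 f0 = mass (U 0)"
  proof -
    have "line_moment 2 f0 = mass u0" using represents_line_moment(1)[OF r0, of 2 0] by simp
    also have "\<dots> = mass (U 0)" by (rule integral_cong_AE) (use u0 in \<open>auto elim: eventually_mono\<close>)
    finally show ?thesis .
  qed
  have e0: "energy f0 = 4 * pi * h3"
  proof -
    have "(LBINT r. r * u0 r) = (LBINT r. r * U 0 r)"
      by (rule integral_cong_AE) (use u0 in \<open>auto elim: eventually_mono\<close>)
    thus ?thesis using represents_energy[OF r0] is_flowD(3)[OF fl order_refl] by simp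
  qed
  have \<sigma>lim: "(\<sigma> \<longlongrightarrow> \<sigma> t) (at t within S)" if "t \<in> S" "S \<subseteq> {0..}" for t S
    using continuous_on_subset[OF \<sigma>(4) that(2)] that(1) by (simp add: continuous_on_def)
  have ncc: "continuous_on {0..} nc"
    unfolding nc_def[abs_def]
    by (intro continuous_intros continuous_on_compose2[OF is_flow_mass_continuous[OF fl] \<sigma>(4)]) (use \<sigma>(2) in auto)
  have alim: "(a \<longlongrightarrow> a t) (at t within S)" if t: "t \<in> S" "S \<subseteq> {0..}" for t S
  proof -
    have "(nc \<longlongrightarrow> nc t) (at t within S)" using continuous_on_subset[OF ncc t(2)] t(1) by (simp add: continuous_on_def)
    moreover have "nc t \<noteq> 0" using ncl[of t] t \<delta> by auto
    ultimately show ?thesis unfolding a_def[abs_def] by (intro tendsto_divide tendsto_const)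
  qed
  have L1c: "L1_continuous_on {0..T} (\<lambda>t. radial (f t))" for T
    unfolding L1_continuous_on_def
  proof (intro ballI conjI)
    fix t assume t: "t \<in> {0..T}"
    show "integrable lborel (radial (f t))" by (rule represents_integrable[OF rep]) (use t in simp)
    have "((\<lambda>s. ldist (U (\<sigma> s)) (U (\<sigma> t))) \<longlongrightarrow> 0) (at t within {0..T})"
      by (rule is_flow_compose_continuous[OF fl t \<sigma>(2) \<sigma>lim[OF t]]) auto
    thus "((\<lambda>s. L1_norm (\<lambda>p. radial (f s) p - radial (f t) p)) \<longlongrightarrow> 0) (at t within {0..T})"
      by (rule tendsto_zero_within_cong[where c = "4 * pi"]) (use t in \<open>auto intro!: represents_L1_dist rep\<close>)
  qed
  have L1d: "L1_has_derivative_on {0<..T} (\<lambda>t. radial (f t)) (\<lambda>t p. a t * radial (collision (f t)) p)" for T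
    unfolding L1_has_derivative_on_def
  proof (intro ballI conjI)
    fix t assume t: "t \<in> {0<..T}"
    hence t0: "0 \<le> t" "0 < t" by auto
    show "integrable lborel (radial (f t))" by (rule represents_integrable[OF rep[OF t0(1)]])
    show "integrable lborel (\<lambda>p. a t * radial (collision (f t)) p)"
      by (intro integrable_mult_right represents_collision_integrable[OF rep cm] t0)
    have "((\<lambda>s. LBINT r. \<bar>(U (\<sigma> s) r - U (\<sigma> t) r) / (s - t) - a t * coll (U (\<sigma> t)) r\<bar>) \<longlongrightarrow> 0) (at t within {0<..T})"
      by (rule is_flow_chain_rule[OF fl t _ \<sigma>d[OF t0(2)]]) (simp add: \<sigma>(2))
    thus "((\<lambda>s. L1_norm (\<lambda>p. (radial (f s) p - radial (f t) p) / (s - t) - a t * radial (collision (f t)) p)) \<longlongrightarrow> 0) (at t within {0<..T})"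
      by (rule tendsto_zero_within_cong[where c = "4 * pi"]) (use t0 in \<open>auto intro!: represents_L1_rate rep cm\<close>)
  qed
  have L1dc: "L1_continuous_on {0<..T} (\<lambda>t p. a t * radial (collision (f t)) p)" for T
    unfolding L1_continuous_on_def
  proof (intro ballI conjI)
    fix t assume t: "t \<in> {0<..T}"
    hence t0: "0 \<le> t" "0 < t" by auto
    show "integrable lborel (\<lambda>p. a t * radial (collision (f t)) p)"
      by (intro integrable_mult_right represents_collision_integrable[OF rep cm] t0)
    have "((\<lambda>s. LBINT r. \<bar>a s * coll (U (\<sigma> s)) r - a t * coll (U (\<sigma> t)) r\<bar>) \<longlongrightarrow> 0) (at t within {0<..T})"
      by (rule is_flow_rate_continuous[OF fl t \<sigma>(2) \<sigma>lim[OF t] alim[OF t]]) auto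
    thus "((\<lambda>s. L1_norm (\<lambda>p. a s * radial (collision (f s)) p - a t * radial (collision (f t)) p)) \<longlongrightarrow> 0) (at t within {0<..T})"
      by (rule tendsto_zero_within_cong[where c = "4 * pi"]) (use t0 in \<open>auto intro!: represents_L1_collision_diff rep cm\<close>)
  qed
  have cmass: "collision_mass (f t) = (LBINT r. coll (U (\<sigma> t)) r)" if "0 \<le> t" for t
    by (rule represents_collision_mass[OF rep cm]) (use that in auto)
  have ncd: "(nc has_real_derivative - (a t * (LBINT r. coll (U (\<sigma> t)) r))) (at t within {0<..T})" if t: "t \<in> {0<..T}" for t T
  proof -
    have "((\<lambda>s. mass (U (\<sigma> s))) has_real_derivative a t * (LBINT r. coll (U (\<sigma> t)) r)) (at t within {0<..T})"
      by (rule is_flow_mass_derivative[OF fl t _ \<sigma>d]) (use t \<sigma>(2) in auto)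
    from DERIV_diff[OF DERIV_const this] show ?thesis unfolding nc_def[abs_def] by simp
  qed
  have ncC1: "C1_on {0<..T} nc" for T
    unfolding C1_on_def
  proof (intro exI conjI ballI)
    show "(nc has_real_derivative - (a t * (LBINT r. coll (U (\<sigma> t)) r))) (at t within {0<..T})" if "t \<in> {0<..T}" for t
      by (rule ncd[OF that])
    show "continuous_on {0<..T} (\<lambda>t. - (a t * (LBINT r. coll (U (\<sigma> t)) r)))"
      unfolding continuous_on_def
    proof (intro ballI tendsto_minus)
      fix t assume t: "t \<in> {0<..T}"
      show "((\<lambda>s. a s * (LBINT r. coll (U (\<sigma> s)) r)) \<longlongrightarrow> a t * (LBINT r. coll (U (\<sigma> t)) r)) (at t within {0<..T})"
        by (rule is_flow_rate_functional_continuous[OF fl t \<sigma>(2) \<sigma>lim[OF t] alim[OF t]]) auto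
    qed
  qed
  have reg: "regular_on (state_set h3 h8 M) T f nc" for T
    unfolding regular_on_def
  proof (intro conjI ballI L1c ncC1)
    show "f t \<in> state_set h3 h8 M" if "t \<in> {0..T}" for t
    proof -
      have t: "0 \<le> \<sigma> t" using that \<sigma>(2) by simp
      show ?thesis unfolding f_def by (rule profile_state_set[OF is_flowD(1,2,3,4)[OF fl t]])
    qed
    show "L1_C1_on {0<..T} (\<lambda>t. radial (f t))" unfolding L1_C1_on_def using L1d L1dc by blast
    show "continuous_on {0..T} nc" by (rule continuous_on_subset[OF ncc]) simp
  qed
  have solves: "solves_system_on \<kappa>0 T f0 n0 f nc" for T
    unfolding solves_system_on_def
  proof (intro conjI ballI L1d[unfolded a_def])
    show "AE p in lborel. radial (f 0) p = radial f0 p"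
      using represents_AE_eq[OF rep[OF order_refl] r0] u0 \<sigma>(1) by simp
    show "nc 0 = n0" using m0 N \<sigma>(1) by (simp add: nc_def)
    show "(nc has_real_derivative - (\<kappa>0 / nc t) * collision_mass (f t)) (at t within {0<..T})" if "t \<in> {0<..T}" for t
      using ncd[OF that] that by (simp add: cmass a_def)
  qed
  have "conservative f0 n0 f nc"
    unfolding conservative_def
    using e0 represents_energy[OF rep] is_flowD(3)[OF fl \<sigma>(2)] mass_eq N by (simp add: momentum_eq_0 nc_def)
  thus ?thesis using reg solves \<sigma>(2,3) unfolding f_def[abs_def] nc_def[abs_def] by blast
qed

text \<open>The derivative b is the right-hand side itself, so the defect is 0.\<close>

lemma exact_solution_approx:
  assumes d: "\<And>t. t \<in> {0..T} \<Longrightarrow> dens (u t)" and B: "\<And>t. t \<in> {0..T} \<Longrightarrow> mom 6 (u t) \<le> B"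
    and c: "\<And>t. t \<in> {0..T} \<Longrightarrow> ((\<lambda>s. ldist (u s) (u t)) \<longlongrightarrow> 0) (at t within {0..T})"
    and r: "\<And>t. 0 < t \<Longrightarrow> t < T \<Longrightarrow> ((\<lambda>s. LBINT r. \<bar>(u s r - u t r) / (s - t) - a t * coll (u t) r\<bar>) \<longlongrightarrow> 0) (at t)"
  shows "approx_solution B a 0 T u"
  unfolding approx_solution_def
proof (intro conjI ballI d B c)
  fix t assume t: "t \<in> {0<..<T}"
  have dt: "dens (u t)" using d t by auto
  show "\<exists>b. integrable lborel b \<and> (\<forall>r\<le>0. b r = 0)
          \<and> ((\<lambda>h. (LBINT r. \<bar>u (t + h) r - u t r - h * b r\<bar>) / h) \<longlongrightarrow> 0) (at_right 0)
          \<and> integrable lborel (\<lambda>r. (1 + r) * \<bar>b r - a t * coll (u t) r\<bar>)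
          \<and> (LBINT r. 4 * (1 + r) * \<bar>b r - a t * coll (u t) r\<bar>) \<le> 0"
  proof (intro exI[of _ "\<lambda>r. a t * coll (u t) r"] conjI allI impI)
    show "integrable lborel (\<lambda>r. a t * coll (u t) r)" by (intro integrable_mult_right coll_integrable dt)
    show "a t * coll (u t) r = 0" if "r \<le> 0" for r using coll_nonpos[OF dt that] by simp
    have "((\<lambda>s. LBINT r. \<bar>(u s r - u t r) / (s - t) - a t * coll (u t) r\<bar>) \<longlongrightarrow> 0) (at_right t)"
      by (rule tendsto_mono[OF at_le r]) (use t in auto)
    hence "((\<lambda>h. LBINT r. \<bar>(u (h + t) r - u t r) / (h + t - t) - a t * coll (u t) r\<bar>) \<longlongrightarrow> 0) (at_right 0)"
      by (subst (asm) filterlim_at_right_to_0)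
    thus "((\<lambda>h. (LBINT r. \<bar>u (t + h) r - u t r - h * (a t * coll (u t) r)\<bar>) / h) \<longlongrightarrow> 0) (at_right 0)"
    proof (rule Lim_transform_eventually)
      have "(LBINT r. \<bar>(u (h + t) r - u t r) / (h + t - t) - a t * coll (u t) r\<bar>) = (LBINT r. \<bar>u (t + h) r - u t r - h * (a t * coll (u t) r)\<bar>) / h"
        if h: "0 < h" for h
      proof -
        have "\<bar>x / h - y\<bar> = \<bar>x - h * y\<bar> / h" for x y :: real
        proof -
          have "x / h - y = (x - h * y) / h" using h by (simp add: diff_divide_distrib)
          thus ?thesis using h by (simp add: abs_divide)
        qed
        thus ?thesis by (simp add: add.commute)
      qed
      thus "eventually (\<lambda>h. (LBINT r. \<bar>(u (h + t) r - u t r) / (h + t - t) - a t * coll (u t) r\<bar>)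
          = (LBINT r. \<bar>u (t + h) r - u t r - h * (a t * coll (u t) r)\<bar>) / h) (at_right 0)"
        by (simp add: eventually_at_filter)
    qed
  qed simp_all
qed

section \<open>Mass bound, uniqueness and conclusion\<close>

lemma mass_nonneg: "dens u \<Longrightarrow> 0 \<le> mass u"
  by (simp add: dens_nonneg)

lemma mass_le:
  assumes u: "dens u" and m: "\<And>r. u r \<le> m" and R: "0 < R"
  shows "mass u \<le> m * R + (LBINT r. r * u r) / R"
proof -
  have m0: "0 \<le> m" using m[of 0] dens_nonneg[OF u, of 0] by linarith
  note i1 = pow_integrable[OF u, of 1, simplified]
  have "mass u \<le> (LBINT r. m * indicator {0..R} r + r * u r / R)"
  proof (rule integral_mono)
    show "integrable lborel u" by (rule dens_integrable_self[OF u])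
    show "integrable lborel (\<lambda>r. m * indicator {0..R} r + r * u r / R)"
      by (intro Bochner_Integration.integrable_add integrable_mult_right integrable_indicator_Icc integrable_divide i1)
    fix r
    show "u r \<le> m * indicator {0..R} r + r * u r / R"
    proof (cases "0 < r")
      case True
      show ?thesis
      proof (cases "r \<le> R")
        case True
        thus ?thesis using \<open>0 < r\<close> m[of r] R dens_nonneg[OF u, of r] by (simp add: add_increasing2)
      next
        case False
        hence "1 * u r \<le> r / R * u r" using R dens_nonneg[OF u, of r] by (intro mult_right_mono) auto
        thus ?thesis using False by simp
      qed
    qed (use dens_zero[OF u, of r] m0 in simp)
  qed
  also have "\<dots> = m * R + (LBINT r. r * u r) / R"
    using i1 R integrable_indicator_Icc[of 0 R] by simp
  finally show ?thesis .
qed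

text \<open>The radius sqrt (h / m) balances the two terms m R and h / R of the splitting at
  R.\<close>

lemma mass_le_sqrt:
  assumes u: "dens u" and m: "\<And>r. u r \<le> m" "0 < m" and h: "(LBINT r. r * u r) = h" "0 < h"
  shows "mass u \<le> 2 * sqrt (h * m)"
proof -
  have R: "0 < sqrt h / sqrt m" using m h by simp
  have "mass u \<le> m * (sqrt h / sqrt m) + h / (sqrt h / sqrt m)" using mass_le[OF u m(1) R] h by simp
  also have "m * (sqrt h / sqrt m) = sqrt h * (m / sqrt m)" by simp
  also have "m / sqrt m = sqrt m" using m by (simp add: real_div_sqrt)
  also have "h / (sqrt h / sqrt m) = h / sqrt h * sqrt m" by simp
  also have "h / sqrt h = sqrt h" using h by (simp add: real_div_sqrt)
  finally show ?thesis by (simp add: real_sqrt_mult)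
qed

text \<open>A competitor (g, mc) brings its own clock, the integral of kappa_0 / mc. Its density and
  the flow run by this clock solve the same linear-in-rate equation w' = a(t) coll w, so stability
  identifies them. Conservation of mass then determines mc, and F turns out to invert that
  clock.\<close>

lemma flow_system_unique:
  assumes fl: "is_flow h3 h8 M U" and \<kappa>: "0 < \<kappa>0" and \<delta>: "0 < \<delta>" and low: "\<And>\<tau>. 0 \<le> \<tau> \<Longrightarrow> \<delta> \<le> N - mass (U \<tau>)"
    and r0: "represents u0 f0" and u0: "AE r in lborel. U 0 r = u0 r" and N: "N = line_moment 2 f0 + n0"
    and g: "\<And>T. 0 < T \<Longrightarrow> regular_on (state_set h3 h8 M) T g mc \<and> (\<forall>t\<in>{0..T}. \<delta> \<le> mc t) \<and> solves_system_on \<kappa>0 T f0 n0 g mc"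
    and cons: "conservative f0 n0 g mc" and t: "0 \<le> t"
  shows "\<exists>\<tau>\<ge>0. integral {0..\<tau>} (\<lambda>\<xi>. (N - mass (U \<xi>)) / \<kappa>0) = t
    \<and> (AE p in lborel. radial (g t) p = radial (\<lambda>r. U \<tau> r / r\<^sup>2) p) \<and> mc t = N - mass (U \<tau>)"
proof -
  \<comment> \<open>Positive even for t = 0, and for t > 0 it makes t an interior time.\<close>
  define T where "T = t + 1"
  have T0: "0 < T" using t by (simp add: T_def)
  have st: "g s \<in> state_set h3 h8 M" if "s \<in> {0..T}" for s
    using g[OF T0] that by (auto simp: regular_on_def)
  have L1c: "L1_continuous_on {0..T} (\<lambda>t. radial (g t))" and mcc: "continuous_on {0..T} mc"
    and mcl: "\<And>s. s \<in> {0..T} \<Longrightarrow> \<delta> \<le> mc s"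
    and init: "AE p in lborel. radial (g 0) p = radial f0 p"
    and L1d: "L1_has_derivative_on {0<..T} (\<lambda>t. radial (g t)) (\<lambda>t p. \<kappa>0 / mc t * radial (collision (g t)) p)"
    using g[OF T0] by (auto simp: regular_on_def solves_system_on_def)
  have "\<forall>s\<in>{0..T}. \<exists>u. represents u (g s) \<and> (\<forall>r. u r \<le> M) \<and> (LBINT r. r * u r) = h3 \<and> (LBINT r. r ^ 6 * u r) \<le> h8"
  proof
    fix s assume "s \<in> {0..T}"
    hence s: "g s \<in> state_set h3 h8 M" by (rule st)
    show "\<exists>u. represents u (g s) \<and> (\<forall>r. u r \<le> M) \<and> (LBINT r. r * u r) = h3 \<and> (LBINT r. r ^ 6 * u r) \<le> h8"
      by (rule state_set_profile[OF s]) (use s in \<open>simp add: state_set_def\<close>)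
  qed
  from bchoice[OF this] obtain v where
    v: "\<And>s. s \<in> {0..T} \<Longrightarrow> represents (v s) (g s) \<and> (\<forall>r. v s r \<le> M) \<and> (LBINT r. r * v s r) = h3 \<and> (LBINT r. r ^ 6 * v s r) \<le> h8"
    by blast
  have rep: "represents (v s) (g s)" if "s \<in> {0..T}" for s using v[OF that] by blast
  have d: "dens (v s)" if "s \<in> {0..T}" for s by (rule representsD(1)[OF rep[OF that]])
  define B where "B = 64 * (M + h8)"
  have vB: "mom 6 (v s) \<le> B" if "s \<in> {0..T}" for s
    unfolding B_def by (rule mom6_le[OF d[OF that]]) (use v[OF that] in blast)+
  define a where "a s = \<kappa>0 / mc s" for s
  have apos: "0 < a s" "a s \<le> \<kappa>0 / \<delta>" if "s \<in> {0..T}" for s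
    using mcl[OF that] \<kappa> \<delta> unfolding a_def by (auto intro!: divide_left_mono divide_pos_pos)
  have ac: "continuous_on {0..T} a"
    unfolding a_def[abs_def] by (intro continuous_intros mcc) (use mcl \<delta> in force)
  have ai: "a integrable_on {x..y}" if "0 \<le> x" "y \<le> T" for x y
    using that by (intro integrable_continuous_real continuous_on_subset[OF ac]) auto
  define \<sigma> where "\<sigma> s = integral {0..s} a" for s
  have \<sigma>0: "\<sigma> 0 = 0" by (simp add: \<sigma>_def)
  have \<sigma>c: "continuous_on {0..T} \<sigma>"
    unfolding \<sigma>_def[abs_def] by (rule indefinite_integral_continuous_1[OF ai]) auto
  have \<sigma>p: "0 \<le> \<sigma> s" "\<sigma> s \<le> \<kappa>0 / \<delta> * T" if "s \<in> {0..T}" for s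
  proof -
    show "0 \<le> \<sigma> s" unfolding \<sigma>_def
      by (rule integral_nonneg[OF ai]) (use that in \<open>auto intro!: less_imp_le[OF apos(1)]\<close>)
    have "\<sigma> s \<le> integral {0..s} (\<lambda>_. \<kappa>0 / \<delta>)" unfolding \<sigma>_def
      by (rule integral_le[OF ai]) (use that apos(2) in auto)
    also have "\<dots> = \<kappa>0 / \<delta> * s" using that by simp
    also have "\<dots> \<le> \<kappa>0 / \<delta> * T" using that \<kappa> \<delta> by (intro mult_left_mono) auto
    finally show "\<sigma> s \<le> \<kappa>0 / \<delta> * T" .
  qed
  have \<sigma>d: "(\<sigma> has_real_derivative a s) (at s)" if "0 < s" "s < T" for s
  proof -
    have "(\<sigma> has_real_derivative a s) (at s within {0..T})"
      unfolding \<sigma>_def[abs_def] by (rule integral_has_real_derivative[OF ac]) (use that in auto)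
    thus ?thesis using that by (simp add: at_within_Icc_at)
  qed
  have appv: "approx_solution B a 0 T v"
  proof (rule exact_solution_approx[OF d vB])
    fix s assume s: "s \<in> {0..T}"
    have "((\<lambda>z. L1_norm (\<lambda>p. radial (g z) p - radial (g s) p)) \<longlongrightarrow> 0) (at s within {0..T})"
      using L1c s unfolding L1_continuous_on_def by blast
    thus "((\<lambda>z. ldist (v z) (v s)) \<longlongrightarrow> 0) (at s within {0..T})"
      by (rule tendsto_zero_within_cong[where c = "1 / (4 * pi)"]) (simp add: represents_L1_dist[OF rep rep[OF s]])
  next
    fix s assume s: "0 < s" "s < T"
    have s': "s \<in> {0..T}" using s by simp
    have i: "integrable lborel (\<lambda>p. a s * radial (collision (g s)) p)"
      and lim: "((\<lambda>z. L1_norm (\<lambda>p. (radial (g z) p - radial (g s) p) / (z - s) - a s * radial (collision (g s)) p)) \<longlongrightarrow> 0) (at s within {0<..T})"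
      using L1d s unfolding L1_has_derivative_on_def a_def by auto
    \<comment> \<open>Measurability of the collision term of an unknown representative is recovered
      from the integrable right-hand side by dividing by the positive rate.\<close>
    have "(\<lambda>p. a s * radial (collision (g s)) p) \<in> borel_measurable borel" using borel_measurable_integrable[OF i] by simp
    hence "(\<lambda>p. a s * radial (collision (g s)) p / a s) \<in> borel_measurable borel" by (rule borel_measurable_divide) simp
    moreover have "(\<lambda>p. a s * radial (collision (g s)) p / a s) = radial (collision (g s))" using apos(1)[OF s'] by (simp add: fun_eq_iff)
    ultimately have m: "radial (collision (g s)) \<in> borel_measurable borel" by simp
    have "((\<lambda>z. LBINT r. \<bar>(v z r - v s r) / (z - s) - a s * coll (v s) r\<bar>) \<longlongrightarrow> 0) (at s within {0<..T})"
      by (rule tendsto_zero_within_cong[where c = "1 / (4 * pi)", OF lim]) (simp add: represents_L1_rate[OF rep rep[OF s'] m])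
    hence "((\<lambda>z. LBINT r. \<bar>(v z r - v s r) / (z - s) - a s * coll (v s) r\<bar>) \<longlongrightarrow> 0) (at s within {0<..<T})"
      by (rule tendsto_within_subset) auto
    thus "((\<lambda>z. LBINT r. \<bar>(v z r - v s r) / (z - s) - a s * coll (v s) r\<bar>) \<longlongrightarrow> 0) (at s)"
      using s by (simp add: at_within_open[of s "{0<..<T}"])
  qed
  have appU: "approx_solution B a 0 T (\<lambda>s. U (\<sigma> s))"
  proof (rule exact_solution_approx)
    show "dens (U (\<sigma> s))" "mom 6 (U (\<sigma> s)) \<le> B" if "s \<in> {0..T}" for s
      using is_flowD(1,5)[OF fl \<sigma>p(1)[OF that]] by (simp_all add: B_def)
    show "((\<lambda>z. ldist (U (\<sigma> z)) (U (\<sigma> s))) \<longlongrightarrow> 0) (at s within {0..T})" if s: "s \<in> {0..T}" for s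
    proof (rule is_flow_compose_continuous[OF fl s \<sigma>p(1)])
      show "(\<sigma> \<longlongrightarrow> \<sigma> s) (at s within {0..T})" using \<sigma>c s by (simp add: continuous_on_def)
    qed
    fix s assume s: "0 < s" "s < T"
    have s': "s \<in> {0<..<T}" using s by simp
    have "((\<lambda>z. LBINT r. \<bar>(U (\<sigma> z) r - U (\<sigma> s) r) / (z - s) - a s * coll (U (\<sigma> s)) r\<bar>) \<longlongrightarrow> 0) (at s within {0<..<T})"
      by (rule is_flow_chain_rule[OF fl s' \<sigma>p(1) has_field_derivative_at_within[OF \<sigma>d[OF s]]]) auto
    thus "((\<lambda>z. LBINT r. \<bar>(U (\<sigma> z) r - U (\<sigma> s) r) / (z - s) - a s * coll (U (\<sigma> s)) r\<bar>) \<longlongrightarrow> 0) (at s)"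
      using s by (simp add: at_within_open[of s "{0<..<T}"])
  qed
  have zero: "0 \<in> {0..T}" using T0 by simp
  have v0: "AE r in lborel. v 0 r = U 0 r"
  proof -
    have "AE r in lborel. v 0 r = u0 r" using represents_AE_eq[OF rep[OF zero] r0] init by blast
    thus ?thesis using u0 by eventually_elim simp
  qed
  have m0: "mom 1 (\<lambda>r. \<bar>v 0 r - U (\<sigma> 0) r\<bar>) = 0"
    unfolding mom_def \<sigma>0 by (rule integral_eq_zero_AE) (use v0 in \<open>auto elim: eventually_mono\<close>)
  have vU: "AE r in lborel. v s r = U (\<sigma> s) r" if s: "s \<in> {0..T}" for s
  proof -
    have B0: "0 \<le> B" using vB[OF zero] mom_nonneg[OF d[OF zero], of 6] by linarith
    have "ldist (v s) (U (\<sigma> s)) \<le> exp (\<kappa>0 / \<delta> * growth_const B * s) * (4 * mom 1 (\<lambda>r. \<bar>v 0 r - U (\<sigma> 0) r\<bar>) + (0 + 0) * s)"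
      by (rule approx_solution_stability[OF appv appU]) (use apos s T0 \<kappa> \<delta> B0 in \<open>auto intro: less_imp_le\<close>)
    hence "ldist (v s) (U (\<sigma> s)) = 0" using m0 ldist_nonneg[of "v s" "U (\<sigma> s)"] by simp
    thus ?thesis using ldist_eq_0_iff_AE[OF d[OF s] is_flowD(1)[OF fl \<sigma>p(1)[OF s]]] by simp
  qed
  have mc: "mc s = N - mass (U (\<sigma> s))" if s: "s \<in> {0..T}" for s
  proof -
    note [measurable] = dens_meas[OF d[OF s]] dens_meas[OF is_flowD(1)[OF fl \<sigma>p(1)[OF s]]]
    have "line_moment 2 (g s) = mass (v s)" using represents_line_moment(1)[OF rep[OF s], of 2 0] by simp
    also have "\<dots> = mass (U (\<sigma> s))" by (rule integral_cong_AE) (use vU[OF s] in auto)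
    finally have "line_moment 2 (g s) = mass (U (\<sigma> s))" .
    moreover have "line_moment 2 (g s) + mc s = line_moment 2 f0 + n0" using cons s by (simp add: conservative_def)
    ultimately show ?thesis using N by simp
  qed
  define G where "G \<xi> = (N - mass (U \<xi>)) / \<kappa>0" for \<xi>
  have Gc: "continuous_on {0..} G"
    unfolding G_def using \<kappa> by (intro continuous_intros is_flow_mass_continuous[OF fl]) simp
  have Gl: "\<delta> / \<kappa>0 \<le> G \<xi>" if "0 \<le> \<xi>" for \<xi>
    using low[OF that] \<kappa> unfolding G_def by (intro divide_right_mono) auto
  have \<delta>\<kappa>: "0 < \<delta> / \<kappa>0" using \<delta> \<kappa> by simp
  define F where "F \<tau> = integral {0..\<tau>} G" for \<tau>
  have Fd: "(F has_real_derivative G \<tau>) (at \<tau>)" if "0 < \<tau>" for \<tau>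
    unfolding F_def[abs_def] by (rule clock_exists(2)[OF Gc \<delta>\<kappa> Gl that])
  have Fc: "continuous_on {0..\<tau>} F" for \<tau>
    unfolding F_def[abs_def] by (rule clock_exists(3)[OF Gc \<delta>\<kappa> Gl])
  have N0: "0 < N" using low[of 0] mass_nonneg[OF is_flowD(1)[OF fl order_refl]] \<delta> by simp
  \<comment> \<open>F is differentiated at positive arguments only. The clock leaves 0 at once, as
    mc <= N bounds its speed from below.\<close>
  have \<sigma>pos: "0 < \<sigma> s" if s: "0 < s" "s \<le> T" for s
  proof -
    have "\<kappa>0 / N \<le> a x" if x: "x \<in> {0..T}" for x
    proof -
      have "mc x \<le> N" using mc[OF x] mass_nonneg[OF is_flowD(1)[OF fl \<sigma>p(1)[OF x]]] by simp
      thus ?thesis unfolding a_def using \<kappa> mcl[OF x] \<delta> N0 by (intro divide_left_mono) auto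
    qed
    hence "integral {0..s} (\<lambda>_. \<kappa>0 / N) \<le> \<sigma> s" unfolding \<sigma>_def
      using s by (intro integral_le ai integrable_const_ivl) auto
    moreover have "0 < s * (\<kappa>0 / N)" using s \<kappa> N0 by simp
    ultimately show ?thesis using s by simp
  qed
  have "F (\<sigma> t) = t"
  proof (cases "t = 0")
    case True thus ?thesis by (simp add: \<sigma>0 F_def)
  next
    case False
    hence t0: "0 < t" "t < T" using t by (auto simp: T_def)
    \<comment> \<open>The two speeds mc / kappa_0 and kappa_0 / mc cancel, so F composed with the
      competitor's clock is the identity.\<close>
    have "F (\<sigma> t) - t = F (\<sigma> 0) - 0"
    proof (rule DERIV_isconst_end[OF t0(1)])
      show "continuous_on {0..t} (\<lambda>s. F (\<sigma> s) - s)"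
        by (intro continuous_intros continuous_on_compose2[OF Fc[of "\<kappa>0 / \<delta> * T"] continuous_on_subset[OF \<sigma>c]])
          (use \<sigma>p t0 in auto)
      fix s assume s: "0 < s" "s < t"
      have s': "s < T" "s \<in> {0..T}" "s \<le> T" using s t0 by auto
      have "((\<lambda>s. F (\<sigma> s)) has_real_derivative G (\<sigma> s) * a s) (at s)"
        by (rule DERIV_chain2[OF Fd[OF \<sigma>pos[OF s(1) s'(3)]] \<sigma>d[OF s(1) s'(1)]])
      moreover have "G (\<sigma> s) * a s = 1"
        using mcl[OF s'(2)] \<delta> \<kappa> mc[OF s'(2)] by (simp add: G_def a_def)
      ultimately have "((\<lambda>s. F (\<sigma> s)) has_real_derivative 1) (at s)" by simp
      from DERIV_diff[OF this DERIV_ident] show "((\<lambda>s. F (\<sigma> s) - s) has_real_derivative 0) (at s)" by simp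
    qed
    thus ?thesis by (simp add: \<sigma>0 F_def)
  qed
  moreover have t': "t \<in> {0..T}" using t by (simp add: T_def)
  moreover have "AE p in lborel. radial (g t) p = radial (\<lambda>r. U (\<sigma> t) r / r\<^sup>2) p"
    using represents_AE_eq[OF rep[OF t'] represents_profile[OF is_flowD(1)[OF fl \<sigma>p(1)[OF t']]]] vU[OF t'] by simp
  ultimately show ?thesis using mc[OF t'] \<sigma>p(1)[OF t'] unfolding F_def G_def[abs_def] by blast
qed

lemma is_flow_exists:
  assumes C: "eighth_moment_constants C8 c8" "0 < C8" "0 < c8" and h3: "0 < h3" and h8: "2 * h_star C8 c8 h3 \<le> h8"
    and M: "60 * (h3 + h8) + 1 \<le> M"
    and u0: "dens u0" "\<And>r. u0 r \<le> M" "(LBINT r. r * u0 r) = h3" "(LBINT r. r ^ 6 * u0 r) \<le> h8"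
  shows "\<exists>U. is_flow h3 h8 M U \<and> (AE r in lborel. U 0 r = u0 r)
    \<and> (\<forall>T m4 M'. 0 < m4 \<longrightarrow> (\<forall>r. u0 r \<le> M') \<longrightarrow> (\<forall>t\<in>{0..T}. (LBINT r. r\<^sup>2 * U t r) \<le> m4)
         \<longrightarrow> m4 \<le> M' * h3 powr (3 / 4) * (1 / 30) powr (1 / 4) \<longrightarrow> (\<forall>t\<in>{0..T}. \<forall>r. U t r \<le> M'))"
proof -
  define L where "L = (22 * (64 * (M + h8)) + 3) * (64 * (M + h8))"
  have "0 < h_star C8 c8 h3" using C h3 by (simp add: h_star_def)
  hence "0 \<le> M + h8" using M h3 h8 by (simp add: distrib_left)
  hence L: "0 \<le> L" unfolding L_def by (simp only: mult_nonneg_nonneg add_nonneg_nonneg zero_le_numeral)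
  from autonomous_solution_exists[OF C h3 h8 M u0, folded L_def] obtain U where
    U: "\<forall>t\<ge>0. dens (U t) \<and> (\<forall>r. U t r \<le> M) \<and> (LBINT r. r * U t r) = h3 \<and> (LBINT r. r ^ 6 * U t r) \<le> h8"
       "AE r in lborel. U 0 r = u0 r"
       "\<forall>s t. 0 \<le> s \<longrightarrow> s \<le> t \<longrightarrow> ldist (U s) (U t) \<le> L * (t - s)"
       "\<forall>c d b \<sigma>. 0 \<le> c \<longrightarrow> c \<le> d \<longrightarrow> integrable lborel b \<longrightarrow> (\<forall>\<xi>\<in>{c..d}. (LBINT r. \<bar>coll (U \<xi>) r - b r\<bar>) \<le> \<sigma>)
         \<longrightarrow> (LBINT r. \<bar>U d r - U c r - (d - c) * b r\<bar>) \<le> (d - c) * \<sigma>"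
       "\<forall>T m4 M'. 0 < m4 \<longrightarrow> (\<forall>r. u0 r \<le> M') \<longrightarrow> (\<forall>t\<in>{0..T}. (LBINT r. r\<^sup>2 * U t r) \<le> m4)
         \<longrightarrow> m4 \<le> M' * h3 powr (3 / 4) * (1 / 30) powr (1 / 4) \<longrightarrow> (\<forall>t\<in>{0..T}. \<forall>r. U t r \<le> M')"
    by (elim exE conjE) (rule that)
  have "is_flow h3 h8 M U"
    unfolding is_flow_def using U(1) U(4) by (intro conjI exI[of _ L] L U(3))
  thus ?thesis using U(2,5) by (intro exI[of _ U] conjI)
qed

text \<open>The auxiliary system uses kappa_0 = 1. Its clock reaches every autonomous time, so the
  bound for solutions covers the entire flow.\<close>

lemma is_flow_fourth_moment:
  assumes fl: "is_flow h3 h8 M U" and h3: "0 < h3" and C: "fourth_moment_constant C"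
    and f0: "f0 \<in> state_set h3 h8 M" and r0: "represents u0 f0" and u0: "AE r in lborel. U 0 r = u0 r" and \<tau>: "0 \<le> \<tau>"
  shows "(LBINT r. r\<^sup>2 * U \<tau> r) \<le> max (line_moment 4 f0) (C * line_moment 3 f0 powr (5/4))"
proof -
  \<comment> \<open>Splitting the mass integral at R = 1 bounds it by M + h3, so this total leaves
    n_c >= 1 at all times.\<close>
  define N where "N = M + h3 + 1"
  have low: "1 \<le> N - mass (U \<xi>)" if "0 \<le> \<xi>" for \<xi>
    using mass_le[OF is_flowD(1,2)[OF fl that], of 1] is_flowD(3)[OF fl that] by (simp add: N_def)
  have N: "N = line_moment 2 f0 + (N - line_moment 2 f0)" by simp
  have one: "0 < (1 :: real)" by simp
  have n0: "0 < N - line_moment 2 f0"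
  proof -
    note [measurable] = dens_meas[OF representsD(1)[OF r0]] dens_meas[OF is_flowD(1)[OF fl order_refl]]
    have "line_moment 2 f0 = mass u0" using represents_line_moment(1)[OF r0, of 2 0] by simp
    also have "\<dots> = mass (U 0)" by (rule integral_cong_AE) (use u0 in \<open>auto elim: eventually_mono\<close>)
    finally show ?thesis using low[of 0] by simp
  qed
  obtain \<sigma> where \<sigma>: "\<And>t. 0 \<le> t \<Longrightarrow> 0 \<le> \<sigma> t" "\<And>\<tau>. 0 \<le> \<tau> \<Longrightarrow> \<exists>t\<ge>0. \<sigma> t = \<tau>"
    and sol: "\<And>T. 0 < T \<Longrightarrow> regular_on (state_set h3 h8 M) T (\<lambda>t r. U (\<sigma> t) r / r\<^sup>2) (\<lambda>t. N - mass (U (\<sigma> t)))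
          \<and> solves_system_on 1 T f0 (N - line_moment 2 f0) (\<lambda>t r. U (\<sigma> t) r / r\<^sup>2) (\<lambda>t. N - mass (U (\<sigma> t)))"
    using flow_solves_system[OF fl one one low r0 u0 N] by blast
  obtain t where t: "0 \<le> t" "\<sigma> t = \<tau>" using \<sigma>(2)[OF \<tau>] by blast
  define f where "f = (\<lambda>t r. U (\<sigma> t) r / r\<^sup>2)"
  define nc where "nc = (\<lambda>t. N - mass (U (\<sigma> t)))"
  have t1: "0 < t + 1" using t by simp
  have pos: "\<forall>s\<in>{0..t+1}. 0 < nc s"
  proof
    fix s assume "s \<in> {0..t+1}"
    hence "1 \<le> nc s" unfolding nc_def by (intro low \<sigma>(1)) simp
    thus "0 < nc s" by simp
  qed
  have "(1 :: real) > 0 \<and> h3 > 0 \<and> t + 1 > 0 \<and> N - line_moment 2 f0 > 0 \<and> f0 \<in> state_set h3 h8 M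
        \<and> regular_on (state_set h3 h8 M) (t + 1) f nc \<and> solves_system_on 1 (t + 1) f0 (N - line_moment 2 f0) f nc
        \<and> (\<forall>s\<in>{0..t+1}. nc s > 0)"
    using h3 t1 n0 f0 sol[OF t1] pos unfolding f_def nc_def by (intro conjI zero_less_one) blast+
  hence "\<forall>s\<in>{0..t+1}. line_moment 4 (f s) \<le> max (line_moment 4 f0) (C * line_moment 3 f0 powr (5/4))"
    using C unfolding fourth_moment_constant_def by blast
  moreover have "t \<in> {0..t+1}" using t by simp
  ultimately have "line_moment 4 (f t) \<le> max (line_moment 4 f0) (C * line_moment 3 f0 powr (5/4))" by blast
  moreover have "represents (U \<tau>) (f t)"
    unfolding f_def t(2) by (rule represents_profile[OF is_flowD(1)[OF fl \<tau>]])
  ultimately show ?thesis using represents_line_moment(1)[of "U \<tau>" "f t" 4 2] by simp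
qed

theorem theorem6p2:
  fixes C8 c8 C :: real
  assumes "C8 > 0" and "c8 > 0" and "eighth_moment_constants C8 c8"
    and "C > 0" and "fourth_moment_constant C"
  shows "\<exists>H :: real \<Rightarrow> real \<Rightarrow> real.
    \<forall>\<kappa>0 h3 \<delta> h8 hinf :: real. \<forall>S. \<kappa>0 > 0 \<longrightarrow> h3 > 0 \<longrightarrow> \<delta> > 0 \<longrightarrow>
      h8 = h_eight C8 c8 \<kappa>0 \<delta> h3 \<longrightarrow> hinf \<ge> H h3 h8 \<longrightarrow> S = state_set h3 h8 hinf \<longrightarrow>
      (\<forall>f0 \<in> S. \<forall>n0 :: real. n0 > 0 \<longrightarrow> n0 \<ge> mass_threshold C f0 - line_moment 2 f0 + \<delta> \<longrightarrow>
        (\<exists>f nc.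
          (\<forall>T>0. regular_on S T f nc \<and> (\<forall>t\<in>{0..T}. \<delta> \<le> nc t) \<and> solves_system_on \<kappa>0 T f0 n0 f nc)
          \<and> conservative f0 n0 f nc
          \<and> (\<forall>g mc.
               (\<forall>T>0. regular_on S T g mc \<and> (\<forall>t\<in>{0..T}. \<delta> \<le> mc t)
                  \<and> solves_system_on \<kappa>0 T f0 n0 g mc)
               \<and> conservative f0 n0 g mc
               \<longrightarrow> (\<forall>t\<ge>0. (AE p in lborel. radial (g t) p = radial (f t) p) \<and> mc t = nc t))))"
\<comment> \<open>The lower bound for \<open>hinf\<close> is the level that is admissible for any
  density with energy at most \<open>h3\<close> and sixth moment at most \<open>h8\<close>.\<close>
proof (rule exI[of _ "\<lambda>h3 h8. 60 * (h3 + h8) + 1"], intro allI impI ballI)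
  fix \<kappa>0 h3 \<delta> h8 hinf :: real and S f0 and n0 :: real
  assume \<kappa>: "0 < \<kappa>0" and h3: "0 < h3" and \<delta>: "0 < \<delta>" and h8: "h8 = h_eight C8 c8 \<kappa>0 \<delta> h3"
    and hinf: "60 * (h3 + h8) + 1 \<le> hinf" and S: "S = state_set h3 h8 hinf" and f0S: "f0 \<in> S"
    and n0: "0 < n0" "mass_threshold C f0 - line_moment 2 f0 + \<delta> \<le> n0"
  have f0: "f0 \<in> state_set h3 h8 hinf" using f0S S by simp
  have "0 \<le> \<kappa>0 / \<delta> * C8 * h3 powr (7/2)" using \<kappa> \<delta> assms(1) by simp
  hence h8': "2 * h_star C8 c8 h3 \<le> h8" unfolding h8 h_eight_def by simp
  have hs: "0 < h_star C8 c8 h3" using assms(1,2) h3 by (simp add: h_star_def)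
  have hinf0: "0 \<le> hinf" using hinf h3 h8' hs by (simp add: distrib_left)
  have m3: "line_moment 3 f0 = h3" using f0 by (simp add: state_set_def)
  define \<Lambda> where "\<Lambda> = Linfty_norm (\<lambda>p. radial f0 p * (norm p)\<^sup>2)"
  define c where "c = real_of_ereal \<Lambda>"
  have "\<Lambda> \<le> ereal hinf" using f0 by (simp add: state_set_def \<Lambda>_def)
  \<comment> \<open>The norm is bounded above by a real number, so its real part is still an upper
    bound for it.\<close>
  hence c: "\<Lambda> \<le> ereal c" "c \<le> hinf" unfolding c_def using hinf0 by (cases \<Lambda>; simp)+
  obtain u0 where r0: "represents u0 f0" and u0c: "\<And>r. u0 r \<le> c" and u0m: "(LBINT r. r * u0 r) = h3" "(LBINT r. r ^ 6 * u0 r) \<le> h8"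
    using state_set_profile[OF f0 c(1)[unfolded \<Lambda>_def]] by blast
  have u0h: "u0 r \<le> hinf" for r using u0c[of r] c(2) by simp
  from is_flow_exists[OF assms(3,1,2) h3 h8' hinf representsD(1)[OF r0] u0h u0m] obtain U where
    fl: "is_flow h3 h8 hinf U" and U0: "AE r in lborel. U 0 r = u0 r"
    and level: "\<forall>T m4 M'. 0 < m4 \<longrightarrow> (\<forall>r. u0 r \<le> M') \<longrightarrow> (\<forall>t\<in>{0..T}. (LBINT r. r\<^sup>2 * U t r) \<le> m4)
         \<longrightarrow> m4 \<le> M' * h3 powr (3 / 4) * (1 / 30) powr (1 / 4) \<longrightarrow> (\<forall>t\<in>{0..T}. \<forall>r. U t r \<le> M')"
    by (elim exE conjE) (rule that)
  define m4 where "m4 = max (line_moment 4 f0) (C * h3 powr (5/4))"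
  have m40: "0 < m4" unfolding m4_def using assms(4) h3 by (simp add: less_max_iff_disj)
  have U4: "(LBINT r. r\<^sup>2 * U \<tau> r) \<le> m4" if "0 \<le> \<tau>" for \<tau>
    using is_flow_fourth_moment[OF fl h3 assms(5) f0 r0 U0 that] by (simp add: m4_def m3)
  define D where "D = (1 / 30) powr (1 / 4) * h3 powr (3 / 4)"
  have D0: "0 < D" using h3 by (simp add: D_def)
  define m where "m = max c (3 * m4 / (2 * D))"
  have thr: "mass_threshold C f0 = 2 * sqrt (h3 * m)"
    unfolding mass_threshold_def m_def c_def \<Lambda>_def m4_def D_def m3 c_zero_eq by (simp only: mult.assoc)
  \<comment> \<open>The second entry of the maximum in the threshold; it makes m an admissible level
    once the second moment of the flow is bounded by \<open>m4\<close>.\<close>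
  have mD: "3 * m4 / 2 \<le> m * D"
  proof -
    have "3 * m4 / (2 * D) * D \<le> m * D" unfolding m_def using D0 by (intro mult_right_mono) auto
    thus ?thesis using D0 by simp
  qed
  have m0: "0 < m" using m40 D0 unfolding m_def by (simp add: less_max_iff_disj)
  have Um: "U \<tau> r \<le> m" if \<tau>: "0 \<le> \<tau>" for \<tau> r
  proof -
    have "\<forall>r. u0 r \<le> m" using u0c unfolding m_def by (simp add: le_max_iff_disj)
    moreover have "\<forall>t\<in>{0..\<tau>}. (LBINT r. r\<^sup>2 * U t r) \<le> m4" using U4 by simp
    moreover have "m4 \<le> m * h3 powr (3 / 4) * (1 / 30) powr (1 / 4)"
      using mD m40 by (simp add: D_def mult_ac)
    ultimately have "\<forall>t\<in>{0..\<tau>}. \<forall>r. U t r \<le> m" using level m40 by blast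
    thus ?thesis using \<tau> by simp
  qed
  define N where "N = line_moment 2 f0 + n0"
  \<comment> \<open>At level m the mass never exceeds the threshold, and the condition on
    \<open>n0\<close> leaves \<open>\<delta>\<close> for n_c.\<close>
  have low: "\<delta> \<le> N - mass (U \<tau>)" if \<tau>: "0 \<le> \<tau>" for \<tau>
    using mass_le_sqrt[OF is_flowD(1)[OF fl \<tau>] Um[OF \<tau>] m0 is_flowD(3)[OF fl \<tau>] h3] n0(2) thr by (simp add: N_def)
  note flow = fl \<kappa> \<delta> low r0 U0 N_def
  obtain \<sigma> where \<sigma>: "\<And>t. 0 \<le> t \<Longrightarrow> 0 \<le> \<sigma> t"
      "\<And>\<tau>. 0 \<le> \<tau> \<Longrightarrow> \<sigma> (integral {0..\<tau>} (\<lambda>\<xi>. (N - mass (U \<xi>)) / \<kappa>0)) = \<tau>"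
    and sol: "\<forall>T>0. regular_on S T (\<lambda>t r. U (\<sigma> t) r / r\<^sup>2) (\<lambda>t. N - mass (U (\<sigma> t)))
          \<and> solves_system_on \<kappa>0 T f0 n0 (\<lambda>t r. U (\<sigma> t) r / r\<^sup>2) (\<lambda>t. N - mass (U (\<sigma> t)))"
    and cons: "conservative f0 n0 (\<lambda>t r. U (\<sigma> t) r / r\<^sup>2) (\<lambda>t. N - mass (U (\<sigma> t)))"
    using flow_solves_system[OF flow, folded S] by blast
  show "\<exists>f nc. (\<forall>T>0. regular_on S T f nc \<and> (\<forall>t\<in>{0..T}. \<delta> \<le> nc t) \<and> solves_system_on \<kappa>0 T f0 n0 f nc)
          \<and> conservative f0 n0 f nc
          \<and> (\<forall>g mc. (\<forall>T>0. regular_on S T g mc \<and> (\<forall>t\<in>{0..T}. \<delta> \<le> mc t) \<and> solves_system_on \<kappa>0 T f0 n0 g mc)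
               \<and> conservative f0 n0 g mc
               \<longrightarrow> (\<forall>t\<ge>0. (AE p in lborel. radial (g t) p = radial (f t) p) \<and> mc t = nc t))"
  proof (rule exI[of _ "\<lambda>t r. U (\<sigma> t) r / r\<^sup>2"], rule exI[of _ "\<lambda>t. N - mass (U (\<sigma> t))"], intro conjI cons)
    show "\<forall>T>0. regular_on S T (\<lambda>t r. U (\<sigma> t) r / r\<^sup>2) (\<lambda>t. N - mass (U (\<sigma> t))) \<and> (\<forall>t\<in>{0..T}. \<delta> \<le> N - mass (U (\<sigma> t)))
        \<and> solves_system_on \<kappa>0 T f0 n0 (\<lambda>t r. U (\<sigma> t) r / r\<^sup>2) (\<lambda>t. N - mass (U (\<sigma> t)))"
      using sol low \<sigma>(1) by simp
    show "\<forall>g mc. (\<forall>T>0. regular_on S T g mc \<and> (\<forall>t\<in>{0..T}. \<delta> \<le> mc t) \<and> solves_system_on \<kappa>0 T f0 n0 g mc)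
        \<and> conservative f0 n0 g mc
        \<longrightarrow> (\<forall>t\<ge>0. (AE p in lborel. radial (g t) p = radial (\<lambda>r. U (\<sigma> t) r / r\<^sup>2) p) \<and> mc t = N - mass (U (\<sigma> t)))"
    proof (intro allI impI)
      fix g mc and t :: real
      assume g: "(\<forall>T>0. regular_on S T g mc \<and> (\<forall>t\<in>{0..T}. \<delta> \<le> mc t) \<and> solves_system_on \<kappa>0 T f0 n0 g mc)
        \<and> conservative f0 n0 g mc" and t: "0 \<le> t"
      obtain \<tau> where \<tau>: "0 \<le> \<tau>" "integral {0..\<tau>} (\<lambda>\<xi>. (N - mass (U \<xi>)) / \<kappa>0) = t"
        "AE p in lborel. radial (g t) p = radial (\<lambda>r. U \<tau> r / r\<^sup>2) p" "mc t = N - mass (U \<tau>)"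
        using flow_system_unique[OF flow g[THEN conjunct1, rule_format, unfolded S] g[THEN conjunct2] t] by blast
      have "\<sigma> t = \<tau>" using \<sigma>(2)[OF \<tau>(1)] \<tau>(2) by simp
      thus "(AE p in lborel. radial (g t) p = radial (\<lambda>r. U (\<sigma> t) r / r\<^sup>2) p) \<and> mc t = N - mass (U (\<sigma> t))"
        using \<tau>(3,4) by simp
    qed
  qed
qed

end
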